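(* Let $\Omega\subset\mathbb R^3$ be an open bounded connected domain with closure $\overline\Omega$, and let $X\subset\mathbb R^3\setminus\overline\Omega$ be a two-dimensional (affine) plane. Let $v\in L^\infty(\mathbb R^3)$ (complex-valued) with $\operatorname{supp}v\subset\Omega$. Let $\kappa>0$ be fixed, suppose that the unique solvability property (US) holds for $v$, $\Omega$, $\kappa$, and let $R_v^+(x,y,\kappa)$ be the outgoing Green function for the equation $-\Delta\psi+v\psi=\kappa^2\psi+\delta(x-y)$. Let $\mathcal D$ be an arbitrary non-empty open domain of $X$. Then $v$ is uniquely determined by $\operatorname{Im}R_v^+(\cdot,\cdot,\kappa)$ on $\mathcal D\times\mathcal D$. That is, if $v_1,v_2\in L^\infty(\mathbb R^3)$ (complex-valued) satisfy $\operatorname{supp}v_j\subset\Omega$ and property (US) holds for $v_j$, $\Omega$, $\kappa$, for $j=1,2$ (with the same $\Omega,X,\kappa,\mathcal D$), and $\operatorname{Im}R_{v_1}^+(\cdot,\cdot,\kappa)=\operatorname{Im}R_{v_2}^+(\cdot,\cdot,\kappa)$ on $\mathcal D\times\mathcal D$, then $v_1=v_2$ (almost everywhere).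
   Context: Put $G^+(x,\kappa)=-\dfrac{e^{i\kappa|x|}}{4\pi|x|}$, $x\in\mathbb R^3$. The outgoing Green function $R_v^+(x,y,\kappa)$ is, for each fixed $y\in\mathbb R^3$, the solution $\psi=R_v^+(\cdot,y,\kappa)$ of $-\Delta\psi(x)+v(x)\psi(x)=\kappa^2\psi(x)+\delta(x-y)$, $x\in\mathbb R^3$ ($\delta$ the Dirac delta), satisfying the Sommerfeld radiation condition $|x|\left(\frac{\partial}{\partial|x|}-i\kappa\right)\psi(x)\to0$ as $|x|\to+\infty$, uniformly in $x/|x|$. It satisfies the integral equation $$R_v^+(x,y,\kappa)=-G^+(x-y,\kappa)+\int_\Omega G^+(x-z,\kappa)v(z)R_v^+(z,y,\kappa)\,dz,\qquad x,y\in\mathbb R^3.$$ Property (US) for $v,\Omega,\kappa$: for the given $\kappa>0$ this integral equation is uniquely solvable for $R_v^+(\cdot,y,\kappa)\in L^2(\Omega)$. On the diagonal $x=y$ outside $\operatorname{supp}v$, $\operatorname{Im}R_v^+(x,y,\kappa)$ is understood by continuous extension. "Open domain of $X$" means open in the relative topology of $X$. *)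

theory Defs
  imports "HOL-Analysis.Analysis"
begin

definition L_infty :: "(real ^ 3 \<Rightarrow> complex) \<Rightarrow> bool" where
  "L_infty v \<longleftrightarrow>
     v \<in> borel_measurable lebesgue \<and> (\<exists>C. AE x in lebesgue. norm (v x) \<le> C)"

definition L2_on :: "(real ^ 3) set \<Rightarrow> (real ^ 3 \<Rightarrow> complex) \<Rightarrow> bool" where
  "L2_on \<Omega> \<psi> \<longleftrightarrow>
     set_borel_measurable lebesgue \<Omega> \<psi> \<and> set_integrable lebesgue \<Omega> (\<lambda>x. (norm (\<psi> x))\<^sup>2)"

definition locally_integrable :: "(real ^ 3 \<Rightarrow> complex) \<Rightarrow> bool" where
  "locally_integrable \<psi> \<longleftrightarrow> (\<forall>K. compact K \<longrightarrow> set_integrable lebesgue K \<psi>)"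

definition ess_support :: "(real ^ 3 \<Rightarrow> complex) \<Rightarrow> (real ^ 3) set" where
  "ess_support v = - \<Union>{U. open U \<and> (AE x in lebesgue. x \<in> U \<longrightarrow> v x = 0)}"

definition partial :: "3 \<Rightarrow> (real ^ 3 \<Rightarrow> complex) \<Rightarrow> real ^ 3 \<Rightarrow> complex" where
  "partial i f x = frechet_derivative f (at x) (axis i 1)"

definition laplacian :: "(real ^ 3 \<Rightarrow> complex) \<Rightarrow> real ^ 3 \<Rightarrow> complex" where
  "laplacian f x = (\<Sum>i\<in>UNIV. partial i (partial i f) x)"

fun C_k :: "nat \<Rightarrow> (real ^ 3 \<Rightarrow> complex) \<Rightarrow> bool" where
  "C_k 0 f \<longleftrightarrow> continuous_on UNIV f"
| "C_k (Suc k) f \<longleftrightarrow> (\<forall>x. f differentiable (at x)) \<and> (\<forall>i. C_k k (partial i f))"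

definition test_function :: "(real ^ 3 \<Rightarrow> complex) \<Rightarrow> bool" where
  "test_function \<phi> \<longleftrightarrow> (\<forall>k. C_k k \<phi>) \<and> compact (closure {x. \<phi> x \<noteq> 0})"

definition G_plus :: "real \<Rightarrow> real ^ 3 \<Rightarrow> complex" where
  "G_plus \<kappa> x = - exp (\<i> * of_real (\<kappa> * norm x)) / of_real (4 * pi * norm x)"

text \<open>The equation \<open>-\<Delta>\<psi> + v \<psi> = \<kappa>\<^sup>2 \<psi> + \<delta>(\<cdot> - y)\<close> in the sense of distributions.\<close>

definition schroedinger_delta ::
    "(real ^ 3 \<Rightarrow> complex) \<Rightarrow> real \<Rightarrow> real ^ 3 \<Rightarrow> (real ^ 3 \<Rightarrow> complex) \<Rightarrow> bool" where
  "schroedinger_delta v \<kappa> y \<psi> \<longleftrightarrow>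
     locally_integrable \<psi> \<and>
     (\<forall>\<phi>. test_function \<phi> \<longrightarrow>
        (LINT x|lebesgue. \<psi> x * (- laplacian \<phi> x + v x * \<phi> x))
          = (LINT x|lebesgue. of_real (\<kappa>\<^sup>2) * \<psi> x * \<phi> x) + \<phi> y)"

text \<open>Uniformity in the direction \<open>x/|x| = sgn x\<close> is expressed by the filter
  \<^const>\<open>at_infinity\<close> on \<open>\<real>\<^sup>3\<close>.\<close>

definition radiation_condition :: "real \<Rightarrow> (real ^ 3 \<Rightarrow> complex) \<Rightarrow> bool" where
  "radiation_condition \<kappa> \<psi> \<longleftrightarrow>
     (\<forall>\<^sub>F x in at_infinity. (\<lambda>r. \<psi> (r *\<^sub>R sgn x)) differentiable (at (norm x))) \<and>
     ((\<lambda>x. of_real (norm x) *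
           (vector_derivative (\<lambda>r. \<psi> (r *\<^sub>R sgn x)) (at (norm x)) - \<i> * of_real \<kappa> * \<psi> x))
        \<longlongrightarrow> 0) at_infinity"

definition integral_equation_at ::
    "(real ^ 3 \<Rightarrow> complex) \<Rightarrow> (real ^ 3) set \<Rightarrow> real \<Rightarrow> real ^ 3 \<Rightarrow>
     (real ^ 3 \<Rightarrow> complex) \<Rightarrow> real ^ 3 \<Rightarrow> bool" where
  "integral_equation_at v \<Omega> \<kappa> y \<psi> x \<longleftrightarrow>
     \<psi> x = - G_plus \<kappa> (x - y) + (LINT z:\<Omega>|lebesgue. G_plus \<kappa> (x - z) * v z * \<psi> z)"

definition US :: "(real ^ 3 \<Rightarrow> complex) \<Rightarrow> (real ^ 3) set \<Rightarrow> real \<Rightarrow> bool" where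
  "US v \<Omega> \<kappa> \<longleftrightarrow>
     (\<forall>y.
       (\<exists>\<psi>. L2_on \<Omega> \<psi> \<and>
            (AE x in lebesgue. x \<in> \<Omega> \<longrightarrow> integral_equation_at v \<Omega> \<kappa> y \<psi> x)) \<and>
       (\<forall>\<psi>\<^sub>1 \<psi>\<^sub>2.
          L2_on \<Omega> \<psi>\<^sub>1 \<and> (AE x in lebesgue. x \<in> \<Omega> \<longrightarrow> integral_equation_at v \<Omega> \<kappa> y \<psi>\<^sub>1 x) \<and>
          L2_on \<Omega> \<psi>\<^sub>2 \<and> (AE x in lebesgue. x \<in> \<Omega> \<longrightarrow> integral_equation_at v \<Omega> \<kappa> y \<psi>\<^sub>2 x)
          \<longrightarrow> (AE x in lebesgue. x \<in> \<Omega> \<longrightarrow> \<psi>\<^sub>1 x = \<psi>\<^sub>2 x)))"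

text \<open>A distributional solution is determined only up to null sets.  Its pointwise values, which
  are needed on the null set \<open>\<D> \<times> \<D>\<close>, are those given by the integral equation at every
  \<open>x \<noteq> y\<close>; \<open>R y y\<close> is left arbitrary, the Green function being singular there.\<close>

definition outgoing_green ::
    "(real ^ 3 \<Rightarrow> complex) \<Rightarrow> (real ^ 3) set \<Rightarrow> real \<Rightarrow> (real ^ 3 \<Rightarrow> real ^ 3 \<Rightarrow> complex) \<Rightarrow> bool"
  where
  "outgoing_green v \<Omega> \<kappa> R \<longleftrightarrow>
     (\<forall>y.
        schroedinger_delta v \<kappa> y (\<lambda>x. R x y) \<and>
        radiation_condition \<kappa> (\<lambda>x. R x y) \<and>
        L2_on \<Omega> (\<lambda>x. R x y) \<and>
        (\<forall>x. x \<noteq> y \<longrightarrow> integral_equation_at v \<Omega> \<kappa> y (\<lambda>x. R x y) x))"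

text \<open>The singularity \<open>1 / (4 \<pi> |x - y|)\<close> of the Green function is real, so away from the support of
  the potential its imaginary part extends continuously to the diagonal.\<close>

definition Im_green :: "(real ^ 3 \<Rightarrow> real ^ 3 \<Rightarrow> complex) \<Rightarrow> real ^ 3 \<Rightarrow> real ^ 3 \<Rightarrow> real" where
  "Im_green R x y =
     (if x \<noteq> y then Im (R x y)
      else Lim (at (x, y) within {(a, b). a \<noteq> b}) (\<lambda>(a, b). Im (R a b)))"

end

theory Submission
  imports Defs "HOL-Complex_Analysis.Complex_Analysis" "HOL-Probability.Probability" "HOL-Real_Asymp.Real_Asymp"
begin

text \<open>
  Write \<open>T f\<close> for the convolution of \<open>G_plus\<close> with \<open>f\<close>. For \<open>y \<in> \<D>\<close> the difference
  \<open>R\<^sub>1(x,y) - R\<^sub>2(x,y)\<close> equals \<open>T \<rho>(x)\<close> for a bounded density \<open>\<rho>\<close> supported in \<open>\<Omega>\<close>. On a line missing \<open>\<Omega>\<close>,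
  \<open>T \<rho>\<close> is real analytic and behaves at infinity like \<open>e\<^sup>i\<^sup>\<kappa>\<^sup>|\<^sup>x\<^sup>|/|x|\<close> times an analytic function of
  \<open>1/|x|\<close>. The oscillating factor runs through all phases, so \<open>T \<rho>\<close> vanishes on the line if its imaginary part
  vanishes on an interval. With reciprocity, \<open>R\<^sub>1 = R\<^sub>2\<close> on \<open>X \<times> X\<close>.

  If \<open>T f = 0\<close> on \<open>X\<close> and \<open>f\<close> lives on one side of \<open>X\<close>, then \<open>f\<close> is orthogonal to all exponentials
  \<open>exp(i \<zeta> \<cdot> z)\<close> with \<open>\<zeta> \<cdot> \<zeta> = \<kappa>\<^sup>2\<close>: expand \<open>G_plus\<close> in plane waves (Sommerfeld's integral), localise the
  propagating ones with a Gaussian weight on \<open>X\<close>, and continue analytically in \<open>\<zeta>\<close>.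

  Subtracting from \<open>G_plus\<close> a superposition of plane waves gives a Faddeev type Green function with small
  conjugated kernel, hence solutions \<open>u\<^sub>j = e\<^sup>i\<^sup>\<zeta>\<^sup>z(1 + o(1))\<close> for the potential \<open>v\<^sub>j\<close>. For \<open>x \<in> X\<close> the
  density \<open>v\<^sub>1 R\<^sub>1(\<cdot>,x) - v\<^sub>2 R\<^sub>2(\<cdot>,x)\<close> is orthogonal to the exponentials, which gives
  \<open>\<integral>(v\<^sub>1 - v\<^sub>2) R\<^sub>1(\<cdot>,x) u\<^sub>2 = 0\<close>. Solving a Lippmann-Schwinger equation for \<open>v\<^sub>1\<close> (Fredholm alternative and
  (US)) with source \<open>(v\<^sub>1 - v\<^sub>2) u\<^sub>2\<close> turns this into a second density with vanishing potential on \<open>X\<close>, and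
  then \<open>\<integral>(v\<^sub>1 - v\<^sub>2) u\<^sub>1 u\<^sub>2 = 0\<close>. Letting \<open>\<zeta>\<^sub>1 + \<zeta>\<^sub>2 = p\<close> and \<open>|\<zeta>\<^sub>j| \<rightarrow> \<infinity>\<close> shows that the Fourier transform
  of \<open>v\<^sub>1 - v\<^sub>2\<close> vanishes.
\<close>

section \<open>Orthonormal frames and singular integrands\<close>

text \<open>Two obstacles shape the proof. The data live on a piece of the plane X, so in place of a
  continuation from X to the exterior of \<Omega> only the consequence \<open>annihilates\<close> of
  vanishing on X is drawn; it is exactly what makes a correction of \<open>G_plus\<close> by plane
  waves drop out of every pairing. And \<open>v\<close> is complex, so there is no self-adjointness:
  all dualities are bilinear, without conjugation, and rest on the evenness of
  \<open>G_plus\<close>. The second density is needed because Green functions with source on X are a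
  special family of solutions; the Lippmann-Schwinger equation converts orthogonality to this family
  into vanishing of a new potential on X, to which \<open>annihilates\<close> applies again. The
  growing Green function comes from Sommerfeld's integral truncated at \<tau> rather than from a
  Fourier multiplier: its homogeneous part is then visibly a superposition of exponentials, and the
  decay t^(-1/2) of the Bessel function gives \<tau>^(-1/4), enough since any decay makes the
  fixed-point map a contraction.\<close>

lemma borel_measurable_indicator_cball [measurable]:
  "indicat_real (cball c M) \<in> borel_measurable borel"
  by (intro borel_measurable_indicator borel_closed closed_cball)

lemma nn_integral_abs_powr_finite:
  fixes a M :: real
  assumes "a < 1" "M \<ge> 0"
  shows "(\<integral>\<^sup>+ t. ennreal (indicator {-M..M} t * \<bar>t\<bar> powr (-a)) \<partial>lborel) < \<infinity>"
proof -
  define I where "I = M powr (-a+1) / (-a+1)"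
  have pos: "((\<lambda>x. x powr (-a)) has_integral I) {0..M}"
    unfolding I_def by (rule has_integral_powr_from_0) (use assms in auto)
  have 1: "((\<lambda>x. \<bar>x\<bar> powr (-a)) has_integral I) {0..M}"
    by (rule has_integral_eq[OF _ pos]) auto
  have "((\<lambda>x. \<bar>-x\<bar> powr (-a)) has_integral I) {-M..-0}"
    using has_integral_reflect_lemma_real[OF 1] by simp
  hence 2: "((\<lambda>x. \<bar>x\<bar> powr (-a)) has_integral I) {-M..0}" by simp
  have "((\<lambda>x. \<bar>x\<bar> powr (-a)) has_integral (I+I)) {-M..M}"
    by (rule has_integral_combine[OF _ _ 2 1]) (use assms in auto)
  from nn_integral_has_integral_lebesgue[OF _ this] show ?thesis by simp
qed

text \<open>The orientation is left free because \<open>e\<close> takes two roles: the normal of X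
  in the half-space argument, and the growth direction of the exponential solutions, which is chosen
  orthogonal to the frequency at which the Fourier transform is tested.\<close>

locale frame =
  fixes a b e :: "real ^ 3"
  assumes aa [simp]: "a \<bullet> a = 1" and bb [simp]: "b \<bullet> b = 1" and ee [simp]: "e \<bullet> e = 1"
    and ab [simp]: "a \<bullet> b = 0" and ae [simp]: "a \<bullet> e = 0" and be [simp]: "b \<bullet> e = 0"
begin

lemma ba [simp]: "b \<bullet> a = 0" and ea [simp]: "e \<bullet> a = 0" and eb [simp]: "e \<bullet> b = 0"
  using ab ae be by (simp_all add: inner_commute)

definition rot :: "real ^ 3 \<Rightarrow> real ^ 3" where
  "rot c = (c $ 1) *\<^sub>R a + (c $ 2) *\<^sub>R b + (c $ 3) *\<^sub>R e"

lemma linear_rot: "linear rot"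
  by (rule linearI) (simp_all add: rot_def algebra_simps)

lemma inner_rot: "rot c \<bullet> rot d = c \<bullet> d"
  by (simp add: rot_def inner_add_left inner_add_right inner_vec_def[of c d] sum_3)

lemma orthogonal_rot: "orthogonal_transformation rot"
  by (simp add: orthogonal_transformation_def linear_rot inner_rot)

lemma rot_coord [simp]: "rot c \<bullet> a = c $ 1" "rot c \<bullet> b = c $ 2" "rot c \<bullet> e = c $ 3"
  by (simp_all add: rot_def algebra_simps)

lemma frame_expand: "y = (y \<bullet> a) *\<^sub>R a + (y \<bullet> b) *\<^sub>R b + (y \<bullet> e) *\<^sub>R e"
proof -
  obtain c where c: "y = rot c" using orthogonal_transformation_surj[OF orthogonal_rot] by (metis surjD)
  show ?thesis unfolding c rot_coord by (simp add: rot_def)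
qed

lemma frame_inner: "y \<bullet> z = (y \<bullet> a) * (z \<bullet> a) + (y \<bullet> b) * (z \<bullet> b) + (y \<bullet> e) * (z \<bullet> e)"
proof -
  have "y \<bullet> z = ((y \<bullet> a) *\<^sub>R a + (y \<bullet> b) *\<^sub>R b + (y \<bullet> e) *\<^sub>R e) \<bullet> z"
    using frame_expand[of y] by simp
  thus ?thesis by (simp add: inner_add_left inner_add_right inner_commute)
qed

lemma frame_norm: "(norm y)\<^sup>2 = (y \<bullet> a)\<^sup>2 + (y \<bullet> b)\<^sup>2 + (y \<bullet> e)\<^sup>2"
  unfolding power2_norm_eq_inner using frame_inner[of y y] by (simp only: power2_eq_square)

lemma distr_rot: "distr lborel borel rot = lborel"
proof (rule lborel_eqI[symmetric])
  fix l u :: "real ^ 3"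
  assume lu: "\<And>b. b \<in> Basis \<Longrightarrow> l \<bullet> b \<le> u \<bullet> b"
  have m: "rot \<in> borel_measurable borel"
    by (intro borel_measurable_continuous_onI linear_continuous_on)
      (use linear_rot in \<open>simp add: linear_conv_bounded_linear\<close>)
  let ?g = "inv rot"
  have og: "orthogonal_transformation ?g" by (rule orthogonal_transformation_inv[OF orthogonal_rot])
  have bij: "bij rot" by (rule orthogonal_transformation_bij[OF orthogonal_rot])
  have "emeasure (distr lborel borel rot) (box l u) = emeasure lborel (rot -` box l u)"
    using m by (subst emeasure_distr) auto
  also have "rot -` box l u = ?g ` box l u"
    by (rule bij_vimage_eq_inv_image[OF bij])
  also have "emeasure lborel (?g ` box l u) = emeasure lebesgue (?g ` box l u)"
  proof -
    have "rot -` box l u \<in> sets borel" using measurable_sets[OF m, of "box l u"] by simp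
    hence "?g ` box l u \<in> sets borel" using bij_vimage_eq_inv_image[OF bij] by metis
    thus ?thesis by (simp add: emeasure_completion)
  qed
  also have "\<dots> = measure lebesgue (?g ` box l u)"
    using measurable_orthogonal_image[OF og lmeasurable_box[of l u]]
    by (intro emeasure_eq_measure2) (auto simp: fmeasurable_def)
  also have "\<dots> = measure lebesgue (box l u)"
    using measure_orthogonal_image[OF og, of "box l u"] by simp
  also have "\<dots> = (\<Prod>b\<in>Basis. (u - l) \<bullet> b)" using lu by (simp add: measure_lborel_box_eq measure_completion)
  finally show "emeasure (distr lborel borel rot) (box l u) = (\<Prod>b\<in>Basis. (u - l) \<bullet> b)" .
qed simp

lemma measurable_rot [measurable]: "rot \<in> borel_measurable borel"
  by (intro borel_measurable_continuous_onI linear_continuous_on)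
    (use linear_rot in \<open>simp add: linear_conv_bounded_linear\<close>)

lemma AE_inner_nonzero: "AE y in lborel. y \<bullet> a \<noteq> 0 \<and> y \<bullet> b \<noteq> 0 \<and> y \<bullet> e \<noteq> 0"
proof -
  have "AE y in lborel. y \<bullet> c \<noteq> 0" if "c \<bullet> c = 1" for c :: "real ^ 3"
  proof -
    have "negligible {y. c \<bullet> y = 0}" using that by (intro negligible_hyperplane) auto
    hence "AE y in lebesgue. y \<notin> {y. c \<bullet> y = 0}"
      by (intro AE_not_in) (simp add: negligible_iff_null_sets)
    hence "AE y in lborel. y \<notin> {y. c \<bullet> y = 0}" by (simp add: AE_completion_iff)
    thus ?thesis by (simp add: inner_commute)
  qed
  from this[OF aa] this[OF bb] this[OF ee] show ?thesis by eventually_elim simp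
qed

lemma nn_integral_product:
  fixes f g h :: "real \<Rightarrow> ennreal"
  assumes [measurable]: "f \<in> borel_measurable borel" "g \<in> borel_measurable borel" "h \<in> borel_measurable borel"
  shows "(\<integral>\<^sup>+ y. f (y \<bullet> a) * g (y \<bullet> b) * h (y \<bullet> e) \<partial>lborel)
    = (\<integral>\<^sup>+ t. f t \<partial>lborel) * (\<integral>\<^sup>+ t. g t \<partial>lborel) * (\<integral>\<^sup>+ t. h t \<partial>lborel)"
proof -
  let ?F = "\<lambda>i::real^3. if i = axis 1 1 then f else if i = axis 2 1 then g else h"
  have B: "Basis = {axis 1 1, axis 2 1, axis 3 (1::real) :: real ^ 3}"
    by (auto simp: Basis_vec_def UNIV_3)
  have d: "axis 1 (1::real) \<noteq> (axis 2 1 :: real^3)" "axis 1 (1::real) \<noteq> (axis 3 1 :: real^3)"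
    "axis 2 (1::real) \<noteq> (axis 3 1 :: real^3)"
    by (simp_all add: axis_eq_axis)
  have "(\<integral>\<^sup>+ y. f (y \<bullet> a) * g (y \<bullet> b) * h (y \<bullet> e) \<partial>distr lborel borel rot)
    = (\<integral>\<^sup>+ c. f ((c::real^3) $ 1) * g (c $ 2) * h (c $ 3) \<partial>lborel)"
    by (subst nn_integral_distr) simp_all
  also have "\<dots> = (\<integral>\<^sup>+ c. (\<Prod>i\<in>Basis. ?F i (c \<bullet> i)) \<partial>lborel)"
    using d by (simp add: B cart_eq_inner_axis mult.assoc)
  also have "\<dots> = (\<Prod>i\<in>Basis. (\<integral>\<^sup>+ t. ?F i t \<partial>lborel))"
    by (rule nn_integral_lborel_prod) auto
  also have "\<dots> = (\<integral>\<^sup>+ t. f t \<partial>lborel) * (\<integral>\<^sup>+ t. g t \<partial>lborel) * (\<integral>\<^sup>+ t. h t \<partial>lborel)"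
    using d by (simp add: B mult.assoc)
  finally show ?thesis by (simp add: distr_rot)
qed

text \<open>Tonelli in frame coordinates, each factor being a one-dimensional singularity of
  exponent below 1. Both singular majorants of the proof, the inverse square of the norm and the
  bound of the Faddeev kernel, are dominated by such products, in place of polar
  coordinates.\<close>

lemma integrable_product_powr:
  fixes p q r M :: real
  assumes "p < 1" "q < 1" "r < 1" "M \<ge> 0"
  shows "set_integrable lborel (cball 0 M)
    (\<lambda>y. \<bar>y \<bullet> a\<bar> powr (-p) * \<bar>y \<bullet> b\<bar> powr (-q) * \<bar>y \<bullet> e\<bar> powr (-r))" (is "set_integrable _ _ ?f")
proof -
  let ?g = "\<lambda>p t. ennreal (indicator {-M..M} t * \<bar>t\<bar> powr (-p))"
  have *: "\<bar>y \<bullet> c\<bar> \<le> M" if "norm y \<le> M" "c \<bullet> c = 1" for y c :: "real^3"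
    using Cauchy_Schwarz_ineq2[of y c] that by (simp add: norm_eq_sqrt_inner)
  have "(\<integral>\<^sup>+ y. norm (indicator (cball 0 M) y *\<^sub>R ?f y) \<partial>lborel)
    \<le> (\<integral>\<^sup>+ y. ?g p (y \<bullet> a) * ?g q (y \<bullet> b) * ?g r (y \<bullet> e) \<partial>lborel)"
  proof (rule nn_integral_mono)
    fix y :: "real^3"
    show "ennreal (norm (indicator (cball 0 M) y *\<^sub>R ?f y)) \<le> ?g p (y \<bullet> a) * ?g q (y \<bullet> b) * ?g r (y \<bullet> e)"
      using *[of y a] *[of y b] *[of y e]
      by (auto simp: indicator_def abs_le_iff simp flip: ennreal_mult split: if_splits)
  qed
  also have "\<dots> = (\<integral>\<^sup>+ t. ?g p t \<partial>lborel) * (\<integral>\<^sup>+ t. ?g q t \<partial>lborel) * (\<integral>\<^sup>+ t. ?g r t \<partial>lborel)"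
    by (rule nn_integral_product) measurable
  also have "\<dots> < \<infinity>"
    using nn_integral_abs_powr_finite[OF assms(1,4)] nn_integral_abs_powr_finite[OF assms(2,4)]
      nn_integral_abs_powr_finite[OF assms(3,4)]
    by (simp add: ennreal_mult_less_top)
  finally show ?thesis
    unfolding set_integrable_def by (intro integrableI_bounded) (simp_all, measurable)
qed

end

lemma frame_axes: "frame (axis 1 1) (axis 2 1) (axis 3 (1::real))"
  by unfold_locales (simp_all add: inner_axis_axis)

text \<open>Each coordinate is at most \<open>norm y\<close> in modulus, so
  \<open>norm y powr (-2)\<close>, split into three factors of exponent 2/3 < 1, is at most the
  product of the coordinate powers. The planes where a coordinate vanishes, and \<open>powr\<close>
  returns 0, form a null set.\<close>

lemma set_integrable_inverse_square:
  assumes "M \<ge> 0"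
  shows "set_integrable lborel (cball 0 M) (\<lambda>y::real^3. 1 / (norm y)\<^sup>2)"
proof -
  interpret frame "axis 1 1" "axis 2 1" "axis 3 (1::real)" by (rule frame_axes)
  have i: "set_integrable lborel (cball 0 M) (\<lambda>y::real^3. \<bar>y \<bullet> axis 1 1\<bar> powr (-(2/3)) *
    \<bar>y \<bullet> axis 2 1\<bar> powr (-(2/3)) * \<bar>y \<bullet> axis 3 1\<bar> powr (-(2/3)))"
    by (rule integrable_product_powr) (use assms in auto)
  show ?thesis unfolding set_integrable_def
  proof (rule Bochner_Integration.integrable_bound[OF i[unfolded set_integrable_def]])
    have *: "1 / (norm y)\<^sup>2 \<le> \<bar>y \<bullet> c1\<bar> powr (-(2/3)) * \<bar>y \<bullet> c2\<bar> powr (-(2/3)) * \<bar>y \<bullet> c3\<bar> powr (-(2/3))"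
      if "y \<bullet> c1 \<noteq> 0 \<and> y \<bullet> c2 \<noteq> 0 \<and> y \<bullet> c3 \<noteq> 0" "norm c1 = 1" "norm c2 = 1" "norm c3 = 1"
      for y c1 c2 c3 :: "real^3"
    proof -
      have y: "norm y > 0" using that by auto
      have "norm y powr (-(2/3)) \<le> \<bar>y \<bullet> c\<bar> powr (-(2/3))" if "y \<bullet> c \<noteq> 0" "norm c = 1" for c
        using Cauchy_Schwarz_ineq2[of y c] that by (intro powr_mono2') auto
      hence "norm y powr (-(2/3)) * norm y powr (-(2/3)) * norm y powr (-(2/3))
         \<le> \<bar>y \<bullet> c1\<bar> powr (-(2/3)) * \<bar>y \<bullet> c2\<bar> powr (-(2/3)) * \<bar>y \<bullet> c3\<bar> powr (-(2/3))"
        using that by (intro mult_mono) auto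
      also have "norm y powr (-(2/3)) * norm y powr (-(2/3)) * norm y powr (-(2/3)) = norm y powr (-2)"
        by (simp flip: powr_add)
      also have "\<dots> = 1 / (norm y)\<^sup>2" using y by (simp add: powr_minus powr_numeral divide_inverse)
      finally show ?thesis .
    qed
    show "AE y in lborel. norm (indicator (cball 0 M) y *\<^sub>R (1 / (norm (y::real^3))\<^sup>2)) \<le>
      norm (indicator (cball 0 M) y *\<^sub>R (\<bar>y \<bullet> axis 1 1\<bar> powr (-(2/3)) *
    \<bar>y \<bullet> axis 2 1\<bar> powr (-(2/3)) * \<bar>y \<bullet> axis 3 1\<bar> powr (-(2/3))))"
      using AE_inner_nonzero
    proof eventually_elim
      case (elim y)
      show ?case using *[OF elim] by (auto simp: indicator_def)
    qed
  qed (simp, measurable)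
qed

section \<open>The volume potential\<close>

lemma distr_lborel_diff: "distr lborel borel (\<lambda>z. x - z) = (lborel :: (real^3) measure)"
proof -
  have "lborel = density (distr lborel borel (\<lambda>z::real^3. x + (-1) *\<^sub>R z)) (\<lambda>_. \<bar>-1::real\<bar>^DIM(real^3))"
    by (rule lborel_affine) simp
  thus ?thesis by (simp add: density_1)
qed

lemma integral_lborel_diff:
  fixes f :: "real^3 \<Rightarrow> 'b::{banach, second_countable_topology}"
  assumes [measurable]: "f \<in> borel_measurable borel"
  shows "(LINT z|lborel. f (x - z)) = (LINT y|lborel. f y)"
  by (subst (2) distr_lborel_diff[of x, symmetric], subst integral_distr) simp_all

lemma integrable_lborel_diff:
  fixes f :: "real^3 \<Rightarrow> 'b::{banach, second_countable_topology}"
  assumes [measurable]: "f \<in> borel_measurable borel"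
  shows "integrable lborel (\<lambda>z. f (x - z)) \<longleftrightarrow> integrable lborel f"
  by (subst (2) distr_lborel_diff[of x, symmetric], subst integrable_distr_eq) simp_all

lemma norm_integral_le_AE:
  fixes f :: "'a \<Rightarrow> 'b::{banach, second_countable_topology}"
  assumes "integrable M f" "integrable M g" "AE x in M. norm (f x) \<le> g x"
  shows "norm (integral\<^sup>L M f) \<le> integral\<^sup>L M g"
  using integral_norm_bound[of M f] integral_mono_AE[OF integrable_norm[OF assms(1)] assms(2,3)]
  by linarith

lemma AE_lborel_singleton: "AE z in lborel. z \<noteq> (x :: 'a::euclidean_space)"
proof -
  have "{x} \<in> null_sets lborel" by (rule finite_imp_null_set_lborel) simp
  from AE_not_in[OF this] show ?thesis by simp
qed

text \<open>Borel measurability and vanishing everywhere off \<open>K\<close>, not only almost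
  everywhere, keep products and case distinctions on \<open>z \<in> K\<close> free of null
  sets.\<close>

definition bdd_density :: "(real^3) set \<Rightarrow> (real^3 \<Rightarrow> complex) \<Rightarrow> bool" where
  "bdd_density K f \<longleftrightarrow> f \<in> borel_measurable borel \<and> bounded (range f) \<and> (\<forall>z. z \<notin> K \<longrightarrow> f z = 0)"

definition potential :: "real \<Rightarrow> (real^3 \<Rightarrow> complex) \<Rightarrow> real^3 \<Rightarrow> complex" where
  "potential \<kappa> f x = (LINT z|lborel. G_plus \<kappa> (x - z) * f z)"

text \<open>One integrable majorant for three purposes: on bounded sets it dominates the kernel, the
  square of the kernel and, as a sum of two copies, the difference quotients of the kernel. The
  cut-off is used at \<open>2 * M\<close>, which covers all differences of two points of the ball of
  radius \<open>M\<close>.\<close>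

definition sing :: "real \<Rightarrow> real^3 \<Rightarrow> real" where
  "sing N y = indicator (cball 0 N) y * (1 + 1 / (norm y)\<^sup>2)"

lemma sing_nonneg [simp]: "0 \<le> sing N y"
  by (simp add: sing_def)

lemma measurable_sing [measurable]: "sing N \<in> borel_measurable borel"
  unfolding sing_def by measurable

lemma integrable_sing: "integrable lborel (sing N)"
proof (cases "N \<ge> 0")
  case True
  have "set_integrable lborel (cball 0 N) (\<lambda>y::real^3. 1 + 1 / (norm y)\<^sup>2)"
    by (intro set_integral_add set_integrable_inverse_square True)
      (auto simp: set_integrable_def intro!: integrable_real_indicator emeasure_lborel_cball_finite)
  thus ?thesis unfolding set_integrable_def sing_def by simp
next
  case False
  hence "sing N = (\<lambda>_. 0)" by (auto simp: sing_def fun_eq_iff indicator_def)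
  thus ?thesis by simp
qed

definition sing_mass :: "real \<Rightarrow> real" where "sing_mass N = (LINT y|lborel. sing N y)"

lemma sing_mass_nonneg: "0 \<le> sing_mass N"
  unfolding sing_mass_def by (intro Bochner_Integration.integral_nonneg) simp

lemma integrable_sing_diff: "integrable lborel (\<lambda>z. sing N (x - z))"
  using integrable_lborel_diff[of "sing N" x] integrable_sing by simp

lemma integral_sing_diff: "(LINT z|lborel. sing N (x - z)) = sing_mass N"
  unfolding sing_mass_def by (rule integral_lborel_diff) simp

lemma norm_G_plus: "norm (G_plus \<kappa> y) = 1 / (4 * pi * norm y)"
  by (simp add: G_plus_def norm_divide norm_mult)

lemma measurable_G_plus [measurable]: "G_plus \<kappa> \<in> borel_measurable borel"
  unfolding G_plus_def by measurable

lemma norm_G_plus_le: "norm (G_plus \<kappa> y) \<le> 1 + 1 / (norm y)\<^sup>2"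
proof (cases "y = 0")
  case False
  define t where "t = 1 / norm y"
  have t: "t > 0" using False by (simp add: t_def)
  have "norm (G_plus \<kappa> y) = t / (4 * pi)" by (simp add: norm_G_plus t_def)
  also have "\<dots> \<le> t / 1" using t pi_gt3 by (intro divide_left_mono) auto
  also have "\<dots> \<le> 1 + t\<^sup>2" using zero_le_power2[of "t - 1/2"] by (simp add: power2_eq_square algebra_simps)
  finally show ?thesis by (simp add: t_def power_one_over)
qed (simp add: G_plus_def)

lemma G_plus_even: "G_plus \<kappa> (x - y) = G_plus \<kappa> (y - x)"
  by (simp add: G_plus_def norm_minus_commute)

lemma norm_exp_i_diff: "norm (exp (\<i> * of_real s) - exp (\<i> * of_real t)) \<le> \<bar>s - t\<bar>" for s t :: real
proof -
  have "norm (cis s - cis t) \<le> \<bar>s - t\<bar>"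
  proof -
    have "(norm (cis s - cis t))\<^sup>2 = (cos s - cos t)\<^sup>2 + (sin s - sin t)\<^sup>2"
      by (simp add: cmod_power2)
    also have "\<dots> = 2 - 2 * cos (s - t)"
      using sin_cos_squared_add[of s] sin_cos_squared_add[of t]
      by (simp add: cos_diff power2_eq_square algebra_simps)
    also have "\<dots> = (2 * sin ((s - t) / 2))\<^sup>2"
    proof -
      define u where "u = (s - t) / 2"
      have "s - t = 2 * u" by (simp add: u_def)
      thus ?thesis unfolding u_def[symmetric] using cos_double_sin[of u] by (simp add: power2_eq_square)
    qed
    finally have "sqrt ((2 * sin ((s - t) / 2))\<^sup>2) = norm (cis s - cis t)"
      by (rule real_sqrt_unique) simp
    hence "norm (cis s - cis t) = \<bar>2 * sin ((s - t) / 2)\<bar>" by (simp only: real_sqrt_abs)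
    also have "\<dots> \<le> \<bar>s - t\<bar>" using abs_sin_x_le_abs_x[of "(s-t)/2"] by (simp add: abs_mult)
    finally show ?thesis .
  qed
  thus ?thesis by (simp add: cis_conv_exp)
qed

text \<open>With s and t the two norms, changing phase and denominator one at a time gives |s - t|
  (\<kappa> / s + 1 / (s t)). The product 1 / (s t) is then bounded by a sum of squares, which
  separates the two points, so that integration against a bounded density yields a Lipschitz
  constant.\<close>

lemma G_plus_diff_le:
  assumes "\<kappa> \<ge> 0" "y \<noteq> 0" "y' \<noteq> 0"
  shows "norm (G_plus \<kappa> y - G_plus \<kappa> y')
    \<le> (\<kappa> + 1) * norm (y - y') * ((1 + 1 / (norm y)\<^sup>2) + (1 + 1 / (norm y')\<^sup>2))"
proof -
  define s t where "s = norm y" and "t = norm y'"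
  have st: "s > 0" "t > 0" using assms by (simp_all add: s_def t_def)
  let ?e = "\<lambda>r. exp (\<i> * of_real (\<kappa> * r))"
  have d: "\<bar>s - t\<bar> \<le> norm (y - y')" unfolding s_def t_def by (rule norm_triangle_ineq3)
  have "G_plus \<kappa> y - G_plus \<kappa> y' = - (1 / of_real (4 * pi)) *
     ((?e s - ?e t) / of_real s + ?e t * of_real ((t - s) / (s * t)))"
  proof -
    have *: "- A / (P * S) - (- B / (P * T)) = - (1 / P) * ((A - B) / S + B * ((T - S) / (S * T)))"
      if "P \<noteq> 0" "S \<noteq> 0" "T \<noteq> 0" for A B P S T :: complex
      using that by (simp add: divide_simps) (simp add: algebra_simps)
    show ?thesis using *[of "of_real (4 * pi)" "of_real s" "of_real t" "?e s" "?e t"] st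
      by (simp add: G_plus_def s_def t_def)
  qed
  hence "norm (G_plus \<kappa> y - G_plus \<kappa> y') = (1 / (4 * pi)) *
     norm ((?e s - ?e t) / of_real s + ?e t * of_real ((t - s) / (s * t)))"
    by (simp add: norm_mult norm_divide)
  also have "\<dots> \<le> 1 * (\<bar>\<kappa> * s - \<kappa> * t\<bar> / s + \<bar>t - s\<bar> / (s * t))"
  proof (intro mult_mono order_trans[OF norm_triangle_ineq] add_mono)
    show "norm ((?e s - ?e t) / of_real s) \<le> \<bar>\<kappa> * s - \<kappa> * t\<bar> / s"
      using norm_exp_i_diff[of "\<kappa> * s" "\<kappa> * t"] st by (simp add: norm_divide divide_right_mono)
    show "norm (?e t * of_real ((t - s) / (s * t))) \<le> \<bar>t - s\<bar> / (s * t)"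
      using st by (simp add: norm_mult norm_divide abs_mult flip: of_real_diff)
  qed (use pi_gt3 in auto)
  also have "\<dots> = \<bar>s - t\<bar> * (\<kappa> / s + 1 / (s * t))"
  proof -
    have "\<bar>\<kappa> * s - \<kappa> * t\<bar> = \<kappa> * \<bar>s - t\<bar>" "\<bar>t - s\<bar> = \<bar>s - t\<bar>"
      using assms(1) by (simp_all add: abs_mult flip: right_diff_distrib)
    thus ?thesis by (simp add: distrib_left)
  qed
  also have "\<dots> \<le> norm (y - y') * ((\<kappa> + 1) * ((1 + 1 / s\<^sup>2) + (1 + 1 / t\<^sup>2)))"
  proof (rule mult_mono[OF d])
    define p q where "p = 1 / s" and "q = 1 / t"
    have pq: "p > 0" "q > 0" using st by (simp_all add: p_def q_def)
    have "p \<le> 1 + p\<^sup>2" using zero_le_power2[of "p - 1/2"] by (simp add: power2_eq_square algebra_simps)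
    hence p: "p \<le> (1 + p\<^sup>2) + (1 + q\<^sup>2)" using zero_le_power2[of q] by linarith
    have "p * q \<le> (1 + p\<^sup>2) + (1 + q\<^sup>2)"
      using zero_le_power2[of "p - q"] zero_le_power2[of p] zero_le_power2[of q] mult_pos_pos[OF pq]
      by (simp add: power2_eq_square algebra_simps)
    hence "\<kappa> * p + p * q \<le> (\<kappa> + 1) * ((1 + p\<^sup>2) + (1 + q\<^sup>2))"
      using mult_left_mono[OF p assms(1)] by (simp add: algebra_simps)
    thus "\<kappa> / s + 1 / (s * t) \<le> (\<kappa> + 1) * ((1 + 1 / s\<^sup>2) + (1 + 1 / t\<^sup>2))"
      by (simp add: p_def q_def power_one_over)
  qed (use assms st in auto)
  finally show ?thesis unfolding s_def t_def by (simp add: mult_ac)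
qed

lemma sing_cball:
  assumes "norm z \<le> M" "norm x \<le> M"
  shows "sing (2 * M) (x - z) = 1 + 1 / (norm (x - z))\<^sup>2"
  using norm_triangle_ineq4[of x z] assms by (simp add: sing_def)

lemma integrable_potential:
  assumes f: "bdd_density K f" and K: "bounded K"
  shows "integrable lborel (\<lambda>z. G_plus \<kappa> (x - z) * f z)"
proof -
  obtain B where B: "\<And>z. norm (f z) \<le> B" using f unfolding bdd_density_def bounded_iff by auto
  obtain M0 where M0: "\<And>z. z \<in> K \<Longrightarrow> norm z \<le> M0" using K unfolding bounded_iff by auto
  define M where "M = max M0 (norm x)"
  have [measurable]: "f \<in> borel_measurable borel" using f by (simp add: bdd_density_def)
  show ?thesis
  proof (rule Bochner_Integration.integrable_bound)
    show "integrable lborel (\<lambda>z. sing (2 * M) (x - z) * B)"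
      by (intro integrable_mult_left integrable_sing_diff)
    have "norm (G_plus \<kappa> (x - z) * f z) \<le> norm (sing (2 * M) (x - z) * B)" for z
    proof (cases "z \<in> K")
      case True
      have "norm (G_plus \<kappa> (x - z) * f z) \<le> sing (2 * M) (x - z) * B"
        unfolding norm_mult using True M0 B norm_G_plus_le[of \<kappa> "x - z"]
        by (subst sing_cball) (auto simp: M_def le_max_iff_disj intro!: mult_mono)
      thus ?thesis by simp
    qed (use f in \<open>simp add: bdd_density_def\<close>)
    thus "AE z in lborel. norm (G_plus \<kappa> (x - z) * f z) \<le> norm (sing (2 * M) (x - z) * B)" by simp
  qed measurable
qed

lemma potential_bound:
  assumes f: "bdd_density K f" and K: "K \<subseteq> cball 0 M" and B: "\<And>z. norm (f z) \<le> B"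
    and x: "norm x \<le> M"
  shows "norm (potential \<kappa> f x) \<le> B * sing_mass (2 * M)"
proof -
  have "norm (potential \<kappa> f x) \<le> (LINT z|lborel. sing (2 * M) (x - z) * B)"
    unfolding potential_def
  proof (rule Bochner_Integration.integral_norm_bound_integral)
    show "integrable lborel (\<lambda>z. G_plus \<kappa> (x - z) * f z)"
      by (rule integrable_potential[OF f]) (use K bounded_subset bounded_cball in blast)
    show "integrable lborel (\<lambda>z. sing (2 * M) (x - z) * B)"
      by (intro integrable_mult_left integrable_sing_diff)
    have "B \<ge> 0" using B[of 0] norm_ge_zero order_trans by blast
    fix z
    show "norm (G_plus \<kappa> (x - z) * f z) \<le> sing (2 * M) (x - z) * B"
    proof (cases "z \<in> K")
      case True
      thus ?thesis unfolding norm_mult using K B x norm_G_plus_le[of \<kappa> "x - z"]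
        by (subst sing_cball) (auto intro!: mult_mono)
    qed (use f \<open>B \<ge> 0\<close> in \<open>simp add: bdd_density_def\<close>)
  qed
  also have "\<dots> = B * sing_mass (2 * M)" by (simp add: integral_sing_diff)
  finally show ?thesis .
qed

text \<open>The constant depends on the density only through \<open>B\<close>; this is the
  equicontinuity that later makes the potential a compact operator.\<close>

lemma potential_lipschitz:
  assumes f: "bdd_density K f" and K: "K \<subseteq> cball 0 M" and B: "\<And>z. norm (f z) \<le> B"
    and x: "norm x \<le> M" "norm x' \<le> M" and \<kappa>: "\<kappa> \<ge> 0"
  shows "norm (potential \<kappa> f x - potential \<kappa> f x')
    \<le> 2 * (\<kappa> + 1) * B * sing_mass (2 * M) * norm (x - x')"
proof -
  have bK: "bounded K" using K bounded_subset bounded_cball by blast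
  have B0: "B \<ge> 0" using B[of 0] norm_ge_zero order_trans by blast
  let ?c = "(\<kappa> + 1) * norm (x - x') * B"
  let ?g = "\<lambda>z. ?c * (sing (2 * M) (x - z) + sing (2 * M) (x' - z))"
  note i = integrable_potential[OF f bK]
  have "potential \<kappa> f x - potential \<kappa> f x' = (LINT z|lborel. (G_plus \<kappa> (x - z) - G_plus \<kappa> (x' - z)) * f z)"
    unfolding potential_def by (subst Bochner_Integration.integral_diff[symmetric]) (auto intro: i simp: left_diff_distrib)
  also have "norm \<dots> \<le> (LINT z|lborel. ?g z)"
  proof (rule norm_integral_le_AE)
    show "integrable lborel (\<lambda>z. (G_plus \<kappa> (x - z) - G_plus \<kappa> (x' - z)) * f z)"
      unfolding left_diff_distrib by (intro Bochner_Integration.integrable_diff i)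
    show "integrable lborel ?g"
      by (intro integrable_mult_right Bochner_Integration.integrable_add integrable_sing_diff)
  next
    have "AE z in lborel. z \<noteq> x \<and> z \<noteq> x'"
      using AE_lborel_singleton[of x] AE_lborel_singleton[of x'] by eventually_elim simp
    thus "AE z in lborel. norm ((G_plus \<kappa> (x - z) - G_plus \<kappa> (x' - z)) * f z) \<le> ?g z"
    proof eventually_elim
      case (elim z)
      show ?case
      proof (cases "z \<in> K")
        case True
        hence z: "norm z \<le> M" using K by auto
        have "norm (G_plus \<kappa> (x - z) - G_plus \<kappa> (x' - z))
          \<le> (\<kappa> + 1) * norm (x - x') * (sing (2 * M) (x - z) + sing (2 * M) (x' - z))"
          using G_plus_diff_le[OF \<kappa>, of "x - z" "x' - z"] elim
          by (auto simp: sing_cball[OF z x(1)] sing_cball[OF z x(2)])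
        from mult_mono[OF this B[of z]] \<kappa> show ?thesis by (simp add: norm_mult mult_ac)
      qed (use f B0 \<kappa> in \<open>simp add: bdd_density_def\<close>)
    qed
  qed
  also have "\<dots> = ?c * (2 * sing_mass (2 * M))"
    by (simp add: integral_sing_diff integrable_sing_diff)
  finally show ?thesis by (simp add: algebra_simps)
qed

section \<open>Algebra of bounded densities, continuity and symmetry of the potential\<close>

lemma bounded_subset_cball0: "bounded K \<Longrightarrow> \<exists>M. K \<subseteq> cball (0::'a::real_normed_vector) M"
  by (meson bounded_iff mem_cball_0 subsetI)

lemma bdd_densityI:
  assumes "f \<in> borel_measurable borel" "\<And>z. z \<in> K \<Longrightarrow> norm (f z) \<le> B" "\<And>z. z \<notin> K \<Longrightarrow> f z = 0"
  shows "bdd_density K f"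
proof -
  have "norm (f z) \<le> max B 0" for z
    using assms(2,3)[of z] by (cases "z \<in> K") auto
  thus ?thesis using assms(1,3) unfolding bdd_density_def bounded_iff by auto
qed

lemma bdd_density_bound:
  assumes "bdd_density K f"
  obtains B where "B > 0" "\<And>z. norm (f z) \<le> B"
proof -
  from assms have "bounded (range f)" by (simp add: bdd_density_def)
  thus thesis using that by (auto simp: bounded_pos)
qed

lemma bdd_density_measurable: "bdd_density K f \<Longrightarrow> f \<in> borel_measurable borel"
  by (simp add: bdd_density_def)

lemma bdd_density_zero: "bdd_density K f \<Longrightarrow> z \<notin> K \<Longrightarrow> f z = 0"
  by (simp add: bdd_density_def)

lemma bdd_density_mult:
  assumes v: "bdd_density K v" and g: "g \<in> borel_measurable borel" and B: "\<And>z. z \<in> K \<Longrightarrow> norm (g z) \<le> B"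
  shows "bdd_density K (\<lambda>z. v z * g z)"
proof -
  obtain A where A: "A > 0" "\<And>z. norm (v z) \<le> A" using bdd_density_bound[OF v] by blast
  have [measurable]: "v \<in> borel_measurable borel" by (rule bdd_density_measurable[OF v])
  note g [measurable]
  show ?thesis
  proof (rule bdd_densityI)
    fix z assume "z \<in> K"
    thus "norm (v z * g z) \<le> A * B" unfolding norm_mult using A B by (intro mult_mono) (auto intro: less_imp_le)
  qed (use v in \<open>auto simp: bdd_density_def\<close>)
qed

lemma bdd_density_mult_cont:
  assumes v: "bdd_density K v" and K: "bounded K" and g: "continuous_on UNIV g"
  shows "bdd_density K (\<lambda>z. v z * g z)"
proof -
  obtain M where M: "K \<subseteq> cball 0 M" using K by (metis bounded_subset_cball0)
  have "compact (g ` cball 0 M)" by (intro compact_continuous_image continuous_on_subset[OF g]) auto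
  then obtain B where "\<And>z. z \<in> cball 0 M \<Longrightarrow> norm (g z) \<le> B"
    using compact_imp_bounded bounded_iff by (metis imageI)
  thus ?thesis using M by (intro bdd_density_mult[OF v, of g B] borel_measurable_continuous_onI g) auto
qed

lemma bdd_density_add:
  assumes "bdd_density K f" "bdd_density K g"
  shows "bdd_density K (\<lambda>z. f z + g z)"
proof -
  obtain A where A: "\<And>z. norm (f z) \<le> A" using bdd_density_bound[OF assms(1)] by blast
  obtain B where B: "\<And>z. norm (g z) \<le> B" using bdd_density_bound[OF assms(2)] by blast
  note assms[THEN bdd_density_measurable, measurable]
  show ?thesis
    by (rule bdd_densityI[of _ _ "A + B"])
      (use A B assms in \<open>auto simp: bdd_density_def intro!: norm_triangle_le add_mono\<close>)
qed

lemma bdd_density_uminus: "bdd_density K f \<Longrightarrow> bdd_density K (\<lambda>z. - f z)"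
  by (auto simp: bdd_density_def bounded_iff)

lemma bdd_density_diff:
  assumes "bdd_density K f" "bdd_density K g"
  shows "bdd_density K (\<lambda>z. f z - g z)"
  using bdd_density_add[OF assms(1) bdd_density_uminus[OF assms(2)]] by simp

lemma integrable_bdd_density:
  assumes f: "bdd_density K f" and K: "bounded K" 
  shows "integrable lborel f"
proof -
  obtain B where B: "\<And>z. norm (f z) \<le> B" using bdd_density_bound[OF f] by blast
  obtain M where M: "K \<subseteq> cball 0 M" using K by (metis bounded_subset_cball0)
  show ?thesis
  proof (rule Bochner_Integration.integrable_bound)
    show "integrable lborel (\<lambda>z::real^3. indicat_real (cball 0 M) z * B)"
      by (auto intro!: integrable_real_indicator emeasure_lborel_cball_finite)
    have "norm (f z) \<le> norm (indicat_real (cball 0 M) z * B)" for z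
      using B[of z] M bdd_density_zero[OF f, of z] by (cases "z \<in> K") (auto simp: indicator_def)
    thus "AE z in lborel. norm (f z) \<le> norm (indicat_real (cball 0 M) z * B)" by simp
  qed (use bdd_density_measurable[OF f] in simp)
qed

lemma continuous_potential:
  assumes f: "bdd_density K f" and K: "bounded K" and \<kappa>: "\<kappa> \<ge> 0"
  shows "continuous_on UNIV (potential \<kappa> f)"
proof -
  obtain B where B: "B > 0" "\<And>z. norm (f z) \<le> B" using bdd_density_bound[OF f] by blast
  obtain M where M: "K \<subseteq> cball 0 M" using K by (metis bounded_subset_cball0)
  have "continuous_on (ball 0 N) (potential \<kappa> f)" for N
  proof -
    define L where "L = 2 * (\<kappa> + 1) * B * sing_mass (2 * max M N)"
    have "L-lipschitz_on (ball 0 N) (potential \<kappa> f)"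
    proof (rule lipschitz_onI)
      fix x y :: "real^3" assume "x \<in> ball 0 N" "y \<in> ball 0 N"
      hence "norm x \<le> max M N" "norm y \<le> max M N" by auto
      thus "dist (potential \<kappa> f x) (potential \<kappa> f y) \<le> L * dist x y"
        unfolding dist_norm L_def
        by (intro potential_lipschitz[OF f _ B(2)] \<kappa>) (use M in auto)
    qed (use B \<kappa> in \<open>auto simp: L_def sing_mass_nonneg\<close>)
    thus ?thesis by (rule lipschitz_on_continuous_on)
  qed
  hence "isCont (potential \<kappa> f) x" for x
    by (rule continuous_on_interior[of "ball 0 (norm x + 1)"]) simp
  thus ?thesis by (simp add: continuous_at_imp_continuous_on)
qed

text \<open>Fubini, dominated by a translate of \<open>sing\<close>. The kernel is general so as to
  cover both \<open>G_plus\<close> and the continuous kernel \<open>hom\<close>; the bound is asked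
  only on the ball of radius \<open>2 * M\<close> because \<open>hom\<close> may grow at
  infinity.\<close>

lemma conv_symmetric:
  fixes k :: "real^3 \<Rightarrow> complex"
  assumes f: "bdd_density K f" and g: "bdd_density K g" and K: "K \<subseteq> cball 0 M"
    and [measurable]: "k \<in> borel_measurable borel"
    and k: "\<And>y. norm y \<le> 2 * M \<Longrightarrow> norm (k y) \<le> C * (1 + 1 / (norm y)\<^sup>2)"
  shows "(LINT x|lborel. g x * (LINT z|lborel. k (x - z) * f z))
    = (LINT z|lborel. f z * (LINT x|lborel. k (x - z) * g x))"
proof -
  obtain A where A: "A > 0" "\<And>z. norm (f z) \<le> A" using bdd_density_bound[OF f] by blast
  obtain B where B: "B > 0" "\<And>z. norm (g z) \<le> B" using bdd_density_bound[OF g] by blast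
  have [measurable]: "f \<in> borel_measurable borel" "g \<in> borel_measurable borel"
    using f g by (simp_all add: bdd_density_def)
  let ?F = "\<lambda>x z. g x * (k (x - z) * f z)"
  have bound: "norm (?F x z) \<le> norm (indicator (cball 0 M) x * (B * A * \<bar>C\<bar> * sing (2 * M) (x - z)))" for x z
  proof (cases "x \<in> K \<and> z \<in> K")
    case True
    hence xz: "norm x \<le> M" "norm z \<le> M" using K by auto
    have "norm (k (x - z)) \<le> \<bar>C\<bar> * sing (2 * M) (x - z)"
    proof -
      have "norm (k (x - z)) \<le> C * (1 + 1 / (norm (x - z))\<^sup>2)"
        using norm_triangle_ineq4[of x z] xz by (intro k) auto
      also have "\<dots> \<le> \<bar>C\<bar> * (1 + 1 / (norm (x - z))\<^sup>2)" by (intro mult_right_mono) auto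
      finally show ?thesis by (simp add: sing_cball[OF xz(2,1)])
    qed
    hence "norm (g x) * (norm (k (x - z)) * norm (f z)) \<le> B * ((\<bar>C\<bar> * sing (2 * M) (x - z)) * A)"
      using A B by (intro mult_mono) (auto intro: less_imp_le)
    thus ?thesis using A B xz by (simp add: norm_mult abs_mult mult_ac)
  qed (use f g in \<open>auto simp: bdd_density_def\<close>)
  have int: "integrable (lborel \<Otimes>\<^sub>M lborel) (\<lambda>(x, z). ?F x z)"
  proof (rule Bochner_Integration.integrable_bound)
    show "integrable (lborel \<Otimes>\<^sub>M lborel)
      (\<lambda>(x, z). indicator (cball 0 M) x * (B * A * \<bar>C\<bar> * sing (2 * M) (x - z)))"
    proof (rule lborel_pair.Fubini_integrable)
      have "integrable lborel (\<lambda>x::real^3. indicat_real (cball 0 M) x * (B * A * \<bar>C\<bar> * sing_mass (2 * M)))"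
        by (auto intro!: integrable_real_indicator emeasure_lborel_cball_finite)
      thus "integrable lborel (\<lambda>x::real^3. LINT z|lborel. norm (case (x, z) of (x, z) \<Rightarrow>
         indicat_real (cball 0 M) x * (B * A * \<bar>C\<bar> * sing (2 * M) (x - z))))"
        using A B by (simp add: abs_mult integral_sing_diff mult_ac)
      show "AE x in lborel. integrable lborel (\<lambda>z. case (x::real^3, z) of (x, z) \<Rightarrow>
         indicat_real (cball 0 M) x * (B * A * \<bar>C\<bar> * sing (2 * M) (x - z)))"
        by (auto intro!: integrable_sing_diff)
    qed simp
    show "AE p in lborel \<Otimes>\<^sub>M lborel. norm (case p of (x, z) \<Rightarrow> ?F x z) \<le>
        norm (case p of (x, z) \<Rightarrow> indicator (cball 0 M) x * (B * A * \<bar>C\<bar> * sing (2 * M) (x - z)))"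
      using bound by auto
  qed simp
  have "(LINT x|lborel. g x * (LINT z|lborel. k (x - z) * f z)) = (LINT x|lborel. LINT z|lborel. ?F x z)"
    by simp
  also have "\<dots> = (LINT z|lborel. LINT x|lborel. ?F x z)"
    by (rule lborel_pair.Fubini_integral[OF int, symmetric])
  also have "\<dots> = (LINT z|lborel. LINT x|lborel. f z * (k (x - z) * g x))"
    by (simp add: mult_ac)
  finally show ?thesis by simp
qed

lemma potential_symmetric:
  assumes "bdd_density K f" "bdd_density K g" "bounded K"
  shows "(LINT x|lborel. g x * potential \<kappa> f x) = (LINT x|lborel. f x * potential \<kappa> g x)"
proof -
  obtain M where M: "K \<subseteq> cball 0 M" using assms(3) by (metis bounded_subset_cball0)
  show ?thesis unfolding potential_def
    using conv_symmetric[OF assms(1,2) M measurable_G_plus, of \<kappa> 1] norm_G_plus_le[of \<kappa>]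
    by (simp add: G_plus_even)
qed

section \<open>Real zeros of the potential along a line\<close>

text \<open>Cauchy's inequality on discs of radius r/2 bounds the derivative in t, hence the
  difference quotients, by 2 B / r uniformly in \<open>z \<in> K\<close>; dominated convergence then
  differentiates under the integral.\<close>

lemma holomorphic_integral:
  fixes g :: "complex \<Rightarrow> real^3 \<Rightarrow> complex"
  assumes S: "open S"
    and f: "bdd_density K f" "bounded K"
    and m: "\<And>t. t \<in> S \<Longrightarrow> (\<lambda>z. g t z * f z) \<in> borel_measurable borel"
    and h: "\<And>z. z \<in> K \<Longrightarrow> (\<lambda>t. g t z) holomorphic_on S"
    and b: "\<And>t0. t0 \<in> S \<Longrightarrow> \<exists>r>0. \<exists>B. \<forall>t\<in>cball t0 r. \<forall>z\<in>K. norm (g t z) \<le> B"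
  shows "(\<lambda>t. LINT z|lborel. g t z * f z) holomorphic_on S"
proof -
  have "(\<lambda>t. LINT z|lborel. g t z * f z) field_differentiable at t0" if t0: "t0 \<in> S" for t0
  proof -
    obtain r1 where r1: "r1 > 0" "cball t0 r1 \<subseteq> S" using S t0 open_contains_cball by blast
    obtain r2 B0 where r2: "r2 > 0" and B0: "\<And>t z. t \<in> cball t0 r2 \<Longrightarrow> z \<in> K \<Longrightarrow> norm (g t z) \<le> B0"
      using b[OF t0] by blast
    define r where "r = min r1 r2"
    define B where "B = max B0 0"
    have r: "r > 0" "cball t0 r \<subseteq> S" using r1 r2 by (auto simp: r_def)
    have B: "norm (g t z) \<le> B" if "t \<in> cball t0 r" "z \<in> K" for t z
      using B0[of t z] that by (auto simp: B_def r_def)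
    have B00: "B \<ge> 0" by (simp add: B_def)
    define U where "U = ball t0 (r/2)"
    have U: "U \<subseteq> cball t0 r" "t0 \<in> U" "open U" "convex U" using r by (auto simp: U_def)
    define q where "q t z = (g t z * f z - g t0 z * f z) / (t - t0)" for t z
    define d where "d z = deriv (\<lambda>t. g t z) t0 * f z" for z
    have f0: "f z = 0" if "z \<notin> K" for z using f(1) that by (rule bdd_density_zero)
    have lip: "norm (q t z) \<le> 2 * B / r * norm (f z)" if t: "t \<in> U - {t0}" for t z
    proof (cases "z \<in> K")
      case True
      have hz: "(\<lambda>t. g t z) holomorphic_on cball t0 r" using h[OF True] r by (meson holomorphic_on_subset)
      have der: "norm (deriv (\<lambda>t. g t z) s) \<le> 2 * B / r" if s: "s \<in> U" for s
      proof -
        have sub: "cball s (r/2) \<subseteq> cball t0 r"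
        proof
          fix w assume "w \<in> cball s (r/2)"
          thus "w \<in> cball t0 r" using s dist_triangle[of t0 w s] by (auto simp: U_def)
        qed
        have "norm ((deriv ^^ 1) (\<lambda>t. g t z) s) \<le> fact 1 * B / (r/2)^1"
        proof (rule Cauchy_inequality)
          show "(\<lambda>t. g t z) holomorphic_on ball s (r/2)"
            using hz sub by (meson ball_subset_cball holomorphic_on_subset order_trans)
          show "continuous_on (cball s (r/2)) (\<lambda>t. g t z)"
            using holomorphic_on_imp_continuous_on[OF hz] sub continuous_on_subset by blast
          fix x assume "norm (s - x) = r/2"
          hence "x \<in> cball t0 r" using sub by (auto simp: dist_norm)
          thus "norm (g x z) \<le> B" using B True by blast
        qed (use r in auto)
        thus ?thesis by (simp add: mult.commute)
      qed
      have "norm (g t z - g t0 z) \<le> 2 * B / r * norm (t - t0)"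
      proof (rule field_differentiable_bound[OF U(4) _ der])
        fix s assume s: "s \<in> U"
        have "(\<lambda>t. g t z) holomorphic_on U" using hz U by (meson holomorphic_on_subset)
        thus "((\<lambda>t. g t z) has_field_derivative deriv (\<lambda>t. g t z) s) (at s within U)"
          using s U by (meson holomorphic_derivI)
      qed (use t U in auto)
      moreover have "t \<noteq> t0" using t by auto
      ultimately have "norm (g t z - g t0 z) / norm (t - t0) \<le> 2 * B / r"
        by (simp add: pos_divide_le_eq)
      moreover have "norm (q t z) = norm (g t z - g t0 z) / norm (t - t0) * norm (f z)"
        by (simp add: q_def norm_mult norm_divide flip: left_diff_distrib)
      ultimately show ?thesis by (metis mult_right_mono norm_ge_zero)
    qed (simp add: q_def f0)
    have lim: "(\<lambda>i. q (X i) z) \<longlonglongrightarrow> d z" if X: "\<And>i. X i \<in> U - {t0}" "X \<longlonglongrightarrow> t0" for X z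
    proof (cases "z \<in> K")
      case True
      have "((\<lambda>t. g t z) has_field_derivative deriv (\<lambda>t. g t z) t0) (at t0 within U)"
        using h[OF True] t0 S by (metis holomorphic_derivI has_field_derivative_at_within)
      hence "((\<lambda>t. (g t z - g t0 z) / (t - t0)) \<longlongrightarrow> deriv (\<lambda>t. g t z) t0) (at t0 within U)"
        by (simp add: has_field_derivative_iff)
      hence "(\<lambda>i. (g (X i) z - g t0 z) / (X i - t0)) \<longlonglongrightarrow> deriv (\<lambda>t. g t z) t0"
        using X unfolding tendsto_at_iff_sequentially comp_def by blast
      hence "(\<lambda>i. (g (X i) z - g t0 z) / (X i - t0) * f z) \<longlonglongrightarrow> d z"
        unfolding d_def by (intro tendsto_intros)
      thus ?thesis by (simp add: q_def left_diff_distrib)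
    qed (simp add: q_def d_def f0)
    have mq: "q t \<in> borel_measurable borel" if "t \<in> U" for t
      unfolding q_def using m that U r t0 by (intro borel_measurable_divide borel_measurable_diff) auto
    have if': "integrable lborel f" by (rule integrable_bdd_density[OF f])
    have ig: "integrable lborel (\<lambda>z. g t z * f z)" if "t \<in> U" for t
    proof (rule Bochner_Integration.integrable_bound[of _ "\<lambda>z. B * norm (f z)"])
      show "(\<lambda>z. g t z * f z) \<in> borel_measurable lborel" using m that U r by auto
      have "norm (g t z * f z) \<le> norm (B * norm (f z))" for z
        using B[of t z] that U B00 by (cases "z \<in> K") (auto simp: f0 norm_mult abs_mult intro!: mult_right_mono)
      thus "AE z in lborel. norm (g t z * f z) \<le> norm (B * norm (f z))" by simp
    qed (use if' in simp)
    have "((\<lambda>t. (LINT z|lborel. g t z * f z)) has_field_derivative (LINT z|lborel. d z)) (at t0 within U)"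
      unfolding has_field_derivative_iff tendsto_at_iff_sequentially
    proof (intro allI impI)
      fix X assume X: "\<forall>i. X i \<in> U - {t0}" "X \<longlonglongrightarrow> t0"
      have "(\<lambda>i. LINT z|lborel. q (X i) z) \<longlonglongrightarrow> (LINT z|lborel. d z)"
      proof (rule integral_dominated_convergence[where w = "\<lambda>z. 2 * B / r * norm (f z)"])
        show "d \<in> borel_measurable lborel"
          using borel_measurable_LIMSEQ_metric[of "\<lambda>i. q (X i)" borel d] X(1) lim[of X, OF _ X(2)] mq by auto
        show "AE z in lborel. (\<lambda>i. q (X i) z) \<longlonglongrightarrow> d z" using lim[of X, OF _ X(2)] X(1) by simp
        show "AE z in lborel. norm (q (X i) z) \<le> 2 * B / r * norm (f z)" for i
          using lip[of "X i"] X(1) by simp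
        show "q (X i) \<in> borel_measurable lborel" for i using mq[of "X i"] X(1) by simp
        show "integrable lborel (\<lambda>z. 2 * B / r * norm (f z))" using if' by simp
      qed
      moreover have "(LINT z|lborel. q (X i) z) = ((LINT z|lborel. g (X i) z * f z) - (LINT z|lborel. g t0 z * f z)) / (X i - t0)" for i
        unfolding q_def using X U ig by (simp add: Bochner_Integration.integral_diff)
      ultimately show "((\<lambda>t. ((LINT z|lborel. g t z * f z) - (LINT z|lborel. g t0 z * f z)) / (t - t0)) \<circ> X)
          \<longlonglongrightarrow> (LINT z|lborel. d z)" by (simp add: comp_def)
    qed
    thus ?thesis using at_within_open[OF U(2,3)] by (auto simp: field_differentiable_def)
  qed
  thus ?thesis by (simp add: holomorphic_on_def field_differentiable_at_within)
qed

lemma measurable_mult_density: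
  fixes g :: "real^3 \<Rightarrow> complex"
  assumes f: "bdd_density K f" and K: "compact K" and g: "continuous_on K g"
  shows "(\<lambda>z. g z * f z) \<in> borel_measurable borel"
proof -
  have "(\<lambda>z. indicator K z *\<^sub>R g z) \<in> borel_measurable borel"
    using K g by (intro borel_measurable_continuous_on_indicator) (auto intro: borel_compact)
  hence "(\<lambda>z. (indicator K z *\<^sub>R g z) * f z) \<in> borel_measurable borel"
    by (rule borel_measurable_times[OF _ bdd_density_measurable[OF f]])
  moreover have "(indicator K z *\<^sub>R g z) * f z = g z * f z" for z
    using bdd_density_zero[OF f, of z] by (cases "z \<in> K") auto
  ultimately show ?thesis by simp
qed

lemma holomorphic_integral_compact:
  fixes g :: "complex \<Rightarrow> real^3 \<Rightarrow> complex"
  assumes S: "open S" and f: "bdd_density K f" and K: "compact K"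
    and c: "continuous_on (S \<times> K) (\<lambda>(t, z). g t z)"
    and h: "\<And>z. z \<in> K \<Longrightarrow> (\<lambda>t. g t z) holomorphic_on S"
  shows "(\<lambda>t. LINT z|lborel. g t z * f z) holomorphic_on S"
proof (rule holomorphic_integral[OF S f compact_imp_bounded[OF K] _ h])
  fix t assume t: "t \<in> S"
  have "continuous_on K (Pair t)" by (intro continuous_intros)
  hence "continuous_on K (g t)"
    using continuous_on_compose2[OF c, of K "Pair t"] t by auto
  thus "(\<lambda>z. g t z * f z) \<in> borel_measurable borel" by (rule measurable_mult_density[OF f K])
next
  fix t0 assume "t0 \<in> S"
  then obtain r where r: "r > 0" "cball t0 r \<subseteq> S" using S open_contains_cball by blast
  have "compact ((\<lambda>(t, z). g t z) ` (cball t0 r \<times> K))"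
    using r K by (intro compact_continuous_image continuous_on_subset[OF c] compact_Times) auto
  hence "bounded ((\<lambda>(t, z). g t z) ` (cball t0 r \<times> K))" by (rule compact_imp_bounded)
  then obtain B where "\<forall>w\<in>(\<lambda>(t, z). g t z) ` (cball t0 r \<times> K). norm w \<le> B"
    unfolding bounded_iff by blast
  hence "\<forall>t\<in>cball t0 r. \<forall>z\<in>K. norm (g t z) \<le> B" by auto
  thus "\<exists>r>0. \<exists>B. \<forall>t\<in>cball t0 r. \<forall>z\<in>K. norm (g t z) \<le> B" using r by blast
qed

text \<open>Near \<open>s = 0\<close> the factor \<open>exp (\<i> \<kappa> / s)\<close> takes every phase arbitrarily often, while the phase of a
  nonzero holomorphic function stabilises.\<close>

lemma holomorphic_oscillation_zero:
  assumes h: "h holomorphic_on ball 0 r" and r: "r > 0" and \<kappa>: "\<kappa> > (0::real)"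
    and real: "\<And>s::real. 0 < s \<Longrightarrow> s < r \<Longrightarrow> Im (exp (\<i> * of_real (\<kappa> / s)) * h (of_real s)) = 0"
    and w: "w \<in> ball 0 r"
  shows "h w = 0"
proof (rule ccontr)
  assume nz: "h w \<noteq> 0"
  \<comment> \<open>The power of s split off at the zero is positive on the ray, so the reality
    hypothesis passes to \<open>g\<close>, which does not vanish at 0.\<close>
  obtain g r' n where r': "0 < r'" "ball 0 r' \<subseteq> ball (0::complex) r" and g: "g holomorphic_on ball 0 r'"
    and hg: "\<And>w. w \<in> ball 0 r' \<Longrightarrow> h w = w ^ n * g w" and g0: "g 0 \<noteq> 0"
  proof (cases "h constant_on ball 0 r \<or> h 0 \<noteq> 0")
    case True
    have "h 0 \<noteq> 0"
    proof
      assume "h 0 = 0"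
      with True obtain c where "\<And>x. x \<in> ball 0 r \<Longrightarrow> h x = c" by (auto simp: constant_on_def)
      with \<open>h 0 = 0\<close> w nz r show False by (metis centre_in_ball)
    qed
    thus thesis using that[of r h 0] h r by auto
  next
    case False
    hence nc: "\<not> h constant_on ball 0 r" "h 0 = 0" by auto
    show thesis
    proof (rule holomorphic_factor_zero_nonconstant[OF h open_ball connected_ball _ nc(2) nc(1)])
      fix g r' n
      assume "0 < (n::nat)" "0 < r'" "ball 0 r' \<subseteq> ball (0::complex) r" "g holomorphic_on ball 0 r'"
        "\<And>w. w \<in> ball 0 r' \<Longrightarrow> h w = (w - 0) ^ n * g w" "\<And>w. w \<in> ball 0 r' \<Longrightarrow> g w \<noteq> 0"
      thus thesis using that[of r' g n] by auto
    qed (use r in auto)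
  qed
  have re: "Im (exp (\<i> * of_real (\<kappa> / s)) * g (of_real s)) = 0" if s: "0 < s" "s < r'" for s
  proof -
    have "s < r" using subsetD[OF r'(2), of "of_real s"] s by simp
    hence "0 = Im (exp (\<i> * of_real (\<kappa> / s)) * h (of_real s))" using real s by simp
    also have "\<dots> = Im (of_real (s ^ n) * (exp (\<i> * of_real (\<kappa> / s)) * g (of_real s)))"
      using hg[of "of_real s"] s by (simp add: mult_ac)
    also have "\<dots> = s ^ n * Im (exp (\<i> * of_real (\<kappa> / s)) * g (of_real s))"
      by simp
    finally show ?thesis using s by simp
  qed
  have lim: "Im (exp (\<i> * of_real \<phi>) * g 0) = 0" if \<phi>: "\<phi> \<ge> 0" for \<phi> :: real
  proof -
    \<comment> \<open>Chosen so that \<kappa> / s j = 2 pi (j + 1) + \<phi>: the oscillating factor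
      is then the constant exp(i \<phi>), while s j tends to 0.\<close>
    define s where "s j = \<kappa> / (2 * pi * real (Suc j) + \<phi>)" for j
    have den: "2 * pi * real (Suc j) + \<phi> > 0" for j using \<phi> by (intro add_pos_nonneg) auto
    have sp: "s j > 0" for j using \<kappa> den by (simp add: s_def)
    have s0: "s \<longlonglongrightarrow> 0"
    proof (rule real_tendsto_sandwich[OF _ _ tendsto_const])
      show "\<forall>\<^sub>F j in sequentially. 0 \<le> s j" using sp by (simp add: less_imp_le)
      have "s j \<le> \<kappa> * inverse (real (Suc j))" for j
      proof -
        have "real (Suc j) \<le> 2 * pi * real (Suc j) + \<phi>"
        proof -
          have "1 * real (Suc j) \<le> 2 * pi * real (Suc j)" using pi_gt3 by (intro mult_right_mono) auto
          thus ?thesis using add_increasing2[OF \<phi>] by (metis mult_1)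
        qed
        thus ?thesis unfolding s_def divide_inverse using \<kappa>
          by (intro mult_left_mono le_imp_inverse_le) auto
      qed
      thus "\<forall>\<^sub>F j in sequentially. s j \<le> \<kappa> * inverse (real (Suc j))" by simp
      show "(\<lambda>j. \<kappa> * inverse (real (Suc j))) \<longlonglongrightarrow> 0"
        using tendsto_mult_left[OF LIMSEQ_inverse_real_of_nat, of \<kappa>] by simp
    qed
    have ex: "exp (\<i> * of_real (\<kappa> / s j)) = exp (\<i> * of_real \<phi>)" for j
    proof -
      have "\<kappa> / s j = 2 * pi * real (Suc j) + \<phi>" using \<kappa> den[of j] by (simp add: s_def)
      hence "cis (\<kappa> / s j) = cis (2 * pi * real (Suc j)) * cis \<phi>" by (simp only: cis_mult)
      also have "cis (2 * pi * real (Suc j)) = 1" by (rule cis_multiple_2pi) simp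
      finally show ?thesis by (simp add: cis_conv_exp)
    qed
    have "isCont g 0" using holomorphic_on_imp_continuous_on[OF g] r'
      by (simp add: continuous_on_eq_continuous_at)
    moreover have "(\<lambda>j. complex_of_real (s j)) \<longlonglongrightarrow> 0" using tendsto_of_real[OF s0] by simp
    ultimately have "(\<lambda>j. g (of_real (s j))) \<longlonglongrightarrow> g 0" by (rule isCont_tendsto_compose)
    hence "(\<lambda>j. Im (exp (\<i> * of_real \<phi>) * g (of_real (s j)))) \<longlonglongrightarrow> Im (exp (\<i> * of_real \<phi>) * g 0)"
      by (intro tendsto_intros)
    moreover have "\<forall>\<^sub>F j in sequentially. Im (exp (\<i> * of_real \<phi>) * g (of_real (s j))) = 0"
      using order_tendstoD(2)[OF s0 r'(1)]
    proof eventually_elim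
      case (elim j)
      show ?case using re[OF sp elim] unfolding ex .
    qed
    ultimately show ?thesis using tendsto_eventually tendsto_unique[OF sequentially_bot] by metis
  qed
  \<comment> \<open>The phases 0 and pi / 2 isolate the imaginary and the real part of
    \<open>g 0\<close>.\<close>
  have "Im (g 0) = 0" using lim[of 0] by simp
  moreover have "Re (g 0) = 0" using lim[of "pi/2"] by (simp flip: cis_conv_exp del: of_real_divide)
  ultimately show False using g0 by (simp add: complex_eq_iff)
qed

lemma csqrt_square_pos:
  assumes "Re q > 0"
  shows "csqrt (q\<^sup>2) = q"
  using assms by (intro csqrt_unique) auto

lemma norm_line_power2:
  "(norm (x0 + t *\<^sub>R d - z))\<^sup>2 = t\<^sup>2 * (d \<bullet> d) + 2 * (d \<bullet> (x0 - z)) * t + (x0 - z) \<bullet> (x0 - z)"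
  for d :: "'a::real_inner"
proof -
  have "x0 + t *\<^sub>R d - z = t *\<^sub>R d + (x0 - z)" by simp
  thus ?thesis unfolding power2_norm_eq_inner
    by (simp only:) (simp add: inner_add_left inner_add_right inner_commute power2_eq_square algebra_simps)
qed

text \<open>The squared distance from z to the point of parameter t is a quadratic polynomial P in
  t, so the potential continues holomorphically to complex t. Near infinity the substitution t = 1/s
  brings out the factor exp(i \<kappa> / s), to which \<open>holomorphic_oscillation_zero\<close>
  applies; the zeros found for large t then spread over the strip by the identity theorem.\<close>

lemma potential_line_zero:
  assumes f: "bdd_density K f" and K: "compact K" and \<kappa>: "\<kappa> > 0" and d: "norm d = 1"
    and line: "\<And>t. x0 + t *\<^sub>R d \<notin> K"
    and \<epsilon>: "\<epsilon> > 0" and Im0: "\<And>t. \<bar>t\<bar> < \<epsilon> \<Longrightarrow> Im (potential \<kappa> f (x0 + t *\<^sub>R d)) = 0"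
  shows "potential \<kappa> f (x0 + t *\<^sub>R d) = 0"
proof -
  define b where "b z = d \<bullet> (x0 - z)" for z
  define c where "c z = (x0 - z) \<bullet> (x0 - z)" for z
  have dd: "d \<bullet> d = 1" using d by (simp add: norm_eq_sqrt_inner)
  have contbc: "continuous_on A b" "continuous_on A c" for A
    unfolding b_def c_def by (intro continuous_intros)+
  have nrm: "(norm (x0 + t *\<^sub>R d - z))\<^sup>2 = t\<^sup>2 + 2 * b z * t + c z" for t z
    using norm_line_power2[of x0 t d z] by (simp add: dd b_def c_def)
  \<comment> \<open>\<open>c z - (b z)\<^sup>2\<close> is the squared distance of z from the line,
    and by compactness it has a positive lower bound on \<open>K\<close>.\<close>
  obtain \<delta> where \<delta>: "\<delta> > 0" "\<And>z. z \<in> K \<Longrightarrow> c z - (b z)\<^sup>2 \<ge> \<delta>\<^sup>2"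
  proof (cases "K = {}")
    case False
    have "continuous_on K (\<lambda>z. c z - (b z)\<^sup>2)" by (intro continuous_intros contbc)
    then obtain z0 where z0: "z0 \<in> K" "\<And>z. z \<in> K \<Longrightarrow> c z0 - (b z0)\<^sup>2 \<le> c z - (b z)\<^sup>2"
      using continuous_attains_inf[OF K False] by blast
    have "c z0 - (b z0)\<^sup>2 = (norm (x0 + (- b z0) *\<^sub>R d - z0))\<^sup>2"
      using nrm[of "- b z0" z0] by (simp add: power2_eq_square)
    hence "c z0 - (b z0)\<^sup>2 > 0" using line[of "- b z0"] z0 by (simp add: zero_less_power2) (metis add.commute)?
    thus thesis using z0 that[of "sqrt (c z0 - (b z0)\<^sup>2)"] by simp
  qed (use that[of 1] in auto)
  define P where "P t z = t\<^sup>2 + 2 * of_real (b z) * t + of_real (c z)" for t :: complex and z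
  \<comment> \<open>In this strip the real part of P stays positive for \<open>z \<in> K\<close>, so
    that the principal square root is holomorphic.\<close>
  define S where "S = {t. \<bar>Im t\<bar> < \<delta>}"
  define g where "g t z = exp (\<i> * of_real \<kappa> * csqrt (P t z)) / csqrt (P t z)" for t z
  have S_convex: "convex S"
  proof -
    have "S = {t. Im t < \<delta>} \<inter> {t. Im t > - \<delta>}" by (auto simp: S_def)
    thus ?thesis by (auto intro!: convex_Int convex_halfspace_Im_lt convex_halfspace_Im_gt)
  qed
  have S_open: "open S"
  proof -
    have "S = {t. Im t < \<delta>} \<inter> {t. Im t > - \<delta>}" by (auto simp: S_def)
    thus ?thesis by (auto intro!: open_Int open_halfspace_Im_lt open_halfspace_Im_gt)
  qed
  have PS: "P t z \<notin> \<real>\<^sub>\<le>\<^sub>0" if t: "t \<in> S" and z: "z \<in> K" for t z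
  proof
    assume "P t z \<in> \<real>\<^sub>\<le>\<^sub>0"
    hence 1: "Re (P t z) \<le> 0" "Im (P t z) = 0" by (simp_all add: complex_nonpos_Reals_iff)
    have re: "Re (P t z) = (Re t + b z)\<^sup>2 - (Im t)\<^sup>2 + (c z - (b z)\<^sup>2)"
      by (simp add: P_def power2_eq_square algebra_simps)
    have im: "Im (P t z) = 2 * Im t * (Re t + b z)" by (simp add: P_def power2_eq_square algebra_simps)
    have "(Im t)\<^sup>2 < \<delta>\<^sup>2" using t \<delta>(1) power_strict_mono[of "\<bar>Im t\<bar>" \<delta> 2] by (simp add: S_def)
    hence "(Re t + b z)\<^sup>2 - (Im t)\<^sup>2 + (c z - (b z)\<^sup>2) > 0"
      using \<delta>(2)[OF z] zero_le_power2[of "Re t + b z"] by linarith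
    thus False using 1 re by linarith
  qed
  have contP: "continuous_on A (\<lambda>p. P (fst p) (snd p))" for A
  proof -
    have "continuous_on A (\<lambda>p. b (snd p))" "continuous_on A (\<lambda>p. c (snd p))" for A :: "(complex \<times> (real^3)) set"
      by (rule continuous_on_compose2[OF contbc(1)[of UNIV] continuous_on_snd[OF continuous_on_id]]
          continuous_on_compose2[OF contbc(2)[of UNIV] continuous_on_snd[OF continuous_on_id]]; simp)+
    thus ?thesis unfolding P_def by (intro continuous_intros)
  qed
  define W where "W t = (LINT z|lborel. g t z * f z)" for t
  have W: "W holomorphic_on S" unfolding W_def
  proof (rule holomorphic_integral_compact[OF S_open f K])
    have c1: "continuous_on (S \<times> K) (\<lambda>p. csqrt (P (fst p) (snd p)))"
      by (rule continuous_on_compose2[OF continuous_on_csqrt contP]) (use PS in auto)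
    have "csqrt (P (fst p) (snd p)) \<noteq> 0" if "p \<in> S \<times> K" for p using PS[of "fst p" "snd p"] that by auto
    hence "continuous_on (S \<times> K) (\<lambda>p. g (fst p) (snd p))" unfolding g_def
      by (intro continuous_intros c1) auto
    thus "continuous_on (S \<times> K) (\<lambda>(t, z). g t z)" by (simp add: case_prod_beta)
    fix z assume z: "z \<in> K"
    have "(\<lambda>t. csqrt (P t z)) holomorphic_on S"
      using PS[OF _ z] by (intro holomorphic_on_csqrt') (auto simp: P_def intro!: holomorphic_intros)
    moreover have "csqrt (P t z) \<noteq> 0" if "t \<in> S" for t using PS[OF that z] by auto
    moreover have "(\<lambda>t. exp (\<i> * of_real \<kappa> * q t) / q t) holomorphic_on S"
      if "q holomorphic_on S" "\<And>t. t \<in> S \<Longrightarrow> q t \<noteq> 0" for q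
      using that by (intro holomorphic_intros) auto
    ultimately show "(\<lambda>t. g t z) holomorphic_on S" unfolding g_def by blast
  qed
  have Wreal: "potential \<kappa> f (x0 + t *\<^sub>R d) = - 1 / (4 * of_real pi) * W (of_real t)" for t
  proof -
    have "P (of_real t) z = of_real ((norm (x0 + t *\<^sub>R d - z))\<^sup>2)" for z
      by (simp add: nrm P_def algebra_simps)
    hence "csqrt (P (of_real t) z) = of_real (norm (x0 + t *\<^sub>R d - z))" for z
      by (simp only:) (simp add: csqrt_of_real_nonneg)
    hence "G_plus \<kappa> (x0 + t *\<^sub>R d - z) * f z = - 1 / (4 * of_real pi) * (g (of_real t) z * f z)" for z
      by (simp add: G_plus_def g_def mult.assoc)
    thus ?thesis unfolding potential_def W_def by (simp only: integral_mult_right_zero)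
  qed
  have ImW: "Im (W (of_real t)) = 0" for t
  proof -
    \<comment> \<open>Difference of W and its Schwarz reflection: on the real axis it equals 2 i Im
      W, which vanishes on an interval, hence everywhere.\<close>
    define V where "V t = W t - cnj (W (cnj t))" for t
    have "x \<in> cnj ` S" if "x \<in> S" for x
      using that by (intro image_eqI[of _ _ "cnj x"]) (auto simp: S_def)
    hence "cnj ` S = S" by (auto simp: S_def)
    hence "(\<lambda>t. cnj (W (cnj t))) holomorphic_on S"
      using holomorphic_on_compose_cnj_cnj[of W S] W S_open by (simp add: comp_def)
    hence V: "V holomorphic_on S" unfolding V_def by (intro holomorphic_intros W)
    have "V (of_real t) = 0"
    proof (rule analytic_continuation[OF V S_open convex_connected[OF S_convex]])
      show "of_real ` {0<..<\<epsilon>} \<subseteq> S" using \<delta> by (auto simp: S_def)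
      show "(0::complex) \<in> S" "of_real t \<in> S" using \<delta> by (auto simp: S_def)
      show "0 islimpt complex_of_real ` {0<..<\<epsilon>}"
        unfolding islimpt_approachable
      proof (intro allI impI)
        fix e :: real assume "e > 0"
        thus "\<exists>x'\<in>complex_of_real ` {0<..<\<epsilon>}. x' \<noteq> 0 \<and> dist x' 0 < e"
          using \<epsilon> by (intro bexI[of _ "of_real (min e \<epsilon> / 2)"] image_eqI[OF refl])
            (auto simp del: of_real_divide)
      qed
      fix w assume "w \<in> complex_of_real ` {0<..<\<epsilon>}"
      then obtain s where s: "w = of_real s" "\<bar>s\<bar> < \<epsilon>" by auto
      have "Im (W w) = 0" using Im0[OF s(2)] unfolding Wreal s(1) by (simp add: Im_divide_of_real)
      thus "V w = 0" by (simp add: V_def s(1) complex_eq_iff)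
    qed
    thus ?thesis by (simp add: V_def complex_eq_iff)
  qed
  obtain m where m: "m > 0" "\<And>z. z \<in> K \<Longrightarrow> \<bar>b z\<bar> \<le> m" "\<And>z. z \<in> K \<Longrightarrow> \<bar>c z\<bar> \<le> m"
  proof -
    have "bounded (b ` K)" "bounded (c ` K)"
      by (intro compact_imp_bounded compact_continuous_image contbc K)+
    then obtain m1 m2 where "m1 > 0" "\<forall>x\<in>b ` K. norm x \<le> m1" "m2 > 0" "\<forall>x\<in>c ` K. norm x \<le> m2"
      unfolding bounded_pos by blast
    thus thesis using that[of "max m1 m2"] by (auto simp: le_max_iff_disj)
  qed
  \<comment> \<open>\<open>s0 * m \<le> 1/4\<close> gives |Q - 1| < 1 on the disc, which keeps Q in
    the right half-plane.\<close>
  define s0 where "s0 = 1 / (4 * (m + 1))"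
  have s0: "s0 > 0" "s0 \<le> 1/4" "s0 * m \<le> 1/4" using m(1) by (auto simp: s0_def divide_simps)
  define Q where "Q s z = 1 + 2 * of_real (b z) * s + of_real (c z) * s\<^sup>2" for s :: complex and z
  \<comment> \<open>With q the root of Q, the root of P at t = 1/s is q / s = 1 / s + (q - 1) / s.
    The last fraction is rationalised to (2 b + c s) / (q + 1), which has no pole at s = 0.\<close>
  define h where "h s z = exp (\<i> * of_real \<kappa> * ((2 * of_real (b z) + of_real (c z) * s) / (csqrt (Q s z) + 1))) / csqrt (Q s z)" for s z
  have Qre: "Re (Q s z) > 0" if s: "s \<in> ball 0 s0" and z: "z \<in> K" for s z
  proof -
    have ns: "norm s \<le> s0" using s by simp
    have "norm (Q s z - 1) \<le> 2 * \<bar>b z\<bar> * norm s + \<bar>c z\<bar> * (norm s)\<^sup>2"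
      unfolding Q_def by (rule order_trans[OF _ norm_triangle_ineq[THEN order_trans]]) (auto simp: norm_mult norm_power)
    also have "\<dots> \<le> 2 * m * s0 + m * (s0 * (1/4))"
      unfolding power2_eq_square using ns m(2,3)[OF z] m(1) s0 by (intro add_mono mult_mono) auto
    also have "\<dots> < 1" using s0 by (simp add: mult_ac)
    finally have "\<bar>Re (Q s z - 1)\<bar> < 1" using abs_Re_le_cmod[of "Q s z - 1"] by linarith
    thus ?thesis by simp
  qed
  hence Qn: "Q s z \<notin> \<real>\<^sub>\<le>\<^sub>0" if "s \<in> ball 0 s0" "z \<in> K" for s z
    using that by (fastforce simp: complex_nonpos_Reals_iff)
  have Q1: "csqrt (Q s z) \<noteq> 0" "csqrt (Q s z) + 1 \<noteq> 0" if "s \<in> ball 0 s0" "z \<in> K" for s z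
  proof -
    show "csqrt (Q s z) \<noteq> 0" using Qn[OF that] by auto
    have "Re (csqrt (Q s z) + 1) > 0" using csqrt_principal[of "Q s z"] by (auto simp del: csqrt.sel)
    thus "csqrt (Q s z) + 1 \<noteq> 0" by (metis less_irrefl zero_complex.sel(1))
  qed
  define H where "H s = (LINT z|lborel. h s z * f z)" for s
  have H: "H holomorphic_on ball 0 s0" unfolding H_def
  proof (rule holomorphic_integral_compact[OF open_ball f K])
    let ?A = "ball 0 s0 \<times> K"
    have cbc: "continuous_on ?A (\<lambda>p. b (snd p))" "continuous_on ?A (\<lambda>p. c (snd p))"
      by (rule continuous_on_compose2[OF contbc(1)[of UNIV] continuous_on_snd[OF continuous_on_id]]
          continuous_on_compose2[OF contbc(2)[of UNIV] continuous_on_snd[OF continuous_on_id]]; simp)+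
    hence "continuous_on ?A (\<lambda>p. Q (fst p) (snd p))" unfolding Q_def by (intro continuous_intros)
    hence c1: "continuous_on ?A (\<lambda>p. csqrt (Q (fst p) (snd p)))"
      by (rule continuous_on_compose2[OF continuous_on_csqrt]) (use Qn in auto)
    have "continuous_on ?A (\<lambda>p. h (fst p) (snd p))" unfolding h_def
      using Q1 by (intro continuous_intros c1 cbc) (auto simp: mem_Times_iff)
    thus "continuous_on ?A (\<lambda>(t, z). h t z)" by (simp add: case_prod_beta)
    fix z assume z: "z \<in> K"
    have hq: "(\<lambda>t. csqrt (Q t z)) holomorphic_on ball 0 s0"
      using Qn[OF _ z] by (intro holomorphic_on_csqrt') (auto simp: Q_def intro!: holomorphic_intros)
    have gen: "(\<lambda>t. exp (\<i> * of_real \<kappa> * ((2 * of_real (b z) + of_real (c z) * t) / (q t + 1))) / q t)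
        holomorphic_on ball 0 s0"
      if "q holomorphic_on ball 0 s0" "\<And>t. t \<in> ball 0 s0 \<Longrightarrow> q t \<noteq> 0" "\<And>t. t \<in> ball 0 s0 \<Longrightarrow> q t + 1 \<noteq> 0" for q
      using that by (intro holomorphic_intros) auto
    show "(\<lambda>t. h t z) holomorphic_on ball 0 s0" unfolding h_def
      by (rule gen[OF hq Q1[OF _ z]])
  qed
  have WH: "W (of_real (1 / s)) = of_real s * (exp (\<i> * of_real (\<kappa> / s)) * H (of_real s))"
    if s: "0 < s" "s < s0" for s
  proof -
    have *: "g (of_real (1 / s)) z = of_real s * exp (\<i> * of_real (\<kappa> / s)) * h (of_real s) z" if z: "z \<in> K" for z
    proof -
      have sb: "complex_of_real s \<in> ball 0 s0" using s by simp
      define q where "q = csqrt (Q (of_real s) z)"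
      have q2: "q\<^sup>2 = Q (of_real s) z" by (simp add: q_def)
      have "Im (Q (of_real s) z) = 0" by (simp add: Q_def power2_eq_square)
      hence q: "q = of_real (sqrt (Re (Q (of_real s) z)))" unfolding q_def
        using Qre[OF sb z] by (intro csqrt_of_real_nonneg) auto
      hence qre: "Re q > 0" using Qre[OF sb z] by simp
      have "P (of_real (1 / s)) z = (q / of_real s)\<^sup>2"
        unfolding power_divide q2 P_def Q_def using s by (simp add: field_simps power2_eq_square)
      moreover have "Re (q / of_real s) > 0" using qre s by simp
      ultimately have cP: "csqrt (P (of_real (1 / s)) z) = q / of_real s" by (metis csqrt_square_pos)
      have q1: "q + 1 \<noteq> 0" "q \<noteq> 0" using Q1[OF sb z] by (simp_all add: q_def)
      have "(q - 1) * (q + 1) = of_real s * (2 * of_real (b z) + of_real (c z) * of_real s)"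
        using q2 by (simp add: Q_def power2_eq_square algebra_simps)
      hence "q = 1 + of_real s * ((2 * of_real (b z) + of_real (c z) * of_real s) / (q + 1))"
        using q1 by (simp add: field_simps)
      hence "q / of_real s = 1 / of_real s + (2 * of_real (b z) + of_real (c z) * of_real s) / (q + 1)"
        (is "_ = _ + ?X")
      proof -
        have "q / of_real s = (1 + of_real s * ?X) / of_real s"
          using \<open>q = 1 + of_real s * ?X\<close> by (rule arg_cong)
        thus ?thesis using s by (simp add: add_divide_distrib)
      qed
      hence "exp (\<i> * of_real \<kappa> * (q / of_real s)) = exp (\<i> * of_real (\<kappa> / s)) *
          exp (\<i> * of_real \<kappa> * ((2 * of_real (b z) + of_real (c z) * of_real s) / (q + 1)))"
        by (simp add: distrib_left exp_add)
      thus ?thesis unfolding g_def cP h_def q_def[symmetric] using s q1 by (simp add: field_simps)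
    qed
    have "g (of_real (1 / s)) z * f z = (of_real s * exp (\<i> * of_real (\<kappa> / s))) * (h (of_real s) z * f z)" for z
      using *[of z] bdd_density_zero[OF f, of z] by (cases "z \<in> K") auto
    thus ?thesis unfolding W_def H_def by (simp only: integral_mult_right_zero mult.assoc)
  qed
  have H0: "H w = 0" if "w \<in> ball 0 s0" for w
  proof (rule holomorphic_oscillation_zero[OF H s0(1) \<kappa> _ that])
    fix s :: real assume s: "0 < s" "s < s0"
    have "Im (W (of_real (1 / s))) = s * Im (exp (\<i> * of_real (\<kappa> / s)) * H (of_real s))"
      unfolding WH[OF s] by simp
    thus "Im (exp (\<i> * of_real (\<kappa> / s)) * H (of_real s)) = 0" using ImW[of "1/s"] s by simp
  qed
  have "W (of_real t) = 0"
  proof (rule analytic_continuation[OF W S_open convex_connected[OF S_convex]])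
    let ?U = "complex_of_real ` {1 / s0<..}"
    show "?U \<subseteq> S" using \<delta> by (auto simp: S_def)
    define x where "x = 1 / s0 + 1"
    show "complex_of_real x \<in> S" "of_real t \<in> S" using \<delta> by (auto simp: S_def)
    show "complex_of_real x islimpt ?U"
      unfolding islimpt_approachable
    proof (intro allI impI)
      fix e :: real assume e: "e > 0"
      have "complex_of_real (x + e / 2) \<in> ?U" using e by (intro imageI) (simp add: x_def)
      moreover have "complex_of_real (x + e / 2) \<noteq> complex_of_real x" using e by (simp only: of_real_eq_iff)
      moreover have "dist (complex_of_real (x + e / 2)) (complex_of_real x) < e"
        using e by (simp only: dist_of_real) (simp add: dist_real_def)
      ultimately show "\<exists>x'\<in>?U. x' \<noteq> complex_of_real x \<and> dist x' (complex_of_real x) < e" by blast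
    qed
    fix w assume "w \<in> ?U"
    then obtain t where t: "w = of_real t" "t > 1 / s0" by auto
    have t0: "t > 0" using t s0 by (meson less_trans zero_less_divide_1_iff)
    hence "1 / t < s0" using t s0 by (simp add: field_simps)
    moreover have "complex_of_real (1 / t) \<in> ball 0 s0"
      using \<open>1 / t < s0\<close> t0 by (simp add: norm_divide)
    ultimately show "W w = 0" using WH[of "1 / t"] H0[of "of_real (1 / t)"] t0 by (simp add: t)
  qed
  thus ?thesis by (simp add: Wreal)
qed

section \<open>The Bessel function of order zero\<close>

definition J0 :: "real \<Rightarrow> real" where
  "J0 t = integral {0..2*pi} (\<lambda>\<theta>. cos (t * cos \<theta>)) / (2 * pi)"

definition J0' :: "real \<Rightarrow> real" where
  "J0' t = - integral {0..2*pi} (\<lambda>\<theta>. cos \<theta> * sin (t * cos \<theta>)) / (2 * pi)"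

definition J0'' :: "real \<Rightarrow> real" where
  "J0'' t = - integral {0..2*pi} (\<lambda>\<theta>. (cos \<theta>)\<^sup>2 * cos (t * cos \<theta>)) / (2 * pi)"

lemma J0_deriv: "(J0 has_real_derivative J0' t) (at t)"
proof -
  have "((\<lambda>t. integral (cbox 0 (2*pi)) (\<lambda>\<theta>. cos (t * cos \<theta>))) has_field_derivative
    integral (cbox 0 (2*pi)) (\<lambda>\<theta>. - (cos \<theta> * sin (t * cos \<theta>)))) (at t within UNIV)"
    by (rule leibniz_rule_field_derivative)
      (auto intro!: derivative_eq_intros integrable_continuous_interval continuous_intros simp: case_prod_beta)
  from DERIV_cdivide[OF this, of "2*pi"] show ?thesis
    by (simp add: J0_def[abs_def] J0'_def)
qed

lemma J0'_deriv: "(J0' has_real_derivative J0'' t) (at t)"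
proof -
  have "((\<lambda>t. integral (cbox 0 (2*pi)) (\<lambda>\<theta>. - (cos \<theta> * sin (t * cos \<theta>)))) has_field_derivative
    integral (cbox 0 (2*pi)) (\<lambda>\<theta>. - ((cos \<theta>)\<^sup>2 * cos (t * cos \<theta>)))) (at t within UNIV)"
    by (rule leibniz_rule_field_derivative)
      (auto intro!: derivative_eq_intros integrable_continuous_interval continuous_intros
         simp: case_prod_beta power2_eq_square)
  from DERIV_cdivide[OF this, of "2*pi"] show ?thesis
    by (simp add: J0'_def[abs_def] J0''_def)
qed

text \<open>The integrands on the left add up to minus the derivative of sin \<theta> sin (t cos
  \<theta>), whose integral over a full period vanishes.\<close>

lemma J0_ode: "t * J0'' t + J0' t + t * J0 t = 0"
proof -
  let ?f = "\<lambda>\<theta>. cos \<theta> * sin (t * cos \<theta>) - t * (cos (t * cos \<theta>) - (cos \<theta>)\<^sup>2 * cos (t * cos \<theta>))"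
  have eq: "?f \<theta> = cos \<theta> * sin (t * cos \<theta>) - t * ((sin \<theta>)\<^sup>2 * cos (t * cos \<theta>))" for \<theta>
    by (simp add: sin_squared_eq algebra_simps)
  have "((\<lambda>\<theta>. sin \<theta> * sin (t * cos \<theta>)) has_vector_derivative ?f \<theta>) (at \<theta> within {0..2*pi})" for \<theta>
    unfolding has_real_derivative_iff_has_vector_derivative[symmetric] eq
    by (auto intro!: derivative_eq_intros simp: power2_eq_square algebra_simps)
  hence "(?f has_integral (sin (2*pi) * sin (t * cos (2*pi)) - sin 0 * sin (t * cos 0))) {0..2*pi}"
    by (intro fundamental_theorem_of_calculus) auto
  hence "integral {0..2*pi} ?f = 0" by (simp add: integral_unique)
  moreover have "integral {0..2*pi} ?f = integral {0..2*pi} (\<lambda>\<theta>. cos \<theta> * sin (t * cos \<theta>))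
     - t * (integral {0..2*pi} (\<lambda>\<theta>. cos (t * cos \<theta>)) - integral {0..2*pi} (\<lambda>\<theta>. (cos \<theta>)\<^sup>2 * cos (t * cos \<theta>)))"
    by (simp add: Henstock_Kurzweil_Integration.integral_diff integrable_continuous_interval continuous_intros)
  ultimately show ?thesis by (simp add: J0_def J0'_def J0''_def field_simps)
qed

lemma abs_J0_le: "\<bar>J0 t\<bar> \<le> 1"
proof -
  have "norm (integral {0..2*pi} (\<lambda>\<theta>. cos (t * cos \<theta>))) \<le> 1 * (2*pi - 0)"
    by (rule integral_bound) (auto intro!: continuous_intros)
  thus ?thesis by (simp add: J0_def divide_simps)
qed

lemma abs_J0'_le: "\<bar>J0' t\<bar> \<le> 1"
proof -
  have "norm (integral {0..2*pi} (\<lambda>\<theta>. cos \<theta> * sin (t * cos \<theta>))) \<le> 1 * (2*pi - 0)"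
    by (rule integral_bound) (auto intro!: continuous_intros simp: abs_mult mult_le_one)
  thus ?thesis by (simp add: J0'_def divide_simps)
qed

lemma J0_0 [simp]: "J0 0 = 1"
  by (simp add: J0_def)

lemma continuous_on_J0 [continuous_intros]: "continuous_on A f \<Longrightarrow> continuous_on A (\<lambda>x. J0 (f x))"
  by (rule continuous_on_compose2[of UNIV J0])
    (auto intro!: DERIV_continuous_on[of UNIV J0 J0'] J0_deriv)

lemma continuous_on_J0' [continuous_intros]: "continuous_on A f \<Longrightarrow> continuous_on A (\<lambda>x. J0' (f x))"
  by (rule continuous_on_compose2[of UNIV J0'])
    (auto intro!: DERIV_continuous_on[of UNIV J0' J0''] J0'_deriv)

text \<open>\<open>E\<close> is the energy of \<open>\<surd>t J\<^sub>0(t)\<close>, which satisfies \<open>y'' + (1 + 1/(4t\<^sup>2)) y = 0\<close>.\<close>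

lemma J0_decay:
  assumes "t > 0"
  shows "\<bar>J0 t\<bar> \<le> 2 / sqrt t"
proof (cases "t \<le> 1")
  case True
  hence "sqrt t \<le> 1" by simp
  hence "sqrt t \<le> 2" by linarith
  hence "1 \<le> 2 / sqrt t" using assms by (simp add: pos_le_divide_eq)
  thus ?thesis using abs_J0_le[of t] by linarith
next
  case False
  define E where "E t = t * (J0' t)\<^sup>2 + J0 t * J0' t + t * (J0 t)\<^sup>2 + (J0 t)\<^sup>2 / (2 * t)" for t
  \<comment> \<open>Only the explicit coefficient 1 / (4 t^2) dissipates: Bessel's equation reduces
    the derivative of E to - J0^2 / (2 t^2).\<close>
  have "E t \<le> E 1"
  proof (rule DERIV_nonpos_imp_nonincreasing[of 1 t E])
    fix s :: real assume s: "1 \<le> s" "s \<le> t"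
    have J: "J0'' s = - J0' s / s - J0 s" using J0_ode[of s] s by (simp add: field_simps)
    have "(E has_real_derivative (J0' s)\<^sup>2 + s * (2 * J0' s * J0'' s) + (J0' s * J0' s + J0 s * J0'' s)
       + ((J0 s)\<^sup>2 + s * (2 * J0 s * J0' s)) + (2 * J0 s * J0' s * (2 * s) - (J0 s)\<^sup>2 * 2) / (2 * s)\<^sup>2) (at s)"
      unfolding E_def[abs_def] using s
      by (auto intro!: derivative_eq_intros J0_deriv J0'_deriv simp: power2_eq_square)
    moreover have "(J0' s)\<^sup>2 + s * (2 * J0' s * J0'' s) + (J0' s * J0' s + J0 s * J0'' s)
       + ((J0 s)\<^sup>2 + s * (2 * J0 s * J0' s)) + (2 * J0 s * J0' s * (2 * s) - (J0 s)\<^sup>2 * 2) / (2 * s)\<^sup>2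
       = - (J0 s)\<^sup>2 / (2 * s\<^sup>2)"
      unfolding J using s by (simp add: field_simps power2_eq_square)
    ultimately show "\<exists>y. (E has_real_derivative y) (at s) \<and> y \<le> 0"
      by (metis divide_nonpos_nonneg neg_le_0_iff_le zero_le_power2 mult_nonneg_nonneg zero_le_numeral)
  qed (use False in auto)
  also have "E 1 \<le> 4"
  proof -
    have "(J0 1)\<^sup>2 \<le> 1" "(J0' 1)\<^sup>2 \<le> 1" using abs_J0_le[of 1] abs_J0'_le[of 1] by (simp_all add: abs_square_le_1)
    moreover have "J0 1 * J0' 1 \<le> 1" using abs_J0_le[of 1] abs_J0'_le[of 1]
      by (metis abs_le_D1 abs_mult mult_le_one abs_ge_zero)
    ultimately show ?thesis by (simp add: E_def)
  qed
  finally have "E t \<le> 4" .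
  \<comment> \<open>Completing the square shows that t J0^2 is at most E; the constant 2 in the
    claim is the root of 4.\<close>
  moreover have "E t = t * (J0' t + J0 t / (2 * t))\<^sup>2 + t * (J0 t)\<^sup>2 + (J0 t)\<^sup>2 / (4 * t)"
    using assms by (simp add: E_def field_simps power2_eq_square)
  moreover have "t * (J0' t + J0 t / (2 * t))\<^sup>2 \<ge> 0" "(J0 t)\<^sup>2 / (4 * t) \<ge> 0" using assms by simp_all
  ultimately have "t * (J0 t)\<^sup>2 \<le> 4" by linarith
  hence "(\<bar>J0 t\<bar> * sqrt t)\<^sup>2 \<le> 2\<^sup>2" using assms by (simp add: power_mult_distrib mult.commute)
  hence "\<bar>J0 t\<bar> * sqrt t \<le> 2" by (rule power2_le_imp_le) simp
  thus ?thesis using assms by (simp add: field_simps)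
qed

section \<open>Circular averages of plane waves\<close>

lemma integral_complex_of_real:
  fixes f :: "real \<Rightarrow> real"
  assumes "f integrable_on S"
  shows "integral S (\<lambda>x. complex_of_real (f x)) = of_real (integral S f)"
  using integral_linear[OF assms bounded_linear_of_real] by (simp add: comp_def)

lemma integral_periodic_shift:
  fixes f :: "real \<Rightarrow> 'b::euclidean_space"
  assumes f: "continuous_on UNIV f" and per: "\<And>x. f (x + p) = f x" and \<phi>: "0 \<le> \<phi>" "\<phi> \<le> p"
  shows "integral {0..p} (\<lambda>\<theta>. f (\<theta> - \<phi>)) = integral {0..p} f"
proof -
  have i: "f integrable_on {a..b}" for a b
    by (intro integrable_continuous_interval continuous_on_subset[OF f]) auto
  have sh: "integral {a..b} (\<lambda>x. f (x + c)) = integral {a+c..b+c} f" for a b c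
    using integral_shift[of a c b f] continuous_on_subset[OF f] by (auto simp: comp_def)
  have "integral {0..p} (\<lambda>\<theta>. f (\<theta> - \<phi>)) = integral {-\<phi>..p-\<phi>} f" using sh[of 0 p "-\<phi>"] by simp
  also have "\<dots> = integral {-\<phi>..0} f + integral {0..p-\<phi>} f"
    by (rule Henstock_Kurzweil_Integration.integral_combine[symmetric]) (use \<phi> i in auto)
  also have "integral {-\<phi>..0} f = integral {p-\<phi>..p} f"
    using sh[of "-\<phi>" 0 p] by (simp add: per)
  also have "integral {p-\<phi>..p} f + integral {0..p-\<phi>} f = integral {0..p} f"
    by (subst add.commute, rule Henstock_Kurzweil_Integration.integral_combine) (use \<phi> i in auto)
  finally show ?thesis .
qed

text \<open>For (x, y) = r (cos \<phi>, sin \<phi>) the phase is r cos (\<theta> - \<phi>), and by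
  periodicity the shift by \<phi> is immaterial; the sine part changes sign under the shift by pi
  and so integrates to 0.\<close>

lemma integral_plane_wave:
  "integral {0..2*pi} (\<lambda>\<theta>. exp (\<i> * of_real (x * cos \<theta> + y * sin \<theta>))) = 2 * of_real pi * of_real (J0 (sqrt (x\<^sup>2 + y\<^sup>2)))"
proof -
  define r where "r = sqrt (x\<^sup>2 + y\<^sup>2)"
  obtain \<phi> where \<phi>: "0 \<le> \<phi>" "\<phi> < 2 * pi" "x = r * cos \<phi>" "y = r * sin \<phi>"
  proof (cases "r = 0")
    case True
    hence "x = 0" "y = 0" by (auto simp: r_def sum_power2_eq_zero_iff)
    thus thesis using that[of 0] True by simp
  next
    case False
    have "(x / r)\<^sup>2 + (y / r)\<^sup>2 = 1" using False by (simp add: power_divide r_def add_divide_distrib[symmetric])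
    then obtain \<phi> where "0 \<le> \<phi>" "\<phi> < 2 * pi" "x / r = cos \<phi>" "y / r = sin \<phi>"
      using sincos_total_2pi[of "x/r" "y/r"] by metis
    thus thesis using that[of \<phi>] False by (simp add: field_simps)
  qed
  have e: "x * cos \<theta> + y * sin \<theta> = r * cos (\<theta> - \<phi>)" for \<theta> by (simp add: \<phi>(3,4) cos_diff algebra_simps)
  have s0: "integral {0..2*pi} (\<lambda>\<theta>. sin (r * cos \<theta>)) = 0"
  proof -
    have "integral {0..2*pi} (\<lambda>\<theta>. sin (r * cos (\<theta> - pi))) = integral {0..2*pi} (\<lambda>\<theta>. sin (r * cos \<theta>))"
      by (rule integral_periodic_shift) (auto intro!: continuous_intros)
    thus ?thesis by simp
  qed
  have "integral {0..2*pi} (\<lambda>\<theta>. exp (\<i> * of_real (r * cos (\<theta> - \<phi>)))) = integral {0..2*pi} (\<lambda>\<theta>. exp (\<i> * of_real (r * cos \<theta>)))"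
    by (rule integral_periodic_shift) (use \<phi> in \<open>auto intro!: continuous_intros\<close>)
  also have "\<dots> = integral {0..2*pi} (\<lambda>\<theta>. of_real (cos (r * cos \<theta>)) + \<i> * of_real (sin (r * cos \<theta>)))"
    by (intro Henstock_Kurzweil_Integration.integral_cong) (simp add: cis_conv_exp[symmetric] complex_eq_iff del: of_real_mult)
  also have "\<dots> = of_real (integral {0..2*pi} (\<lambda>\<theta>. cos (r * cos \<theta>))) + \<i> * of_real (integral {0..2*pi} (\<lambda>\<theta>. sin (r * cos \<theta>)))"
  proof -
    have c: "(\<lambda>\<theta>. cos (r * cos \<theta>)) integrable_on {0..2*pi}" "(\<lambda>\<theta>. sin (r * cos \<theta>)) integrable_on {0..2*pi}"
      by (auto intro!: integrable_continuous_interval continuous_intros)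
    have "(\<lambda>\<theta>. complex_of_real (cos (r * cos \<theta>))) integrable_on {0..2*pi}"
      "(\<lambda>\<theta>. \<i> * complex_of_real (sin (r * cos \<theta>))) integrable_on {0..2*pi}"
      by (auto intro!: integrable_continuous_interval continuous_intros)
    thus ?thesis
      by (simp add: Henstock_Kurzweil_Integration.integral_add integral_complex_of_real[OF c(1)] integral_complex_of_real[OF c(2)])
  qed
  finally show ?thesis unfolding e r_def[symmetric] s0 by (simp add: J0_def)
qed

section \<open>Sommerfeld's integral\<close>

text \<open>Horizontal wave number of a wave with vertical dependence exp(- m h) (\<open>Qm\<close>)
  or exp(i p h) (\<open>kp\<close>). Integrating over the vertical parameter instead of the
  horizontal one, q, removes the factor q / sqrt (\<kappa>^2 - q^2) and its singularity at q =
  \<kappa> from Sommerfeld's integral.\<close>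

definition Qm :: "real \<Rightarrow> real \<Rightarrow> real" where "Qm \<kappa> m = sqrt (m\<^sup>2 + \<kappa>\<^sup>2)"
definition kp :: "real \<Rightarrow> real \<Rightarrow> real" where "kp \<kappa> p = sqrt (\<kappa>\<^sup>2 - p\<^sup>2)"

lemma continuous_on_Qm [continuous_intros]: "continuous_on A f \<Longrightarrow> continuous_on A (\<lambda>x. Qm \<kappa> (f x))"
  unfolding Qm_def by (intro continuous_intros)

lemma continuous_on_kp [continuous_intros]: "continuous_on A f \<Longrightarrow> continuous_on A (\<lambda>x. kp \<kappa> (f x))"
  unfolding kp_def by (intro continuous_intros)

definition propagating :: "real \<Rightarrow> real \<Rightarrow> real \<Rightarrow> complex" where
  "propagating \<kappa> \<rho> h = integral {0..\<kappa>} (\<lambda>p. of_real (J0 (\<rho> * kp \<kappa> p)) * exp (\<i> * of_real (p * h)))"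

definition evanescent :: "real \<Rightarrow> real \<Rightarrow> real \<Rightarrow> real \<Rightarrow> real \<Rightarrow> real" where
  "evanescent \<kappa> \<rho> h S T = integral {S..T} (\<lambda>m. J0 (\<rho> * Qm \<kappa> m) * exp (- m * h))"

lemma J0_polar_deriv:
  "((\<lambda>\<phi>. J0 (R * sin \<phi> * q)) has_real_derivative R * cos \<phi> * q * J0' (R * sin \<phi> * q)) (at \<phi>)"
  by (rule DERIV_chain2[OF J0_deriv, THEN DERIV_cong]) (auto intro!: derivative_eq_intros)

text \<open>In polar coordinates \<open>h = R cos \<phi>\<close>, \<open>\<rho> = R sin \<phi>\<close> the \<open>\<phi>\<close>-derivatives of the integrands of
  \<open>propagating\<close> and \<open>evanescent\<close> are exact derivatives in the integration variable.\<close>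

lemma evanescent_polar_deriv:
  assumes \<kappa>: "\<kappa> > 0" and T: "T \<ge> 0"
  shows "((\<lambda>\<phi>. evanescent \<kappa> (R * sin \<phi>) (R * cos \<phi>) 0 T) has_real_derivative
     (\<kappa> * J0' (R * sin \<phi> * \<kappa>) - Qm \<kappa> T * J0' (R * sin \<phi> * Qm \<kappa> T) * exp (- T * (R * cos \<phi>)))) (at \<phi>)"
proof -
  define D where "D \<phi> m = (R * cos \<phi> * Qm \<kappa> m * J0' (R * sin \<phi> * Qm \<kappa> m)
     + m * R * sin \<phi> * J0 (R * sin \<phi> * Qm \<kappa> m)) * exp (- m * (R * cos \<phi>))" for \<phi> m
  have Q: "Qm \<kappa> m > 0" for m using \<kappa> by (simp add: Qm_def add_nonneg_pos)
  have "((\<lambda>\<phi>. integral (cbox 0 T) (\<lambda>m. J0 (R * sin \<phi> * Qm \<kappa> m) * exp (- m * (R * cos \<phi>)))) has_field_derivative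
      integral (cbox 0 T) (D \<phi>)) (at \<phi> within UNIV)"
  proof (rule leibniz_rule_field_derivative)
    fix \<phi> m :: real
    show "((\<lambda>\<phi>. J0 (R * sin \<phi> * Qm \<kappa> m) * exp (- m * (R * cos \<phi>))) has_field_derivative D \<phi> m) (at \<phi> within UNIV)"
      unfolding D_def
      by (rule DERIV_cong[OF DERIV_mult[OF J0_polar_deriv]]) (auto intro!: derivative_eq_intros simp: algebra_simps)
    show "continuous_on (UNIV \<times> cbox 0 T) (\<lambda>(\<phi>, m). D \<phi> m)"
      unfolding D_def case_prod_beta by (intro continuous_intros)
  qed (auto intro!: integrable_continuous_interval continuous_intros)
  \<comment> \<open>With Q = \<open>Qm \<kappa> m\<close> the primitive in m is - Q J0'(R sin \<phi>
    Q) exp(- m R cos \<phi>); Bessel's equation multiplied by m / Q matches its derivative with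
    D.\<close>
  moreover have "(D \<phi> has_integral (- (Qm \<kappa> T * J0' (R * sin \<phi> * Qm \<kappa> T) * exp (- T * (R * cos \<phi>)))
      - - (Qm \<kappa> 0 * J0' (R * sin \<phi> * Qm \<kappa> 0) * exp (- 0 * (R * cos \<phi>))))) {0..T}"
  proof (rule fundamental_theorem_of_calculus[OF T])
    fix m :: real
    let ?Q = "Qm \<kappa> m"
    have dQ: "(Qm \<kappa> has_real_derivative m / ?Q) (at m within {0..T})"
      unfolding Qm_def using \<kappa> Q[of m]
      by (auto intro!: derivative_eq_intros simp: add_nonneg_pos Qm_def field_simps)
    have dJ: "((\<lambda>m. J0' (R * sin \<phi> * Qm \<kappa> m)) has_real_derivative J0'' (R * sin \<phi> * ?Q) * (R * sin \<phi> * (m / ?Q))) (at m within {0..T})"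
      by (rule DERIV_chain2[OF J0'_deriv]) (intro DERIV_cmult dQ)
    have "((\<lambda>m. - (Qm \<kappa> m * J0' (R * sin \<phi> * Qm \<kappa> m) * exp (- m * (R * cos \<phi>)))) has_real_derivative
       - ((m / ?Q * J0' (R * sin \<phi> * ?Q) + J0'' (R * sin \<phi> * ?Q) * (R * sin \<phi> * (m / ?Q)) * ?Q) * exp (- m * (R * cos \<phi>))
        + - (R * cos \<phi>) * exp (- m * (R * cos \<phi>)) * (?Q * J0' (R * sin \<phi> * ?Q)))) (at m within {0..T})"
      by (intro DERIV_minus DERIV_mult dQ dJ) (auto intro!: derivative_eq_intros)
    moreover have "m / ?Q * J0' (R * sin \<phi> * ?Q) + J0'' (R * sin \<phi> * ?Q) * (R * sin \<phi> * (m / ?Q)) * ?Q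
       = - (m * R * sin \<phi> * J0 (R * sin \<phi> * ?Q))"
    proof -
      have "m / ?Q * (R * sin \<phi> * ?Q * J0'' (R * sin \<phi> * ?Q) + J0' (R * sin \<phi> * ?Q)) = m / ?Q * (- (R * sin \<phi> * ?Q * J0 (R * sin \<phi> * ?Q)))"
        using J0_ode[of "R * sin \<phi> * ?Q"] by (intro arg_cong2[of _ _ _ _ "(*)"]) auto
      thus ?thesis using Q[of m] by (simp add: field_simps)
    qed
    ultimately show "((\<lambda>m. - (Qm \<kappa> m * J0' (R * sin \<phi> * Qm \<kappa> m) * exp (- m * (R * cos \<phi>)))) has_vector_derivative D \<phi> m) (at m within {0..T})"
      unfolding has_real_derivative_iff_has_vector_derivative[symmetric] D_def
      by (simp only:) (erule DERIV_cong, simp add: algebra_simps)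
  qed
  moreover have "Qm \<kappa> 0 = \<kappa>" using \<kappa> by (simp add: Qm_def)
  ultimately show ?thesis by (simp add: evanescent_def integral_unique)
qed

lemma propagating_polar_deriv:
  assumes \<kappa>: "\<kappa> > 0"
  shows "((\<lambda>\<phi>. propagating \<kappa> (R * sin \<phi>) (R * cos \<phi>)) has_vector_derivative
     (\<i> * of_real (\<kappa> * J0' (R * sin \<phi> * \<kappa>)))) (at \<phi>)"
proof -
  define D where "D \<phi> p = (of_real (R * cos \<phi> * kp \<kappa> p * J0' (R * sin \<phi> * kp \<kappa> p))
     - \<i> * of_real (p * R * sin \<phi> * J0 (R * sin \<phi> * kp \<kappa> p))) * exp (\<i> * of_real (p * (R * cos \<phi>)))" for \<phi> p
  have exd: "((\<lambda>\<phi>. exp (\<i> * of_real (f \<phi>))) has_vector_derivative \<i> * of_real f' * exp (\<i> * of_real (f \<phi>))) (at \<phi> within A)"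
    if "(f has_real_derivative f') (at \<phi> within A)" for f :: "real \<Rightarrow> real" and f' \<phi> A
  proof -
    have "((\<lambda>\<phi>. \<i> * of_real (f \<phi>)) has_vector_derivative \<i> * of_real f') (at \<phi> within A)"
      by (intro has_vector_derivative_mult_right has_vector_derivative_of_real) 
        (use that in \<open>simp add: has_real_derivative_iff_has_vector_derivative\<close>)
    thus ?thesis using field_vector_diff_chain_within[OF _ has_field_derivative_at_within[OF DERIV_exp]] by (auto simp: comp_def)
  qed
  have "((\<lambda>\<phi>. integral (cbox 0 \<kappa>) (\<lambda>p. of_real (J0 (R * sin \<phi> * kp \<kappa> p)) * exp (\<i> * of_real (p * (R * cos \<phi>))))) has_vector_derivative
      integral (cbox 0 \<kappa>) (D \<phi>)) (at \<phi> within UNIV)"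
  proof (rule leibniz_rule_vector_derivative)
    fix \<phi> p :: real
    have "((\<lambda>\<phi>. of_real (J0 (R * sin \<phi> * kp \<kappa> p)) * exp (\<i> * of_real (p * (R * cos \<phi>)))) has_vector_derivative
       of_real (J0 (R * sin \<phi> * kp \<kappa> p)) * (\<i> * of_real (p * (R * - sin \<phi>)) * exp (\<i> * of_real (p * (R * cos \<phi>))))
       + of_real (R * cos \<phi> * kp \<kappa> p * J0' (R * sin \<phi> * kp \<kappa> p)) * exp (\<i> * of_real (p * (R * cos \<phi>)))) (at \<phi> within UNIV)"
      by (intro has_vector_derivative_mult has_vector_derivative_of_real exd)
        (auto intro!: derivative_eq_intros J0_polar_deriv simp flip: has_real_derivative_iff_has_vector_derivative)
    thus "((\<lambda>\<phi>. of_real (J0 (R * sin \<phi> * kp \<kappa> p)) * exp (\<i> * of_real (p * (R * cos \<phi>)))) has_vector_derivative D \<phi> p) (at \<phi> within UNIV)"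
      by (rule has_vector_derivative_eq_rhs) (simp add: D_def algebra_simps)
    show "continuous_on (UNIV \<times> cbox 0 \<kappa>) (\<lambda>(\<phi>, m). D \<phi> m)"
      unfolding D_def case_prod_beta by (intro continuous_intros)
  qed (auto intro!: integrable_continuous_interval continuous_intros)
  \<comment> \<open>\<open>kp \<kappa>\<close> is not differentiable at p = \<kappa>, so the
    derivative is computed in the interior only. The primitive vanishes at that end because
    \<open>kp \<kappa> \<kappa> = 0\<close>, and the end p = 0 alone contributes.\<close>
  moreover have "(D \<phi> has_integral (- \<i> * (of_real (kp \<kappa> \<kappa> * J0' (R * sin \<phi> * kp \<kappa> \<kappa>)) * exp (\<i> * of_real (\<kappa> * (R * cos \<phi>))))
      - - \<i> * (of_real (kp \<kappa> 0 * J0' (R * sin \<phi> * kp \<kappa> 0)) * exp (\<i> * of_real (0 * (R * cos \<phi>)))))) {0..\<kappa>}"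
  proof (rule fundamental_theorem_of_calculus_interior)
    fix p :: real assume p: "p \<in> {0<..<\<kappa>}"
    let ?k = "kp \<kappa> p"
    have k: "?k > 0" "\<kappa>\<^sup>2 - p\<^sup>2 > 0" using p by (auto simp: kp_def intro!: power_strict_mono)
    have dk: "(kp \<kappa> has_real_derivative - p / ?k) (at p)"
      unfolding kp_def using k
      by (auto intro!: derivative_eq_intros simp: kp_def field_simps)
    have dJ: "((\<lambda>p. J0' (R * sin \<phi> * kp \<kappa> p)) has_real_derivative J0'' (R * sin \<phi> * ?k) * (R * sin \<phi> * (- p / ?k))) (at p)"
      by (rule DERIV_chain2[OF J0'_deriv]) (intro DERIV_cmult dk)
    have dkJ: "((\<lambda>p. kp \<kappa> p * J0' (R * sin \<phi> * kp \<kappa> p)) has_real_derivative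
      (- p / ?k * J0' (R * sin \<phi> * ?k) + J0'' (R * sin \<phi> * ?k) * (R * sin \<phi> * (- p / ?k)) * ?k)) (at p)"
      by (rule DERIV_mult[OF dk dJ])
    have dl: "((\<lambda>p. p * (R * cos \<phi>)) has_real_derivative R * cos \<phi>) (at p)"
      by (auto intro!: derivative_eq_intros)
    have ode: "- p / ?k * J0' (R * sin \<phi> * ?k) + J0'' (R * sin \<phi> * ?k) * (R * sin \<phi> * (- p / ?k)) * ?k
       = p * R * sin \<phi> * J0 (R * sin \<phi> * ?k)"
    proof -
      have "- p / ?k * (R * sin \<phi> * ?k * J0'' (R * sin \<phi> * ?k) + J0' (R * sin \<phi> * ?k)) = - p / ?k * (- (R * sin \<phi> * ?k * J0 (R * sin \<phi> * ?k)))"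
        using J0_ode[of "R * sin \<phi> * ?k"] by (intro arg_cong2[of _ _ _ _ "(*)"]) auto
      thus ?thesis using k by (simp add: field_simps)
    qed
    have "((\<lambda>p. - \<i> * (of_real (kp \<kappa> p * J0' (R * sin \<phi> * kp \<kappa> p)) * exp (\<i> * of_real (p * (R * cos \<phi>))))) has_vector_derivative
       - \<i> * (of_real (?k * J0' (R * sin \<phi> * ?k)) * (\<i> * of_real (R * cos \<phi>) * exp (\<i> * of_real (p * (R * cos \<phi>))))
        + of_real (- p / ?k * J0' (R * sin \<phi> * ?k) + J0'' (R * sin \<phi> * ?k) * (R * sin \<phi> * (- p / ?k)) * ?k) * exp (\<i> * of_real (p * (R * cos \<phi>))))) (at p)"
      by (intro has_vector_derivative_mult_right has_vector_derivative_mult has_vector_derivative_of_real exd dl dkJ)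
    thus "((\<lambda>p. - \<i> * (of_real (kp \<kappa> p * J0' (R * sin \<phi> * kp \<kappa> p)) * exp (\<i> * of_real (p * (R * cos \<phi>))))) has_vector_derivative D \<phi> p) (at p)"
      unfolding ode by (rule has_vector_derivative_eq_rhs) (simp add: D_def algebra_simps)
  qed (use \<kappa> in \<open>auto intro!: continuous_intros\<close>)
  moreover have "kp \<kappa> 0 = \<kappa>" "kp \<kappa> \<kappa> = 0" using \<kappa> by (simp_all add: kp_def)
  ultimately show ?thesis by (simp add: propagating_def integral_unique)
qed

text \<open>One moves along the arc of radius R from the axis \<rho> = 0, where both integrals are
  elementary, to the given point. The boundary terms of the two derivatives at wave number \<kappa>
  cancel; what remains is the one at T, at most \<open>Qm \<kappa> T * exp (- T * h)\<close> because
  the height along the arc stays above h. A finite T with explicit error takes the place of an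
  improper integral.\<close>

lemma sommerfeld:
  assumes \<kappa>: "\<kappa> > 0" and h: "h > 0" and \<rho>: "\<rho> \<ge> 0" and T: "T \<ge> 0"
  defines "R \<equiv> sqrt (h\<^sup>2 + \<rho>\<^sup>2)"
  shows "norm (\<i> * propagating \<kappa> \<rho> h + of_real (evanescent \<kappa> \<rho> h 0 T) - exp (\<i> * of_real (\<kappa> * R)) / of_real R)
    \<le> exp (- T * h) / h + 2 * Qm \<kappa> T * exp (- T * h)"
proof -
  have R: "R > 0" "R \<ge> h" using h by (auto simp: R_def add_pos_nonneg intro: real_le_rsqrt)
  have "(h / R)\<^sup>2 + (\<rho> / R)\<^sup>2 = 1"
    using R h by (simp add: power_divide add_divide_distrib[symmetric]) (simp add: R_def)
  then obtain \<phi>1 where \<phi>1: "0 \<le> \<phi>1" "\<phi>1 \<le> pi / 2" "h / R = cos \<phi>1" "\<rho> / R = sin \<phi>1"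
    using sincos_total_pi_half[of "h / R" "\<rho> / R"] h \<rho> R by auto
  have hR: "R * cos \<phi>1 = h" "R * sin \<phi>1 = \<rho>" using \<phi>1 R by (simp_all add: field_simps)
  define U where "U \<phi> = \<i> * propagating \<kappa> (R * sin \<phi>) (R * cos \<phi>)
     + of_real (evanescent \<kappa> (R * sin \<phi>) (R * cos \<phi>) 0 T)" for \<phi>
  define U' where "U' \<phi> = - complex_of_real (Qm \<kappa> T * J0' (R * sin \<phi> * Qm \<kappa> T) * exp (- T * (R * cos \<phi>)))" for \<phi>
  have dU: "(U has_vector_derivative U' \<phi>) (at \<phi>)" for \<phi>
  proof -
    have "(U has_vector_derivative \<i> * (\<i> * of_real (\<kappa> * J0' (R * sin \<phi> * \<kappa>))) + of_real
       (\<kappa> * J0' (R * sin \<phi> * \<kappa>) - Qm \<kappa> T * J0' (R * sin \<phi> * Qm \<kappa> T) * exp (- T * (R * cos \<phi>)))) (at \<phi>)"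
      unfolding U_def[abs_def]
      by (intro has_vector_derivative_add has_vector_derivative_mult_right has_vector_derivative_of_real
          propagating_polar_deriv[OF \<kappa>] evanescent_polar_deriv[OF \<kappa> T])
    thus ?thesis by (rule has_vector_derivative_eq_rhs) (simp add: U'_def)
  qed
  have Q: "Qm \<kappa> T \<ge> 0" by (simp add: Qm_def)
  have nU': "norm (U' \<phi>) \<le> Qm \<kappa> T * exp (- T * h)" if "0 \<le> \<phi>" "\<phi> \<le> \<phi>1" for \<phi>
  proof -
    have "cos \<phi>1 \<le> cos \<phi>" using that \<phi>1 by (intro cos_monotone_0_pi_le) auto
    hence "h \<le> R * cos \<phi>" using R hR(1) by (metis mult_left_mono less_imp_le)
    hence "exp (- T * (R * cos \<phi>)) \<le> exp (- T * h)" using T by (simp add: mult_left_mono)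
    hence "Qm \<kappa> T * \<bar>J0' (R * sin \<phi> * Qm \<kappa> T)\<bar> * exp (- T * (R * cos \<phi>)) \<le> Qm \<kappa> T * 1 * exp (- T * h)"
      using Q abs_J0'_le by (intro mult_mono) auto
    thus ?thesis using Q by (simp add: U'_def norm_mult)
  qed
  have "norm (U \<phi>1 - U 0) \<le> Qm \<kappa> T * exp (- T * h) * norm (\<phi>1 - 0)"
  proof (rule differentiable_bound[of "{0..\<phi>1}" U "\<lambda>\<phi> t. t *\<^sub>R U' \<phi>"])
    fix \<phi> assume \<phi>: "\<phi> \<in> {0..\<phi>1}"
    show "(U has_derivative (\<lambda>t. t *\<^sub>R U' \<phi>)) (at \<phi> within {0..\<phi>1})"
      using has_vector_derivative_at_within[OF dU] by (simp add: has_vector_derivative_def)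
    show "onorm (\<lambda>t. t *\<^sub>R U' \<phi>) \<le> Qm \<kappa> T * exp (- T * h)"
      using nU'[of \<phi>] \<phi> by (intro onorm_le) (simp add: mult.commute mult_left_mono)
  qed (use \<phi>1 in auto)
  \<comment> \<open>The arc has angle at most pi / 2 < 2.\<close>
  also have "\<dots> \<le> Qm \<kappa> T * exp (- T * h) * 2"
    using \<phi>1 Q pi_less_4 by (intro mult_left_mono) auto
  finally have 1: "norm (U \<phi>1 - U 0) \<le> 2 * Qm \<kappa> T * exp (- T * h)" by simp
  have U0: "U 0 = exp (\<i> * of_real (\<kappa> * R)) / of_real R - of_real (exp (- T * R) / R)"
  proof -
    have "((\<lambda>p. exp (\<i> * of_real (p * R))) has_integral (exp (\<i> * of_real (\<kappa> * R)) / (\<i> * of_real R) - exp (\<i> * of_real (0 * R)) / (\<i> * of_real R))) {0..\<kappa>}"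
    proof (rule fundamental_theorem_of_calculus)
      fix p :: real
      have "((\<lambda>p. exp (\<i> * of_real R * p) / (\<i> * of_real R)) has_field_derivative exp (\<i> * of_real R * of_real p)) (at (of_real p))"
        using R by (auto intro!: derivative_eq_intros)
      from has_vector_derivative_real_field[OF this, of "{0..\<kappa>}"]
      show "((\<lambda>p. exp (\<i> * of_real (p * R)) / (\<i> * of_real R)) has_vector_derivative exp (\<i> * of_real (p * R))) (at p within {0..\<kappa>})"
        by (simp add: mult_ac)
    qed (use \<kappa> in auto)
    hence p: "propagating \<kappa> 0 R = (exp (\<i> * of_real (\<kappa> * R)) - 1) / (\<i> * of_real R)"
      by (simp add: propagating_def integral_unique diff_divide_distrib)
    have "((\<lambda>m. exp (- m * R)) has_integral (- exp (- T * R) / R - - exp (- 0 * R) / R)) {0..T}"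
      by (rule fundamental_theorem_of_calculus[OF T])
        (use R in \<open>auto intro!: derivative_eq_intros simp flip: has_real_derivative_iff_has_vector_derivative\<close>)
    hence "evanescent \<kappa> 0 R 0 T = (1 - exp (- T * R)) / R"
      by (simp add: evanescent_def integral_unique diff_divide_distrib)
    moreover have "\<i> * propagating \<kappa> 0 R = (exp (\<i> * of_real (\<kappa> * R)) - 1) / of_real R"
      unfolding p by simp
    ultimately show ?thesis unfolding U_def by (simp add: diff_divide_distrib)
  qed
  have 2: "norm (U 0 - exp (\<i> * of_real (\<kappa> * R)) / of_real R) \<le> exp (- T * h) / h"
  proof -
    have "norm (U 0 - exp (\<i> * of_real (\<kappa> * R)) / of_real R) = norm (complex_of_real (exp (- T * R) / R))"
      unfolding U0 by (simp add: norm_minus_commute del: of_real_divide)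
    also have "\<dots> = exp (- T * R) / R" using R by (simp only: norm_of_real) simp
    also have "\<dots> \<le> exp (- T * h) / h" using R h T by (intro frac_le) (auto intro: mult_left_mono)
    finally show ?thesis .
  qed
  have "U \<phi>1 = \<i> * propagating \<kappa> \<rho> h + of_real (evanescent \<kappa> \<rho> h 0 T)" by (simp add: U_def hR)
  thus ?thesis using norm_diff_triangle_le[OF 1 2] by (simp only: add.commute)
qed

section \<open>A growing Green function\<close>

lemma powr_le_exp:
  fixes x \<alpha> :: real
  assumes "x \<ge> 0" "0 \<le> \<alpha>" "\<alpha> \<le> 1"
  shows "x powr \<alpha> \<le> exp x"
proof (cases "x \<le> 1")
  case True
  hence "x powr \<alpha> \<le> 1" using powr_mono2[of \<alpha> x 1] assms by simp
  thus ?thesis using assms(1) by (meson one_le_exp_iff order_trans)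
next
  case False
  hence "x powr \<alpha> \<le> x powr 1" using assms by (intro powr_mono) auto
  moreover have "x < exp x" using exp_ge_add_one_self[of x] by linarith
  ultimately show ?thesis using False by simp
qed

lemma abs_J0_Qm_le:
  assumes "\<rho> > 0" "m > 0"
  shows "\<bar>J0 (\<rho> * Qm \<kappa> m)\<bar> \<le> 2 * \<rho> powr (-1/2) * m powr (-1/2)"
proof -
  have Q: "Qm \<kappa> m \<ge> m" using assms by (auto simp: Qm_def intro: real_le_rsqrt)
  hence "\<rho> * m \<le> \<rho> * Qm \<kappa> m" using assms by simp
  hence "2 / sqrt (\<rho> * Qm \<kappa> m) \<le> 2 / sqrt (\<rho> * m)" using assms by (intro divide_left_mono) auto
  moreover have "\<bar>J0 (\<rho> * Qm \<kappa> m)\<bar> \<le> 2 / sqrt (\<rho> * Qm \<kappa> m)" using Q assms by (intro J0_decay) auto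
  moreover have "2 / sqrt (\<rho> * m) = 2 * \<rho> powr (-1/2) * m powr (-1/2)"
    using assms by (simp add: real_sqrt_mult powr_minus_divide powr_half_sqrt)
  ultimately show ?thesis by linarith
qed

text \<open>Two bounds are averaged geometrically. Replacing m^(-1/2) in the Bessel decay by
  \<tau>^(-1/2) gives \<tau>^(-1/2) / g, which is not integrable in g near 0; replacing it by (m -
  \<tau>)^(-1/2) gives g^(-1/2), without decay in \<tau>. The geometric mean \<tau>^(-1/4) g^(-3/4)
  is integrable and decays.\<close>

lemma evanescent_tail_bound:
  assumes \<rho>: "\<rho> > 0" and g: "g > 0" and \<tau>: "\<tau> > 0" "\<tau> \<le> T"
  shows "\<bar>exp (\<tau> * g) * evanescent \<kappa> \<rho> g \<tau> T\<bar> \<le> 4 * \<tau> powr (-1/4) * \<rho> powr (-1/2) * g powr (-3/4)"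
proof -
  let ?X = "\<bar>exp (\<tau> * g) * evanescent \<kappa> \<rho> g \<tau> T\<bar>"
  have e: "exp (\<tau> * g) * evanescent \<kappa> \<rho> g \<tau> T = integral {\<tau>..T} (\<lambda>m. J0 (\<rho> * Qm \<kappa> m) * exp (- (m - \<tau>) * g))"
    unfolding evanescent_def integral_mult_right[symmetric]
    by (intro Henstock_Kurzweil_Integration.integral_cong) (simp add: exp_add[symmetric] algebra_simps)
  have i: "(\<lambda>m. J0 (\<rho> * Qm \<kappa> m) * exp (- (m - \<tau>) * g)) integrable_on {\<tau>..T}"
    by (intro integrable_continuous_interval continuous_intros)
  have A: "?X \<le> 2 * \<rho> powr (-1/2) * \<tau> powr (-1/2) / g"
  proof -
    have hi: "((\<lambda>m. 2 * \<rho> powr (-1/2) * \<tau> powr (-1/2) * exp (- (m - \<tau>) * g)) has_integral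
        (2 * \<rho> powr (-1/2) * \<tau> powr (-1/2) * (- exp (- (T - \<tau>) * g) / g) - 2 * \<rho> powr (-1/2) * \<tau> powr (-1/2) * (- exp (- (\<tau> - \<tau>) * g) / g))) {\<tau>..T}"
      by (rule fundamental_theorem_of_calculus)
        (use \<tau> g in \<open>auto intro!: derivative_eq_intros simp flip: has_real_derivative_iff_has_vector_derivative\<close>)
    have "norm (integral {\<tau>..T} (\<lambda>m. J0 (\<rho> * Qm \<kappa> m) * exp (- (m - \<tau>) * g)))
       \<le> integral {\<tau>..T} (\<lambda>m. 2 * \<rho> powr (-1/2) * \<tau> powr (-1/2) * exp (- (m - \<tau>) * g))"
    proof (rule integral_norm_bound_integral[OF i])
      fix m assume m: "m \<in> {\<tau>..T}"
      have "\<bar>J0 (\<rho> * Qm \<kappa> m)\<bar> \<le> 2 * \<rho> powr (-1/2) * m powr (-1/2)" using m \<tau> \<rho> by (intro abs_J0_Qm_le) auto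
      also have "\<dots> \<le> 2 * \<rho> powr (-1/2) * \<tau> powr (-1/2)" using m \<tau> by (intro mult_left_mono powr_mono2') auto
      finally show "norm (J0 (\<rho> * Qm \<kappa> m) * exp (- (m - \<tau>) * g)) \<le> 2 * \<rho> powr (-1/2) * \<tau> powr (-1/2) * exp (- (m - \<tau>) * g)"
        by (simp add: abs_mult mult_right_mono)
    qed (use hi in auto)
    also have "\<dots> \<le> 2 * \<rho> powr (-1/2) * \<tau> powr (-1/2) / g"
      using g by (subst integral_unique[OF hi]) (simp add: divide_nonneg_pos)
    finally show ?thesis unfolding e by simp
  qed
  have B: "?X \<le> 2 * \<rho> powr (-1/2) * (4 * g powr (-1/2))"
  proof -
    let ?c = "2 * \<rho> powr (-1/2)"
    \<comment> \<open>exp(- x g) \<le> 1 / (1 + x g) gives a majorant whose primitive is an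
      arctangent, bounded independently of T.\<close>
    have hi: "((\<lambda>m. ?c * (1 / (sqrt (m - \<tau>) * (1 + (m - \<tau>) * g)))) has_integral
        (?c * (2 / sqrt g * arctan (sqrt ((T - \<tau>) * g))) - ?c * (2 / sqrt g * arctan (sqrt ((\<tau> - \<tau>) * g))))) {\<tau>..T}"
    proof (rule fundamental_theorem_of_calculus_interior[OF \<tau>(2)])
      fix m assume "m \<in> {\<tau><..<T}"
      hence m: "m - \<tau> > 0" by auto
      have "((\<lambda>m. arctan (sqrt ((m - \<tau>) * g))) has_real_derivative
         (inverse (1 + (sqrt ((m - \<tau>) * g))\<^sup>2) * (inverse (sqrt ((m - \<tau>) * g)) / 2 * g))) (at m)"
        using mult_pos_pos[OF m g] by (auto intro!: derivative_eq_intros)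
      hence "((\<lambda>m. ?c * (2 / sqrt g * arctan (sqrt ((m - \<tau>) * g)))) has_real_derivative
         ?c * (2 / sqrt g * (inverse (1 + (sqrt ((m - \<tau>) * g))\<^sup>2) * (inverse (sqrt ((m - \<tau>) * g)) / 2 * g)))) (at m)"
        by (intro DERIV_cmult)
      moreover have "2 / sqrt g * (inverse (1 + (sqrt ((m - \<tau>) * g))\<^sup>2) * (inverse (sqrt ((m - \<tau>) * g)) / 2 * g))
        = 1 / (sqrt (m - \<tau>) * (1 + (m - \<tau>) * g))"
      proof -
        have "sqrt g * sqrt g = g" using g by simp
        thus ?thesis using m g by (simp add: real_sqrt_mult divide_simps add_pos_pos) 
      qed
      ultimately show "((\<lambda>m. ?c * (2 / sqrt g * arctan (sqrt ((m - \<tau>) * g)))) has_vector_derivative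
         ?c * (1 / (sqrt (m - \<tau>) * (1 + (m - \<tau>) * g)))) (at m)"
        by (simp only: has_real_derivative_iff_has_vector_derivative)
    qed (intro continuous_intros)
    \<comment> \<open>At \<open>m = \<tau>\<close> division by zero gives the majorant the value 0,
      so it is redefined at this one point.\<close>
    have "norm (integral {\<tau>..T} (\<lambda>m. J0 (\<rho> * Qm \<kappa> m) * exp (- (m - \<tau>) * g)))
       \<le> integral {\<tau>..T} (\<lambda>m. if m = \<tau> then \<bar>J0 (\<rho> * Qm \<kappa> m)\<bar> else ?c * (1 / (sqrt (m - \<tau>) * (1 + (m - \<tau>) * g))))"
    proof (rule integral_norm_bound_integral[OF i])
      show "(\<lambda>m. if m = \<tau> then \<bar>J0 (\<rho> * Qm \<kappa> m)\<bar> else ?c * (1 / (sqrt (m - \<tau>) * (1 + (m - \<tau>) * g)))) integrable_on {\<tau>..T}"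
        using has_integral_integrable[OF hi] by (rule integrable_spike_finite[of "{\<tau>}", rotated -1]) auto
      fix m assume m: "m \<in> {\<tau>..T}"
      show "norm (J0 (\<rho> * Qm \<kappa> m) * exp (- (m - \<tau>) * g))
        \<le> (if m = \<tau> then \<bar>J0 (\<rho> * Qm \<kappa> m)\<bar> else ?c * (1 / (sqrt (m - \<tau>) * (1 + (m - \<tau>) * g))))"
      proof (cases "m = \<tau>")
        case False
        hence m': "m - \<tau> > 0" using m by auto
        have "\<bar>J0 (\<rho> * Qm \<kappa> m)\<bar> \<le> ?c * m powr (-1/2)" using m \<tau> \<rho> by (intro abs_J0_Qm_le) auto
        also have "\<dots> \<le> ?c * (m - \<tau>) powr (-1/2)" using m' \<tau> by (intro mult_left_mono powr_mono2') auto
        also have "\<dots> = ?c * (1 / sqrt (m - \<tau>))" using m' by (simp add: powr_minus_divide powr_half_sqrt)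
        finally have 1: "\<bar>J0 (\<rho> * Qm \<kappa> m)\<bar> \<le> ?c * (1 / sqrt (m - \<tau>))" .
        have "exp (- (m - \<tau>) * g) = 1 / exp ((m - \<tau>) * g)" by (metis exp_minus inverse_eq_divide mult_minus_left)
        also have "\<dots> \<le> 1 / (1 + (m - \<tau>) * g)"
          using m' g exp_ge_add_one_self[of "(m - \<tau>) * g"] 
          by (intro divide_left_mono) (use mult_pos_pos[OF m' g] in \<open>auto intro!: mult_pos_pos add_pos_pos\<close>)
        finally have "\<bar>J0 (\<rho> * Qm \<kappa> m)\<bar> * exp (- (m - \<tau>) * g) \<le> ?c * (1 / sqrt (m - \<tau>)) * (1 / (1 + (m - \<tau>) * g))"
          using 1 m' by (intro mult_mono) auto
        thus ?thesis using False by (simp add: abs_mult)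
      qed simp
    qed
    also have "\<dots> = integral {\<tau>..T} (\<lambda>m. ?c * (1 / (sqrt (m - \<tau>) * (1 + (m - \<tau>) * g))))"
      by (rule integral_spike[of "{\<tau>}"]) auto
    also have "\<dots> = ?c * (2 / sqrt g * arctan (sqrt ((T - \<tau>) * g)))"
      by (subst integral_unique[OF hi]) simp
    also have "\<dots> \<le> ?c * (2 / sqrt g * 2)"
      using arctan_ubound[of "sqrt ((T - \<tau>) * g)"] pi_less_4 g by (intro mult_left_mono) auto
    also have "2 / sqrt g * 2 = 4 * g powr (-1/2)" using g by (simp add: powr_minus_divide powr_half_sqrt)
    finally show ?thesis unfolding e by simp
  qed
  let ?r = "\<rho> powr (-1/2)"
  have X0: "?X \<ge> 0" by simp
  have "?X * ?X \<le> (2 * ?r * \<tau> powr (-1/2) / g) * (2 * ?r * (4 * g powr (-1/2)))"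
    by (rule mult_mono[OF A B]) (use g in auto)
  also have "\<dots> = (4 * \<tau> powr (-1/4) * ?r * g powr (-3/4))\<^sup>2"
  proof -
    have "(\<tau> powr (-1/4))\<^sup>2 = \<tau> powr (-1/2)" "(g powr (-3/4))\<^sup>2 = g powr (-3/2)"
      by (simp_all add: power2_eq_square flip: powr_add)
    moreover have "g powr (-3/2) = g powr (-1/2) / g"
      using powr_diff[of g "-1/2" 1] g by simp
    ultimately show ?thesis by (simp add: power_mult_distrib) (simp add: power2_eq_square)
  qed
  finally have "?X\<^sup>2 \<le> (4 * \<tau> powr (-1/4) * ?r * g powr (-3/4))\<^sup>2" by (simp add: power2_eq_square)
  thus ?thesis by (rule power2_le_imp_le) simp
qed

text \<open>For m up to \<tau> / 2 the exponential is at most exp(- \<tau> h / 2); beyond it the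
  Bessel decay is of order \<tau>^(-1/2). The sum of both majorants has an elementary primitive, and
  comparison of exp(- x / 2) and 1 - exp(- x), for x = \<tau> h, with fractional powers of x yields
  the same weight \<tau>^(-1/4) h^(-3/4) as for the tail.\<close>

lemma evanescent_head_bound:
  assumes \<rho>: "\<rho> > 0" and h: "h > 0" and \<tau>: "\<tau> > 0"
  shows "\<bar>exp (- \<tau> * h) * evanescent \<kappa> \<rho> (-h) 0 \<tau>\<bar> \<le> 12 * \<tau> powr (-1/4) * \<rho> powr (-1/2) * h powr (-3/4)"
proof -
  let ?c = "2 * \<rho> powr (-1/2)"
  have e: "exp (- \<tau> * h) * evanescent \<kappa> \<rho> (-h) 0 \<tau> = integral {0..\<tau>} (\<lambda>m. J0 (\<rho> * Qm \<kappa> m) * exp (- (\<tau> - m) * h))"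
    unfolding evanescent_def integral_mult_right[symmetric]
    by (intro Henstock_Kurzweil_Integration.integral_cong) (simp add: exp_add[symmetric] algebra_simps)
  have i: "(\<lambda>m. J0 (\<rho> * Qm \<kappa> m) * exp (- (\<tau> - m) * h)) integrable_on {0..\<tau>}"
    by (intro integrable_continuous_interval continuous_intros)
  define A E where "A = sqrt 2 / sqrt \<tau>" and "E = exp (- (\<tau> / 2) * h)"
  let ?w = "\<lambda>m. ?c * (E * (1 / sqrt m) + A * exp (- (\<tau> - m) * h))"
  let ?W = "\<lambda>m. ?c * (E * (2 * sqrt m) + A * (exp (- (\<tau> - m) * h) / h))"
  have hi: "(?w has_integral (?W \<tau> - ?W 0)) {0..\<tau>}"
  proof (rule fundamental_theorem_of_calculus_interior)
    fix m assume m: "m \<in> {0<..<\<tau>}"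
    show "(?W has_vector_derivative ?w m) (at m)"
      unfolding has_real_derivative_iff_has_vector_derivative[symmetric]
      using m h by (auto intro!: derivative_eq_intros simp: field_simps)
  qed (use \<tau> h in \<open>auto intro!: continuous_intros\<close>)
  have "norm (integral {0..\<tau>} (\<lambda>m. J0 (\<rho> * Qm \<kappa> m) * exp (- (\<tau> - m) * h)))
     \<le> integral {0..\<tau>} (\<lambda>m. if m = 0 then \<bar>J0 (\<rho> * Qm \<kappa> m)\<bar> else ?w m)"
  proof (rule integral_norm_bound_integral[OF i])
    show "(\<lambda>m. if m = 0 then \<bar>J0 (\<rho> * Qm \<kappa> m)\<bar> else ?w m) integrable_on {0..\<tau>}"
      using has_integral_integrable[OF hi] by (rule integrable_spike_finite[of "{0}", rotated -1]) auto
    fix m assume m: "m \<in> {0..\<tau>}"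
    show "norm (J0 (\<rho> * Qm \<kappa> m) * exp (- (\<tau> - m) * h)) \<le> (if m = 0 then \<bar>J0 (\<rho> * Qm \<kappa> m)\<bar> else ?w m)"
    proof (cases "m = 0")
      case True
      thus ?thesis using \<tau> h by (simp add: abs_mult mult_left_le)
    next
      case False
      hence m': "m > 0" using m by auto
      have 1: "\<bar>J0 (\<rho> * Qm \<kappa> m)\<bar> \<le> ?c * (1 / sqrt m)"
        using abs_J0_Qm_le[OF \<rho> m', of \<kappa>] m' by (simp add: powr_minus_divide powr_half_sqrt)
      have "1 / sqrt m * exp (- (\<tau> - m) * h) \<le> E * (1 / sqrt m) + A * exp (- (\<tau> - m) * h)"
      proof (cases "m \<le> \<tau> / 2")
        case True
        have "exp (- (\<tau> - m) * h) \<le> exp (- (\<tau> / 2) * h)"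
          using mult_right_mono[of "- (\<tau> - m)" "- (\<tau> / 2)" h] True h by simp
        hence "1 / sqrt m * exp (- (\<tau> - m) * h) \<le> 1 / sqrt m * exp (- (\<tau> / 2) * h)"
          using m' by (intro mult_left_mono) auto
        moreover have "sqrt 2 / sqrt \<tau> * exp (- (\<tau> - m) * h) \<ge> 0" using \<tau> by simp
        ultimately show ?thesis unfolding A_def E_def by (simp add: mult.commute)
      next
        case False
        hence "sqrt \<tau> \<le> sqrt (2 * m)" by simp
        hence "1 / sqrt m \<le> sqrt 2 / sqrt \<tau>" using \<tau> m' by (simp add: real_sqrt_mult divide_simps)
        hence "1 / sqrt m * exp (- (\<tau> - m) * h) \<le> sqrt 2 / sqrt \<tau> * exp (- (\<tau> - m) * h)"
          by (intro mult_right_mono) auto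
        moreover have "exp (- (\<tau> / 2) * h) * (1 / sqrt m) \<ge> 0" using m' by simp
        ultimately show ?thesis unfolding A_def E_def by linarith
      qed
      hence "?c * (1 / sqrt m * exp (- (\<tau> - m) * h)) \<le> ?w m" by (intro mult_left_mono) auto
      moreover have "\<bar>J0 (\<rho> * Qm \<kappa> m)\<bar> * exp (- (\<tau> - m) * h) \<le> ?c * (1 / sqrt m) * exp (- (\<tau> - m) * h)"
        using 1 by (intro mult_right_mono) auto
      ultimately show ?thesis using False by (simp add: abs_mult)
    qed
  qed
  also have "\<dots> = integral {0..\<tau>} ?w" by (rule integral_spike[of "{0}"]) auto
  also have "\<dots> = ?W \<tau> - ?W 0" by (rule integral_unique[OF hi])
  also have "\<dots> = ?c * (2 * (sqrt \<tau> * exp (- (\<tau> / 2) * h)) + sqrt 2 / sqrt \<tau> * ((1 - exp (- \<tau> * h)) / h))"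
    unfolding A_def E_def using h by (simp add: algebra_simps diff_divide_distrib)
  also have "\<dots> \<le> ?c * (2 * (2 * (\<tau> powr (-1/4) * h powr (-3/4))) + 2 * (\<tau> powr (-1/4) * h powr (-3/4)))"
  proof (intro mult_left_mono add_mono)
    let ?x = "\<tau> * h"
    have x: "?x > 0" using \<tau> h by simp
    have s\<tau>: "sqrt \<tau> = \<tau> powr (1/2)" using \<tau> by (simp add: powr_half_sqrt)
    have "?x powr (3/4) \<le> 2 * exp (\<tau> / 2 * h)"
    proof -
      have "(?x/2) powr (3/4) \<le> exp (?x/2)" using x by (intro powr_le_exp) auto
      moreover have "?x powr (3/4) = 2 powr (3/4) * (?x/2) powr (3/4)" using x by (simp flip: powr_mult)
      moreover have "2 powr (3/4) \<le> (2::real) powr 1" by (intro powr_mono) auto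
      ultimately have "?x powr (3/4) \<le> 2 * exp (?x/2)" by (simp only:) (intro mult_mono; simp)
      thus ?thesis by simp
    qed
    hence "exp (- (\<tau> / 2) * h) \<le> 2 * ?x powr (-3/4)"
      using x \<tau> h by (simp add: exp_minus powr_minus_divide divide_simps mult.commute)
    hence "sqrt \<tau> * exp (- (\<tau> / 2) * h) \<le> sqrt \<tau> * (2 * ?x powr (-3/4))" using \<tau> by (intro mult_left_mono) auto
    also have "\<dots> = 2 * (\<tau> powr (1/2) * \<tau> powr (-3/4) * h powr (-3/4))"
      using \<tau> h by (simp add: s\<tau> powr_mult)
    also have "\<tau> powr (1/2) * \<tau> powr (-3/4) = \<tau> powr (-1/4)" by (simp flip: powr_add)
    finally show "sqrt \<tau> * exp (- (\<tau> / 2) * h) \<le> 2 * (\<tau> powr (-1/4) * h powr (-3/4))" .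
    have "1 - exp (- ?x) \<le> ?x powr (1/4)"
    proof (cases "?x \<le> 1")
      case True
      have "1 - exp (- ?x) \<le> ?x" using exp_ge_add_one_self[of "- ?x"] by simp
      also have "?x = ?x powr 1" using x by simp
      also have "\<dots> \<le> ?x powr (1/4)" using x True by (intro powr_mono') auto
      finally show ?thesis .
    next
      case False
      have "1 - exp (- ?x) \<le> 1" by simp
      also have "1 \<le> ?x powr (1/4)" using False by (intro ge_one_powr_ge_zero) auto
      finally show ?thesis .
    qed
    hence "(1 - exp (- ?x)) / h \<le> (\<tau> powr (1/4) * h powr (1/4)) / h"
      using h \<tau> by (intro divide_right_mono) (auto simp: powr_mult)
    also have "\<dots> = \<tau> powr (1/4) * h powr (-3/4)"
      using powr_diff[of h "1/4" 1] h by simp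
    finally have 3: "(1 - exp (- ?x)) / h \<le> \<tau> powr (1/4) * h powr (-3/4)" .
    have "sqrt 2 / sqrt \<tau> * ((1 - exp (- ?x)) / h) \<le> 2 / sqrt \<tau> * (\<tau> powr (1/4) * h powr (-3/4))"
      using 3 \<tau> h sqrt2_less_2 by (intro mult_mono divide_right_mono) auto
    also have "\<dots> = 2 * (\<tau> powr (1/4) / \<tau> powr (1/2) * h powr (-3/4))" by (simp add: s\<tau>)
    also have "\<tau> powr (1/4) / \<tau> powr (1/2) = \<tau> powr (-1/4)" by (simp flip: powr_diff)
    finally show "sqrt 2 / sqrt \<tau> * ((1 - exp (- \<tau> * h)) / h) \<le> 2 * (\<tau> powr (-1/4) * h powr (-3/4))" by simp
  qed auto
  finally show ?thesis unfolding e by (simp add: mult_ac)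
qed

lemma evanescent_combine:
  assumes "0 \<le> \<tau>" "\<tau> \<le> T"
  shows "evanescent \<kappa> \<rho> g 0 T = evanescent \<kappa> \<rho> g 0 \<tau> + evanescent \<kappa> \<rho> g \<tau> T"
  unfolding evanescent_def
  by (rule Henstock_Kurzweil_Integration.integral_combine[symmetric])
    (use assms in \<open>auto intro!: integrable_continuous_interval continuous_intros\<close>)

lemma norm_propagating_le:
  assumes "\<kappa> \<ge> 0"
  shows "norm (propagating \<kappa> \<rho> h) \<le> \<kappa>"
proof -
  have "norm (propagating \<kappa> \<rho> h) \<le> 1 * (\<kappa> - 0)"
    unfolding propagating_def
    by (rule integral_bound) (use assms abs_J0_le in \<open>auto intro!: continuous_intros simp: norm_mult\<close>)
  thus ?thesis by simp
qed

text \<open>For \<open>h < 0\<close> the truncated evanescent waves cancel the spherical wave up to the tail \<open>m > \<tau>\<close>;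
  for \<open>h > 0\<close> every term is damped by \<open>exp (-\<tau> h)\<close>.\<close>

lemma faddeev_scalar_bound:
  assumes \<kappa>: "\<kappa> > 0" and \<rho>: "\<rho> > 0" "\<rho> \<le> M" and h: "h \<noteq> 0" "\<bar>h\<bar> \<le> M" and \<tau>: "\<tau> > 0"
  defines "R \<equiv> sqrt (h\<^sup>2 + \<rho>\<^sup>2)"
  defines "X \<equiv> \<i> * propagating \<kappa> \<rho> (-h) + of_real (evanescent \<kappa> \<rho> (-h) 0 \<tau>) - exp (\<i> * of_real (\<kappa> * R)) / of_real R"
  shows "exp (- \<tau> * h) * norm X \<le> (13 + \<kappa> * M) * (\<tau> powr (-1/4) * \<rho> powr (-1/2) * \<bar>h\<bar> powr (-3/4))"
proof (cases "h < 0")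
  case True
  define g where "g = - h"
  have g: "g > 0" using True by (simp add: g_def)
  let ?c = "4 * \<tau> powr (-1/4) * \<rho> powr (-1/2) * g powr (-3/4)"
  let ?f = "\<lambda>T. exp (\<tau> * g) * (exp (- T * g) / g + 2 * Qm \<kappa> T * exp (- T * g))"
  have "(?f \<longlongrightarrow> 0) at_top"
    unfolding Qm_def using g by real_asymp
  \<comment> \<open>As T tends to infinity Sommerfeld's error disappears even after multiplication
    by exp(\<tau> g), while the bound for the tail beyond \<tau> does not depend on T.\<close>
  hence lim: "((\<lambda>T. ?f T + ?c) \<longlongrightarrow> 0 + ?c) at_top" by (intro tendsto_intros)
  have "exp (\<tau> * g) * norm X \<le> 0 + ?c"
  proof (rule tendsto_lowerbound[OF lim])
    have "exp (\<tau> * g) * norm X \<le> ?f T + ?c" if T: "T \<ge> \<tau>" for T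
    proof -
      let ?S = "\<i> * propagating \<kappa> \<rho> g + of_real (evanescent \<kappa> \<rho> g 0 T) - exp (\<i> * of_real (\<kappa> * R)) / of_real R"
      have "X = ?S - of_real (evanescent \<kappa> \<rho> g \<tau> T)"
        using evanescent_combine[of \<tau> T \<kappa> \<rho> g] \<tau> T by (simp add: X_def g_def)
      hence "norm X \<le> norm ?S + \<bar>evanescent \<kappa> \<rho> g \<tau> T\<bar>" using norm_triangle_ineq4 by (metis norm_of_real)
      also have "norm ?S \<le> exp (- T * g) / g + 2 * Qm \<kappa> T * exp (- T * g)"
        using sommerfeld[OF \<kappa> g less_imp_le[OF \<rho>(1)], of T] T \<tau> unfolding R_def g_def by simp
      finally have "norm X \<le> exp (- T * g) / g + 2 * Qm \<kappa> T * exp (- T * g) + \<bar>evanescent \<kappa> \<rho> g \<tau> T\<bar>" by simp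
      hence "exp (\<tau> * g) * norm X \<le> exp (\<tau> * g) * (exp (- T * g) / g + 2 * Qm \<kappa> T * exp (- T * g) + \<bar>evanescent \<kappa> \<rho> g \<tau> T\<bar>)"
        by (intro mult_left_mono) auto
      also have "\<dots> = ?f T + \<bar>exp (\<tau> * g) * evanescent \<kappa> \<rho> g \<tau> T\<bar>" by (simp only: distrib_left abs_mult abs_exp_cancel)
      finally show ?thesis using evanescent_tail_bound[OF \<rho>(1) g \<tau> T, of \<kappa>] by linarith
    qed
    thus "\<forall>\<^sub>F T in at_top. exp (\<tau> * g) * norm X \<le> ?f T + ?c"
      by (rule eventually_mono[OF eventually_ge_at_top[of \<tau>]])
  qed simp
  also have "0 + ?c = 4 * (\<tau> powr (-1/4) * \<rho> powr (-1/2) * g powr (-3/4))" by simp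
  also have "\<dots> \<le> (13 + \<kappa> * M) * (\<tau> powr (-1/4) * \<rho> powr (-1/2) * g powr (-3/4))"
  proof (rule mult_right_mono)
    have "\<kappa> * M \<ge> 0" using \<kappa> \<rho> by simp
    thus "4 \<le> 13 + \<kappa> * M" by linarith
  qed simp
  finally show ?thesis using True by (simp add: g_def)
next
  case False
  hence h': "h > 0" "h \<le> M" using h by auto
  let ?P = "\<tau> powr (-1/4) * \<rho> powr (-1/2) * h powr (-3/4)"
  have R: "R \<ge> \<rho>" "R \<ge> h" "R > 0"
    using \<rho> h' by (auto simp: R_def intro: real_le_rsqrt add_pos_pos)
  have eh: "exp (- \<tau> * h) \<le> \<tau> powr (-1/4) * h powr (-1/4)"
  proof -
    have "(\<tau> * h) powr (1/4) \<le> exp (\<tau> * h)" using \<tau> h' by (intro powr_le_exp) auto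
    hence "exp (- \<tau> * h) \<le> 1 / (\<tau> * h) powr (1/4)" using \<tau> h'
      by (simp add: exp_minus divide_simps mult.commute)
    also have "\<dots> = \<tau> powr (-1/4) * h powr (-1/4)" using \<tau> h' by (simp add: powr_minus_divide powr_mult)
    finally show ?thesis .
  qed
  \<comment> \<open>R dominates both \<rho> and h, so 1 / R is at most \<rho>^(-1/2) h^(-1/2); the
    exponential supplies the missing \<tau>^(-1/4) h^(-1/4).\<close>
  have i1: "exp (- \<tau> * h) * (1 / R) \<le> ?P"
  proof -
    have "R powr (-1/2) \<le> \<rho> powr (-1/2)" "R powr (-1/2) \<le> h powr (-1/2)"
      using R \<rho> h' by (auto intro!: powr_mono2')
    hence "R powr (-1/2) * R powr (-1/2) \<le> \<rho> powr (-1/2) * h powr (-1/2)" by (intro mult_mono) auto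
    also have "R powr (-1/2) * R powr (-1/2) = 1 / R" using R by (simp add: powr_minus_divide flip: powr_add)
    finally have "exp (- \<tau> * h) * (1 / R) \<le> (\<tau> powr (-1/4) * h powr (-1/4)) * (\<rho> powr (-1/2) * h powr (-1/2))"
      using eh R by (intro mult_mono) auto
    also have "\<dots> = \<tau> powr (-1/4) * \<rho> powr (-1/2) * (h powr (-1/4) * h powr (-1/2))" by simp
    also have "h powr (-1/4) * h powr (-1/2) = h powr (-3/4)" by (simp flip: powr_add)
    finally show ?thesis .
  qed
  have i2: "exp (- \<tau> * h) * \<kappa> \<le> \<kappa> * M * ?P"
  proof -
    have "\<rho> powr (1/2) * h powr (1/2) \<le> M powr (1/2) * M powr (1/2)"
      using \<rho> h' by (intro mult_mono powr_mono2) auto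
    also have "\<dots> = M" using \<rho> by (simp flip: powr_add)
    finally have "(\<rho> powr (1/2) * h powr (1/2)) * (\<rho> powr (-1/2) * h powr (-3/4)) \<le> M * (\<rho> powr (-1/2) * h powr (-3/4))"
      by (intro mult_right_mono) auto
    moreover have "(\<rho> powr (1/2) * h powr (1/2)) * (\<rho> powr (-1/2) * h powr (-3/4)) = (\<rho> powr (1/2) * \<rho> powr (-1/2)) * (h powr (1/2) * h powr (-3/4))"
      by (simp only: mult_ac)
    moreover have "\<rho> powr (1/2) * \<rho> powr (-1/2) = 1" using \<rho> by (simp flip: powr_add)
    moreover have "h powr (1/2) * h powr (-3/4) = h powr (-1/4)" by (simp flip: powr_add)
    ultimately have "h powr (-1/4) \<le> M * (\<rho> powr (-1/2) * h powr (-3/4))" by (simp only: mult_1)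
    hence "\<tau> powr (-1/4) * h powr (-1/4) \<le> \<tau> powr (-1/4) * (M * (\<rho> powr (-1/2) * h powr (-3/4)))"
      by (intro mult_left_mono) auto
    with eh have "exp (- \<tau> * h) \<le> \<tau> powr (-1/4) * (M * (\<rho> powr (-1/2) * h powr (-3/4)))" by linarith
    from mult_right_mono[OF this, of \<kappa>] \<kappa> show ?thesis by (simp add: mult_ac)
  qed
  have "norm X \<le> norm (propagating \<kappa> \<rho> (-h)) + \<bar>evanescent \<kappa> \<rho> (-h) 0 \<tau>\<bar> + 1 / R"
  proof -
    have "norm (exp (\<i> * of_real (\<kappa> * R)) / complex_of_real R) = 1 / R"
      using R by (simp add: norm_divide norm_exp_i_times del: of_real_mult)
    moreover have "norm (\<i> * propagating \<kappa> \<rho> (-h) + of_real (evanescent \<kappa> \<rho> (-h) 0 \<tau>))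
      \<le> norm (propagating \<kappa> \<rho> (-h)) + \<bar>evanescent \<kappa> \<rho> (-h) 0 \<tau>\<bar>"
      using norm_triangle_ineq[of "\<i> * propagating \<kappa> \<rho> (-h)" "of_real (evanescent \<kappa> \<rho> (-h) 0 \<tau>)"]
      by (simp add: norm_mult)
    ultimately show ?thesis unfolding X_def
      using norm_triangle_ineq4[of "\<i> * propagating \<kappa> \<rho> (-h) + of_real (evanescent \<kappa> \<rho> (-h) 0 \<tau>)"
        "exp (\<i> * of_real (\<kappa> * R)) / complex_of_real R"] by linarith
  qed
  also have "\<dots> \<le> \<kappa> + \<bar>evanescent \<kappa> \<rho> (-h) 0 \<tau>\<bar> + 1 / R" using norm_propagating_le[of \<kappa>] \<kappa> by simp
  finally have "exp (- \<tau> * h) * norm X \<le> exp (- \<tau> * h) * (\<kappa> + \<bar>evanescent \<kappa> \<rho> (-h) 0 \<tau>\<bar> + 1 / R)"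
    by (intro mult_left_mono) auto
  also have "\<dots> = exp (- \<tau> * h) * \<kappa> + \<bar>exp (- \<tau> * h) * evanescent \<kappa> \<rho> (-h) 0 \<tau>\<bar> + exp (- \<tau> * h) * (1 / R)"
    by (simp only: distrib_left abs_mult abs_exp_cancel)
  \<comment> \<open>The three terms stem from the propagating waves, the evanescent waves and the
    spherical wave.\<close>
  also have "\<dots> \<le> \<kappa> * M * ?P + 12 * ?P + ?P"
    using i1 i2 evanescent_head_bound[OF \<rho>(1) h'(1) \<tau>, of \<kappa>] by (intro add_mono) (auto simp: mult.assoc)
  also have "\<dots> = (13 + \<kappa> * M) * ?P" by (simp add: algebra_simps)
  finally show ?thesis using h' by simp
qed

definition pw :: "real^3 \<Rightarrow> real^3 \<Rightarrow> real^3 \<Rightarrow> complex" where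
  "pw A B z = exp (\<i> * of_real (A \<bullet> z) - of_real (B \<bullet> z))"

text \<open>\<open>pw A B\<close> is exp(i \<zeta> . z) with \<zeta> = A + i B; the two conditions
  on A and B are the imaginary and the real part of \<zeta> . \<zeta> = \<kappa>^2.\<close>

definition annihilates :: "real \<Rightarrow> (real^3 \<Rightarrow> complex) \<Rightarrow> bool" where
  "annihilates \<kappa> f \<longleftrightarrow> (\<forall>A B. A \<bullet> B = 0 \<longrightarrow> A \<bullet> A - B \<bullet> B = \<kappa>\<^sup>2 \<longrightarrow> (LINT z|lborel. pw A B z * f z) = 0)"

lemma continuous_on_pw [continuous_intros]: "continuous_on S g \<Longrightarrow> continuous_on S (\<lambda>x. pw A B (g x))"
  unfolding pw_def by (intro continuous_intros)

lemma annihilates_affine: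
  assumes f: "annihilates \<kappa> f" and AB: "A \<bullet> B = 0" "A \<bullet> A - B \<bullet> B = \<kappa>\<^sup>2" and c: "c\<^sup>2 = 1"
  shows "(LINT z|lborel. pw A B (c *\<^sub>R z + w) * f z) = 0"
proof -
  have "pw A B (c *\<^sub>R z + w) = pw A B w * pw (c *\<^sub>R A) (c *\<^sub>R B) z" for z
    unfolding pw_def by (simp add: inner_add_right exp_add[symmetric] algebra_simps)
  hence "(LINT z|lborel. pw A B (c *\<^sub>R z + w) * f z) = pw A B w * (LINT z|lborel. pw (c *\<^sub>R A) (c *\<^sub>R B) z * f z)"
    by (simp add: mult.assoc)
  moreover have "(c *\<^sub>R A) \<bullet> (c *\<^sub>R B) = 0" "(c *\<^sub>R A) \<bullet> (c *\<^sub>R A) - (c *\<^sub>R B) \<bullet> (c *\<^sub>R B) = \<kappa>\<^sup>2"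
    using AB c by (simp_all add: power2_eq_square flip: mult.assoc)
  ultimately show ?thesis using f by (simp add: annihilates_def)
qed

text \<open>Fubini between an integral over an interval and one against a weight. The bound is
  required only where the weight is nonzero, so that Gaussian weights on the line and densities of
  bounded support are covered alike.\<close>

lemma integral_weight_swap:
  fixes F :: "real \<Rightarrow> 'a::euclidean_space \<Rightarrow> complex"
  assumes f: "integrable lborel f" and F: "continuous_on UNIV (\<lambda>(p, z). F p z)"
    and C: "\<And>p z. p \<in> {l..u} \<Longrightarrow> f z \<noteq> 0 \<Longrightarrow> norm (F p z) \<le> C"
  shows "(LINT z|lborel. integral {l..u} (\<lambda>p. F p z) * f z) = integral {l..u} (\<lambda>p. LINT z|lborel. F p z * f z)"
proof -
  have [measurable]: "f \<in> borel_measurable borel" using f by auto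
  have Fm: "(\<lambda>(p, z). F p z) \<in> borel_measurable (lborel \<Otimes>\<^sub>M lborel)"
    unfolding lborel_prod using borel_measurable_continuous_onI[OF F] by simp
  let ?G = "\<lambda>p z. indicator {l..u} p *\<^sub>R (F p z * f z)"
  have int: "integrable (lborel \<Otimes>\<^sub>M lborel) (\<lambda>(p, z). ?G p z)"
  proof (rule Bochner_Integration.integrable_bound)
    show "integrable (lborel \<Otimes>\<^sub>M lborel) (\<lambda>(p, z). indicat_real {l..u} p * (C * norm (f z)))"
    proof (rule lborel_pair.Fubini_integrable)
      have "integrable lborel (\<lambda>p. indicat_real {l..u} p * (LINT z|lborel. \<bar>C\<bar> * norm (f z)))"
        by (intro integrable_mult_left integrable_real_indicator)
          (use emeasure_bounded_finite[of "{l..u}"] in auto)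
      thus "integrable lborel (\<lambda>p. LINT z|lborel. norm (case (p, z) of (p, z) \<Rightarrow> indicat_real {l..u} p * (C * norm (f z))))"
        by (simp add: abs_mult)
    qed (use f in simp_all)
    show "(\<lambda>(p, z). ?G p z) \<in> borel_measurable (lborel \<Otimes>\<^sub>M lborel)"
      using Fm by (simp add: case_prod_beta)
    have "norm (?G p z) \<le> norm (indicat_real {l..u} p * (C * norm (f z)))" for p z
    proof (cases "p \<in> {l..u} \<and> f z \<noteq> 0")
      case True
      hence "norm (F p z) \<le> \<bar>C\<bar>" using C[of p z] by auto
      hence "norm (F p z * f z) \<le> \<bar>C\<bar> * norm (f z)" unfolding norm_mult by (rule mult_right_mono) simp
      thus ?thesis using True by (simp add: abs_mult)
    qed (auto simp: indicator_def)
    thus "AE x in lborel \<Otimes>\<^sub>M lborel. norm (case x of (p, z) \<Rightarrow> ?G p z)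
        \<le> norm (case x of (p, z) \<Rightarrow> indicat_real {l..u} p * (C * norm (f z)))" by auto
  qed
  have Fc: "continuous_on {l..u} (\<lambda>p. F p z)" for z
  proof -
    have "continuous_on {l..u} (\<lambda>p. (p, z))" by (intro continuous_intros)
    from continuous_on_compose2[OF F this] show ?thesis by simp
  qed
  have 1: "integral {l..u} (\<lambda>p. F p z) * f z = (LINT p|lborel. ?G p z)" for z
  proof -
    have "set_integrable lborel {l..u} (\<lambda>p. F p z)"
      using borel_integrable_atLeastAtMost'[OF Fc] .
    hence "integral {l..u} (\<lambda>p. F p z) = (LINT p:{l..u}|lborel. F p z)"
      by (simp add: set_borel_integral_eq_integral(2))
    thus ?thesis by (simp add: set_lebesgue_integral_def flip: integral_mult_left_zero)
  qed
  have 2: "integral {l..u} (\<lambda>p. LINT z|lborel. F p z * f z) = (LINT p|lborel. LINT z|lborel. ?G p z)"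
  proof -
    have "integrable lborel (\<lambda>p. LINT z|lborel. ?G p z)"
      using lborel_pair.integrable_fst[OF int] .
    hence "set_integrable lborel {l..u} (\<lambda>p. LINT z|lborel. F p z * f z)"
      by (simp add: set_integrable_def)
    from set_borel_integral_eq_integral(2)[OF this] show ?thesis by (simp add: set_lebesgue_integral_def)
  qed
  show ?thesis unfolding 1 2 by (rule lborel_pair.Fubini_integral[OF int])
qed

lemma integral_density_swap:
  fixes F :: "real \<Rightarrow> real^3 \<Rightarrow> complex"
  assumes f: "bdd_density K f" and K: "bounded K" and F: "continuous_on UNIV (\<lambda>(p, z). F p z)"
  shows "(LINT z|lborel. integral {l..u} (\<lambda>p. F p z) * f z) = integral {l..u} (\<lambda>p. LINT z|lborel. F p z * f z)"
proof -
  obtain M where M: "K \<subseteq> cball 0 M" using bounded_subset_cball0[OF K] by blast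
  have "compact ((\<lambda>(p, z). F p z) ` ({l..u} \<times> cball 0 M))"
    by (intro compact_continuous_image continuous_on_subset[OF F] compact_Times) auto
  hence "bounded ((\<lambda>(p, z). F p z) ` ({l..u} \<times> cball 0 M))" by (rule compact_imp_bounded)
  then obtain C where "\<forall>w\<in>(\<lambda>(p, z). F p z) ` ({l..u} \<times> cball 0 M). norm w \<le> C"
    unfolding bounded_iff by blast
  hence C: "norm (F p z) \<le> C" if "p \<in> {l..u}" "z \<in> cball 0 M" for p z
    using that by auto
  show ?thesis
  proof (rule integral_weight_swap[OF integrable_bdd_density[OF f K] F])
    fix p z assume "p \<in> {l..u}" "f z \<noteq> 0"
    thus "norm (F p z) \<le> C" using C M bdd_density_zero[OF f, of z] by blast
  qed
qed

section \<open>The Faddeev type kernel in an orthonormal frame\<close>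

context frame
begin

definition rho :: "real^3 \<Rightarrow> real" where
  "rho y = sqrt ((y \<bullet> a)\<^sup>2 + (y \<bullet> b)\<^sup>2)"

text \<open>The height is \<open>- (y \<bullet> e)\<close>, so that for
  \<open>y \<bullet> e < 0\<close> Sommerfeld's integral approximates \<open>- G_plus\<close> and
  the sum \<open>G_plus + hom\<close> cancels up to the waves beyond \<tau>. On the other side the
  waves grow, but at most like exp(\<tau> (y . e)), the rate that the conjugation undoes.\<close>

definition hom :: "real \<Rightarrow> real \<Rightarrow> real^3 \<Rightarrow> complex" where
  "hom \<kappa> \<tau> y = (\<i> * propagating \<kappa> (rho y) (- (y \<bullet> e)) + of_real (evanescent \<kappa> (rho y) (- (y \<bullet> e)) 0 \<tau>))
     / of_real (4 * pi)"

lemma norm_rho: "norm y = sqrt ((y \<bullet> e)\<^sup>2 + (rho y)\<^sup>2)"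
  using frame_norm[of y] by (intro real_sqrt_unique[symmetric]) (simp_all add: rho_def)

lemma continuous_on_rho [continuous_intros]: "continuous_on S f \<Longrightarrow> continuous_on S (\<lambda>x. rho (f x))"
  unfolding rho_def by (intro continuous_intros)

lemma continuous_on_hom: "continuous_on UNIV (hom \<kappa> \<tau>)"
proof -
  have "continuous_on UNIV (\<lambda>y. propagating \<kappa> (rho y) (- (y \<bullet> e)))"
    unfolding propagating_def cbox_interval[symmetric]
    by (rule integral_continuous_on_param) (unfold case_prod_beta, intro continuous_intros)
  moreover have "continuous_on UNIV (\<lambda>y. evanescent \<kappa> (rho y) (- (y \<bullet> e)) 0 \<tau>)"
    unfolding evanescent_def cbox_interval[symmetric]
    by (rule integral_continuous_on_param) (unfold case_prod_beta, intro continuous_intros)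
  ultimately show ?thesis unfolding hom_def[abs_def] by (intro continuous_intros) auto
qed

text \<open>The inequality 2 |y . a| |y . b| \<le> \<open>(rho y)\<^sup>2\<close> trades the factor
  \<rho>^(-1/2) for coordinate powers. The exponents 1/4, 1/4 and 3/4 are all below 1, so the bound
  is locally integrable by \<open>integrable_product_powr\<close>.\<close>

lemma faddeev_bound:
  assumes \<kappa>: "\<kappa> > 0" and \<tau>: "\<tau> > 0" and y: "norm y \<le> M" "y \<bullet> a \<noteq> 0" "y \<bullet> b \<noteq> 0" "y \<bullet> e \<noteq> 0"
  shows "exp (- \<tau> * (y \<bullet> e)) * norm (G_plus \<kappa> y + hom \<kappa> \<tau> y) \<le> (13 + \<kappa> * M) * \<tau> powr (-1/4) *
    (\<bar>y \<bullet> a\<bar> powr (-(1/4)) * \<bar>y \<bullet> b\<bar> powr (-(1/4)) * \<bar>y \<bullet> e\<bar> powr (-(3/4)))"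
proof -
  let ?h = "y \<bullet> e"
  define R where "R = sqrt (?h\<^sup>2 + (rho y)\<^sup>2)"
  define X where "X = \<i> * propagating \<kappa> (rho y) (- ?h) + of_real (evanescent \<kappa> (rho y) (- ?h) 0 \<tau>)
    - exp (\<i> * of_real (\<kappa> * R)) / of_real R"
  have \<rho>: "rho y > 0" using y by (simp add: rho_def sum_power2_gt_zero_iff)
  have le: "rho y \<le> M" "\<bar>?h\<bar> \<le> M"
  proof -
    have "rho y \<le> norm y" "\<bar>?h\<bar> \<le> norm y" using \<rho> unfolding norm_rho by (auto intro: real_le_rsqrt)
    thus "rho y \<le> M" "\<bar>?h\<bar> \<le> M" using y(1) by auto
  qed
  have M: "\<kappa> * M \<ge> 0" using \<kappa> \<rho> le by simp
  have "G_plus \<kappa> y + hom \<kappa> \<tau> y = X / of_real (4 * pi)"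
    unfolding G_plus_def hom_def X_def norm_rho R_def by (simp add: diff_divide_distrib add_divide_distrib mult.commute)
  hence n: "norm (G_plus \<kappa> y + hom \<kappa> \<tau> y) = norm X / (4 * pi)" by (simp add: norm_divide)
  have "norm X / (4 * pi) \<le> norm X / 1" using pi_gt3 by (intro divide_left_mono) auto
  hence "exp (- \<tau> * ?h) * norm (G_plus \<kappa> y + hom \<kappa> \<tau> y) \<le> exp (- \<tau> * ?h) * norm X"
    unfolding n by (intro mult_left_mono) auto
  also have "\<dots> \<le> (13 + \<kappa> * M) * (\<tau> powr (-1/4) * rho y powr (-1/2) * \<bar>?h\<bar> powr (-3/4))"
    unfolding X_def R_def by (rule faddeev_scalar_bound) (use \<kappa> \<rho> le y \<tau> in auto)
  also have "\<dots> \<le> (13 + \<kappa> * M) * (\<tau> powr (-1/4) * (\<bar>y \<bullet> a\<bar> powr (-1/4) * \<bar>y \<bullet> b\<bar> powr (-1/4)) * \<bar>?h\<bar> powr (-3/4))"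
  proof -
    have "2 * (\<bar>y \<bullet> a\<bar> * \<bar>y \<bullet> b\<bar>) \<le> (rho y)\<^sup>2"
      using zero_le_power2[of "\<bar>y \<bullet> a\<bar> - \<bar>y \<bullet> b\<bar>"] by (simp add: rho_def power2_diff mult.assoc)
    moreover have "0 \<le> \<bar>y \<bullet> a\<bar> * \<bar>y \<bullet> b\<bar>" by simp
    ultimately have "\<bar>y \<bullet> a\<bar> * \<bar>y \<bullet> b\<bar> \<le> (rho y)\<^sup>2" by linarith
    hence "((rho y)\<^sup>2) powr (-1/4) \<le> (\<bar>y \<bullet> a\<bar> * \<bar>y \<bullet> b\<bar>) powr (-1/4)"
      using y by (intro powr_mono2') auto
    moreover have "((rho y)\<^sup>2) powr (-1/4) = rho y powr (-1/2)"
      using \<rho> by (simp add: powr_powr flip: powr_numeral)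
    ultimately have "rho y powr (-1/2) \<le> \<bar>y \<bullet> a\<bar> powr (-1/4) * \<bar>y \<bullet> b\<bar> powr (-1/4)"
      by (simp add: powr_mult)
    thus ?thesis using M by (intro mult_left_mono mult_right_mono) auto
  qed
  finally show ?thesis by (simp add: mult_ac)
qed

text \<open>Unrolling the Bessel function as an average over horizontal directions presents
  \<open>hom\<close> as a superposition of exponentials with \<zeta> . \<zeta> = \<kappa>^2; this
  holds for \<open>kp\<close> and \<open>Qm\<close> by their definition. Affine changes of z with
  linear part 1 or -1 preserve this class up to constant factors.\<close>

lemma hom_annihilates:
  assumes f: "bdd_density K f" and K: "bounded K" and ann: "annihilates \<kappa> f" and c: "c\<^sup>2 = 1" and \<kappa>: "\<kappa> \<ge> 0" and \<tau>: "\<tau> \<ge> 0"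
  shows "(LINT z|lborel. hom \<kappa> \<tau> (c *\<^sub>R z + w) * f z) = 0"
proof -
  let ?y = "\<lambda>z. c *\<^sub>R z + w"
  define u where "u \<theta> = cos \<theta> *\<^sub>R a + sin \<theta> *\<^sub>R b" for \<theta>
  have u: "u \<theta> \<bullet> u \<theta> = 1" "u \<theta> \<bullet> e = 0" "e \<bullet> u \<theta> = 0" for \<theta>
    using sin_cos_squared_add2[of \<theta>] by (simp_all add: u_def inner_add_left inner_add_right power2_eq_square)
  \<comment> \<open>Covers both parts of \<open>hom\<close>: \<open>A0 = - p *\<^sub>R e\<close> and
    \<open>B0 = 0\<close> for propagating waves, \<open>A0 = 0\<close> and
    \<open>B0 = - m *\<^sub>R e\<close> for evanescent ones.\<close>
  have plane: "(LINT z|lborel. of_real (J0 (rho (?y z) * q)) * (pw A0 B0 (?y z) * f z)) = 0"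
    if AB: "\<And>\<theta>. (A0 + q *\<^sub>R u \<theta>) \<bullet> B0 = 0" "\<And>\<theta>. (A0 + q *\<^sub>R u \<theta>) \<bullet> (A0 + q *\<^sub>R u \<theta>) - B0 \<bullet> B0 = \<kappa>\<^sup>2" and q: "q \<ge> 0"
    for q A0 B0
  proof -
    have J: "of_real (J0 (rho y * q)) * pw A0 B0 y = integral {0..2*pi} (\<lambda>\<theta>. pw (A0 + q *\<^sub>R u \<theta>) B0 y) / (2 * of_real pi)" for y
    proof -
      have "sqrt ((q * (y \<bullet> a))\<^sup>2 + (q * (y \<bullet> b))\<^sup>2) = rho y * q"
      proof -
        have "(q * (y \<bullet> a))\<^sup>2 + (q * (y \<bullet> b))\<^sup>2 = ((y \<bullet> a)\<^sup>2 + (y \<bullet> b)\<^sup>2) * q\<^sup>2" by (simp add: power_mult_distrib algebra_simps)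
        thus ?thesis using q by (simp add: rho_def real_sqrt_mult)
      qed
      hence "of_real (J0 (rho y * q)) = integral {0..2*pi} (\<lambda>\<theta>. exp (\<i> * of_real ((q * (y \<bullet> a)) * cos \<theta> + (q * (y \<bullet> b)) * sin \<theta>))) / (2 * of_real pi)"
        using integral_plane_wave[of "q * (y \<bullet> a)" "q * (y \<bullet> b)"] by simp
      also have "\<dots> * pw A0 B0 y = integral {0..2*pi} (\<lambda>\<theta>. exp (\<i> * of_real ((q * (y \<bullet> a)) * cos \<theta> + (q * (y \<bullet> b)) * sin \<theta>)) * pw A0 B0 y) / (2 * of_real pi)"
        by simp
      also have "(\<lambda>\<theta>. exp (\<i> * of_real ((q * (y \<bullet> a)) * cos \<theta> + (q * (y \<bullet> b)) * sin \<theta>)) * pw A0 B0 y) = (\<lambda>\<theta>. pw (A0 + q *\<^sub>R u \<theta>) B0 y)"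
        by (simp add: fun_eq_iff pw_def u_def inner_add_left inner_commute exp_add[symmetric] algebra_simps)
      finally show ?thesis .
    qed
    have "(LINT z|lborel. of_real (J0 (rho (?y z) * q)) * (pw A0 B0 (?y z) * f z))
      = (LINT z|lborel. (integral {0..2*pi} (\<lambda>\<theta>. pw (A0 + q *\<^sub>R u \<theta>) B0 (?y z)) * f z) / (2 * of_real pi))"
      by (simp only: mult.assoc[symmetric] J) simp
    also have "\<dots> = (LINT z|lborel. integral {0..2*pi} (\<lambda>\<theta>. pw (A0 + q *\<^sub>R u \<theta>) B0 (?y z)) * f z) / (2 * of_real pi)"
      by simp
    also have "(LINT z|lborel. integral {0..2*pi} (\<lambda>\<theta>. pw (A0 + q *\<^sub>R u \<theta>) B0 (?y z)) * f z)
      = integral {0..2*pi} (\<lambda>\<theta>. LINT z|lborel. pw (A0 + q *\<^sub>R u \<theta>) B0 (?y z) * f z)"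
      by (rule integral_density_swap[OF f K]) (unfold case_prod_beta pw_def u_def, intro continuous_intros)
    also have "\<dots> = integral {0..2*pi} (\<lambda>\<theta>. 0)" by (simp only: annihilates_affine[OF ann AB c])
    finally show ?thesis by simp
  qed
  have P: "(LINT z|lborel. propagating \<kappa> (rho (?y z)) (- (?y z \<bullet> e)) * f z) = 0"
  proof -
    have "(LINT z|lborel. propagating \<kappa> (rho (?y z)) (- (?y z \<bullet> e)) * f z)
      = integral {0..\<kappa>} (\<lambda>p. LINT z|lborel. of_real (J0 (rho (?y z) * kp \<kappa> p)) * exp (\<i> * of_real (p * - (?y z \<bullet> e))) * f z)"
      unfolding propagating_def
      by (rule integral_density_swap[OF f K]) (unfold case_prod_beta, intro continuous_intros)
    also have "\<dots> = integral {0..\<kappa>} (\<lambda>p. 0)"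
    proof (rule Henstock_Kurzweil_Integration.integral_cong)
      fix p assume p: "p \<in> {0..\<kappa>}"
      have k: "kp \<kappa> p \<ge> 0" "(kp \<kappa> p)\<^sup>2 = \<kappa>\<^sup>2 - p\<^sup>2" using p by (auto simp: kp_def intro!: power_mono)
      have eq: "exp (\<i> * of_real (p * - (y \<bullet> e))) = pw (- p *\<^sub>R e) 0 y" for y
        by (simp add: pw_def inner_commute)
      have pl: "(LINT z|lborel. of_real (J0 (rho (?y z) * kp \<kappa> p)) * (pw (- p *\<^sub>R e) 0 (?y z) * f z)) = 0"
        using k by (intro plane) (simp_all add: inner_add_left inner_add_right inner_diff_left inner_diff_right u power2_eq_square)
      show "(LINT z|lborel. of_real (J0 (rho (?y z) * kp \<kappa> p)) * exp (\<i> * of_real (p * - (?y z \<bullet> e))) * f z) = 0"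
        by (simp only: eq mult.assoc pl)
    qed
    finally show ?thesis by simp
  qed
  have E: "(LINT z|lborel. of_real (evanescent \<kappa> (rho (?y z)) (- (?y z \<bullet> e)) 0 \<tau>) * f z) = 0"
  proof -
    have ev: "of_real (evanescent \<kappa> (rho y) (- (y \<bullet> e)) 0 \<tau>)
       = integral {0..\<tau>} (\<lambda>m. of_real (J0 (rho y * Qm \<kappa> m)) * pw 0 (- m *\<^sub>R e) y)" for y
      unfolding evanescent_def pw_def
      by (subst integral_complex_of_real[symmetric])
        (auto intro!: integrable_continuous_interval continuous_intros simp: inner_commute exp_of_real[symmetric] simp del: exp_of_real)
    have "(LINT z|lborel. of_real (evanescent \<kappa> (rho (?y z)) (- (?y z \<bullet> e)) 0 \<tau>) * f z)
      = integral {0..\<tau>} (\<lambda>m. LINT z|lborel. of_real (J0 (rho (?y z) * Qm \<kappa> m)) * pw 0 (- m *\<^sub>R e) (?y z) * f z)"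
      unfolding ev
      by (rule integral_density_swap[OF f K]) (unfold case_prod_beta pw_def, intro continuous_intros)
    also have "\<dots> = integral {0..\<tau>} (\<lambda>m. 0)"
    proof (rule Henstock_Kurzweil_Integration.integral_cong)
      fix m assume m: "m \<in> {0..\<tau>}"
      have k: "Qm \<kappa> m \<ge> 0" "(Qm \<kappa> m)\<^sup>2 = m\<^sup>2 + \<kappa>\<^sup>2" by (auto simp: Qm_def)
      have pl: "(LINT z|lborel. of_real (J0 (rho (?y z) * Qm \<kappa> m)) * (pw 0 (- m *\<^sub>R e) (?y z) * f z)) = 0"
        using k by (intro plane) (simp_all add: u power2_eq_square)
      show "(LINT z|lborel. of_real (J0 (rho (?y z) * Qm \<kappa> m)) * pw 0 (- m *\<^sub>R e) (?y z) * f z) = 0"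
        by (simp only: mult.assoc pl)
    qed
    finally show ?thesis by simp
  qed
  have int: "integrable lborel (\<lambda>z. g z * f z)" if g: "continuous_on UNIV g" for g
  proof -
    have "integrable lborel (\<lambda>z. f z * g z)"
      by (rule integrable_bdd_density[OF bdd_density_mult_cont[OF f K g] K])
    thus ?thesis by (simp add: mult.commute)
  qed
  have cP: "continuous_on UNIV (\<lambda>z. propagating \<kappa> (rho (?y z)) (- (?y z \<bullet> e)))"
    unfolding propagating_def cbox_interval[symmetric]
    by (rule integral_continuous_on_param) (unfold case_prod_beta, intro continuous_intros)
  have cE: "continuous_on UNIV (\<lambda>z. complex_of_real (evanescent \<kappa> (rho (?y z)) (- (?y z \<bullet> e)) 0 \<tau>))"
    unfolding evanescent_def cbox_interval[symmetric]
    by (intro continuous_on_of_real integral_continuous_on_param) (unfold case_prod_beta, intro continuous_intros)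
  have "(LINT z|lborel. hom \<kappa> \<tau> (?y z) * f z) = (LINT z|lborel. \<i> / of_real (4 * pi) * (propagating \<kappa> (rho (?y z)) (- (?y z \<bullet> e)) * f z)
     + 1 / of_real (4 * pi) * (of_real (evanescent \<kappa> (rho (?y z)) (- (?y z \<bullet> e)) 0 \<tau>) * f z))"
    by (simp add: hom_def add_divide_distrib distrib_right mult.assoc)
  also have "\<dots> = 0"
    using int[OF cP] int[OF cE] by (subst Bochner_Integration.integral_add) (simp_all add: P E)
  finally show ?thesis .
qed

end

section \<open>Orthogonality to exponentials\<close>

lemma continuous_density_integral:
  fixes F :: "'b::euclidean_space \<Rightarrow> real^3 \<Rightarrow> complex"
  assumes f: "bdd_density K f" and K: "bounded K" and F: "continuous_on UNIV (\<lambda>(t, z). F t z)"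
  shows "continuous_on UNIV (\<lambda>t. LINT z|lborel. F t z * f z)"
proof -
  obtain M where M: "K \<subseteq> cball 0 M" using bounded_subset_cball0[OF K] by blast
  have [measurable]: "f \<in> borel_measurable borel" by (rule bdd_density_measurable[OF f])
  have Fm: "F t \<in> borel_measurable borel" for t
  proof -
    have "continuous_on UNIV (\<lambda>z. (t, z))" by (intro continuous_intros)
    from continuous_on_compose2[OF F this] show ?thesis by (intro borel_measurable_continuous_onI) simp
  qed
  have "continuous_on (ball t0 1) (\<lambda>t. LINT z|lborel. F t z * f z)" for t0
    unfolding continuous_on_sequentially
  proof (intro allI ballI impI)
    fix X t assume t: "t \<in> ball t0 1" and "(\<forall>n. X n \<in> ball t0 1) \<and> X \<longlonglongrightarrow> t"
    hence X: "X n \<in> ball t0 1" "X \<longlonglongrightarrow> t" for n by auto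
    have "compact ((\<lambda>(t, z). F t z) ` (cball t0 1 \<times> cball 0 M))"
      by (intro compact_continuous_image continuous_on_subset[OF F] compact_Times) auto
    hence "bounded ((\<lambda>(t, z). F t z) ` (cball t0 1 \<times> cball 0 M))" by (rule compact_imp_bounded)
    then obtain C where "\<forall>w\<in>(\<lambda>(t, z). F t z) ` (cball t0 1 \<times> cball 0 M). norm w \<le> C"
      unfolding bounded_iff by blast
    hence C: "norm (F t z) \<le> C" if "t \<in> cball t0 1" "z \<in> cball 0 M" for t z
      using that by auto
    have "(\<lambda>n. LINT z|lborel. F (X n) z * f z) \<longlonglongrightarrow> (LINT z|lborel. F t z * f z)"
    proof (rule integral_dominated_convergence[where w = "\<lambda>z. C * norm (f z)"])
      show "integrable lborel (\<lambda>z. C * norm (f z))" using integrable_bdd_density[OF f K] by simp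
      have "(\<lambda>n. F (X n) z) \<longlonglongrightarrow> F t z" for z
      proof -
        have 1: "(\<lambda>n. (X n, z)) \<longlonglongrightarrow> (t, z)" using X by (intro tendsto_intros)
        have 2: "isCont (\<lambda>(t, z). F t z) (t, z)" using F by (simp add: continuous_on_eq_continuous_at)
        show ?thesis using isCont_tendsto_compose[OF 2 1] by simp
      qed
      hence "(\<lambda>n. F (X n) z * f z) \<longlonglongrightarrow> F t z * f z" for z by (intro tendsto_intros)
      thus "AE z in lborel. (\<lambda>n. F (X n) z * f z) \<longlonglongrightarrow> F t z * f z" by simp
      show "AE z in lborel. norm (F (X n) z * f z) \<le> C * norm (f z)" for n
      proof (rule AE_I2)
        fix z
        show "norm (F (X n) z * f z) \<le> C * norm (f z)"
        proof (cases "z \<in> K")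
          case True
          hence "norm (F (X n) z) \<le> C" using C[of "X n" z] X(1)[of n] M by (auto simp: less_imp_le)
          thus ?thesis by (simp add: norm_mult mult_right_mono)
        qed (simp add: bdd_density_zero[OF f])
      qed
    qed (use Fm in simp_all)
    thus "((\<lambda>t. LINT z|lborel. F t z * f z) \<circ> X) \<longlonglongrightarrow> (LINT z|lborel. F t z * f z)" by (simp add: comp_def)
  qed
  hence "isCont (\<lambda>t. LINT z|lborel. F t z * f z) t" for t
    by (rule continuous_on_interior[of "ball t 1"]) simp
  thus ?thesis by (simp add: continuous_at_imp_continuous_on)
qed

section \<open>Gaussian averages and localisation\<close>

lemma fourier_std_normal:
  "(LINT y|lborel. exp (\<i> * of_real (s * y)) * of_real (std_normal_density y)) = complex_of_real (exp (- (s\<^sup>2) / 2))"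
proof -
  have "char std_normal_distribution s = complex_of_real (exp (- (s\<^sup>2) / 2))"
    by (simp only: char_std_normal_distribution)
  moreover have "char std_normal_distribution s = (LINT y|lborel. std_normal_density y *\<^sub>R exp (\<i> * of_real (s * y)))"
    unfolding char_def by (rule integral_density) (auto simp: normal_density_nonneg)
  ultimately show ?thesis by (simp only: scaleR_conv_of_real mult.commute[of "complex_of_real (std_normal_density _)"])
qed

text \<open>Fubini moves the Gaussian inside, where its Fourier transform replaces exp(i s y) by
  exp(- s^2 / 2): averaging in y damps every wave in proportion to its distance from s = 0.\<close>

lemma gauss_average:
  fixes s :: "real \<Rightarrow> real \<Rightarrow> real" and \<Psi> :: "real \<Rightarrow> real \<Rightarrow> complex" and u v :: real
  assumes s: "continuous_on UNIV (\<lambda>(p, \<theta>). s p \<theta>)" and \<Psi>: "continuous_on UNIV (\<lambda>(p, \<theta>). \<Psi> p \<theta>)"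
  defines "N \<equiv> \<lambda>y. integral {0..u} (\<lambda>p. integral {0..v} (\<lambda>\<theta>. exp (\<i> * of_real (s p \<theta> * y)) * \<Psi> p \<theta>))"
  shows "integrable lborel (\<lambda>y. N y * of_real (std_normal_density y))"
    and "(LINT y|lborel. N y * of_real (std_normal_density y))
      = integral {0..u} (\<lambda>p. integral {0..v} (\<lambda>\<theta>. of_real (exp (- ((s p \<theta>)\<^sup>2) / 2)) * \<Psi> p \<theta>))"
proof -
  have s': "continuous_on A (\<lambda>x. s (g x) (h x))" if "continuous_on A g" "continuous_on A h"
    for A :: "'x::topological_space set" and g h
    using continuous_on_compose2[OF s continuous_on_Pair[OF that]] by simp
  have \<Psi>': "continuous_on A (\<lambda>x. \<Psi> (g x) (h x))" if "continuous_on A g" "continuous_on A h"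
    for A :: "'x::topological_space set" and g h
    using continuous_on_compose2[OF \<Psi> continuous_on_Pair[OF that]] by simp
  let ?w = "\<lambda>y. complex_of_real (std_normal_density y)"
  have w: "integrable lborel ?w" using integrable_normal_density[of 1 0] by simp
  let ?F = "\<lambda>p y. integral {0..v} (\<lambda>\<theta>. exp (\<i> * of_real (s p \<theta> * y)) * \<Psi> p \<theta>)"
  have Fc: "continuous_on UNIV (\<lambda>(p, y). ?F p y)"
    unfolding case_prod_beta cbox_interval[symmetric]
    by (rule integral_continuous_on_param) (unfold case_prod_beta, intro continuous_intros s' \<Psi>')
  have "compact ((\<lambda>(p, \<theta>). \<Psi> p \<theta>) ` ({0..u} \<times> {0..v}))"
    by (intro compact_continuous_image continuous_on_subset[OF \<Psi>] compact_Times) auto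
  hence "bounded ((\<lambda>(p, \<theta>). \<Psi> p \<theta>) ` ({0..u} \<times> {0..v}))" by (rule compact_imp_bounded)
  then obtain C where "\<forall>w\<in>(\<lambda>(p, \<theta>). \<Psi> p \<theta>) ` ({0..u} \<times> {0..v}). norm w \<le> C"
    unfolding bounded_iff by blast
  hence C: "norm (\<Psi> p \<theta>) \<le> C" if "p \<in> {0..u}" "\<theta> \<in> {0..v}" for p \<theta> using that by auto
  have ne: "norm (exp (\<i> * of_real t)) = 1" for t :: real by (rule norm_exp_i_times)
  have FC: "norm (?F p y) \<le> \<bar>C\<bar> * max 0 v" if p: "p \<in> {0..u}" for p y
  proof (cases "v \<ge> 0")
    case True
    have "norm (?F p y) \<le> \<bar>C\<bar> * (v - 0)"
    proof (rule integral_bound[OF True])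
      show "continuous_on {0..v} (\<lambda>\<theta>. exp (\<i> * of_real (s p \<theta> * y)) * \<Psi> p \<theta>)"
        by (intro continuous_intros s' \<Psi>')
      show "norm (exp (\<i> * of_real (s p \<theta> * y)) * \<Psi> p \<theta>) \<le> \<bar>C\<bar>" if "\<theta> \<in> {0..v}" for \<theta>
        unfolding norm_mult ne using C[OF p that] by simp
    qed
    thus ?thesis using True by simp
  qed simp
  have Nc: "continuous_on UNIV N" unfolding N_def cbox_interval[symmetric]
  proof (rule integral_continuous_on_param)
    have "continuous_on (UNIV \<times> cbox 0 u) (\<lambda>x. (snd x, fst x))" for u :: real by (intro continuous_intros)
    from continuous_on_compose2[OF Fc this]
    show "continuous_on (UNIV \<times> cbox 0 u) (\<lambda>(y, p). integral (cbox 0 v) (\<lambda>\<theta>. exp (\<i> * of_real (s p \<theta> * y)) * \<Psi> p \<theta>))"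
      by (simp add: case_prod_beta)
  qed
  have NC: "norm (N y) \<le> \<bar>C\<bar> * max 0 v * max 0 u" for y
  proof (cases "u \<ge> 0")
    case True
    have "norm (N y) \<le> (\<bar>C\<bar> * max 0 v) * (u - 0)" unfolding N_def
    proof (rule integral_bound[OF True _ FC])
      have "continuous_on {0..u} (\<lambda>p. (p, y))" by (intro continuous_intros)
      from continuous_on_compose2[OF Fc this]
      show "continuous_on {0..u} (\<lambda>p. ?F p y)" by simp
    qed
    thus ?thesis using True by simp
  qed (simp add: N_def)
  show "integrable lborel (\<lambda>y. N y * ?w y)"
  proof (rule Bochner_Integration.integrable_bound)
    show "integrable lborel (\<lambda>y. (\<bar>C\<bar> * max 0 v * max 0 u) * norm (?w y))" using w by simp
    show "(\<lambda>y. N y * ?w y) \<in> borel_measurable lborel"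
      using borel_measurable_continuous_onI[OF Nc] by simp
    show "AE y in lborel. norm (N y * ?w y) \<le> norm ((\<bar>C\<bar> * max 0 v * max 0 u) * norm (?w y))"
    proof (rule AE_I2)
      fix y
      have "norm (N y * ?w y) \<le> (\<bar>C\<bar> * max 0 v * max 0 u) * norm (?w y)"
        unfolding norm_mult by (rule mult_right_mono[OF NC]) simp
      thus "norm (N y * ?w y) \<le> norm ((\<bar>C\<bar> * max 0 v * max 0 u) * norm (?w y))"
        unfolding real_norm_def by (rule order_trans[OF _ abs_ge_self])
    qed
  qed
  have "(LINT y|lborel. N y * ?w y) = integral {0..u} (\<lambda>p. LINT y|lborel. ?F p y * ?w y)"
    unfolding N_def by (rule integral_weight_swap[OF w Fc FC])
  also have "\<dots> = integral {0..u} (\<lambda>p. integral {0..v} (\<lambda>\<theta>. of_real (exp (- ((s p \<theta>)\<^sup>2) / 2)) * \<Psi> p \<theta>))"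
  proof (rule Henstock_Kurzweil_Integration.integral_cong)
    fix p assume p: "p \<in> {0..u}"
    have "(LINT y|lborel. ?F p y * ?w y) = integral {0..v} (\<lambda>\<theta>. LINT y|lborel. exp (\<i> * of_real (s p \<theta> * y)) * \<Psi> p \<theta> * ?w y)"
    proof (rule integral_weight_swap[OF w])
      show "continuous_on UNIV (\<lambda>(\<theta>, y). exp (\<i> * of_real (s p \<theta> * y)) * \<Psi> p \<theta>)"
        unfolding case_prod_beta by (intro continuous_intros s' \<Psi>')
      show "norm (exp (\<i> * of_real (s p \<theta> * y)) * \<Psi> p \<theta>) \<le> C" if "\<theta> \<in> {0..v}" for \<theta> y
        unfolding norm_mult ne using C[OF p that] by simp
    qed
    also have "\<dots> = integral {0..v} (\<lambda>\<theta>. of_real (exp (- ((s p \<theta>)\<^sup>2) / 2)) * \<Psi> p \<theta>)"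
    proof (rule Henstock_Kurzweil_Integration.integral_cong)
      fix \<theta>
      have "(LINT y|lborel. exp (\<i> * of_real (s p \<theta> * y)) * \<Psi> p \<theta> * ?w y)
        = (LINT y|lborel. \<Psi> p \<theta> * (exp (\<i> * of_real (s p \<theta> * y)) * ?w y))" by (simp only: mult_ac)
      also have "\<dots> = \<Psi> p \<theta> * of_real (exp (- ((s p \<theta>)\<^sup>2) / 2))"
        by (simp only: integral_mult_right_zero fourier_std_normal)
      finally show "(LINT y|lborel. exp (\<i> * of_real (s p \<theta> * y)) * \<Psi> p \<theta> * ?w y) = of_real (exp (- ((s p \<theta>)\<^sup>2) / 2)) * \<Psi> p \<theta>"
        by (simp only: mult.commute)
    qed
    finally show "(LINT y|lborel. ?F p y * ?w y) = integral {0..v} (\<lambda>\<theta>. of_real (exp (- ((s p \<theta>)\<^sup>2) / 2)) * \<Psi> p \<theta>)" .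
  qed
  finally show "(LINT y|lborel. N y * ?w y)
      = integral {0..u} (\<lambda>p. integral {0..v} (\<lambda>\<theta>. of_real (exp (- ((s p \<theta>)\<^sup>2) / 2)) * \<Psi> p \<theta>))" .
qed

text \<open>If g did not vanish at the only zero \<alpha> of D, a small box about \<alpha> would
  contribute at least a constant times exp(- t r / 2), whereas the assumed bound and the rest of the
  domain are of order exp(- t r); large t is then impossible. This crude form of Laplace's method
  requires neither derivatives nor an asymptotic expansion.\<close>

lemma localization:
  fixes g :: "real \<times> real \<Rightarrow> complex" and D :: "real \<times> real \<Rightarrow> real"
  assumes g: "continuous_on UNIV g" and D: "continuous_on UNIV D"
    and D0: "D \<alpha> = 0" and Dpos: "\<And>\<beta>. \<beta> \<in> cbox l u \<Longrightarrow> \<beta> \<noteq> \<alpha> \<Longrightarrow> D \<beta> > 0"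
    and \<alpha>: "\<alpha> \<in> box l u" and \<rho>: "\<rho> > 0"
    and bound: "\<And>t. t > 0 \<Longrightarrow> norm (integral (cbox l u) (\<lambda>\<beta>. of_real (exp (- (t * D \<beta>))) * g \<beta>)) \<le> C * exp (- (t * \<rho>))"
  shows "g \<alpha> = 0"
proof (rule ccontr)
  assume nz: "g \<alpha> \<noteq> 0"
  define c where "c = (norm (g \<alpha>))\<^sup>2"
  have c: "c > 0" using nz by (simp add: c_def)
  \<comment> \<open>The factor \<open>cnj (g \<alpha>)\<close> rotates g so that its real part is
    positive near \<alpha>.\<close>
  define G where "G \<beta> = Re (cnj (g \<alpha>) * g \<beta>)" for \<beta>
  have G: "continuous_on UNIV G" unfolding G_def by (intro continuous_intros g)
  have Ga: "G \<alpha> = c" unfolding c_def cmod_power2 by (simp add: G_def power2_eq_square)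
  have open1: "open {\<beta>. G \<beta> > c / 2}" by (intro open_Collect_less continuous_intros G)
  define U where "U = {\<beta>. G \<beta> > c / 2} \<inter> box l u"
  have U: "open U" "\<alpha> \<in> U" using open1 Ga c \<alpha> by (auto simp: U_def)
  obtain r0 where r0: "r0 > 0" "\<And>\<beta>. \<beta> \<in> cbox l u - U \<Longrightarrow> D \<beta> \<ge> r0"
  proof (cases "cbox l u - U = {}")
    case False
    have "compact (cbox l u - U)" using U by (intro compact_diff) auto
    then obtain \<beta>0 where "\<beta>0 \<in> cbox l u - U" "\<And>\<beta>. \<beta> \<in> cbox l u - U \<Longrightarrow> D \<beta>0 \<le> D \<beta>"
      using continuous_attains_inf[OF _ False continuous_on_subset[OF D subset_UNIV]] by blast
    thus thesis using that[of "D \<beta>0"] Dpos[of \<beta>0] U by auto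
  qed (use that[of 1] in auto)
  \<comment> \<open>r bounds D from below off U and is at most the given rate. On the small box
    chosen next D stays below r / 2, so its contribution decays more slowly than everything
    else.\<close>
  define r where "r = min r0 \<rho>"
  have r: "r > 0" "r \<le> r0" "r \<le> \<rho>" using r0 \<rho> by (auto simp: r_def)
  have "open (U \<inter> {\<beta>. D \<beta> < r / 2})" by (intro open_Int U open_Collect_less continuous_intros D)
  moreover have "\<alpha> \<in> U \<inter> {\<beta>. D \<beta> < r / 2}" using U D0 r by auto
  ultimately obtain a b where ab: "cbox a b \<subseteq> U \<inter> {\<beta>. D \<beta> < r / 2}" "\<alpha> \<in> box a b"
    by (rule open_contains_cbox)
  have V: "measure lborel (cbox a b) > 0" using ab(2) unfolding content_pos_lt_eq mem_box by (meson less_trans)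
  have sub: "cbox a b \<subseteq> cbox l u" using ab(1) box_subset_cbox[of l u] unfolding U_def by blast
  have "bounded (G ` cbox l u)" by (intro compact_imp_bounded compact_continuous_image continuous_on_subset[OF G]) auto
  then obtain m where "m > 0" "\<forall>x\<in>G ` cbox l u. norm x \<le> m"
    unfolding bounded_pos by blast
  hence m: "m > 0" "\<And>\<beta>. \<beta> \<in> cbox l u \<Longrightarrow> \<bar>G \<beta>\<bar> \<le> m" by auto
  let ?A = "c / 2 * measure lborel (cbox a b)"
  let ?B = "m * measure lborel (cbox l u) + norm (g \<alpha>) * \<bar>C\<bar>"
  have main: "?A * exp (- (t * (r / 2))) \<le> ?B * exp (- (t * r))" if t: "t > 0" for t
  proof -
    let ?w = "\<lambda>\<beta>. exp (- (t * D \<beta>)) * G \<beta>"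
    \<comment> \<open>Off U the weighted integrand is at least - \<open>?e\<close>; adding this
      constant makes it nonnegative on the whole box, so that the integral may be restricted to the
      small box.\<close>
    let ?e = "m * exp (- (t * r))"
    have wc: "continuous_on UNIV ?w" by (intro continuous_intros G D)
    have wi: "?w integrable_on cbox p q" for p q by (intro integrable_continuous continuous_on_subset[OF wc]) auto
    have pos: "?w \<beta> + ?e \<ge> 0" if \<beta>: "\<beta> \<in> cbox l u" for \<beta>
    proof (cases "\<beta> \<in> U")
      case True
      hence "?w \<beta> \<ge> 0" using c by (simp add: U_def)
      thus ?thesis using m(1) by (simp add: add_nonneg_nonneg)
    next
      case False
      hence "r \<le> D \<beta>" using r0(2)[of \<beta>] \<beta> r by auto
      hence "exp (- (t * D \<beta>)) \<le> exp (- (t * r))" using t by simp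
      hence "exp (- (t * D \<beta>)) * \<bar>G \<beta>\<bar> \<le> exp (- (t * r)) * m" using m \<beta> by (intro mult_mono) auto
      hence "\<bar>?w \<beta>\<bar> \<le> ?e" by (simp add: abs_mult mult.commute)
      thus ?thesis by linarith
    qed
    have low: "c / 2 * exp (- (t * (r / 2))) \<le> ?w \<beta> + ?e" if \<beta>: "\<beta> \<in> cbox a b" for \<beta>
    proof -
      have "G \<beta> \<ge> c / 2" "D \<beta> \<le> r / 2" using \<beta> ab(1) by (auto simp: U_def)
      hence "exp (- (t * (r / 2))) * (c / 2) \<le> ?w \<beta>" using t c by (intro mult_mono) auto
      thus ?thesis using m(1) by (simp add: mult.commute add_increasing2)
    qed
    have "c / 2 * exp (- (t * (r / 2))) * measure lborel (cbox a b) = integral (cbox a b) (\<lambda>\<beta>. c / 2 * exp (- (t * (r / 2))))"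
      by simp
    also have "\<dots> \<le> integral (cbox a b) (\<lambda>\<beta>. ?w \<beta> + ?e)"
      by (rule integral_le[OF _ _ low]) (intro integrable_add wi integrable_const)+
    also have "\<dots> \<le> integral (cbox l u) (\<lambda>\<beta>. ?w \<beta> + ?e)"
    proof (rule integral_subset_le[OF sub])
      show "\<forall>\<beta>\<in>cbox l u. 0 \<le> ?w \<beta> + ?e" using pos by blast
    qed (intro integrable_add wi integrable_const)+
    also have "\<dots> = integral (cbox l u) ?w + ?e * measure lborel (cbox l u)"
      by (subst Henstock_Kurzweil_Integration.integral_add) (auto intro: wi)
    also have "integral (cbox l u) ?w = Re (cnj (g \<alpha>) * integral (cbox l u) (\<lambda>\<beta>. of_real (exp (- (t * D \<beta>))) * g \<beta>))"
    proof -
      have i: "(\<lambda>\<beta>. cnj (g \<alpha>) * (of_real (exp (- (t * D \<beta>))) * g \<beta>)) integrable_on cbox l u"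
        by (intro integrable_continuous continuous_intros continuous_on_subset[OF g] continuous_on_subset[OF D]) auto
      have "Re (integral (cbox l u) (\<lambda>\<beta>. cnj (g \<alpha>) * (of_real (exp (- (t * D \<beta>))) * g \<beta>)))
        = integral (cbox l u) (\<lambda>\<beta>. Re (cnj (g \<alpha>) * (of_real (exp (- (t * D \<beta>))) * g \<beta>)))"
        using integral_linear[OF i bounded_linear_Re] by (simp add: comp_def)
      also have "(\<lambda>\<beta>. Re (cnj (g \<alpha>) * (of_real (exp (- (t * D \<beta>))) * g \<beta>))) = ?w"
        by (auto simp: G_def fun_eq_iff algebra_simps)
      finally show ?thesis by simp
    qed
    also have "\<dots> \<le> norm (g \<alpha>) * (\<bar>C\<bar> * exp (- (t * r)))"
    proof -
      have "norm (integral (cbox l u) (\<lambda>\<beta>. of_real (exp (- (t * D \<beta>))) * g \<beta>)) \<le> C * exp (- (t * \<rho>))" by (rule bound[OF t])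
      also have "\<dots> \<le> \<bar>C\<bar> * exp (- (t * r))" using r t by (intro mult_mono) auto
      finally have "norm (cnj (g \<alpha>) * integral (cbox l u) (\<lambda>\<beta>. of_real (exp (- (t * D \<beta>))) * g \<beta>)) \<le> norm (g \<alpha>) * (\<bar>C\<bar> * exp (- (t * r)))"
        unfolding norm_mult by (intro mult_mono) auto
      thus ?thesis using complex_Re_le_cmod order_trans by blast
    qed
    finally show ?thesis by (simp add: algebra_simps)
  qed
  define A B where "A = ?A" and "B = ?B"
  have A: "A > 0" using c V by (simp add: A_def)
  have fin: "A * exp (t * (r / 2)) \<le> B" if t: "t > 0" for t
  proof -
    have "A * exp (- (t * (r / 2))) * exp (t * r) \<le> B * exp (- (t * r)) * exp (t * r)"
      unfolding A_def B_def using main[OF t] by (intro mult_right_mono) auto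
    moreover have "exp (- (t * (r / 2))) * exp (t * r) = exp (t * (r / 2))" "exp (- (t * r)) * exp (t * r) = 1"
      by (simp_all add: exp_add[symmetric])
    ultimately show ?thesis by (simp only: mult.assoc mult_1_right)
  qed
  have "filterlim (\<lambda>t. A * exp (t * (r / 2))) at_top at_top"
    using A r(1) by real_asymp
  hence "\<forall>\<^sub>F t in at_top. A * exp (t * (r / 2)) > B" by (simp add: filterlim_at_top_dense)
  hence "\<forall>\<^sub>F t in at_top. A * exp (t * (r / 2)) > B \<and> t > 0"
    using eventually_gt_at_top[of 0] by eventually_elim simp
  then obtain t where "A * exp (t * (r / 2)) > B" "t > 0"
    using eventually_happens[of _ at_top] by fastforce
  thus False using fin[of t] by linarith
qed

lemma gauss_average_bound:
  fixes N :: "real \<Rightarrow> complex"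
  assumes "\<And>y. norm (N y) \<le> \<beta>"
  shows "norm (LINT y|lborel. N y * of_real (std_normal_density y)) \<le> \<beta>"
proof -
  have "norm (LINT y|lborel. N y * of_real (std_normal_density y)) \<le> (LINT y|lborel. norm (N y * of_real (std_normal_density y)))"
    by (rule integral_norm_bound)
  also have "\<dots> \<le> (LINT y|lborel. \<beta> * std_normal_density y)"
  proof (rule integral_mono')
    show "integrable lborel (\<lambda>y. \<beta> * std_normal_density y)"
      using integrable_normal_density[of 1 0] by simp
    fix y :: real
    have n: "0 \<le> std_normal_density y" by (simp add: normal_density_nonneg)
    thus "norm (N y * of_real (std_normal_density y)) \<le> \<beta> * std_normal_density y"
      by (simp only: norm_mult norm_of_real abs_of_nonneg[OF n]) (intro mult_right_mono assms)
    have "0 \<le> \<beta>" using assms[of y] norm_ge_zero order_trans by blast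
    thus "0 \<le> \<beta> * std_normal_density y" using n by simp
  qed
  also have "\<dots> = \<beta>" using integral_normal_density[of 1 0] by simp
  finally show ?thesis .
qed

section \<open>Plane-wave amplitudes of a potential on a plane beside its density\<close>

lemma kp_nonneg: "0 \<le> p \<Longrightarrow> p \<le> \<kappa> \<Longrightarrow> 0 \<le> kp \<kappa> p"
  by (simp add: kp_def power_mono)

lemma Qm_nonneg: "0 \<le> Qm \<kappa> m"
  by (simp add: Qm_def)

context frame
begin

text \<open>Amplitude in the plane-wave expansion on the plane at height \<open>s0\<close>:
  \<open>k p\<close> is the horizontal wave number, \<theta> the horizontal direction, and
  \<open>c p\<close> the vertical exponent, equal to i p for propagating and to - p for evanescent
  waves.\<close>

definition phi :: "real \<Rightarrow> (real^3 \<Rightarrow> complex) \<Rightarrow> (real \<Rightarrow> real) \<Rightarrow> (real \<Rightarrow> complex) \<Rightarrow> real \<Rightarrow> real \<Rightarrow> complex" where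
  "phi s0 f k c p \<theta> = (LINT z|lborel. exp (c p * of_real (z \<bullet> e - s0)
     - \<i> * of_real (k p * (cos \<theta> * (z \<bullet> a) + sin \<theta> * (z \<bullet> b)))) * f z)"

lemma continuous_phi:
  assumes f: "bdd_density K f" and K: "bounded K" and k: "continuous_on UNIV k" and c: "continuous_on UNIV c"
  shows "continuous_on UNIV (\<lambda>(p, \<theta>). phi s0 f k c p \<theta>)"
proof -
  have k': "continuous_on A (\<lambda>x. k (g x))" if "continuous_on A g" for A :: "'x::topological_space set" and g
    using continuous_on_compose2[OF k that] by simp
  have c': "continuous_on A (\<lambda>x. c (g x))" if "continuous_on A g" for A :: "'x::topological_space set" and g
    using continuous_on_compose2[OF c that] by simp
  show ?thesis unfolding phi_def case_prod_beta
    by (rule continuous_density_integral[OF f K]) (unfold case_prod_beta, intro continuous_intros k' c')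
qed

lemma norm_phi_le:
  assumes f: "bdd_density K f" and K: "bounded K" and L: "\<And>z. z \<in> K \<Longrightarrow> Re (c p) * (z \<bullet> e - s0) \<le> L"
  shows "norm (phi s0 f k c p \<theta>) \<le> exp L * (LINT z|lborel. norm (f z))"
proof -
  have "norm (phi s0 f k c p \<theta>) \<le> (LINT z|lborel. norm (exp (c p * of_real (z \<bullet> e - s0)
     - \<i> * of_real (k p * (cos \<theta> * (z \<bullet> a) + sin \<theta> * (z \<bullet> b)))) * f z))"
    unfolding phi_def by (rule integral_norm_bound)
  also have "\<dots> \<le> (LINT z|lborel. exp L * norm (f z))"
  proof (rule integral_mono')
    show "integrable lborel (\<lambda>z. exp L * norm (f z))" using integrable_bdd_density[OF f K] by simp
    fix z
    show "norm (exp (c p * of_real (z \<bullet> e - s0) - \<i> * of_real (k p * (cos \<theta> * (z \<bullet> a) + sin \<theta> * (z \<bullet> b)))) * f z) \<le> exp L * norm (f z)"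
    proof (cases "z \<in> K")
      case True
      have "norm (exp (c p * of_real (z \<bullet> e - s0) - \<i> * of_real (k p * (cos \<theta> * (z \<bullet> a) + sin \<theta> * (z \<bullet> b))))) = exp (Re (c p) * (z \<bullet> e - s0))"
        by (simp add: norm_exp_eq_Re)
      also have "\<dots> \<le> exp L" using L[OF True] by simp
      finally show ?thesis unfolding norm_mult by (rule mult_right_mono) simp
    qed (simp add: bdd_density_zero[OF f])
  qed simp
  finally show ?thesis by simp
qed

text \<open>Once the Bessel function is unrolled into horizontal plane waves, the point of the plane
  enters only through a phase that does not depend on z, and the integral over z becomes
  \<open>phi\<close>.\<close>

lemma plane_expansion:
  fixes x1 x2 s0 u :: real
  assumes f: "bdd_density K f" and K: "bounded K" and k: "continuous_on UNIV k" and c: "continuous_on UNIV c"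
    and k0: "\<And>p. p \<in> {0..u} \<Longrightarrow> k p \<ge> 0"
  defines "x \<equiv> x1 *\<^sub>R a + x2 *\<^sub>R b + s0 *\<^sub>R e"
  shows "(LINT z|lborel. integral {0..u} (\<lambda>p. of_real (J0 (rho (x - z) * k p)) * exp (c p * of_real (z \<bullet> e - s0))) * f z) * (2 * of_real pi)
    = integral {0..u} (\<lambda>p. integral {0..2*pi} (\<lambda>\<theta>. exp (\<i> * of_real (k p * (x1 * cos \<theta> + x2 * sin \<theta>))) * phi s0 f k c p \<theta>))"
proof -
  have k': "continuous_on A (\<lambda>x. k (g x))" if "continuous_on A g" for A :: "'x::topological_space set" and g
    using continuous_on_compose2[OF k that] by simp
  have c': "continuous_on A (\<lambda>x. c (g x))" if "continuous_on A g" for A :: "'x::topological_space set" and g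
    using continuous_on_compose2[OF c that] by simp
  have "(LINT z|lborel. integral {0..u} (\<lambda>p. of_real (J0 (rho (x - z) * k p)) * exp (c p * of_real (z \<bullet> e - s0))) * f z)
    = integral {0..u} (\<lambda>p. LINT z|lborel. of_real (J0 (rho (x - z) * k p)) * exp (c p * of_real (z \<bullet> e - s0)) * f z)"
    by (rule integral_density_swap[OF f K]) (unfold case_prod_beta, intro continuous_intros k' c')
  hence "(LINT z|lborel. integral {0..u} (\<lambda>p. of_real (J0 (rho (x - z) * k p)) * exp (c p * of_real (z \<bullet> e - s0))) * f z) * (2 * of_real pi)
    = integral {0..u} (\<lambda>p. (LINT z|lborel. of_real (J0 (rho (x - z) * k p)) * exp (c p * of_real (z \<bullet> e - s0)) * f z) * (2 * of_real pi))"
    by simp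
  also have "\<dots> = integral {0..u} (\<lambda>p. integral {0..2*pi} (\<lambda>\<theta>. exp (\<i> * of_real (k p * (x1 * cos \<theta> + x2 * sin \<theta>))) * phi s0 f k c p \<theta>))"
  proof (rule Henstock_Kurzweil_Integration.integral_cong)
    fix p assume p: "p \<in> {0..u}"
    let ?E = "\<lambda>\<theta> z. exp (\<i> * of_real ((k p * (x1 - z \<bullet> a)) * cos \<theta> + (k p * (x2 - z \<bullet> b)) * sin \<theta>))"
    have J: "of_real (J0 (rho (x - z) * k p)) * (2 * of_real pi) = integral {0..2*pi} (\<lambda>\<theta>. ?E \<theta> z)" for z
    proof -
      have "rho (x - z) = sqrt ((x1 - z \<bullet> a)\<^sup>2 + (x2 - z \<bullet> b)\<^sup>2)"
        by (simp add: rho_def x_def inner_diff_left inner_add_left)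
      moreover have "(k p * (x1 - z \<bullet> a))\<^sup>2 + (k p * (x2 - z \<bullet> b))\<^sup>2 = ((x1 - z \<bullet> a)\<^sup>2 + (x2 - z \<bullet> b)\<^sup>2) * (k p)\<^sup>2"
        by (simp only: power_mult_distrib distrib_left mult.commute)
      ultimately have "sqrt ((k p * (x1 - z \<bullet> a))\<^sup>2 + (k p * (x2 - z \<bullet> b))\<^sup>2) = rho (x - z) * k p"
        using k0[OF p] by (simp add: real_sqrt_mult)
      thus ?thesis using integral_plane_wave[of "k p * (x1 - z \<bullet> a)" "k p * (x2 - z \<bullet> b)"] by (simp add: mult.commute)
    qed
    have "(LINT z|lborel. of_real (J0 (rho (x - z) * k p)) * exp (c p * of_real (z \<bullet> e - s0)) * f z) * (2 * of_real pi)
      = (LINT z|lborel. of_real (J0 (rho (x - z) * k p)) * exp (c p * of_real (z \<bullet> e - s0)) * f z * (2 * of_real pi))"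
      by simp
    also have "\<dots> = (LINT z|lborel. (of_real (J0 (rho (x - z) * k p)) * (2 * of_real pi)) * exp (c p * of_real (z \<bullet> e - s0)) * f z)"
      by (simp only: mult_ac)
    also have "\<dots> = (LINT z|lborel. integral {0..2*pi} (\<lambda>\<theta>. ?E \<theta> z * exp (c p * of_real (z \<bullet> e - s0))) * f z)"
      unfolding J by simp
    also have "\<dots> = integral {0..2*pi} (\<lambda>\<theta>. LINT z|lborel. ?E \<theta> z * exp (c p * of_real (z \<bullet> e - s0)) * f z)"
      by (rule integral_density_swap[OF f K]) (unfold case_prod_beta, intro continuous_intros)
    also have "(\<lambda>\<theta>. LINT z|lborel. ?E \<theta> z * exp (c p * of_real (z \<bullet> e - s0)) * f z)
      = (\<lambda>\<theta>. exp (\<i> * of_real (k p * (x1 * cos \<theta> + x2 * sin \<theta>))) * phi s0 f k c p \<theta>)"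
    proof
      fix \<theta>
      have "?E \<theta> z * exp (c p * of_real (z \<bullet> e - s0)) = exp (\<i> * of_real (k p * (x1 * cos \<theta> + x2 * sin \<theta>)))
        * exp (c p * of_real (z \<bullet> e - s0) - \<i> * of_real (k p * (cos \<theta> * (z \<bullet> a) + sin \<theta> * (z \<bullet> b))))" for z
        by (simp add: exp_add[symmetric] algebra_simps)
      thus "(LINT z|lborel. ?E \<theta> z * exp (c p * of_real (z \<bullet> e - s0)) * f z)
        = exp (\<i> * of_real (k p * (x1 * cos \<theta> + x2 * sin \<theta>))) * phi s0 f k c p \<theta>"
        unfolding phi_def by (simp only: mult.assoc integral_mult_right_zero)
    qed
    finally show "(LINT z|lborel. of_real (J0 (rho (x - z) * k p)) * exp (c p * of_real (z \<bullet> e - s0)) * f z) * (2 * of_real pi)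
      = integral {0..2*pi} (\<lambda>\<theta>. exp (\<i> * of_real (k p * (x1 * cos \<theta> + x2 * sin \<theta>))) * phi s0 f k c p \<theta>)" .
  qed
  finally show ?thesis .
qed

text \<open>Two one-dimensional Gaussian averages, first in \<open>x2\<close> and then in
  \<open>x1\<close> modulated by exp(i k0 x1), weigh each wave by the squared distance of its
  horizontal wave vector from (- k0, 0). The dilation by l sharpens this selection as l
  grows.\<close>

lemma gauss_plane:
  fixes u l s0 k0 :: real and k f c
  assumes f: "bdd_density K f" and K: "bounded K" and k: "continuous_on UNIV k" and c: "continuous_on UNIV c"
  defines "N \<equiv> \<lambda>x1 x2. integral {0..u} (\<lambda>p. integral {0..2*pi} (\<lambda>\<theta>. exp (\<i> * of_real (k p * (x1 * cos \<theta> + x2 * sin \<theta>))) * phi s0 f k c p \<theta>))"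
  defines "A \<equiv> \<lambda>x1. LINT y|lborel. N x1 (l * y) * of_real (std_normal_density y)"
  shows "integrable lborel (\<lambda>y. N x1 (l * y) * of_real (std_normal_density y))"
    and "integrable lborel (\<lambda>y. A (l * y) * exp (\<i> * of_real (l * k0 * y)) * of_real (std_normal_density y))"
    and "(LINT y|lborel. A (l * y) * exp (\<i> * of_real (l * k0 * y)) * of_real (std_normal_density y))
      = integral {0..u} (\<lambda>p. integral {0..2*pi} (\<lambda>\<theta>. of_real (exp (- (l\<^sup>2 / 2 * ((k p * cos \<theta> + k0)\<^sup>2 + (k p * sin \<theta>)\<^sup>2)))) * phi s0 f k c p \<theta>))"
proof -
  have k': "continuous_on S (\<lambda>x. k (g x))" if "continuous_on S g" for S :: "'x::topological_space set" and g
    using continuous_on_compose2[OF k that] by simp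
  have ph: "continuous_on S (\<lambda>x. phi s0 f k c (g x) (h x))" if "continuous_on S g" "continuous_on S h"
    for S :: "'x::topological_space set" and g h
    using continuous_on_compose2[OF continuous_phi[OF f K k c] continuous_on_Pair[OF that]] by simp
  let ?s = "\<lambda>p \<theta>. l * (k p * sin \<theta>)"
  let ?P = "\<lambda>x1 p \<theta>. exp (\<i> * of_real (k p * (x1 * cos \<theta>))) * phi s0 f k c p \<theta>"
  have sc: "continuous_on UNIV (\<lambda>(p, \<theta>). ?s p \<theta>)" unfolding case_prod_beta by (intro continuous_intros k')
  have Pc: "continuous_on UNIV (\<lambda>(p, \<theta>). ?P x1 p \<theta>)" for x1 unfolding case_prod_beta by (intro continuous_intros k' ph)
  have Ne: "N x1 (l * y) = integral {0..u} (\<lambda>p. integral {0..2*pi} (\<lambda>\<theta>. exp (\<i> * of_real (?s p \<theta> * y)) * ?P x1 p \<theta>))" for x1 y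
  proof -
    have e: "exp (\<i> * of_real (k p * (x1 * cos \<theta> + l * y * sin \<theta>))) * phi s0 f k c p \<theta> = exp (\<i> * of_real (?s p \<theta> * y)) * ?P x1 p \<theta>" for p \<theta>
      by (simp add: exp_add[symmetric] mult.assoc[symmetric]) (simp add: algebra_simps)
    show ?thesis unfolding N_def e ..
  qed
  show "integrable lborel (\<lambda>y. N x1 (l * y) * of_real (std_normal_density y))"
    unfolding Ne by (rule gauss_average(1)[OF sc Pc])
  have A: "A x1 = integral {0..u} (\<lambda>p. integral {0..2*pi} (\<lambda>\<theta>. of_real (exp (- ((?s p \<theta>)\<^sup>2) / 2)) * ?P x1 p \<theta>))" for x1
    unfolding A_def Ne by (rule gauss_average(2)[OF sc Pc])
  let ?s' = "\<lambda>p \<theta>. l * (k p * cos \<theta> + k0)"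
  let ?P' = "\<lambda>p \<theta>. of_real (exp (- ((?s p \<theta>)\<^sup>2) / 2)) * phi s0 f k c p \<theta>"
  have sc': "continuous_on UNIV (\<lambda>(p, \<theta>). ?s' p \<theta>)" unfolding case_prod_beta by (intro continuous_intros k')
  have Pc': "continuous_on UNIV (\<lambda>(p, \<theta>). ?P' p \<theta>)" unfolding case_prod_beta by (intro continuous_intros k' ph) auto
  have Ae: "A (l * y) * exp (\<i> * of_real (l * k0 * y))
     = integral {0..u} (\<lambda>p. integral {0..2*pi} (\<lambda>\<theta>. exp (\<i> * of_real (?s' p \<theta> * y)) * ?P' p \<theta>))" for y
  proof -
    have e: "of_real (exp (- ((?s p \<theta>)\<^sup>2) / 2)) * ?P (l * y) p \<theta> * exp (\<i> * of_real (l * k0 * y)) = exp (\<i> * of_real (?s' p \<theta> * y)) * ?P' p \<theta>" for p \<theta>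
    proof -
      have "of_real (exp (- ((?s p \<theta>)\<^sup>2) / 2)) * ?P (l * y) p \<theta> * exp (\<i> * of_real (l * k0 * y))
        = (exp (\<i> * of_real (k p * (l * y * cos \<theta>))) * exp (\<i> * of_real (l * k0 * y))) * ?P' p \<theta>"
        by (simp only: mult_ac)
      also have "exp (\<i> * of_real (k p * (l * y * cos \<theta>))) * exp (\<i> * of_real (l * k0 * y)) = exp (\<i> * of_real (?s' p \<theta> * y))"
        by (simp add: exp_add[symmetric]) (simp add: algebra_simps)
      finally show ?thesis .
    qed
    show ?thesis unfolding A e[symmetric] by simp
  qed
  show "integrable lborel (\<lambda>y. A (l * y) * exp (\<i> * of_real (l * k0 * y)) * of_real (std_normal_density y))"
    unfolding Ae by (rule gauss_average(1)[OF sc' Pc'])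
  have "(LINT y|lborel. A (l * y) * exp (\<i> * of_real (l * k0 * y)) * of_real (std_normal_density y))
      = integral {0..u} (\<lambda>p. integral {0..2*pi} (\<lambda>\<theta>. of_real (exp (- ((?s' p \<theta>)\<^sup>2) / 2)) * ?P' p \<theta>))"
    unfolding Ae by (rule gauss_average(2)[OF sc' Pc'])
  also have "(\<lambda>p. integral {0..2*pi} (\<lambda>\<theta>. of_real (exp (- ((?s' p \<theta>)\<^sup>2) / 2)) * ?P' p \<theta>))
     = (\<lambda>p. integral {0..2*pi} (\<lambda>\<theta>. of_real (exp (- (l\<^sup>2 / 2 * ((k p * cos \<theta> + k0)\<^sup>2 + (k p * sin \<theta>)\<^sup>2)))) * phi s0 f k c p \<theta>))"
  proof -
    have "exp (- ((?s' p \<theta>)\<^sup>2) / 2) * exp (- ((?s p \<theta>)\<^sup>2) / 2) = exp (- (l\<^sup>2 / 2 * ((k p * cos \<theta> + k0)\<^sup>2 + (k p * sin \<theta>)\<^sup>2)))" for p \<theta>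
      by (simp only: exp_add[symmetric] power_mult_distrib[of l]) (simp add: add_divide_distrib distrib_left)
    hence e: "of_real (exp (- ((?s' p \<theta>)\<^sup>2) / 2)) * ?P' p \<theta> = of_real (exp (- (l\<^sup>2 / 2 * ((k p * cos \<theta> + k0)\<^sup>2 + (k p * sin \<theta>)\<^sup>2)))) * phi s0 f k c p \<theta>" for p \<theta>
      by (simp only: mult.assoc[symmetric] of_real_mult[symmetric])
    show ?thesis unfolding e ..
  qed
  finally show "(LINT y|lborel. A (l * y) * exp (\<i> * of_real (l * k0 * y)) * of_real (std_normal_density y))
      = integral {0..u} (\<lambda>p. integral {0..2*pi} (\<lambda>\<theta>. of_real (exp (- (l\<^sup>2 / 2 * ((k p * cos \<theta> + k0)\<^sup>2 + (k p * sin \<theta>)\<^sup>2)))) * phi s0 f k c p \<theta>))" .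
qed

text \<open>On the plane the propagating and the evanescent parts cancel up to Sommerfeld's error. A
  Gaussian test concentrated at a horizontal wave vector of length k0 < \<kappa> damps all
  evanescent waves, whose horizontal length is at least \<kappa>, by exp(- t (\<kappa> - k0)^2). The
  propagating part alone is thus exponentially small, and \<open>localization\<close> makes its
  amplitude vanish.\<close>

lemma half_space_propagating_zero:
  assumes f: "bdd_density K f" and K: "compact K" and \<kappa>: "\<kappa> > 0"
    and half: "\<And>z. z \<in> K \<Longrightarrow> z \<bullet> e > s0"
    and zero: "\<And>x. x \<bullet> e = s0 \<Longrightarrow> potential \<kappa> f x = 0"
    and p0: "0 < p0" "p0 < \<kappa>"
  shows "(LINT z|lborel. pw (kp \<kappa> p0 *\<^sub>R a + p0 *\<^sub>R e) 0 z * f z) = 0"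
proof -
  have bK: "bounded K" by (rule compact_imp_bounded[OF K])
  define cf where "cf = (LINT z|lborel. norm (f z))"
  have cf: "cf \<ge> 0" unfolding cf_def by (intro Bochner_Integration.integral_nonneg) simp
  obtain \<epsilon> where \<epsilon>: "\<epsilon> > 0" "\<And>z. z \<in> K \<Longrightarrow> z \<bullet> e - s0 \<ge> \<epsilon>"
  proof (cases "K = {}")
    case False
    have "continuous_on K (\<lambda>z. z \<bullet> e - s0)" by (intro continuous_intros)
    then obtain z0 where "z0 \<in> K" "\<And>z. z \<in> K \<Longrightarrow> z0 \<bullet> e - s0 \<le> z \<bullet> e - s0"
      using continuous_attains_inf[OF K False] by blast
    thus thesis using that[of "z0 \<bullet> e - s0"] half by auto
  qed (use that[of 1] in auto)
  define k0 where "k0 = kp \<kappa> p0"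
  have k0: "0 < k0" "k0 < \<kappa>"
  proof -
    have "p0\<^sup>2 < \<kappa>\<^sup>2" "0 < p0\<^sup>2" using p0 by (auto intro!: power_strict_mono)
    thus "0 < k0" "k0 < \<kappa>" using \<kappa> by (auto simp: k0_def kp_def intro: real_less_lsqrt)
  qed
  \<comment> \<open>Sommerfeld's error at the least height \<epsilon> of \<open>K\<close> above the
    plane, hence a bound for all points of the plane at once.\<close>
  define \<eta> where "\<eta> T = exp (- T * \<epsilon>) / \<epsilon> + 2 * Qm \<kappa> T * exp (- T * \<epsilon>)" for T
  have \<eta>0: "(\<eta> \<longlongrightarrow> 0) at_top"
    unfolding \<eta>_def[abs_def] Qm_def using \<epsilon>(1) by real_asymp
  define cp where "cp p = \<i> * complex_of_real p" for p
  define ce where "ce m = - complex_of_real m" for m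
  have cpc: "continuous_on UNIV cp" and cec: "continuous_on UNIV ce"
    unfolding cp_def ce_def by (intro continuous_intros)+
  have kpc: "continuous_on UNIV (kp \<kappa>)" and Qc: "continuous_on UNIV (Qm \<kappa>)" by (intro continuous_intros)+
  define NP where "NP x1 x2 = integral {0..\<kappa>} (\<lambda>p. integral {0..2*pi} (\<lambda>\<theta>. exp (\<i> * of_real (kp \<kappa> p * (x1 * cos \<theta> + x2 * sin \<theta>))) * phi s0 f (kp \<kappa>) cp p \<theta>))" for x1 x2
  define NE where "NE T x1 x2 = integral {0..T} (\<lambda>p. integral {0..2*pi} (\<lambda>\<theta>. exp (\<i> * of_real (Qm \<kappa> p * (x1 * cos \<theta> + x2 * sin \<theta>))) * phi s0 f (Qm \<kappa>) ce p \<theta>))" for T x1 x2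
  have Nbound: "norm (\<i> * NP x1 x2 + NE T x1 x2) \<le> 2 * pi * (\<eta> T * cf)" if T: "T \<ge> 0" for T x1 x2
  proof -
    define x where "x = x1 *\<^sub>R a + x2 *\<^sub>R b + s0 *\<^sub>R e"
    have xe: "x \<bullet> e = s0" by (simp add: x_def inner_add_left)
    let ?h = "\<lambda>z. z \<bullet> e - s0"
    let ?pr = "\<lambda>z. propagating \<kappa> (rho (x - z)) (?h z)"
    let ?ev = "\<lambda>z. complex_of_real (evanescent \<kappa> (rho (x - z)) (?h z) 0 T)"
    let ?S = "\<lambda>z. exp (\<i> * of_real (\<kappa> * norm (x - z))) / of_real (norm (x - z))"
    have P: "(LINT z|lborel. ?pr z * f z) * (2 * of_real pi) = NP x1 x2"
    proof -
      have eq: "?pr z = integral {0..\<kappa>} (\<lambda>p. of_real (J0 (rho (x - z) * kp \<kappa> p)) * exp (cp p * of_real (?h z)))" for z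
        by (simp add: propagating_def cp_def mult.assoc)
      show ?thesis unfolding eq unfolding NP_def x_def
        by (rule plane_expansion[OF f bK kpc cpc]) (auto intro: kp_nonneg)
    qed
    have E: "(LINT z|lborel. ?ev z * f z) * (2 * of_real pi) = NE T x1 x2"
    proof -
      have eq: "?ev z = integral {0..T} (\<lambda>p. of_real (J0 (rho (x - z) * Qm \<kappa> p)) * exp (ce p * of_real (?h z)))" for z
        unfolding evanescent_def
        by (subst integral_complex_of_real[symmetric])
          (auto intro!: integrable_continuous_interval continuous_intros simp: ce_def exp_of_real[symmetric] simp del: exp_of_real)
      show ?thesis unfolding eq unfolding NE_def x_def
        by (rule plane_expansion[OF f bK Qc cec]) (rule Qm_nonneg)
    qed
    have int: "integrable lborel (\<lambda>z. g z * f z)" if g: "continuous_on UNIV g" for g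
    proof -
      have "integrable lborel (\<lambda>z. f z * g z)"
        by (rule integrable_bdd_density[OF bdd_density_mult_cont[OF f bK g] bK])
      thus ?thesis by (simp add: mult.commute)
    qed
    have cP: "continuous_on UNIV ?pr"
      unfolding propagating_def cbox_interval[symmetric]
      by (rule integral_continuous_on_param) (unfold case_prod_beta, intro continuous_intros)
    have cE: "continuous_on UNIV ?ev"
      unfolding evanescent_def cbox_interval[symmetric]
      by (intro continuous_on_of_real integral_continuous_on_param) (unfold case_prod_beta, intro continuous_intros)
    have SG: "?S z * f z = - of_real (4 * pi) * (G_plus \<kappa> (x - z) * f z)" for z by (simp add: G_plus_def)
    have iS: "integrable lborel (\<lambda>z. ?S z * f z)" unfolding SG
      by (intro integrable_mult_right integrable_potential[OF f bK])
    have S0: "(LINT z|lborel. ?S z * f z) = 0" unfolding SG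
      using zero[OF xe] by (simp add: potential_def)
    have "\<i> * NP x1 x2 + NE T x1 x2 = 2 * of_real pi * (LINT z|lborel. (\<i> * ?pr z + ?ev z - ?S z) * f z)"
    proof -
      have "(LINT z|lborel. (\<i> * ?pr z + ?ev z - ?S z) * f z) = (LINT z|lborel. \<i> * (?pr z * f z) + ?ev z * f z - ?S z * f z)"
        by (simp add: algebra_simps)
      also have "\<dots> = \<i> * (LINT z|lborel. ?pr z * f z) + (LINT z|lborel. ?ev z * f z) - (LINT z|lborel. ?S z * f z)"
        using int[OF cP] int[OF cE] iS by (simp only: Bochner_Integration.integral_diff Bochner_Integration.integral_add
            Bochner_Integration.integrable_add integrable_mult_right integral_mult_right_zero)
      finally show ?thesis unfolding S0 P[symmetric] E[symmetric] by (simp add: algebra_simps)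
    qed
    moreover have "norm (LINT z|lborel. (\<i> * ?pr z + ?ev z - ?S z) * f z) \<le> \<eta> T * cf"
    proof -
      have "norm (LINT z|lborel. (\<i> * ?pr z + ?ev z - ?S z) * f z) \<le> (LINT z|lborel. norm ((\<i> * ?pr z + ?ev z - ?S z) * f z))"
        by (rule integral_norm_bound)
      also have "\<dots> \<le> (LINT z|lborel. \<eta> T * norm (f z))"
      proof (rule integral_mono')
        show "integrable lborel (\<lambda>z. \<eta> T * norm (f z))" using integrable_bdd_density[OF f bK] by simp
        fix z
        have \<eta>p: "\<eta> T \<ge> 0" using \<epsilon> Qm_nonneg[of \<kappa> T] by (simp add: \<eta>_def)
        show "norm ((\<i> * ?pr z + ?ev z - ?S z) * f z) \<le> \<eta> T * norm (f z)"
        proof (cases "z \<in> K")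
          case True
          have h: "?h z \<ge> \<epsilon>" "?h z > 0" using \<epsilon>(2)[OF True] \<epsilon>(1) by auto
          have nr: "norm (x - z) = sqrt ((?h z)\<^sup>2 + (rho (x - z))\<^sup>2)"
            unfolding norm_rho[of "x - z"] by (simp add: inner_diff_left xe power2_commute)
          have "norm (\<i> * ?pr z + ?ev z - ?S z) \<le> exp (- T * ?h z) / ?h z + 2 * Qm \<kappa> T * exp (- T * ?h z)"
            unfolding nr by (rule sommerfeld[OF \<kappa> h(2) _ T]) (simp add: rho_def)
          also have "\<dots> \<le> \<eta> T"
          proof -
            have "exp (- T * ?h z) \<le> exp (- T * \<epsilon>)" using h(1) T by (simp add: mult_left_mono)
            thus ?thesis unfolding \<eta>_def using h \<epsilon>(1) Qm_nonneg[of \<kappa> T]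
              by (intro add_mono frac_le mult_left_mono) auto
          qed
          finally show ?thesis unfolding norm_mult by (rule mult_right_mono) simp
        qed (simp add: bdd_density_zero[OF f])
        show "0 \<le> \<eta> T * norm (f z)" using \<eta>p by simp
      qed
      finally show ?thesis by (simp add: cf_def)
    qed
    ultimately show ?thesis by (simp add: norm_mult mult_left_mono)
  qed
  define D where "D k \<theta> = (k * cos \<theta> + k0)\<^sup>2 + (k * sin \<theta>)\<^sup>2" for k \<theta> :: real
  define IP where "IP t = integral {0..\<kappa>} (\<lambda>p. integral {0..2*pi} (\<lambda>\<theta>. of_real (exp (- (t * D (kp \<kappa> p) \<theta>))) * phi s0 f (kp \<kappa>) cp p \<theta>))" for t
  define IE where "IE t T = integral {0..T} (\<lambda>p. integral {0..2*pi} (\<lambda>\<theta>. of_real (exp (- (t * D (Qm \<kappa> p) \<theta>))) * phi s0 f (Qm \<kappa>) ce p \<theta>))" for t T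
  have Gauss: "norm (\<i> * IP t + IE t T) \<le> 2 * pi * (\<eta> T * cf)" if t: "t > 0" and T: "T \<ge> 0" for t T
  proof -
    \<comment> \<open>This dilation turns the Gaussian weight into exp(- t D).\<close>
    define l where "l = sqrt (2 * t)"
    have l2: "l\<^sup>2 / 2 = t" using t by (simp add: l_def)
    let ?w = "\<lambda>y. complex_of_real (std_normal_density y)"
    let ?E = "\<lambda>y. exp (\<i> * of_real (l * k0 * y))"
    define AP where "AP x1 = (LINT y|lborel. NP x1 (l * y) * ?w y)" for x1
    define BE where "BE x1 = (LINT y|lborel. NE T x1 (l * y) * ?w y)" for x1
    note gP1 = gauss_plane(1)[OF f bK kpc cpc, where u = \<kappa> and ?s0.0 = s0 and l = l, folded NP_def, folded AP_def, unfolded l2, folded D_def, folded IP_def]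
    note gP2 = gauss_plane(2)[OF f bK kpc cpc, where u = \<kappa> and ?s0.0 = s0 and l = l and ?k0.0 = k0, folded NP_def, folded AP_def, unfolded l2, folded D_def, folded IP_def]
    note gP3 = gauss_plane(3)[OF f bK kpc cpc, where u = \<kappa> and ?s0.0 = s0 and l = l and ?k0.0 = k0, folded NP_def, folded AP_def, unfolded l2, folded D_def, folded IP_def]
    note gE1 = gauss_plane(1)[OF f bK Qc cec, where u = T and ?s0.0 = s0 and l = l, folded NE_def, folded BE_def, unfolded l2, folded D_def, folded IE_def]
    note gE2 = gauss_plane(2)[OF f bK Qc cec, where u = T and ?s0.0 = s0 and l = l and ?k0.0 = k0, folded NE_def, folded BE_def, unfolded l2, folded D_def, folded IE_def]
    note gE3 = gauss_plane(3)[OF f bK Qc cec, where u = T and ?s0.0 = s0 and l = l and ?k0.0 = k0, folded NE_def, folded BE_def, unfolded l2, folded D_def, folded IE_def]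
    have "\<i> * AP x1 + BE x1 = (LINT y|lborel. (\<i> * NP x1 (l * y) + NE T x1 (l * y)) * ?w y)" for x1
    proof -
      have "(LINT y|lborel. (\<i> * NP x1 (l * y) + NE T x1 (l * y)) * ?w y) = (LINT y|lborel. \<i> * (NP x1 (l * y) * ?w y) + NE T x1 (l * y) * ?w y)"
        by (simp add: algebra_simps)
      also have "\<dots> = \<i> * AP x1 + BE x1" unfolding AP_def BE_def
        using gP1 gE1 by (simp only: Bochner_Integration.integral_add integrable_mult_right integral_mult_right_zero)
      finally show ?thesis ..
    qed
    hence A: "norm (\<i> * AP x1 + BE x1) \<le> 2 * pi * (\<eta> T * cf)" for x1
      using gauss_average_bound[of "\<lambda>y. \<i> * NP x1 (l * y) + NE T x1 (l * y)", OF Nbound[OF T]] by simp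
    have "\<i> * IP t + IE t T = (LINT y|lborel. ((\<i> * AP (l * y) + BE (l * y)) * ?E y) * ?w y)"
    proof -
      have "(LINT y|lborel. ((\<i> * AP (l * y) + BE (l * y)) * ?E y) * ?w y) = (LINT y|lborel. \<i> * (AP (l * y) * ?E y * ?w y) + BE (l * y) * ?E y * ?w y)"
        by (simp only: distrib_right mult.assoc)
      also have "\<dots> = \<i> * IP t + IE t T"
        using gP2 gE2 by (simp only: Bochner_Integration.integral_add integrable_mult_right integral_mult_right_zero gP3 gE3)
      finally show ?thesis ..
    qed
    also have "norm \<dots> \<le> 2 * pi * (\<eta> T * cf)"
    proof (rule gauss_average_bound)
      fix y
      show "norm ((\<i> * AP (l * y) + BE (l * y)) * ?E y) \<le> 2 * pi * (\<eta> T * cf)"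
        using A[of "l * y"] by (simp only: norm_mult norm_exp_i_times mult_1_right)
    qed
    finally show ?thesis .
  qed
  let ?C = "2 * pi * cf / \<epsilon>"
  have IEb: "norm (IE t T) \<le> ?C * exp (- (t * (\<kappa> - k0)\<^sup>2))" if t: "t > 0" and T: "T \<ge> 0" for t T
  proof -
    let ?M = "2 * pi * cf * exp (- (t * (\<kappa> - k0)\<^sup>2))"
    have hi: "((\<lambda>m. ?M * exp (- m * \<epsilon>)) has_integral (?M * (- exp (- T * \<epsilon>) / \<epsilon>) - ?M * (- exp (- 0 * \<epsilon>) / \<epsilon>))) {0..T}"
      by (rule fundamental_theorem_of_calculus[OF T])
        (use \<epsilon> in \<open>auto intro!: derivative_eq_intros simp flip: has_real_derivative_iff_has_vector_derivative\<close>)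
    have Q': "continuous_on S (\<lambda>x. phi s0 f (Qm \<kappa>) ce (g x) (h x))" if "continuous_on S g" "continuous_on S h"
      for S :: "'x::topological_space set" and g h
      using continuous_on_compose2[OF continuous_phi[OF f bK Qc cec] continuous_on_Pair[OF that]] by simp
    have "norm (IE t T) \<le> integral {0..T} (\<lambda>m. ?M * exp (- m * \<epsilon>))"
      unfolding IE_def
    proof (rule integral_norm_bound_integral)
      have "continuous_on UNIV (\<lambda>p. integral (cbox 0 (2*pi)) (\<lambda>\<theta>. of_real (exp (- (t * D (Qm \<kappa> p) \<theta>))) * phi s0 f (Qm \<kappa>) ce p \<theta>))"
        unfolding D_def
        by (rule integral_continuous_on_param) (unfold case_prod_beta, intro continuous_intros Q')
      thus "(\<lambda>p. integral {0..2*pi} (\<lambda>\<theta>. of_real (exp (- (t * D (Qm \<kappa> p) \<theta>))) * phi s0 f (Qm \<kappa>) ce p \<theta>)) integrable_on {0..T}"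
        by (intro integrable_continuous_interval) (auto intro: continuous_on_subset)
      show "(\<lambda>m. ?M * exp (- m * \<epsilon>)) integrable_on {0..T}" using hi by blast
      fix m assume m: "m \<in> {0..T}"
      have Qk: "Qm \<kappa> m \<ge> \<kappa>" unfolding Qm_def by (rule real_le_rsqrt) simp
      have "norm (integral {0..2*pi} (\<lambda>\<theta>. of_real (exp (- (t * D (Qm \<kappa> m) \<theta>))) * phi s0 f (Qm \<kappa>) ce m \<theta>))
        \<le> (exp (- (t * (\<kappa> - k0)\<^sup>2)) * (exp (- m * \<epsilon>) * cf)) * (2*pi - 0)"
      proof (rule integral_bound)
        show "continuous_on {0..2*pi} (\<lambda>\<theta>. of_real (exp (- (t * D (Qm \<kappa> m) \<theta>))) * phi s0 f (Qm \<kappa>) ce m \<theta>)"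
          unfolding D_def by (intro continuous_intros Q')
        fix \<theta>
        \<comment> \<open>The reverse triangle inequality for horizontal vectors of lengths
          \<open>Qm \<kappa> m\<close> and k0.\<close>
        have "(Qm \<kappa> m - k0)\<^sup>2 \<le> D (Qm \<kappa> m) \<theta>"
        proof -
          have s: "(sin \<theta>)\<^sup>2 = 1 - (cos \<theta>)\<^sup>2" by (rule sin_squared_eq)
          have "D (Qm \<kappa> m) \<theta> = (Qm \<kappa> m - k0)\<^sup>2 + 2 * (Qm \<kappa> m * k0) * (1 + cos \<theta>)"
            unfolding D_def power_mult_distrib s by (simp add: power2_eq_square algebra_simps)
          moreover have "0 \<le> 1 + cos \<theta>" using cos_ge_minus_one[of \<theta>] by linarith
          hence "0 \<le> 2 * (Qm \<kappa> m * k0) * (1 + cos \<theta>)" using Qk k0 \<kappa> by simp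
          ultimately show ?thesis by linarith
        qed
        moreover have "(\<kappa> - k0)\<^sup>2 \<le> (Qm \<kappa> m - k0)\<^sup>2" using Qk k0 by (intro power_mono) auto
        ultimately have "t * (\<kappa> - k0)\<^sup>2 \<le> t * D (Qm \<kappa> m) \<theta>" using t by (intro mult_left_mono) auto
        moreover have "norm (phi s0 f (Qm \<kappa>) ce m \<theta>) \<le> exp (- m * \<epsilon>) * cf"
          unfolding cf_def
        proof (rule norm_phi_le[OF f bK])
          fix z assume "z \<in> K"
          thus "Re (ce m) * (z \<bullet> e - s0) \<le> - m * \<epsilon>" using \<epsilon>(2)[of z] m by (simp add: ce_def mult_left_mono)
        qed
        ultimately show "norm (of_real (exp (- (t * D (Qm \<kappa> m) \<theta>))) * phi s0 f (Qm \<kappa>) ce m \<theta>) \<le> exp (- (t * (\<kappa> - k0)\<^sup>2)) * (exp (- m * \<epsilon>) * cf)"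
          unfolding norm_mult by (intro mult_mono) auto
      qed simp
      thus "norm (integral {0..2*pi} (\<lambda>\<theta>. of_real (exp (- (t * D (Qm \<kappa> m) \<theta>))) * phi s0 f (Qm \<kappa>) ce m \<theta>)) \<le> ?M * exp (- m * \<epsilon>)"
        by (simp add: mult_ac)
    qed
    also have "\<dots> = ?M / \<epsilon> - ?M / \<epsilon> * exp (- T * \<epsilon>)" by (subst integral_unique[OF hi]) simp
    also have "\<dots> \<le> ?M / \<epsilon>" using cf \<epsilon> by simp
    finally show ?thesis by (simp add: mult_ac)
  qed
  have IPb: "norm (IP t) \<le> ?C * exp (- (t * (\<kappa> - k0)\<^sup>2))" if t: "t > 0" for t
  proof -
    have "((\<lambda>T. ?C * exp (- (t * (\<kappa> - k0)\<^sup>2)) + 2 * pi * (\<eta> T * cf)) \<longlongrightarrow> ?C * exp (- (t * (\<kappa> - k0)\<^sup>2)) + 2 * pi * (0 * cf)) at_top"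
      by (intro tendsto_intros \<eta>0)
    moreover have "norm (IP t) \<le> ?C * exp (- (t * (\<kappa> - k0)\<^sup>2)) + 2 * pi * (\<eta> T * cf)" if T: "T \<ge> 0" for T
    proof -
      have "norm (\<i> * IP t) \<le> norm (\<i> * IP t + IE t T) + norm (IE t T)"
        using norm_triangle_ineq4[of "\<i> * IP t + IE t T" "IE t T"] by simp
      thus ?thesis using Gauss[OF t T] IEb[OF t T] by (simp add: norm_mult)
    qed
    hence "\<forall>\<^sub>F T in at_top. norm (IP t) \<le> ?C * exp (- (t * (\<kappa> - k0)\<^sup>2)) + 2 * pi * (\<eta> T * cf)"
      by (rule eventually_mono[OF eventually_ge_at_top[of 0]])
    ultimately have "norm (IP t) \<le> ?C * exp (- (t * (\<kappa> - k0)\<^sup>2)) + 2 * pi * (0 * cf)"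
      by (intro tendsto_lowerbound) auto
    thus ?thesis by simp
  qed
  have gc: "continuous_on UNIV (\<lambda>(p, \<theta>). phi s0 f (kp \<kappa>) cp p \<theta>)"
    by (rule continuous_phi[OF f bK kpc cpc])
  have Dc: "continuous_on UNIV (\<lambda>(p, \<theta>). D (kp \<kappa> p) \<theta>)"
    unfolding D_def case_prod_beta by (intro continuous_intros)
  \<comment> \<open>The modulation with + k0 selects the horizontal vector (- k0, 0), that is the
    angle pi, an interior point of the angular range.\<close>
  have "(\<lambda>(p, \<theta>). phi s0 f (kp \<kappa>) cp p \<theta>) (p0, pi) = 0"
  proof (rule localization[OF gc Dc, where l = "(0, 0)" and u = "(\<kappa>, 2 * pi)" and \<rho> = "(\<kappa> - k0)\<^sup>2" and C = ?C])
    show "(\<lambda>(p, \<theta>). D (kp \<kappa> p) \<theta>) (p0, pi) = 0" by (simp add: D_def k0_def)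
    show "(p0, pi) \<in> box (0, 0) (\<kappa>, 2 * pi)" using p0 by (auto simp: mem_box Basis_prod_def)
    show "0 < (\<kappa> - k0)\<^sup>2" using k0 by simp
  next
    fix t :: real assume t: "0 < t"
    have c: "continuous_on (cbox (0, 0) (\<kappa>, 2*pi)) (\<lambda>\<beta>. of_real (exp (- (t * (\<lambda>(p, \<theta>). D (kp \<kappa> p) \<theta>) \<beta>))) * (\<lambda>(p, \<theta>). phi s0 f (kp \<kappa>) cp p \<theta>) \<beta>)"
      by (intro continuous_intros continuous_on_subset[OF gc] continuous_on_subset[OF Dc]) auto
    show "norm (integral (cbox (0, 0) (\<kappa>, 2*pi)) (\<lambda>\<beta>. of_real (exp (- (t * (\<lambda>(p, \<theta>). D (kp \<kappa> p) \<theta>) \<beta>))) * (\<lambda>(p, \<theta>). phi s0 f (kp \<kappa>) cp p \<theta>) \<beta>)) \<le> ?C * exp (- (t * (\<kappa> - k0)\<^sup>2))"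
      using IPb[OF t] unfolding integral_prod_continuous[OF c] IP_def by simp
  next
    fix \<beta> assume \<beta>: "\<beta> \<in> cbox (0, 0) (\<kappa>, 2 * pi)" "\<beta> \<noteq> (p0, pi)"
    obtain p \<theta> where pt: "\<beta> = (p, \<theta>)" by (cases \<beta>)
    have r: "0 \<le> p" "p \<le> \<kappa>" "0 \<le> \<theta>" "\<theta> \<le> 2 * pi" using \<beta>(1) by (auto simp: pt cbox_Pair_eq)
    have "D (kp \<kappa> p) \<theta> \<noteq> 0"
    proof
      assume "D (kp \<kappa> p) \<theta> = 0"
      hence 1: "kp \<kappa> p * cos \<theta> = - k0" "kp \<kappa> p * sin \<theta> = 0"
        by (simp_all add: D_def sum_power2_eq_zero_iff)
      have k: "kp \<kappa> p > 0" using 1(1) k0 kp_nonneg[OF r(1,2)] by (metis less_eq_real_def mult_zero_left neg_0_equal_iff_equal less_irrefl)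
      hence "sin \<theta> = 0" "cos \<theta> < 0" using 1 k0 by (auto simp: mult_less_0_iff dest!: arg_cong[where f = "\<lambda>x. x < 0"])
      hence \<theta>: "\<theta> = pi" using r
      proof -
        have "\<theta> \<noteq> 0" "\<theta> \<noteq> 2 * pi" using \<open>cos \<theta> < 0\<close> by auto
        thus ?thesis using \<open>sin \<theta> = 0\<close> r sin_gt_zero[of \<theta>] sin_lt_zero[of \<theta>] by (metis less_eq_real_def less_irrefl not_less)
      qed
      hence "kp \<kappa> p = k0" using 1(1) by simp
      hence "\<kappa>\<^sup>2 - p\<^sup>2 = \<kappa>\<^sup>2 - p0\<^sup>2" unfolding k0_def kp_def using real_sqrt_eq_iff by blast
      hence "p = p0" using r p0 by (simp add: power2_eq_iff_nonneg)
      thus False using \<beta>(2) \<theta> pt by simp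
    qed
    moreover have "D (kp \<kappa> p) \<theta> \<ge> 0" by (simp add: D_def)
    ultimately show "0 < (\<lambda>(p, \<theta>). D (kp \<kappa> p) \<theta>) \<beta>" by (simp add: pt)
  qed
  hence z: "phi s0 f (kp \<kappa>) cp p0 pi = 0" by simp
  have "exp (cp p0 * of_real (z \<bullet> e - s0) - \<i> * of_real (kp \<kappa> p0 * (cos pi * (z \<bullet> a) + sin pi * (z \<bullet> b))))
     = exp (- \<i> * of_real (p0 * s0)) * pw (kp \<kappa> p0 *\<^sub>R a + p0 *\<^sub>R e) 0 z" for z
    by (simp add: cp_def pw_def exp_add[symmetric] inner_add_left inner_commute algebra_simps)
  hence "phi s0 f (kp \<kappa>) cp p0 pi = exp (- \<i> * of_real (p0 * s0)) * (LINT z|lborel. pw (kp \<kappa> p0 *\<^sub>R a + p0 *\<^sub>R e) 0 z * f z)"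
    unfolding phi_def by (simp only: mult.assoc integral_mult_right_zero)
  thus ?thesis using z by simp
qed

end

section \<open>Analytic continuation along the quadric of complex wave vectors\<close>

lemma entire_trig_zero:
  fixes w0 w1 w2 :: "real^3 \<Rightarrow> complex"
  assumes f: "bdd_density K f" and K: "compact K"
    and w: "continuous_on UNIV w0" "continuous_on UNIV w1" "continuous_on UNIV w2"
    and lu: "l < u"
    and zero: "\<And>t::real. l < t \<Longrightarrow> t < u \<Longrightarrow> (LINT z|lborel. exp (w0 z + w1 z * of_real (cos t) + w2 z * of_real (sin t)) * f z) = 0"
  shows "(LINT z|lborel. exp (w0 z + w1 z * cos \<phi> + w2 z * sin \<phi>) * f z) = 0"
proof -
  define W where "W \<phi> = (LINT z|lborel. exp (w0 z + w1 z * cos \<phi> + w2 z * sin \<phi>) * f z)" for \<phi>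
  have w': "continuous_on S (\<lambda>x. w0 (g x))" "continuous_on S (\<lambda>x. w1 (g x))" "continuous_on S (\<lambda>x. w2 (g x))"
    if "continuous_on S g" for S :: "'x::topological_space set" and g
    using continuous_on_compose2[OF w(1) that] continuous_on_compose2[OF w(2) that] continuous_on_compose2[OF w(3) that] by simp_all
  have W: "W holomorphic_on UNIV" unfolding W_def
  proof (rule holomorphic_integral_compact[OF open_UNIV f K])
    show "continuous_on (UNIV \<times> K) (\<lambda>(\<phi>, z). exp (w0 z + w1 z * cos \<phi> + w2 z * sin \<phi>))"
      unfolding case_prod_beta by (intro continuous_intros w')
  qed (intro holomorphic_intros)
  define t0 where "t0 = (l + u) / 2"
  have "W \<phi> = 0"
  proof (rule analytic_continuation[OF W open_UNIV connected_UNIV])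
    show "complex_of_real t0 islimpt complex_of_real ` {l<..<u}"
      unfolding islimpt_approachable
    proof (intro allI impI)
      fix r :: real assume r: "r > 0"
      define s where "s = t0 + min (r / 2) ((u - l) / 4)"
      have s: "l < s" "s < u" "s \<noteq> t0" "\<bar>s - t0\<bar> < r" using lu r by (auto simp: s_def t0_def field_simps min_def)
      hence "complex_of_real s \<in> complex_of_real ` {l<..<u}" by auto
      moreover have "complex_of_real s \<noteq> complex_of_real t0" using s(3) by (simp only: of_real_eq_iff) simp
      moreover have "dist (complex_of_real s) (complex_of_real t0) < r" using s(4) by (simp only: dist_of_real) (simp add: dist_real_def)
      ultimately show "\<exists>x'\<in>complex_of_real ` {l<..<u}. x' \<noteq> complex_of_real t0 \<and> dist x' (complex_of_real t0) < r" by blast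
    qed
    fix v assume "v \<in> complex_of_real ` {l<..<u}"
    then obtain t where t: "l < t" "t < u" "v = of_real t" by auto
    show "W v = 0" unfolding W_def t(3) using zero[OF t(1,2)] by (simp add: cos_of_real sin_of_real)
  qed simp_all
  thus ?thesis by (simp add: W_def)
qed

context frame
begin

text \<open>Turning the frame about \<open>e\<close> puts the horizontal part of A along its first
  axis; the plane and the half-space depend on \<open>e\<close> only.\<close>

lemma half_space_sphere_zero:
  assumes f: "bdd_density K f" and K: "compact K" and \<kappa>: "\<kappa> > 0"
    and half: "\<And>z. z \<in> K \<Longrightarrow> z \<bullet> e > s0"
    and zero: "\<And>x. x \<bullet> e = s0 \<Longrightarrow> potential \<kappa> f x = 0"
    and A: "A \<bullet> A = \<kappa>\<^sup>2" "0 < A \<bullet> e" "A \<bullet> e < \<kappa>"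
  shows "(LINT z|lborel. pw A 0 z * f z) = 0"
proof -
  define k where "k = kp \<kappa> (A \<bullet> e)"
  have sq: "(A \<bullet> a)\<^sup>2 + (A \<bullet> b)\<^sup>2 = \<kappa>\<^sup>2 - (A \<bullet> e)\<^sup>2" using frame_inner[of A A] A(1) by (simp add: power2_eq_square)
  have "(A \<bullet> e)\<^sup>2 < \<kappa>\<^sup>2" using A by (intro power_strict_mono) auto
  hence k: "k > 0" "k\<^sup>2 = (A \<bullet> a)\<^sup>2 + (A \<bullet> b)\<^sup>2" by (auto simp: k_def kp_def sq)
  define a' where "a' = (1 / k) *\<^sub>R ((A \<bullet> a) *\<^sub>R a + (A \<bullet> b) *\<^sub>R b)"
  define b' where "b' = (1 / k) *\<^sub>R (- (A \<bullet> b) *\<^sub>R a + (A \<bullet> a) *\<^sub>R b)"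
  have k': "(A \<bullet> a) * (A \<bullet> a) + (A \<bullet> b) * (A \<bullet> b) = k * k" using k(2) by (simp add: power2_eq_square)
  interpret F: frame a' b' e
    by unfold_locales (use k k' in \<open>simp_all add: a'_def b'_def inner_add_left inner_add_right inner_diff_left inner_diff_right field_simps\<close>)
  have "A = k *\<^sub>R a' + (A \<bullet> e) *\<^sub>R e" using frame_expand[of A] k by (simp add: a'_def)
  thus ?thesis using F.half_space_propagating_zero[OF f K \<kappa> half zero A(2,3)] by (simp add: k_def)
qed

text \<open>A circle of real wave vectors that leaves the horizontal plane contains an arc of
  admissible heights, where \<open>half_space_sphere_zero\<close> applies; the integral is entire in
  the angle and therefore vanishes at every complex angle.\<close>

lemma half_space_circle_zero:
  assumes f: "bdd_density K f" and K: "compact K" and \<kappa>: "\<kappa> > 0"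
    and half: "\<And>z. z \<in> K \<Longrightarrow> z \<bullet> e > s0"
    and zero: "\<And>x. x \<bullet> e = s0 \<Longrightarrow> potential \<kappa> f x = 0"
    and uv: "u \<bullet> u = \<kappa>\<^sup>2" "v \<bullet> v = \<kappa>\<^sup>2" "u \<bullet> v = 0" "u \<bullet> e \<noteq> 0 \<or> v \<bullet> e \<noteq> 0"
  shows "(LINT z|lborel. exp (0 + \<i> * of_real (u \<bullet> z) * cos \<phi> + \<i> * of_real (v \<bullet> z) * sin \<phi>) * f z) = 0"
proof -
  define h where "h t = (u \<bullet> e) * cos t + (v \<bullet> e) * sin t" for t
  define \<mu> where "\<mu> = sqrt ((u \<bullet> e)\<^sup>2 + (v \<bullet> e)\<^sup>2)"
  have \<mu>: "\<mu> > 0" using uv(4) by (auto simp: \<mu>_def sum_power2_gt_zero_iff)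
  have nrm: "(cos t *\<^sub>R u + sin t *\<^sub>R v) \<bullet> (cos t *\<^sub>R u + sin t *\<^sub>R v) = \<kappa>\<^sup>2" for t
  proof -
    have "(cos t *\<^sub>R u + sin t *\<^sub>R v) \<bullet> (cos t *\<^sub>R u + sin t *\<^sub>R v) = (cos t)\<^sup>2 * (u \<bullet> u) + (sin t)\<^sup>2 * (v \<bullet> v)"
      using uv(3) by (simp add: inner_add_left inner_add_right inner_commute power2_eq_square)
    thus ?thesis unfolding uv(1,2) by (simp add: sin_squared_eq algebra_simps)
  qed
  have he: "h t = (cos t *\<^sub>R u + sin t *\<^sub>R v) \<bullet> e" for t by (simp add: h_def inner_add_left)
  have hle: "\<bar>h t\<bar> \<le> \<kappa>" for t
  proof -
    have "norm (cos t *\<^sub>R u + sin t *\<^sub>R v) = \<kappa>" using nrm[of t] \<kappa> by (simp add: norm_eq_sqrt_inner)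
    moreover have "norm e = 1" by (simp add: norm_eq_sqrt_inner)
    ultimately show ?thesis using Cauchy_Schwarz_ineq2[of "cos t *\<^sub>R u + sin t *\<^sub>R v" e] by (simp add: he)
  qed
  have "((u \<bullet> e) / \<mu>)\<^sup>2 + ((v \<bullet> e) / \<mu>)\<^sup>2 = 1"
    using \<mu> by (simp add: power_divide add_divide_distrib[symmetric]) (simp add: \<mu>_def)
  then obtain t0 where "0 \<le> t0" "t0 < 2 * pi" "(u \<bullet> e) / \<mu> = cos t0" "(v \<bullet> e) / \<mu> = sin t0"
    using sincos_total_2pi by metis
  hence t0: "u \<bullet> e = \<mu> * cos t0" "v \<bullet> e = \<mu> * sin t0" using \<mu> by (simp_all add: field_simps)
  have ht: "h t = \<mu> * cos (t - t0)" for t by (simp add: h_def t0 cos_diff algebra_simps)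
  have "\<mu> \<le> \<kappa>" using hle[of t0] \<mu> by (simp add: ht)
  \<comment> \<open>The height along the circle is \<mu> cos (t - t0); at the angle pi / 3 from the
    top it is \<mu> / 2, strictly between 0 and \<kappa>.\<close>
  define t1 where "t1 = t0 + pi / 3"
  have "h t1 = \<mu> / 2" by (simp add: ht t1_def cos_60)
  hence h1: "0 < h t1" "h t1 < \<kappa>" using \<mu> \<open>\<mu> \<le> \<kappa>\<close> by auto
  have "open {t. 0 < h t \<and> h t < \<kappa>}"
    unfolding h_def by (intro open_Collect_conj open_Collect_less continuous_intros)
  then obtain r where r: "r > 0" "\<And>t. \<bar>t - t1\<bar> < r \<Longrightarrow> 0 < h t \<and> h t < \<kappa>"
    using h1 unfolding open_dist by (auto simp: dist_real_def)
  show ?thesis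
  proof (rule entire_trig_zero[OF f K, of _ _ _ "t1 - r" "t1 + r"])
    fix t :: real assume "t1 - r < t" "t < t1 + r"
    hence "0 < h t" "h t < \<kappa>" using r(2)[of t] by auto
    hence "(LINT z|lborel. pw (cos t *\<^sub>R u + sin t *\<^sub>R v) 0 z * f z) = 0"
      using he[of t] by (intro half_space_sphere_zero[OF f K \<kappa> half zero nrm]) auto
    thus "(LINT z|lborel. exp (0 + \<i> * of_real (u \<bullet> z) * of_real (cos t) + \<i> * of_real (v \<bullet> z) * of_real (sin t)) * f z) = 0"
      by (simp add: pw_def inner_add_left algebra_simps)
  qed (use r in \<open>auto intro!: continuous_intros\<close>)
qed

lemma ex_orthogonal_vector:
  fixes A :: "real^3"
  assumes \<kappa>: "\<kappa> > 0"
  obtains v where "A \<bullet> v = 0" "v \<bullet> v = \<kappa>\<^sup>2"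
proof -
  obtain y where y: "A \<bullet> y = 0" "y \<noteq> 0"
  proof (cases "A \<bullet> a = 0 \<and> A \<bullet> b = 0")
    case True
    have "a \<noteq> 0" using aa by force
    thus thesis using True that[of a] by simp
  next
    case False
    let ?y = "- (A \<bullet> b) *\<^sub>R a + (A \<bullet> a) *\<^sub>R b"
    have "?y \<bullet> a = - (A \<bullet> b)" "?y \<bullet> b = A \<bullet> a" by (simp_all add: inner_add_left inner_diff_left)
    hence "?y \<noteq> 0" using False by (metis inner_zero_left neg_equal_0_iff_equal)
    thus thesis using that[of ?y] by (simp add: inner_add_right inner_diff_right)
  qed
  have "A \<bullet> ((\<kappa> / norm y) *\<^sub>R y) = 0" using y by simp
  moreover have "((\<kappa> / norm y) *\<^sub>R y) \<bullet> ((\<kappa> / norm y) *\<^sub>R y) = \<kappa>\<^sup>2"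
    using y by (simp add: power2_norm_eq_inner[symmetric] power2_eq_square)
  ultimately show thesis by (rule that)
qed

text \<open>At the imaginary angle i y the circle through orthogonal vectors u and v of length
  \<kappa> passes through cosh y u + i sinh y v, and every \<zeta> = A + i B on the quadric with
  nonzero B has this form. Real \<zeta> and pairs of horizontal vectors are treated apart.\<close>

lemma half_space_annihilates:
  assumes f: "bdd_density K f" and K: "compact K" and \<kappa>: "\<kappa> > 0"
    and half: "\<And>z. z \<in> K \<Longrightarrow> z \<bullet> e > s0"
    and zero: "\<And>x. x \<bullet> e = s0 \<Longrightarrow> potential \<kappa> f x = 0"
  shows "annihilates \<kappa> f"
  unfolding annihilates_def
proof (intro allI impI)
  fix A B :: "real^3" assume AB: "A \<bullet> B = 0" "A \<bullet> A - B \<bullet> B = \<kappa>\<^sup>2"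
  note circle = half_space_circle_zero[OF f K \<kappa> half zero]
  have gen: "(LINT z|lborel. pw A B z * f z) = 0"
    if AB: "A \<bullet> B = 0" "A \<bullet> A - B \<bullet> B = \<kappa>\<^sup>2" "B \<noteq> 0" "A \<bullet> e \<noteq> 0 \<or> B \<bullet> e \<noteq> 0" for A B
  proof -
    have nA: "norm A > 0"
    proof -
      have "A \<bullet> A > 0" using AB(2) \<kappa> inner_ge_zero[of B] zero_less_power[OF \<kappa>, of 2] by linarith
      thus ?thesis by (simp add: inner_gt_zero_iff)
    qed
    have nB: "norm B > 0" using AB(3) by simp
    define u v where "u = (\<kappa> / norm A) *\<^sub>R A" and "v = (\<kappa> / norm B) *\<^sub>R B"
    define y where "y = arsinh (norm B / \<kappa>)"
    have sy: "sinh y = norm B / \<kappa>" by (simp add: y_def)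
    have cy: "cosh y = norm A / \<kappa>"
    proof -
      have "(norm A)\<^sup>2 = (norm B)\<^sup>2 + \<kappa>\<^sup>2" using AB(2) by (simp add: power2_norm_eq_inner)
      hence "(norm A / \<kappa>)\<^sup>2 = (cosh y)\<^sup>2" using \<kappa> cosh_square_eq[of y] by (simp add: sy power_divide field_simps)
      thus ?thesis using nA \<kappa> cosh_real_pos[of y] by (metis divide_nonneg_pos less_imp_le power2_eq_iff_nonneg)
    qed
    have "(LINT z|lborel. exp (0 + \<i> * of_real (u \<bullet> z) * cos (\<i> * of_real y) + \<i> * of_real (v \<bullet> z) * sin (\<i> * of_real y)) * f z) = 0"
    proof (rule circle)
      show "u \<bullet> u = \<kappa>\<^sup>2" "v \<bullet> v = \<kappa>\<^sup>2"
        using nA nB by (simp_all add: u_def v_def power2_norm_eq_inner[symmetric] power2_eq_square)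
      show "u \<bullet> v = 0" using AB by (simp add: u_def v_def)
      show "u \<bullet> e \<noteq> 0 \<or> v \<bullet> e \<noteq> 0" using AB nA nB \<kappa> by (auto simp: u_def v_def)
    qed
    moreover have "0 + \<i> * of_real (u \<bullet> z) * cos (\<i> * of_real y) + \<i> * of_real (v \<bullet> z) * sin (\<i> * of_real y)
      = \<i> * of_real (A \<bullet> z) - of_real (B \<bullet> z)" for z
    proof -
      have c: "cos (\<i> * complex_of_real y) = of_real (cosh y)"
        unfolding cosh_conv_cos[symmetric] by (simp add: cosh_def scaleR_conv_of_real exp_of_real[symmetric] del: exp_of_real)
      have s: "sin (\<i> * complex_of_real y) = \<i> * of_real (sinh y)"
      proof -
        have "complex_of_real (sinh y) = sinh (complex_of_real y)"
          by (simp add: sinh_def scaleR_conv_of_real exp_of_real[symmetric] del: exp_of_real)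
        thus ?thesis unfolding sinh_conv_sin by simp
      qed
      show ?thesis unfolding c s sy cy u_def v_def using nA nB \<kappa> by (simp add: field_simps)
    qed
    ultimately show ?thesis unfolding pw_def by simp
  qed
  show "(LINT z|lborel. pw A B z * f z) = 0"
  proof (cases "B = 0")
    case True
    \<comment> \<open>A real wave vector is the point \<phi> = 0 of a circle through it; v is chosen
      so that this circle leaves the horizontal plane.\<close>
    obtain v where v: "A \<bullet> v = 0" "v \<bullet> v = \<kappa>\<^sup>2" "A \<bullet> e \<noteq> 0 \<or> v \<bullet> e \<noteq> 0"
    proof (cases "A \<bullet> e = 0")
      case True
      thus thesis using that[of "\<kappa> *\<^sub>R e"] \<kappa> by (simp add: power2_eq_square)
    next
      case False
      thus thesis using that ex_orthogonal_vector[OF \<kappa>, of A] by metis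
    qed
    have "(LINT z|lborel. exp (0 + \<i> * of_real (A \<bullet> z) * cos 0 + \<i> * of_real (v \<bullet> z) * sin 0) * f z) = 0"
      by (rule circle) (use AB True v in auto)
    thus ?thesis using True by (simp add: pw_def)
  next
    case False
    show ?thesis
    proof (cases "A \<bullet> e \<noteq> 0 \<or> B \<bullet> e \<noteq> 0")
      case True
      thus ?thesis using gen AB False by blast
    next
      case h: False
      \<comment> \<open>A and B are both horizontal. Turning B towards \<open>e\<close> by a small
        angle t > 0 leads back to \<open>gen\<close>, and continuation in t returns to t =
        0.\<close>
      have "(LINT z|lborel. exp (\<i> * of_real (A \<bullet> z) + - of_real (B \<bullet> z) * cos 0 + - of_real (norm B * (e \<bullet> z)) * sin 0) * f z) = 0"
      proof (rule entire_trig_zero[OF f K, of _ _ _ 0 1])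
        fix t :: real assume t: "0 < t" "t < 1"
        let ?B = "cos t *\<^sub>R B + (norm B * sin t) *\<^sub>R e"
        have st: "sin t > 0" using t pi_gt3 by (intro sin_gt_zero) auto
        have Be: "?B \<bullet> e = norm B * sin t" using h by (simp add: inner_add_left)
        have "?B \<bullet> ?B = (cos t)\<^sup>2 * (B \<bullet> B) + (sin t)\<^sup>2 * (norm B)\<^sup>2"
          using h by (simp add: inner_add_left inner_add_right inner_commute power2_eq_square)
        hence BB: "?B \<bullet> ?B = B \<bullet> B" by (simp add: power2_norm_eq_inner sin_squared_eq algebra_simps)
        have "(LINT z|lborel. pw A ?B z * f z) = 0"
        proof (rule gen)
          show "A \<bullet> ?B = 0" using AB h by (simp add: inner_add_right)
          show "A \<bullet> A - ?B \<bullet> ?B = \<kappa>\<^sup>2" unfolding BB by (rule AB(2))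
          show "?B \<noteq> 0" using Be st False by (metis inner_zero_left mult_eq_0_iff norm_eq_zero less_irrefl)
          show "A \<bullet> e \<noteq> 0 \<or> ?B \<bullet> e \<noteq> 0" using Be st False by simp
        qed
        thus "(LINT z|lborel. exp (\<i> * of_real (A \<bullet> z) + - of_real (B \<bullet> z) * of_real (cos t) + - of_real (norm B * (e \<bullet> z)) * of_real (sin t)) * f z) = 0"
          by (simp add: pw_def inner_add_left algebra_simps)
      qed (auto intro!: continuous_intros)
      thus ?thesis by (simp add: pw_def)
    qed
  qed
qed

end

section \<open>Fredholm theory for the potential\<close>

text \<open>A point of Z outside Y is translated by an element of Y at less than twice its distance
  from Y and then normalised; the factor 2 becomes the constant 1/2.\<close>

lemma riesz_almost_orthogonal:
  fixes Y Z :: "'a::real_normed_vector set"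
  assumes Y: "subspace Y" "closed Y" and Z: "subspace Z" "Y \<subseteq> Z" "Y \<noteq> Z"
  obtains z where "z \<in> Z" "norm z = 1" "\<And>y. y \<in> Y \<Longrightarrow> norm (z - y) \<ge> 1/2"
proof -
  obtain z0 where z0: "z0 \<in> Z" "z0 \<notin> Y" using Z by blast
  have ne: "Y \<noteq> {}" using subspace_0[OF Y(1)] by blast
  define d where "d = infdist z0 Y"
  have d: "d > 0" using in_closed_iff_infdist_zero[OF Y(2) ne, of z0] z0 infdist_nonneg[of z0 Y]
    by (auto simp: d_def order.strict_iff_order)
  have "\<exists>y\<in>Y. dist z0 y < 2 * d"
  proof (rule ccontr)
    assume "\<not> (\<exists>y\<in>Y. dist z0 y < 2 * d)"
    hence "2 * d \<le> infdist z0 Y" unfolding infdist_def using ne by (auto intro!: cINF_greatest)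
    thus False using d by (simp add: d_def)
  qed
  then obtain y0 where y0: "y0 \<in> Y" "norm (z0 - y0) < 2 * d" by (auto simp: dist_norm)
  define r where "r = norm (z0 - y0)"
  have r: "r > 0" using z0 y0 by (auto simp: r_def)
  show thesis
  proof (rule that[of "(1 / r) *\<^sub>R (z0 - y0)"])
    show "(1 / r) *\<^sub>R (z0 - y0) \<in> Z"
      using z0 y0 Z by (intro subspace_mul subspace_diff) auto
    show "norm ((1 / r) *\<^sub>R (z0 - y0)) = 1" using r by (simp add: r_def)
    fix y assume y: "y \<in> Y"
    have "y0 + r *\<^sub>R y \<in> Y" using y y0 Y by (intro subspace_add subspace_mul) auto
    hence "d \<le> norm (z0 - (y0 + r *\<^sub>R y))" unfolding d_def dist_norm[symmetric] by (rule infdist_le)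
    also have "z0 - (y0 + r *\<^sub>R y) = r *\<^sub>R ((1 / r) *\<^sub>R (z0 - y0) - y)" using r by (simp add: algebra_simps)
    finally have "d \<le> r * norm ((1 / r) *\<^sub>R (z0 - y0) - y)" using r by simp
    moreover have "r < 2 * d" using y0 by (simp add: r_def)
    ultimately have "r * (1/2) \<le> r * norm ((1 / r) *\<^sub>R (z0 - y0) - y)" by linarith
    thus "1/2 \<le> norm ((1 / r) *\<^sub>R (z0 - y0) - y)" using r by simp
  qed
qed

text \<open>Injectivity and compactness bound S = id - C from below, so the ranges of the powers of
  S are closed. If S were not onto, injectivity would make them strictly decreasing, and Riesz's
  lemma would give unit vectors whose images under C stay 1/2 apart, against compactness.\<close>

theorem riesz_schauder_surjective:
  fixes C :: "'a::real_normed_vector \<Rightarrow> 'a"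
  assumes C: "bounded_linear C"
    and compact: "\<And>x :: nat \<Rightarrow> 'a. bounded (range x) \<Longrightarrow> \<exists>l r. strict_mono r \<and> (\<lambda>n. C (x (r n))) \<longlonglongrightarrow> l"
    and inj: "\<And>x. C x = x \<Longrightarrow> x = 0"
  shows "\<exists>x. x - C x = y"
proof -
  define S where "S x = x - C x" for x
  interpret C: bounded_linear C by (rule C)
  have S: "bounded_linear S" unfolding S_def by (intro bounded_linear_sub bounded_linear_ident C)
  interpret S: bounded_linear S by (rule S)
  have S0: "x = 0" if "S x = 0" for x using inj[of x] that by (simp add: S_def)
  obtain c where c: "c > 0" "\<And>x. c * norm x \<le> norm (S x)"
  proof (rule ccontr)
    assume "\<not> thesis"
    hence *: "\<And>c. c > 0 \<Longrightarrow> \<exists>x. norm (S x) < c * norm x" using that by (meson not_le)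
    have "\<exists>x. norm x = 1 \<and> norm (S x) < inverse (real (Suc n))" for n
    proof -
      obtain x where x: "norm (S x) < inverse (real (Suc n)) * norm x" using *[of "inverse (real (Suc n))"] by auto
      hence nx: "norm x > 0" by (metis mult_zero_right norm_ge_zero not_le norm_le_zero_iff norm_zero)
      have "norm (S ((1 / norm x) *\<^sub>R x)) = norm (S x) / norm x" by (simp add: S.scaleR)
      also have "\<dots> < inverse (real (Suc n))" using x nx by (simp only: pos_divide_less_eq)
      finally show ?thesis using nx by (intro exI[of _ "(1 / norm x) *\<^sub>R x"]) simp
    qed
    then obtain x where x: "\<And>n. norm (x n) = 1" "\<And>n. norm (S (x n)) < inverse (real (Suc n))" by metis
    have "bounded (range x)" using x(1) by (auto simp: bounded_iff)
    then obtain l r where r: "strict_mono r" "(\<lambda>n. C (x (r n))) \<longlonglongrightarrow> l" using compact by blast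
    have "(\<lambda>n. S (x n)) \<longlonglongrightarrow> 0"
      by (rule Lim_null_comparison[OF _ LIMSEQ_inverse_real_of_nat]) (use x(2) in \<open>auto intro!: always_eventually less_imp_le\<close>)
    hence "(\<lambda>n. S (x (r n))) \<longlonglongrightarrow> 0" using LIMSEQ_subseq_LIMSEQ[OF _ r(1)] by (auto simp: comp_def)
    from tendsto_add[OF this r(2)] have lim: "(\<lambda>n. x (r n)) \<longlonglongrightarrow> l" by (simp add: S_def)
    have "(\<lambda>n. norm (x (r n))) \<longlonglongrightarrow> norm l" by (intro tendsto_intros lim)
    hence "norm l = 1" using x(1) by (simp add: LIMSEQ_const_iff)
    moreover have "(\<lambda>n. S (x (r n))) \<longlonglongrightarrow> S l" by (rule S.tendsto[OF lim])
    hence "S l = 0" using \<open>(\<lambda>n. S (x (r n))) \<longlonglongrightarrow> 0\<close> LIMSEQ_unique by blast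
    ultimately show False using S0[of l] by simp
  qed
  have closed_image: "closed (S ` Y)" if Y: "closed Y" for Y
    unfolding closed_sequential_limits
  proof (intro allI impI)
    fix s z assume s: "(\<forall>n. s n \<in> S ` Y) \<and> s \<longlonglongrightarrow> z"
    then obtain x where x: "\<And>n. x n \<in> Y" "\<And>n. s n = S (x n)" unfolding image_iff by metis
    have "bounded (range s)" using s convergent_imp_bounded by blast
    then obtain b where b: "\<And>n. norm (s n) \<le> b" unfolding bounded_iff by auto
    have "norm (x n) \<le> b / c" for n
      using c(2)[of "x n"] b[of n] c(1) by (simp add: x(2) pos_le_divide_eq mult.commute)
    hence "bounded (range x)" by (auto simp: bounded_iff)
    then obtain l r where r: "strict_mono r" "(\<lambda>n. C (x (r n))) \<longlonglongrightarrow> l" using compact by blast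
    have "(\<lambda>n. S (x (r n))) \<longlonglongrightarrow> z" using LIMSEQ_subseq_LIMSEQ[OF conjunct2[OF s] r(1)] by (simp add: comp_def x(2))
    from tendsto_add[OF this r(2)] have lim: "(\<lambda>n. x (r n)) \<longlonglongrightarrow> z + l" by (simp add: S_def)
    have "z + l \<in> Y" using closed_sequentially[OF Y, of "\<lambda>n. x (r n)"] x(1) lim by blast
    moreover have "S (z + l) = z"
      using S.tendsto[OF lim] \<open>(\<lambda>n. S (x (r n))) \<longlonglongrightarrow> z\<close> LIMSEQ_unique by blast
    ultimately show "z \<in> S ` Y" by (metis imageI)
  qed
  define X where "X n = (S ^^ n) ` UNIV" for n
  have XS: "X (Suc n) = S ` X n" for n by (auto simp: X_def image_iff)
  have Xsub: "subspace (X n)" for n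
    by (induction n) (auto simp: X_def[of 0] XS intro: linear_subspace_image S.linear_axioms)
  have Xcl: "closed (X n)" for n
    by (induction n) (auto simp: X_def[of 0] XS intro: closed_image)
  have Xdec: "X (Suc n) \<subseteq> X n" for n
  proof (induction n)
    case 0
    show ?case by (auto simp: X_def)
  next
    case (Suc n)
    thus ?case unfolding XS[of "Suc n"] XS[of n] by (metis XS image_mono)
  qed
  have Xmono: "X m \<subseteq> X n" if "n \<le> m" for m n by (rule lift_Suc_antimono_le[of X, OF Xdec that])
  have injS: "inj S" using S0 by (auto simp: linear_injective_0[OF S.linear_axioms])
  show ?thesis
  proof (rule ccontr)
    assume "\<nexists>x. x - C x = y"
    hence y: "y \<noteq> S x" for x by (auto simp: S_def)
    have neq: "X (Suc n) \<noteq> X n" for n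
    proof
      assume "X (Suc n) = X n"
      hence "(S ^^ n) y \<in> X (Suc n)" by (simp add: X_def)
      then obtain u where "(S ^^ n) y = (S ^^ Suc n) u" by (auto simp: X_def)
      hence "(S ^^ n) y = (S ^^ n) (S u)" by (simp only: funpow_Suc_right comp_def)
      moreover have "inj (S ^^ n)" by (rule inj_fn[OF injS])
      ultimately show False using y[of u] by (auto dest: injD)
    qed
    have "\<exists>x. x \<in> X n \<and> norm x = 1 \<and> (\<forall>w\<in>X (Suc n). norm (x - w) \<ge> 1/2)" for n
      by (rule riesz_almost_orthogonal[OF Xsub Xcl Xsub Xdec neq]) blast
    then obtain x where x: "\<And>n. x n \<in> X n" "\<And>n. norm (x n) = 1" "\<And>n w. w \<in> X (Suc n) \<Longrightarrow> norm (x n - w) \<ge> 1/2"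
      by metis
    \<comment> \<open>C x_n - C x_m equals x_n minus S x_n + x_m - S x_m, and the latter lies in
      \<open>X (Suc n)\<close>.\<close>
    have sep: "norm (C (x n) - C (x m)) \<ge> 1/2" if nm: "n < m" for n m
    proof -
      have "S (x n) \<in> X (Suc n)" using x(1) by (simp add: XS)
      moreover have "x m \<in> X (Suc n)" using x(1)[of m] Xmono[of "Suc n" m] nm by auto
      moreover have "S (x m) \<in> X (Suc n)" using x(1)[of m] Xmono[of "Suc n" "Suc m"] nm by (auto simp: XS)
      ultimately have "S (x n) + x m - S (x m) \<in> X (Suc n)" by (intro subspace_diff subspace_add Xsub)
      from x(3)[OF this] show ?thesis by (simp add: S_def algebra_simps)
    qed
    have "bounded (range x)" using x(2) by (auto simp: bounded_iff)
    then obtain l r where r: "strict_mono r" "(\<lambda>n. C (x (r n))) \<longlonglongrightarrow> l" using compact by blast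
    have "Cauchy (\<lambda>n. C (x (r n)))" using r(2) convergent_Cauchy convergentI by blast
    then obtain N where "\<And>m n. m \<ge> N \<Longrightarrow> n \<ge> N \<Longrightarrow> dist (C (x (r m))) (C (x (r n))) < 1/2"
      unfolding Cauchy_def by (metis half_gt_zero_iff zero_less_one)
    hence "norm (C (x (r N)) - C (x (r (Suc N)))) < 1/2" by (simp add: dist_norm)
    moreover have "r N < r (Suc N)" using r(1) by (simp add: strict_mono_Suc_iff)
    ultimately show False using sep by (meson not_le)
  qed
qed

section \<open>The potential as a compact operator on bounded continuous functions\<close>

lemma potential_add:
  assumes "bdd_density K f" "bdd_density K g" "bounded K"
  shows "potential \<kappa> (\<lambda>z. f z + g z) x = potential \<kappa> f x + potential \<kappa> g x"
  unfolding potential_def distrib_left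
  by (intro Bochner_Integration.integral_add integrable_potential[OF assms(1,3)] integrable_potential[OF assms(2,3)])

lemma potential_diff:
  assumes "bdd_density K f" "bdd_density K g" "bounded K"
  shows "potential \<kappa> (\<lambda>z. f z - g z) x = potential \<kappa> f x - potential \<kappa> g x"
  unfolding potential_def right_diff_distrib
  by (intro Bochner_Integration.integral_diff integrable_potential[OF assms(1,3)] integrable_potential[OF assms(2,3)])

lemma potential_scaleR: "potential \<kappa> (\<lambda>z. r *\<^sub>R f z) x = r *\<^sub>R potential \<kappa> f x"
  unfolding potential_def by simp

lemma potential_cong_AE:
  assumes "bdd_density K f" "bdd_density L g" "AE z in lborel. f z = g z"
  shows "potential \<kappa> f x = potential \<kappa> g x"
proof -
  note assms(1,2)[THEN bdd_density_measurable, measurable]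
  show ?thesis unfolding potential_def
  proof (rule integral_cong_AE)
    show "AE z in lborel. G_plus \<kappa> (x - z) * f z = G_plus \<kappa> (x - z) * g z"
      using assms(3) by eventually_elim simp
  qed measurable
qed

text \<open>Retraction onto the ball. Composition with it turns a continuous function on the ball
  into a bounded continuous function on the whole space, so that the Banach space of all such
  functions can be used.\<close>

definition proj_ball :: "real \<Rightarrow> real^3 \<Rightarrow> real^3" where
  "proj_ball M = closest_point (cball 0 M)"

lemma norm_proj_ball: "M \<ge> 0 \<Longrightarrow> norm (proj_ball M x) \<le> M"
  using closest_point_in_set[of "cball (0::real^3) M" x] by (simp add: proj_ball_def)

lemma proj_ball_self: "norm x \<le> M \<Longrightarrow> proj_ball M x = x"
  unfolding proj_ball_def by (intro closest_point_self) simp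

lemma continuous_on_proj_ball: "M \<ge> 0 \<Longrightarrow> continuous_on A (proj_ball M)"
  unfolding proj_ball_def by (intro continuous_on_closest_point) (auto simp: convex_cball)

lemma apply_Bcontfun_proj_ball:
  fixes g :: "real^3 \<Rightarrow> 'b::real_normed_vector"
  assumes M: "M \<ge> 0" and g: "continuous_on (cball 0 M) g"
  shows "apply_bcontfun (Bcontfun (\<lambda>x. g (proj_ball M x))) x = g (proj_ball M x)"
proof -
  have "continuous_on UNIV (\<lambda>x. g (proj_ball M x))"
    by (rule continuous_on_compose2[OF g continuous_on_proj_ball[OF M]]) (auto simp: norm_proj_ball[OF M])
  moreover have "bounded (g ` cball 0 M)"
    by (intro compact_imp_bounded compact_continuous_image g) simp
  hence "bounded (range (\<lambda>x. g (proj_ball M x)))"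
    by (rule bounded_subset) (auto simp: norm_proj_ball[OF M])
  ultimately have "(\<lambda>x. g (proj_ball M x)) \<in> bcontfun" by (simp add: bcontfun_def)
  thus ?thesis by (simp add: Bcontfun_inverse)
qed

lemma bdd_density_mult_bcontfun:
  assumes "bdd_density K v"
  shows "bdd_density K (\<lambda>z. v z * apply_bcontfun f z)"
  by (intro bdd_density_mult[OF assms, of _ "norm f"] borel_measurable_continuous_onI norm_bounded) simp

text \<open>Compactness is the theorem of Arzela and Ascoli with the Lipschitz bound of the
  potential, which is uniform on bounded sets of functions. The injectivity hypothesis yields only
  \<open>v z * f z = 0\<close> almost everywhere, the form in which unique solvability is available;
  a fixed point is then the potential of a null density and vanishes.\<close>

theorem lippmann_schwinger_solvable:
  assumes v: "bdd_density K v" and K: "K \<subseteq> cball 0 M" and M: "M \<ge> 0" and \<kappa>: "\<kappa> \<ge> 0"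
    and inj: "\<And>f. continuous_on UNIV f \<Longrightarrow>
      (\<And>x. norm x \<le> M \<Longrightarrow> f x = potential \<kappa> (\<lambda>z. v z * f z) x) \<Longrightarrow> AE z in lborel. v z * f z = 0"
    and g: "continuous_on UNIV g"
  shows "\<exists>\<phi>. continuous_on UNIV \<phi> \<and> (\<forall>x. norm x \<le> M \<longrightarrow> \<phi> x = g x + potential \<kappa> (\<lambda>z. v z * \<phi> z) x)"
proof -
  have bK: "bounded K" using K bounded_subset bounded_cball by blast
  obtain B where B: "B > 0" "\<And>z. norm (v z) \<le> B" using bdd_density_bound[OF v] by blast
  define T where "T f = potential \<kappa> (\<lambda>z. v z * apply_bcontfun f z)" for f :: "(real^3) \<Rightarrow>\<^sub>C complex"
  define C where "C f = Bcontfun (\<lambda>x. T f (proj_ball M x))" for f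
  have dens: "bdd_density K (\<lambda>z. v z * apply_bcontfun f z)" for f by (rule bdd_density_mult_bcontfun[OF v])
  have vf: "norm (v z * apply_bcontfun f z) \<le> B * norm f" for f z
    unfolding norm_mult using B by (intro mult_mono norm_bounded) (auto simp: less_imp_le)
  have contT: "continuous_on UNIV (T f)" for f unfolding T_def by (rule continuous_potential[OF dens bK \<kappa>])
  have Cx: "apply_bcontfun (C f) x = T f (proj_ball M x)" for f x
    unfolding C_def by (intro apply_Bcontfun_proj_ball M continuous_on_subset[OF contT]) simp
  have Tb: "norm (T f x) \<le> B * norm f * sing_mass (2 * M)" if "norm x \<le> M" for f x
    unfolding T_def by (rule potential_bound[OF dens K vf that])
  have Tl: "norm (T f x - T f x') \<le> 2 * (\<kappa> + 1) * (B * norm f) * sing_mass (2 * M) * norm (x - x')"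
    if "norm x \<le> M" "norm x' \<le> M" for f x x'
    unfolding T_def by (rule potential_lipschitz[OF dens K vf that \<kappa>])
  have lin: "bounded_linear C"
  proof (rule bounded_linear_intro[where K="B * sing_mass (2 * M)"])
    show "C (f + h) = C f + C h" for f h
      by (rule bcontfun_eqI) (simp add: Cx T_def distrib_left potential_add[OF dens dens bK])
    show "C (r *\<^sub>R f) = r *\<^sub>R C f" for r f
      by (rule bcontfun_eqI) (simp add: Cx T_def potential_scaleR)
    show "norm (C f) \<le> norm f * (B * sing_mass (2 * M))" for f
      using Tb[OF norm_proj_ball[OF M]] by (intro norm_bound) (simp add: Cx mult_ac)
  qed
  have "\<exists>x. x - C x = Bcontfun (\<lambda>x. g (proj_ball M x))"
  proof (rule riesz_schauder_surjective[OF lin])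
    fix f :: "nat \<Rightarrow> (real^3) \<Rightarrow>\<^sub>C complex" assume "bounded (range f)"
    then obtain A where A: "A > 0" "\<And>n. norm (f n) \<le> A" by (auto simp: bounded_pos)
    define L where "L = 2 * (\<kappa> + 1) * (B * A) * sing_mass (2 * M)"
    have L: "L \<ge> 0" unfolding L_def using \<kappa> B A by (auto intro!: mult_nonneg_nonneg sing_mass_nonneg)
    have bd: "norm (T (f n) x) \<le> B * A * sing_mass (2 * M)" if "x \<in> cball 0 M" for n x
    proof -
      have "norm (T (f n) x) \<le> B * norm (f n) * sing_mass (2 * M)" using Tb that by simp
      also have "\<dots> \<le> B * A * sing_mass (2 * M)"
        using A B by (intro mult_right_mono mult_left_mono sing_mass_nonneg) auto
      finally show ?thesis .
    qed
    have lip: "norm (T (f n) x - T (f n) y) \<le> L * norm (x - y)" if "norm x \<le> M" "norm y \<le> M" for n x y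
    proof -
      have "norm (T (f n) x - T (f n) y) \<le> 2 * (\<kappa> + 1) * (B * norm (f n)) * sing_mass (2 * M) * norm (x - y)"
        using Tl that by simp
      also have "\<dots> \<le> L * norm (x - y)" unfolding L_def
        using A B \<kappa> by (intro mult_right_mono mult_left_mono sing_mass_nonneg) auto
      finally show ?thesis .
    qed
    obtain h k where hk: "continuous_on (cball 0 M) h" "strict_mono (k :: nat \<Rightarrow> nat)"
      "\<And>e. 0 < e \<Longrightarrow> \<exists>N. \<forall>n x. n \<ge> N \<and> x \<in> cball 0 M \<longrightarrow> norm (T (f (k n)) x - h x) < e"
    proof (rule Arzela_Ascoli[of "cball (0::real^3) M" "\<lambda>n. T (f n)" "B * A * sing_mass (2 * M)"])
      show "\<exists>d>0. \<forall>n y. y \<in> cball 0 M \<and> norm (x - y) < d \<longrightarrow> norm (T (f n) x - T (f n) y) < e"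
        if "x \<in> cball 0 M" "0 < e" for x e
      proof (intro exI[of _ "e / (L + 1)"] conjI allI impI)
        show "0 < e / (L + 1)" using L that by simp
        fix n y assume y: "y \<in> cball 0 M \<and> norm (x - y) < e / (L + 1)"
        have "norm (T (f n) x - T (f n) y) \<le> L * norm (x - y)" using lip that y by simp
        also have "\<dots> \<le> (L + 1) * norm (x - y)" by (simp add: distrib_right)
        also have "\<dots> < e" using y L by (simp add: field_simps)
        finally show "norm (T (f n) x - T (f n) y) < e" .
      qed
    qed (use bd in auto)
    define l where "l = Bcontfun (\<lambda>x. h (proj_ball M x))"
    have lx: "apply_bcontfun l x = h (proj_ball M x)" for x
      unfolding l_def by (rule apply_Bcontfun_proj_ball[OF M hk(1)])
    have "(\<lambda>n. C (f (k n))) \<longlonglongrightarrow> l"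
    proof (rule metric_LIMSEQ_I)
      fix e :: real assume "e > 0"
      then obtain N where N: "\<And>n x. n \<ge> N \<Longrightarrow> x \<in> cball 0 M \<Longrightarrow> norm (T (f (k n)) x - h x) < e / 2"
        using hk(3)[of "e / 2"] by auto
      have "dist (C (f (k n))) l \<le> e / 2" if "n \<ge> N" for n
        using N[OF that, of "proj_ball M _"] norm_proj_ball[OF M]
        by (intro dist_bound) (simp add: Cx lx dist_norm less_imp_le)
      thus "\<exists>N. \<forall>n\<ge>N. dist (C (f (k n))) l < e" using \<open>e > 0\<close> by (intro exI[of _ N]) fastforce
    qed
    thus "\<exists>l r. strict_mono r \<and> (\<lambda>n. C (f (r n))) \<longlonglongrightarrow> l" using hk(2) by blast
  next
    fix f assume "C f = f"
    hence fx: "apply_bcontfun f x = T f (proj_ball M x)" for x using Cx[of f x] by simp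
    have "AE z in lborel. v z * apply_bcontfun f z = 0"
    proof (rule inj)
      show "apply_bcontfun f x = potential \<kappa> (\<lambda>z. v z * apply_bcontfun f z) x" if "norm x \<le> M" for x
        using fx[of x] proj_ball_self[OF that] by (simp add: T_def)
    qed simp
    hence "AE z in lborel. v z * apply_bcontfun f z = (\<lambda>_. 0) z" by simp
    hence "T f x = potential \<kappa> (\<lambda>_. 0) x" for x
      unfolding T_def by (intro potential_cong_AE[OF dens, of K]) (auto simp: bdd_density_def)
    thus "f = 0" by (intro bcontfun_eqI) (simp add: fx potential_def)
  qed
  then obtain \<phi> where \<phi>: "\<phi> - C \<phi> = Bcontfun (\<lambda>x. g (proj_ball M x))" by blast
  have "apply_bcontfun \<phi> x = g x + potential \<kappa> (\<lambda>z. v z * apply_bcontfun \<phi> z) x" if "norm x \<le> M" for x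
  proof -
    have "apply_bcontfun (\<phi> - C \<phi>) x = g x"
      unfolding \<phi> using apply_Bcontfun_proj_ball[OF M continuous_on_subset[OF g], of x] proj_ball_self[OF that] by simp
    thus ?thesis by (simp add: Cx proj_ball_self[OF that] T_def algebra_simps)
  qed
  thus ?thesis by (intro exI[of _ "apply_bcontfun \<phi>"]) simp
qed

section \<open>Complex geometrical optics solutions\<close>

context frame
begin

text \<open>Convolution with \<open>G_plus + hom\<close>, conjugated by the exponential of \<open>i \<zeta> \<cdot> z\<close> with
  \<open>\<zeta> = A - i \<tau> e\<close>. The conjugated kernel is \<open>O(\<tau>\<^sup>-\<^sup>1\<^sup>/\<^sup>4)\<close> in \<open>L\<^sup>1\<close> on bounded sets.\<close>

definition faddeev :: "real \<Rightarrow> real \<Rightarrow> real^3 \<Rightarrow> (real^3 \<Rightarrow> complex) \<Rightarrow> real^3 \<Rightarrow> complex" where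
  "faddeev \<kappa> \<tau> A h x = pw (-A) (\<tau> *\<^sub>R e) x *
    (potential \<kappa> (\<lambda>z. pw A (-(\<tau> *\<^sub>R e)) z * h z) x + (LINT z|lborel. hom \<kappa> \<tau> (x - z) * (pw A (-(\<tau> *\<^sub>R e)) z * h z)))"

definition axis_mass :: "real \<Rightarrow> real" where
  "axis_mass M = (LINT y:cball 0 (2 * M)|lborel.
     \<bar>y \<bullet> a\<bar> powr (-(1/4)) * \<bar>y \<bullet> b\<bar> powr (-(1/4)) * \<bar>y \<bullet> e\<bar> powr (-(3/4)))"

lemma axis_mass_nonneg: "axis_mass M \<ge> 0"
  unfolding axis_mass_def set_lebesgue_integral_def by (intro Bochner_Integration.integral_nonneg) simp

lemma bdd_density_pw_mult:
  assumes "bdd_density K h" "bounded K"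
  shows "bdd_density K (\<lambda>z. pw A B z * h z)"
  using bdd_density_mult_cont[OF assms, of "pw A B"] by (simp add: mult.commute continuous_on_pw)

lemma integrable_hom_mult:
  assumes "bdd_density K h" "bounded K"
  shows "integrable lborel (\<lambda>z. hom \<kappa> \<tau> (x - z) * h z)"
proof -
  have "continuous_on UNIV (\<lambda>z. hom \<kappa> \<tau> (x - z))"
    by (intro continuous_on_compose2[OF continuous_on_hom] continuous_intros) auto
  from integrable_bdd_density[OF bdd_density_mult_cont[OF assms this] assms(2)] show ?thesis
    by (simp add: mult.commute)
qed

lemma AE_diff_lborel:
  assumes "AE y in lborel. P y" and [measurable]: "Measurable.pred borel P"
  shows "AE z in lborel. P (x - z :: real^3)"
proof -
  have "AE y in distr lborel borel (\<lambda>z. x - z). P y" using assms(1) by (subst distr_lborel_diff)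
  thus ?thesis by (subst (asm) AE_distr_iff) (auto simp: pred_def)
qed

text \<open>The two exponentials combine to the damping factor of \<open>faddeev_bound\<close> up to
  a factor of modulus 1, which is why the estimate does not depend on \<open>A\<close>.\<close>

lemma faddeev_norm_le:
  assumes h: "bdd_density K h" and K: "K \<subseteq> cball 0 M" and B: "\<And>z. norm (h z) \<le> B"
    and x: "norm x \<le> M" and \<kappa>: "\<kappa> > 0" and \<tau>: "\<tau> > 0"
  shows "norm (faddeev \<kappa> \<tau> A h x) \<le> B * ((13 + \<kappa> * (2 * M)) * \<tau> powr (-1/4) * axis_mass M)"
proof -
  have bK: "bounded K" using K bounded_subset bounded_cball by blast
  have M: "M \<ge> 0" using x norm_ge_zero order_trans by blast
  let ?E = "pw A (-(\<tau> *\<^sub>R e))"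
  let ?P = "\<lambda>y. \<bar>y \<bullet> a\<bar> powr (-(1/4)) * \<bar>y \<bullet> b\<bar> powr (-(1/4)) * \<bar>y \<bullet> e\<bar> powr (-(3/4))"
  let ?w = "\<lambda>y. indicator (cball 0 (2 * M)) y *\<^sub>R ?P y"
  let ?c = "(13 + \<kappa> * (2 * M)) * \<tau> powr (-1/4)"
  have wi: "integrable lborel ?w"
    using integrable_product_powr[of "1/4" "1/4" "3/4" "2 * M"] M unfolding set_integrable_def by simp
  have wm: "?w \<in> borel_measurable borel" by measurable
  have Ed: "bdd_density K (\<lambda>z. ?E z * h z)" by (rule bdd_density_pw_mult[OF h bK])
  have ig: "integrable lborel (\<lambda>z. G_plus \<kappa> (x - z) * (?E z * h z))" by (rule integrable_potential[OF Ed bK])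
  have ih: "integrable lborel (\<lambda>z. hom \<kappa> \<tau> (x - z) * (?E z * h z))" by (rule integrable_hom_mult[OF Ed bK])
  have eq: "faddeev \<kappa> \<tau> A h x = (LINT z|lborel. pw (-A) (\<tau> *\<^sub>R e) x * (G_plus \<kappa> (x - z) * (?E z * h z) + hom \<kappa> \<tau> (x - z) * (?E z * h z)))"
    unfolding faddeev_def potential_def Bochner_Integration.integral_add[OF ig ih, symmetric] by simp
  have "norm (faddeev \<kappa> \<tau> A h x) \<le> (LINT z|lborel. B * (?c * ?w (x - z)))"
    unfolding eq
  proof (rule norm_integral_le_AE)
    show "integrable lborel (\<lambda>z. pw (-A) (\<tau> *\<^sub>R e) x * (G_plus \<kappa> (x - z) * (?E z * h z) + hom \<kappa> \<tau> (x - z) * (?E z * h z)))"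
      by (intro integrable_mult_right Bochner_Integration.integrable_add ig ih)
    show "integrable lborel (\<lambda>z. B * (?c * ?w (x - z)))"
      using wi integrable_lborel_diff[OF wm, of x] by (intro integrable_mult_right) blast
    have "AE z in lborel. (x - z) \<bullet> a \<noteq> 0 \<and> (x - z) \<bullet> b \<noteq> 0 \<and> (x - z) \<bullet> e \<noteq> 0"
      by (rule AE_diff_lborel[OF AE_inner_nonzero]) measurable
    thus "AE z in lborel. norm (pw (-A) (\<tau> *\<^sub>R e) x * (G_plus \<kappa> (x - z) * (?E z * h z) + hom \<kappa> \<tau> (x - z) * (?E z * h z)))
      \<le> B * (?c * ?w (x - z))"
    proof eventually_elim
      case (elim z)
      show ?case
      proof (cases "z \<in> K")
        case True
        hence z: "norm z \<le> M" using K by auto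
        hence n: "norm (x - z) \<le> 2 * M" using norm_triangle_ineq4[of x z] x by linarith
        have E: "norm (pw (-A) (\<tau> *\<^sub>R e) x * ?E z) = exp (- \<tau> * ((x - z) \<bullet> e))"
          unfolding pw_def by (simp add: norm_mult exp_add[symmetric] inner_diff_left inner_commute algebra_simps)
        have "norm (pw (-A) (\<tau> *\<^sub>R e) x * (G_plus \<kappa> (x - z) * (?E z * h z) + hom \<kappa> \<tau> (x - z) * (?E z * h z)))
          = norm (pw (-A) (\<tau> *\<^sub>R e) x * ?E z) * norm (G_plus \<kappa> (x - z) + hom \<kappa> \<tau> (x - z)) * norm (h z)"
          by (simp only: norm_mult[symmetric]) (simp only: algebra_simps)
        also have "\<dots> = exp (- \<tau> * ((x - z) \<bullet> e)) * norm (G_plus \<kappa> (x - z) + hom \<kappa> \<tau> (x - z)) * norm (h z)"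
          by (simp only: E)
        also have "\<dots> \<le> (?c * ?P (x - z)) * B"
          using faddeev_bound[OF \<kappa> \<tau> n] elim B \<kappa> M by (intro mult_mono[OF _ B]) auto
        finally show ?thesis using n by (simp add: mult_ac)
      next
        case False
        hence "h z = 0" by (rule bdd_density_zero[OF h])
        moreover have "B \<ge> 0" using B[of 0] norm_ge_zero order_trans by blast
        ultimately show ?thesis using \<kappa> M by simp
      qed
    qed
  qed
  also have "\<dots> = B * (?c * (LINT y|lborel. ?w y))"
    using integral_lborel_diff[OF wm, of x] by simp
  also have "(LINT y|lborel. ?w y) = axis_mass M" unfolding axis_mass_def set_lebesgue_integral_def ..
  finally show ?thesis .
qed

lemma continuous_on_faddeev:
  assumes h: "bdd_density K h" and K: "bounded K" and \<kappa>: "\<kappa> \<ge> 0"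
  shows "continuous_on UNIV (faddeev \<kappa> \<tau> A h)"
proof -
  have Ed: "bdd_density K (\<lambda>z. pw A (-(\<tau> *\<^sub>R e)) z * h z)" by (rule bdd_density_pw_mult[OF h K])
  have "continuous_on UNIV (\<lambda>(x, z). hom \<kappa> \<tau> (x - z))" unfolding case_prod_beta
    by (intro continuous_on_compose2[OF continuous_on_hom] continuous_intros) auto
  from continuous_density_integral[OF Ed K this] continuous_potential[OF Ed K \<kappa>] show ?thesis
    unfolding faddeev_def[abs_def] by (intro continuous_intros)
qed

lemma faddeev_diff:
  assumes h: "bdd_density K h" "bdd_density K g" and K: "bounded K"
  shows "faddeev \<kappa> \<tau> A (\<lambda>z. h z - g z) x = faddeev \<kappa> \<tau> A h x - faddeev \<kappa> \<tau> A g x"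
proof -
  note d = bdd_density_pw_mult[OF h(1) K] bdd_density_pw_mult[OF h(2) K]
  show ?thesis unfolding faddeev_def right_diff_distrib potential_diff[OF d K]
      Bochner_Integration.integral_diff[OF integrable_hom_mult[OF d(1) K] integrable_hom_mult[OF d(2) K]]
    by (simp add: algebra_simps)
qed

text \<open>Banach's fixed point theorem for the conjugated equation. The threshold for \<tau> is
  uniform in \<open>A\<close> because the kernel estimate is.\<close>

theorem complex_geometrical_optics:
  assumes v: "bdd_density K v" and K: "K \<subseteq> cball 0 M" and M: "M \<ge> 0" and \<kappa>: "\<kappa> > 0" and \<eta>: "\<eta> > 0"
  shows "\<exists>\<tau>0>0. \<forall>\<tau>\<ge>\<tau>0. \<forall>A. \<exists>f. continuous_on UNIV f \<and> (\<forall>x. norm (f x - 1) \<le> \<eta>) \<and>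
    (\<forall>x. norm x \<le> M \<longrightarrow> f x = 1 + faddeev \<kappa> \<tau> A (\<lambda>z. v z * f z) x)"
proof -
  have bK: "bounded K" using K bounded_subset bounded_cball by blast
  obtain B where B: "B > 0" "\<And>z. norm (v z) \<le> B" using bdd_density_bound[OF v] by blast
  define D where "D = B * (13 + \<kappa> * (2 * M)) * axis_mass M"
  \<comment> \<open>At most 1/2 for a contraction, which also forces norm f \<le> 2; at most \<eta>
    / 2 so that the deviation from 1 is then at most \<eta>.\<close>
  define m where "m = min (1/2) (\<eta> / 2)"
  have D: "D \<ge> 0" unfolding D_def using B M \<kappa> axis_mass_nonneg by simp
  have m: "m > 0" "m \<le> 1/2" "m \<le> \<eta> / 2" using \<eta> by (simp_all add: m_def)
  \<comment> \<open>Solves (D + 1) \<tau>^(-1/4) = m; the summand 1 covers D = 0.\<close>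
  define \<tau>0 where "\<tau>0 = ((D + 1) / m) powr 4"
  have \<tau>0: "\<tau>0 > 0" using D m by (simp add: \<tau>0_def)
  have small: "D * \<tau> powr (-1/4) \<le> m" if "\<tau> \<ge> \<tau>0" for \<tau>
  proof -
    have "\<tau> powr (-1/4) \<le> \<tau>0 powr (-1/4)" using that \<tau>0 by (intro powr_mono2') auto
    also have "\<dots> = m / (D + 1)" unfolding \<tau>0_def powr_powr using D m by (simp add: powr_minus field_simps)
    finally have "D * \<tau> powr (-1/4) \<le> D * (m / (D + 1))" using D by (intro mult_left_mono)
    also have "\<dots> \<le> m" using D m by (simp add: field_simps)
    finally show ?thesis .
  qed
  have "\<exists>f. continuous_on UNIV f \<and> (\<forall>x. norm (f x - 1) \<le> \<eta>) \<and>
    (\<forall>x. norm x \<le> M \<longrightarrow> f x = 1 + faddeev \<kappa> \<tau> A (\<lambda>z. v z * f z) x)" if \<tau>: "\<tau> \<ge> \<tau>0" for \<tau> A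
  proof -
    have t0: "\<tau> > 0" using \<tau> \<tau>0 by simp
    define N where "N f = faddeev \<kappa> \<tau> A (\<lambda>z. v z * apply_bcontfun f z)" for f :: "(real^3) \<Rightarrow>\<^sub>C complex"
    define Op where "Op f = Bcontfun (\<lambda>x. 1 + N f (proj_ball M x))" for f
    have dens: "bdd_density K (\<lambda>z. v z * apply_bcontfun f z)" for f by (rule bdd_density_mult_bcontfun[OF v])
    have contN: "continuous_on UNIV (N f)" for f unfolding N_def by (rule continuous_on_faddeev[OF dens bK]) (use \<kappa> in simp)
    have Opx: "apply_bcontfun (Op f) x = 1 + N f (proj_ball M x)" for f x
      unfolding Op_def
      by (rule apply_Bcontfun_proj_ball[OF M]) (intro continuous_intros continuous_on_subset[OF contN], simp)
    have Nb: "norm (N f x) \<le> m * norm f" if x: "norm x \<le> M" for f x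
    proof -
      have "norm (N f x) \<le> (B * norm f) * ((13 + \<kappa> * (2 * M)) * \<tau> powr (-1/4) * axis_mass M)"
        unfolding N_def
      proof (rule faddeev_norm_le[OF dens K _ x \<kappa> t0])
        show "norm (v z * apply_bcontfun f z) \<le> B * norm f" for z
          unfolding norm_mult using B by (intro mult_mono norm_bounded) (auto simp: less_imp_le)
      qed
      also have "\<dots> = (D * \<tau> powr (-1/4)) * norm f" by (simp add: D_def mult_ac)
      also have "\<dots> \<le> m * norm f" using small[OF \<tau>] by (intro mult_right_mono) auto
      finally show ?thesis .
    qed
    have Nd: "N f x - N g x = N (f - g) x" for f g x
      unfolding N_def using faddeev_diff[OF dens dens bK, of \<kappa> \<tau> A f g x] by (simp add: right_diff_distrib)
    have "\<exists>!f. Op f = f"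
    proof (rule banach_fix_type[of m])
      show "\<forall>f g. dist (Op f) (Op g) \<le> m * dist f g"
      proof (intro allI dist_bound)
        fix f g x
        show "dist (apply_bcontfun (Op f) x) (apply_bcontfun (Op g) x) \<le> m * dist f g"
          using Nb[OF norm_proj_ball[OF M], of "f - g" x] by (simp add: Opx dist_norm Nd)
      qed
    qed (use m in auto)
    then obtain f where f: "Op f = f" by blast
    have fx: "apply_bcontfun f x = 1 + N f (proj_ball M x)" for x using Opx[of f x] f by simp
    have f1: "norm (apply_bcontfun f x - 1) \<le> m * norm f" for x
      using Nb[OF norm_proj_ball[OF M], of f x] by (simp add: fx)
    have "norm f \<le> 1 + m * norm f"
    proof (rule norm_bound)
      show "norm (apply_bcontfun f x) \<le> 1 + m * norm f" for x
        using norm_triangle_ineq[of "apply_bcontfun f x - 1" 1] f1[of x] by simp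
    qed
    moreover have "m * norm f \<le> (1/2) * norm f" using m by (intro mult_right_mono) auto
    ultimately have "norm f \<le> 2" by linarith
    hence "m * norm f \<le> (\<eta> / 2) * 2" using m \<eta> by (intro mult_mono) auto
    hence "\<forall>x. norm (apply_bcontfun f x - 1) \<le> \<eta>" using f1 order_trans by fastforce
    moreover have "apply_bcontfun f x = 1 + faddeev \<kappa> \<tau> A (\<lambda>z. v z * apply_bcontfun f z) x" if "norm x \<le> M" for x
      using fx[of x] proj_ball_self[OF that] by (simp add: N_def)
    ultimately show ?thesis by (intro exI[of _ "apply_bcontfun f"]) auto
  qed
  thus ?thesis using \<tau>0 by blast
qed

end

section \<open>Uniqueness of the Fourier transform\<close>

definition fourier_null :: "(real^3) set \<Rightarrow> (real^3 \<Rightarrow> complex) \<Rightarrow> bool" where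
  "fourier_null K q \<longleftrightarrow> bdd_density K q \<and> (\<forall>p. (LINT z|lborel. exp (\<i> * of_real (p \<bullet> z)) * q z) = 0)"

lemma fourier_null_add:
  assumes "fourier_null K f" "fourier_null K g" "bounded K"
  shows "fourier_null K (\<lambda>z. f z + g z)"
proof -
  have i: "integrable lborel (\<lambda>z. exp (\<i> * of_real (p \<bullet> z)) * h z)" if "fourier_null K h" for h p
  proof -
    have "continuous_on UNIV (\<lambda>z. exp (\<i> * of_real (p \<bullet> z)))" by (intro continuous_intros)
    from integrable_bdd_density[OF bdd_density_mult_cont[OF _ assms(3) this] assms(3)] that show ?thesis
      by (simp add: fourier_null_def mult.commute)
  qed
  show ?thesis using assms i[OF assms(1)] i[OF assms(2)] unfolding fourier_null_def
    by (simp add: bdd_density_add distrib_left)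
qed

lemma fourier_null_mult_exp:
  assumes "fourier_null K q" "bounded K"
  shows "fourier_null K (\<lambda>z. c * exp (\<i> * of_real (s \<bullet> z)) * q z)"
proof -
  have c: "continuous_on UNIV (\<lambda>z. c * exp (\<i> * of_real (s \<bullet> z)))" by (intro continuous_intros)
  have "(LINT z|lborel. exp (\<i> * of_real (p \<bullet> z)) * (c * exp (\<i> * of_real (s \<bullet> z)) * q z)) = 0" for p
  proof -
    have "(\<lambda>z. exp (\<i> * of_real (p \<bullet> z)) * (c * exp (\<i> * of_real (s \<bullet> z)) * q z)) = (\<lambda>z. c * (exp (\<i> * of_real ((p + s) \<bullet> z)) * q z))"
      by (simp add: inner_add_left exp_add distrib_left mult_ac)
    thus ?thesis using assms(1) by (simp add: fourier_null_def)
  qed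
  thus ?thesis using assms bdd_density_mult_cont[OF _ assms(2) c, of q]
    by (simp add: fourier_null_def mult.commute[of "q _"])
qed

lemma fourier_null_mult_sin:
  assumes "fourier_null K q" "bounded K"
  shows "fourier_null K (\<lambda>z. of_real (sin (s \<bullet> z - c)) * q z)"
proof -
  have "of_real (sin (s \<bullet> z - c)) * q z = exp (- \<i> * of_real c) / (2 * \<i>) * exp (\<i> * of_real (s \<bullet> z)) * q z
     + (- exp (\<i> * of_real c) / (2 * \<i>)) * exp (\<i> * of_real ((- s) \<bullet> z)) * q z" for z
    unfolding sin_of_real[symmetric] sin_exp_eq by (simp add: exp_diff exp_minus field_simps)
  thus ?thesis by (simp only: fourier_null_add[OF fourier_null_mult_exp fourier_null_mult_exp, OF assms assms assms(2)])
qed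

text \<open>Multiplication by sines shifts frequencies and so preserves
  \<open>fourier_null K\<close>; the real Stone-Weierstrass theorem passes from sines to all
  continuous functions. The ring R asks for preservation at every density rather than at the given
  \<open>q\<close>, which makes it closed under products.\<close>

lemma fourier_null_mult_continuous:
  fixes g :: "real^3 \<Rightarrow> real"
  assumes q: "fourier_null K q" and K: "bounded K" and g: "continuous_on UNIV g"
  shows "(LINT z|lborel. of_real (g z) * q z) = 0"
proof -
  define R where "R = {f :: real^3 \<Rightarrow> real. continuous_on UNIV f \<and> (\<forall>q. fourier_null K q \<longrightarrow> fourier_null K (\<lambda>z. of_real (f z) * q z))}"
  obtain M where M: "K \<subseteq> cball 0 M" using bounded_subset_cball0[OF K] by blast
  have qd: "bdd_density K q" using q by (simp add: fourier_null_def)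
  have sinR: "(\<lambda>z. sin (s \<bullet> z - c)) \<in> R" for s c
    unfolding R_def by (auto intro!: continuous_intros fourier_null_mult_sin K)
  interpret function_ring_on R "cball 0 M"
  proof
    show "(\<lambda>_. c) \<in> R" for c
      unfolding R_def using fourier_null_mult_exp[OF _ K, of _ "of_real c" 0] by auto
    show "(\<lambda>x. f x + g x) \<in> R" if "f \<in> R" "g \<in> R" for f g
      using that unfolding R_def by (auto simp: distrib_right intro!: continuous_intros fourier_null_add K)
    show "(\<lambda>x. f x * g x) \<in> R" if "f \<in> R" "g \<in> R" for f g
      using that unfolding R_def by (auto simp: mult.assoc intro!: continuous_intros)
    fix x y :: "real^3" assume "x \<noteq> y"
    hence n: "(x - y) \<bullet> (x - y) \<noteq> 0" by simp
    \<comment> \<open>Scaled so that s . x - s . y = 1: the function sin (s . z - s . y) separates x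
      from y by the values sin 1 and 0.\<close>
    define s where "s = (x - y) /\<^sub>R ((x - y) \<bullet> (x - y))"
    have "s \<bullet> x - s \<bullet> y = 1" using n unfolding s_def inner_diff_right[symmetric] by simp
    moreover have "sin (1::real) > 0" by (intro sin_gt_zero) (use pi_gt3 in auto)
    ultimately have "sin (s \<bullet> x - s \<bullet> y) \<noteq> sin (s \<bullet> y - s \<bullet> y)" by simp
    thus "\<exists>f\<in>R. f x \<noteq> f y" using sinR[of s "s \<bullet> y"] by (intro bexI)
  qed (auto simp: R_def intro: continuous_on_subset)
  define I where "I = (LINT z|lborel. norm (q z))"
  have I: "I \<ge> 0" unfolding I_def by (intro Bochner_Integration.integral_nonneg) simp
  have "norm (LINT z|lborel. of_real (g z) * q z) \<le> \<epsilon>" if "\<epsilon> > 0" for \<epsilon>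
  proof -
    have e: "\<epsilon> / (I + 1) > 0" using that I by simp
    obtain h where h: "h \<in> R" "\<And>x. x \<in> cball 0 M \<Longrightarrow> \<bar>g x - h x\<bar> < \<epsilon> / (I + 1)"
      using Stone_Weierstrass_basic[OF continuous_on_subset[OF g] e] by blast
    have hc: "continuous_on UNIV h" using h by (simp add: R_def)
    have int: "integrable lborel (\<lambda>z. of_real (f z) * q z)" if "continuous_on UNIV f" for f :: "real^3 \<Rightarrow> real"
      using integrable_bdd_density[OF bdd_density_mult_cont[OF qd K, of "\<lambda>z. of_real (f z)"] K] that
      by (simp add: continuous_on_of_real mult.commute)
    have "fourier_null K (\<lambda>z. of_real (h z) * q z)" using h q by (simp add: R_def)
    hence h0: "(LINT z|lborel. of_real (h z) * q z) = 0" unfolding fourier_null_def by (auto dest: spec[of _ 0])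
    have "(LINT z|lborel. of_real (g z) * q z) = (LINT z|lborel. of_real (g z) * q z - of_real (h z) * q z)"
      using Bochner_Integration.integral_diff[OF int[OF g] int[OF hc]] h0 by simp
    also have "norm \<dots> \<le> (LINT z|lborel. \<epsilon> / (I + 1) * norm (q z))"
    proof (rule Bochner_Integration.integral_norm_bound_integral)
      show "integrable lborel (\<lambda>z. of_real (g z) * q z - of_real (h z) * q z)"
        by (intro Bochner_Integration.integrable_diff int g hc)
      show "integrable lborel (\<lambda>z. \<epsilon> / (I + 1) * norm (q z))"
        by (intro integrable_mult_right integrable_norm integrable_bdd_density[OF qd K])
      fix z
      show "norm (of_real (g z) * q z - of_real (h z) * q z) \<le> \<epsilon> / (I + 1) * norm (q z)"
      proof (cases "z \<in> K")
        case True
        hence "\<bar>g z - h z\<bar> \<le> \<epsilon> / (I + 1)" using h(2)[of z] M by force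
        moreover have "norm (of_real (g z) * q z - of_real (h z) * q z) = \<bar>g z - h z\<bar> * norm (q z)"
          by (simp add: left_diff_distrib[symmetric] norm_mult of_real_diff[symmetric] del: of_real_diff)
        ultimately show ?thesis by (simp only: mult_right_mono norm_ge_zero)
      qed (simp add: bdd_density_zero[OF qd])
    qed
    also have "\<dots> = \<epsilon> * (I / (I + 1))" by (simp add: I_def)
    also have "\<dots> \<le> \<epsilon> * 1" using that I by (intro mult_left_mono) auto
    finally show ?thesis by simp
  qed
  from field_le_epsilon[of _ 0, simplified, OF this] show ?thesis by simp
qed

text \<open>Testing against continuous functions that converge to \<open>q\<close> almost everywhere
  gives, in the limit and after conjugation, the integral of |q|^2. Real test functions suffice once
  real and imaginary parts are taken apart.\<close>

theorem fourier_null_imp_AE_zero: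
  assumes q: "fourier_null K q" and K: "bounded K"
  shows "AE z in lborel. q z = 0"
proof -
  have qd: "bdd_density K q" using q by (simp add: fourier_null_def)
  have [measurable]: "q \<in> borel_measurable borel" by (rule bdd_density_measurable[OF qd])
  obtain B where B: "B > 0" "\<And>z. norm (q z) \<le> B" using bdd_density_bound[OF qd] by blast
  have "q \<in> borel_measurable lborel" by simp
  hence "q \<in> borel_measurable (lebesgue_on UNIV)" by (simp add: lebesgue_on_UNIV_eq measurable_completion)
  hence "q measurable_on UNIV" by (subst measurable_on_iff_borel_measurable) auto
  then obtain N g where N: "negligible N" and gc: "\<And>n. continuous_on UNIV (g n)"
    and gl: "\<And>x. x \<notin> N \<Longrightarrow> (\<lambda>n. g n x) \<longlonglongrightarrow> q x" by (auto simp: measurable_on_def)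
  \<comment> \<open>Radial truncation at modulus B keeps the approximants continuous and uniformly
    bounded, and does not affect the limit since |q| \<le> B.\<close>
  define w where "w n x = g n x / of_real (max 1 (norm (g n x) / B))" for n :: nat and x
  have wc: "continuous_on UNIV (w n)" for n
    unfolding w_def using B by (intro continuous_intros gc) (auto simp: max_def)
  have wb: "norm (w n x) \<le> B" for n x
    using B unfolding w_def by (simp add: norm_divide max_def field_simps)
  have "AE x in lborel. x \<notin> N"
    using AE_not_in[of N lebesgue] N by (simp add: negligible_iff_null_sets AE_completion_iff)
  hence lim: "AE x in lborel. (\<lambda>n. q x * cnj (w n x)) \<longlonglongrightarrow> q x * cnj (q x)"
  proof eventually_elim
    case (elim x)
    have "(\<lambda>n. w n x) \<longlonglongrightarrow> q x / of_real (max 1 (norm (q x) / B))"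
      unfolding w_def using B by (intro tendsto_intros gl elim) (auto simp: max_def)
    moreover have "max 1 (norm (q x) / B) = 1" using B(1) B(2)[of x] by (simp add: max_absorb1)
    ultimately have "(\<lambda>n. w n x) \<longlonglongrightarrow> q x" by simp
    thus ?case by (intro tendsto_intros)
  qed
  have wm [measurable]: "w n \<in> borel_measurable borel" for n by (rule borel_measurable_continuous_onI[OF wc])
  have [measurable]: "cnj \<in> borel_measurable borel" by (intro borel_measurable_continuous_onI continuous_intros)
  have "(\<lambda>n. LINT x|lborel. q x * cnj (w n x)) \<longlonglongrightarrow> (LINT x|lborel. q x * cnj (q x))"
  proof (rule integral_dominated_convergence[where w="\<lambda>x. norm (q x) * B"])
    show "integrable lborel (\<lambda>x. norm (q x) * B)"
      by (intro integrable_mult_left integrable_norm integrable_bdd_density[OF qd K])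
    show "AE x in lborel. norm (q x * cnj (w n x)) \<le> norm (q x) * B" for n
      using wb by (auto simp: norm_mult intro!: mult_left_mono)
  qed (use lim in \<open>auto, measurable\<close>)
  moreover have "(LINT x|lborel. q x * cnj (w n x)) = 0" for n
  proof -
    have r: "continuous_on UNIV (\<lambda>x. Re (w n x))" and i: "continuous_on UNIV (\<lambda>x. Im (w n x))"
      by (intro continuous_intros wc)+
    have int: "integrable lborel (\<lambda>z. of_real (f z) * q z)" if "continuous_on UNIV f" for f :: "real^3 \<Rightarrow> real"
      using integrable_bdd_density[OF bdd_density_mult_cont[OF qd K, of "\<lambda>z. of_real (f z)"] K] that
      by (simp add: continuous_on_of_real mult.commute)
    have "(\<lambda>x. q x * cnj (w n x)) = (\<lambda>x. of_real (Re (w n x)) * q x - \<i> * (of_real (Im (w n x)) * q x))"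
      by (auto simp: complex_eq_iff algebra_simps)
    hence "(LINT x|lborel. q x * cnj (w n x)) = (LINT x|lborel. of_real (Re (w n x)) * q x) - \<i> * (LINT x|lborel. of_real (Im (w n x)) * q x)"
      using Bochner_Integration.integral_diff[OF int[OF r] integrable_mult_right[OF int[OF i]], of \<i>] by simp
    thus ?thesis using fourier_null_mult_continuous[OF q K r] fourier_null_mult_continuous[OF q K i] by simp
  qed
  ultimately have "(LINT x|lborel. q x * cnj (q x)) = 0" by (simp add: LIMSEQ_const_iff)
  hence "(LINT x|lborel. complex_of_real ((norm (q x))\<^sup>2)) = 0" by (simp only: complex_norm_square)
  hence "complex_of_real (LINT x|lborel. (norm (q x))\<^sup>2) = 0" by (subst (asm) Bochner_Integration.integral_complex_of_real)
  hence "(LINT x|lborel. (norm (q x))\<^sup>2) = 0" by (simp only: of_real_eq_0_iff)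
  moreover have "integrable lborel (\<lambda>x. (norm (q x))\<^sup>2)"
  proof (rule Bochner_Integration.integrable_bound)
    show "integrable lborel (\<lambda>x. norm (q x) * B)"
      by (intro integrable_mult_left integrable_norm integrable_bdd_density[OF qd K])
    show "AE x in lborel. norm ((norm (q x))\<^sup>2) \<le> norm (norm (q x) * B)"
      using B by (auto simp: power2_eq_square intro!: mult_left_mono)
  qed measurable
  ultimately have "AE x in lborel. (norm (q x))\<^sup>2 = 0" by (subst (asm) integral_nonneg_eq_0_iff_AE) auto
  thus ?thesis by simp
qed

section \<open>Green functions and their densities\<close>

lemma closed_ess_support: "closed (ess_support v)"
  unfolding ess_support_def by (intro closed_Compl open_Union) auto

text \<open>The complement of the support is an arbitrary union of open sets on which
  \<open>v\<close> vanishes almost everywhere; Lindelof's theorem reduces it to a countable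
  one.\<close>

lemma AE_zero_off_ess_support: "AE x in lebesgue. x \<notin> ess_support v \<longrightarrow> v x = 0"
proof -
  let ?F = "{U. open U \<and> (AE x in lebesgue. x \<in> U \<longrightarrow> v x = 0)}"
  obtain F where F: "F \<subseteq> ?F" "countable F" "\<Union>F = \<Union>?F"
    by (rule Lindelof_openin[of ?F UNIV]) auto
  have "AE x in lebesgue. \<forall>U\<in>F. x \<in> U \<longrightarrow> v x = 0"
    using F by (subst AE_ball_countable) auto
  thus ?thesis
  proof eventually_elim
    case (elim x)
    show ?case
    proof
      assume "x \<notin> ess_support v"
      hence "x \<in> \<Union>F" unfolding F(3) ess_support_def by blast
      thus "v x = 0" using elim by blast
    qed
  qed
qed

lemma ex_borel_version:
  fixes f :: "'a::euclidean_space \<Rightarrow> complex"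
  assumes f: "f \<in> borel_measurable lebesgue"
  obtains g where "g \<in> borel_measurable borel" "AE x in lborel. f x = g x"
proof -
  have "(\<lambda>x. Re (f x)) \<in> borel_measurable lebesgue" "(\<lambda>x. Im (f x)) \<in> borel_measurable lebesgue"
    using f by measurable
  then obtain r i where [measurable]: "r \<in> borel_measurable lborel" "i \<in> borel_measurable lborel"
    and ri: "AE x in lborel. Re (f x) = r x" "AE x in lborel. Im (f x) = i x"
    using completion_ex_borel_measurable_real by metis
  show thesis
  proof (rule that[of "\<lambda>x. of_real (r x) + \<i> * of_real (i x)"])
    show "(\<lambda>x. of_real (r x) + \<i> * of_real (i x)) \<in> borel_measurable borel" by measurable
    show "AE x in lborel. f x = of_real (r x) + \<i> * of_real (i x)"
      using ri by eventually_elim (simp add: complex_eq_iff)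
  qed
qed

lemma L_infty_density:
  assumes v: "L_infty v" and K: "closed K" "ess_support v \<subseteq> K"
  obtains v' where "bdd_density K v'" "AE x in lborel. v x = v' x"
proof -
  obtain C where C: "AE x in lebesgue. norm (v x) \<le> C" using v by (auto simp: L_infty_def)
  obtain g where g [measurable]: "g \<in> borel_measurable borel" and vg: "AE x in lborel. v x = g x"
    using ex_borel_version[of v] v by (auto simp: L_infty_def)
  have [measurable]: "K \<in> sets borel" using K by (intro borel_closed)
  define v' where "v' x = (if x \<in> K \<and> norm (g x) \<le> C then g x else 0)" for x
  have "v' \<in> borel_measurable borel" unfolding v'_def by measurable
  hence "bdd_density K v'" by (rule bdd_densityI[where B="max C 0"]) (auto simp: v'_def)
  moreover have "AE x in lborel. v x = v' x"
    using vg C[unfolded AE_completion_iff] AE_zero_off_ess_support[of v, unfolded AE_completion_iff]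
    by eventually_elim (use K in \<open>auto simp: v'_def\<close>)
  ultimately show thesis by (rule that)
qed

text \<open>The product |G| |p| is at most |G|^2 + |p|^2, and |G|^2 is locally integrable in
  dimension three. The bound is uniform in x, which is what upgrades square integrable solutions to
  bounded ones.\<close>

lemma square_integrable_potential:
  assumes v: "bdd_density K v" and K: "K \<subseteq> cball 0 M" and B: "\<And>z. norm (v z) \<le> B" and x: "norm x \<le> M"
    and [measurable]: "p \<in> borel_measurable borel" and p: "integrable lborel (\<lambda>z. (norm (p z))\<^sup>2)"
  shows "integrable lborel (\<lambda>z. G_plus \<kappa> (x - z) * (v z * p z))"
    and "norm (LINT z|lborel. G_plus \<kappa> (x - z) * (v z * p z)) \<le> B * (sing_mass (2 * M) + (LINT z|lborel. (norm (p z))\<^sup>2))"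
proof -
  have [measurable]: "v \<in> borel_measurable borel" by (rule bdd_density_measurable[OF v])
  have B0: "B \<ge> 0" using B[of 0] norm_ge_zero order_trans by blast
  let ?w = "\<lambda>z. B * (sing (2 * M) (x - z) + (norm (p z))\<^sup>2)"
  have w: "integrable lborel ?w"
    by (intro integrable_mult_right Bochner_Integration.integrable_add integrable_sing_diff p)
  have le: "norm (G_plus \<kappa> (x - z) * (v z * p z)) \<le> ?w z" for z
  proof (cases "z \<in> K")
    case True
    define G where "G = norm (G_plus \<kappa> (x - z))"
    have "G\<^sup>2 \<le> 1 / (norm (x - z))\<^sup>2"
    proof (cases "x = z")
      case False
      have "16 * pi\<^sup>2 \<ge> 1" using pi_gt3 by (intro mult_ge1_I) (auto simp: one_le_power)
      thus ?thesis unfolding G_def norm_G_plus using False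
        by (simp add: power_divide power_mult_distrib field_simps)
    qed (simp add: G_def norm_G_plus)
    also have "\<dots> \<le> sing (2 * M) (x - z)" using sing_cball[of z M x] K True x by auto
    finally have "G\<^sup>2 \<le> sing (2 * M) (x - z)" .
    moreover have "G * norm (p z) \<le> G\<^sup>2 + (norm (p z))\<^sup>2"
      using sum_squares_bound[of G "norm (p z)"] mult_nonneg_nonneg[OF norm_ge_zero[of "G_plus \<kappa> (x - z)"] norm_ge_zero[of "p z"]]
      unfolding G_def by linarith
    ultimately have "G * norm (p z) \<le> sing (2 * M) (x - z) + (norm (p z))\<^sup>2" by linarith
    hence "norm (v z) * (G * norm (p z)) \<le> ?w z"
      using B B0 by (intro mult_mono) (auto simp: G_def)
    thus ?thesis by (simp add: norm_mult G_def mult_ac)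
  qed (use B0 in \<open>simp add: bdd_density_zero[OF v]\<close>)
  show i: "integrable lborel (\<lambda>z. G_plus \<kappa> (x - z) * (v z * p z))"
    by (rule Bochner_Integration.integrable_bound[OF w]) (measurable, use le in \<open>auto intro: order_trans abs_ge_self\<close>)
  have "norm (LINT z|lborel. G_plus \<kappa> (x - z) * (v z * p z)) \<le> integral\<^sup>L lborel ?w"
    by (rule Bochner_Integration.integral_norm_bound_integral[OF i w le])
  also have "\<dots> = B * (sing_mass (2 * M) + (LINT z|lborel. (norm (p z))\<^sup>2))"
    using Bochner_Integration.integral_add[OF integrable_sing_diff p] by (simp add: integral_sing_diff)
  finally show "norm (LINT z|lborel. G_plus \<kappa> (x - z) * (v z * p z)) \<le> B * (sing_mass (2 * M) + (LINT z|lborel. (norm (p z))\<^sup>2))" .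
qed

text \<open>\<open>v'\<close> is a bounded Borel representative of \<open>v\<close> that vanishes
  everywhere off \<open>K\<close>. The set \<open>K\<close> is a parameter because one
  \<open>K\<close> will serve two potentials.\<close>

locale scatterer =
  fixes \<Omega> K :: "(real^3) set" and v v' :: "real^3 \<Rightarrow> complex"
  assumes open_\<Omega>: "open \<Omega>" and bounded_\<Omega>: "bounded \<Omega>" and compact_K: "compact K" and K_subset: "K \<subseteq> \<Omega>"
    and L_infty_v: "L_infty v" and density: "bdd_density K v'" and AE_eq: "AE x in lborel. v x = v' x"
begin

lemma bounded_K: "bounded K"
  using compact_K by (rule compact_imp_bounded)

text \<open>Passes from Lebesgue integrals over \<Omega> with \<open>v\<close> to Borel integrals
  over the whole space with \<open>v'\<close>. The representative \<open>p\<close> depends on \<psi>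
  alone, so all \<kappa> and x are served at once.\<close>

lemma L2_version:
  assumes \<psi>: "L2_on \<Omega> \<psi>"
  shows "\<exists>p. p \<in> borel_measurable borel \<and> (AE z in lborel. z \<in> \<Omega> \<longrightarrow> p z = \<psi> z) \<and>
    integrable lborel (\<lambda>z. (norm (p z))\<^sup>2) \<and>
    (\<forall>\<kappa> x. (LINT z:\<Omega>|lebesgue. G_plus \<kappa> (x - z) * v z * \<psi> z) = (LINT z|lborel. G_plus \<kappa> (x - z) * (v' z * p z)))"
proof -
  have m: "(\<lambda>z. indicator \<Omega> z *\<^sub>R \<psi> z) \<in> borel_measurable lebesgue"
    using \<psi> by (simp add: L2_on_def set_borel_measurable_def)
  have [measurable]: "v \<in> borel_measurable lebesgue" using L_infty_v by (simp add: L_infty_def)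
  have [measurable]: "v' \<in> borel_measurable borel" by (rule bdd_density_measurable[OF density])
  obtain p where p [measurable]: "p \<in> borel_measurable borel" and eq: "AE z in lborel. indicator \<Omega> z *\<^sub>R \<psi> z = p z"
    using ex_borel_version[OF m] by blast
  have pl: "p \<in> borel_measurable lebesgue" by (rule measurable_completion) simp
  have "integrable lebesgue (\<lambda>z. indicat_real \<Omega> z *\<^sub>R (norm (\<psi> z))\<^sup>2)"
    using \<psi> by (simp add: L2_on_def set_integrable_def)
  moreover have "indicat_real \<Omega> z *\<^sub>R (norm (\<psi> z))\<^sup>2 = (norm (indicator \<Omega> z *\<^sub>R \<psi> z))\<^sup>2" for z
    by (simp add: indicator_def)
  ultimately have "integrable lebesgue (\<lambda>z. (norm (indicator \<Omega> z *\<^sub>R \<psi> z))\<^sup>2)" by simp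
  moreover have "AE z in lebesgue. (norm (indicator \<Omega> z *\<^sub>R \<psi> z))\<^sup>2 = (norm (p z))\<^sup>2"
    using eq unfolding AE_completion_iff by eventually_elim simp
  moreover have "(\<lambda>z. (norm (indicator \<Omega> z *\<^sub>R \<psi> z))\<^sup>2) \<in> borel_measurable lebesgue" using m by measurable
  moreover have "(\<lambda>z. (norm (p z))\<^sup>2) \<in> borel_measurable lebesgue" using pl by measurable
  ultimately have "integrable lebesgue (\<lambda>z. (norm (p z))\<^sup>2)" using integrable_cong_AE by blast
  hence pi: "integrable lborel (\<lambda>z. (norm (p z))\<^sup>2)" by (subst (asm) integrable_completion) auto
  have "(LINT z:\<Omega>|lebesgue. G_plus \<kappa> (x - z) * v z * \<psi> z) = (LINT z|lborel. G_plus \<kappa> (x - z) * (v' z * p z))" for \<kappa> x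
  proof -
    have G: "(\<lambda>z. G_plus \<kappa> (x - z)) \<in> borel_measurable lebesgue" by (rule measurable_completion) simp
    have "(LINT z:\<Omega>|lebesgue. G_plus \<kappa> (x - z) * v z * \<psi> z) = (LINT z|lebesgue. G_plus \<kappa> (x - z) * v z * (indicator \<Omega> z *\<^sub>R \<psi> z))"
      unfolding set_lebesgue_integral_def by simp
    also have "\<dots> = (LINT z|lebesgue. G_plus \<kappa> (x - z) * (v' z * p z))"
    proof (rule integral_cong_AE)
      show "(\<lambda>z. G_plus \<kappa> (x - z) * v z * (indicator \<Omega> z *\<^sub>R \<psi> z)) \<in> borel_measurable lebesgue"
        using G m by measurable
      show "(\<lambda>z. G_plus \<kappa> (x - z) * (v' z * p z)) \<in> borel_measurable lebesgue" by (rule measurable_completion) measurable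
      show "AE z in lebesgue. G_plus \<kappa> (x - z) * v z * (indicator \<Omega> z *\<^sub>R \<psi> z) = G_plus \<kappa> (x - z) * (v' z * p z)"
        unfolding AE_completion_iff using eq AE_eq by eventually_elim simp
    qed
    also have "\<dots> = (LINT z|lborel. G_plus \<kappa> (x - z) * (v' z * p z))"
      by (rule integral_completion) measurable
    finally show ?thesis .
  qed
  moreover have "AE z in lborel. z \<in> \<Omega> \<longrightarrow> p z = \<psi> z" using eq by eventually_elim auto
  ultimately show ?thesis using p pi by blast
qed

text \<open>The integral equation improves regularity: its integral term is bounded on
  \<open>K\<close> by \<open>square_integrable_potential\<close>, and the free term is bounded there
  because y lies outside \<Omega>, at positive distance from the compact \<open>K\<close>.\<close>

lemma green_density:
  assumes \<psi>: "L2_on \<Omega> \<psi>" and y: "y \<notin> \<Omega>"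
    and eq: "\<And>x. x \<noteq> y \<Longrightarrow> integral_equation_at v \<Omega> \<kappa> y \<psi> x"
  shows "bdd_density K (\<lambda>z. v' z * \<psi> z)"
    and "\<And>x. x \<noteq> y \<Longrightarrow> \<psi> x = - G_plus \<kappa> (x - y) + potential \<kappa> (\<lambda>z. v' z * \<psi> z) x"
proof -
  obtain p where p [measurable]: "p \<in> borel_measurable borel" and p\<psi>: "AE z in lborel. z \<in> \<Omega> \<longrightarrow> p z = \<psi> z"
    and p2: "integrable lborel (\<lambda>z. (norm (p z))\<^sup>2)"
    and int: "\<And>\<kappa> x. (LINT z:\<Omega>|lebesgue. G_plus \<kappa> (x - z) * v z * \<psi> z) = (LINT z|lborel. G_plus \<kappa> (x - z) * (v' z * p z))"
    using L2_version[OF \<psi>] by blast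
  have [measurable]: "v' \<in> borel_measurable borel" by (rule bdd_density_measurable[OF density])
  obtain B where B: "B > 0" "\<And>z. norm (v' z) \<le> B" using bdd_density_bound[OF density] by blast
  obtain M where M: "K \<subseteq> cball 0 M" using bounded_subset_cball0[OF bounded_K] by blast
  define w where "w x = - G_plus \<kappa> (x - y) + (LINT z|lborel. G_plus \<kappa> (x - z) * (v' z * p z))" for x
  have \<psi>w: "\<psi> x = w x" if "x \<noteq> y" for x
    using eq[OF that] by (simp add: integral_equation_at_def int w_def)
  have wm: "w \<in> borel_measurable borel"
    unfolding w_def[abs_def] by (intro borel_measurable_add borel_measurable_uminus sigma_finite_measure.borel_measurable_lebesgue_integral lborel.sigma_finite_measure_axioms) measurable
  define \<delta> where "\<delta> = setdist {y} K"
  have Gb: "norm (G_plus \<kappa> (x - y)) \<le> 1 + 1 / \<delta>\<^sup>2" if "x \<in> K" for x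
  proof -
    have "\<delta> > 0" unfolding \<delta>_def using compact_K y K_subset that
      by (subst setdist_gt_0_compact_closed) (auto intro: compact_imp_closed)
    moreover have "\<delta> \<le> norm (x - y)" unfolding \<delta>_def
      using setdist_le_dist[of y "{y}" x K] that by (simp add: dist_norm norm_minus_commute)
    ultimately have "1 / (norm (x - y))\<^sup>2 \<le> 1 / \<delta>\<^sup>2" by (intro divide_left_mono power_mono) (auto intro!: mult_pos_pos)
    thus ?thesis using norm_G_plus_le[of \<kappa> "x - y"] by linarith
  qed
  have d: "bdd_density K (\<lambda>z. v' z * w z)"
  proof (rule bdd_density_mult[OF density wm])
    fix x assume x: "x \<in> K"
    hence "norm x \<le> M" using M by auto
    from square_integrable_potential(2)[OF density M B(2) this p p2, of \<kappa>] Gb[OF x]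
    show "norm (w x) \<le> (1 + 1 / \<delta>\<^sup>2) + B * (sing_mass (2 * M) + (LINT z|lborel. (norm (p z))\<^sup>2))"
      unfolding w_def by (intro order_trans[OF norm_triangle_ineq] add_mono) simp_all
  qed
  moreover have "v' z * w z = v' z * \<psi> z" for z
    using bdd_density_zero[OF density, of z] K_subset y \<psi>w[of z] by (cases "z = y") auto
  ultimately show d': "bdd_density K (\<lambda>z. v' z * \<psi> z)" by simp
  show "\<psi> x = - G_plus \<kappa> (x - y) + potential \<kappa> (\<lambda>z. v' z * \<psi> z) x" if "x \<noteq> y" for x
  proof -
    note [measurable] = bdd_density_measurable[OF d']
    have "(LINT z|lborel. G_plus \<kappa> (x - z) * (v' z * p z)) = potential \<kappa> (\<lambda>z. v' z * \<psi> z) x"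
      unfolding potential_def
    proof (rule integral_cong_AE)
      show "AE z in lborel. G_plus \<kappa> (x - z) * (v' z * p z) = G_plus \<kappa> (x - z) * (v' z * \<psi> z)"
        using p\<psi> by eventually_elim (use bdd_density_zero[OF density] K_subset in auto)
    qed measurable
    thus ?thesis using \<psi>w[OF that] by (simp add: w_def)
  qed
qed

text \<open>(US) speaks of the equation with source. Adding a homogeneous solution f to the solution
  for y = 0 gives a second solution with the same source, so f vanishes almost everywhere in
  \<Omega>.\<close>

lemma US_injective:
  assumes US: "US v \<Omega> \<kappa>" and f: "continuous_on UNIV f" and M: "\<Omega> \<subseteq> cball 0 M"
    and eq: "\<And>x. norm x \<le> M \<Longrightarrow> f x = potential \<kappa> (\<lambda>z. v' z * f z) x"
  shows "AE z in lborel. v' z * f z = 0"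
proof -
  obtain \<psi> where \<psi>: "L2_on \<Omega> \<psi>" "AE x in lebesgue. x \<in> \<Omega> \<longrightarrow> integral_equation_at v \<Omega> \<kappa> 0 \<psi> x"
    using US unfolding US_def by blast
  have [measurable]: "v' \<in> borel_measurable borel" by (rule bdd_density_measurable[OF density])
  have fm [measurable]: "f \<in> borel_measurable borel" by (rule borel_measurable_continuous_onI[OF f])
  have fl: "f \<in> borel_measurable lebesgue" by (rule measurable_completion) simp
  have \<Omega>m [measurable]: "\<Omega> \<in> sets borel" using open_\<Omega> by simp
  have "compact (f ` cball 0 M)" by (intro compact_continuous_image continuous_on_subset[OF f]) auto
  then obtain F where F: "\<And>z. z \<in> cball 0 M \<Longrightarrow> norm (f z) \<le> F"
    using compact_imp_bounded bounded_iff by (metis imageI)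
  have m: "(\<lambda>z. indicator \<Omega> z *\<^sub>R \<psi> z) \<in> borel_measurable lebesgue"
    using \<psi> by (simp add: L2_on_def set_borel_measurable_def)
  have \<Omega>l: "\<Omega> \<in> sets lebesgue" by (rule sets_completionI_sets) simp
  have mf: "(\<lambda>z. indicator \<Omega> z *\<^sub>R (\<psi> z + f z)) \<in> borel_measurable lebesgue"
  proof -
    have "(\<lambda>z. indicator \<Omega> z *\<^sub>R \<psi> z + indicator \<Omega> z *\<^sub>R f z) \<in> borel_measurable lebesgue"
      using m fl \<Omega>l by measurable
    thus ?thesis by (simp add: scaleR_add_right)
  qed
  have L2: "L2_on \<Omega> (\<lambda>z. \<psi> z + f z)" unfolding L2_on_def
  proof
    show "set_borel_measurable lebesgue \<Omega> (\<lambda>z. \<psi> z + f z)" using mf by (simp add: set_borel_measurable_def)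
    have fin: "emeasure lebesgue \<Omega> < \<infinity>"
      using emeasure_bounded_finite[OF bounded_\<Omega>] by simp
    show "set_integrable lebesgue \<Omega> (\<lambda>x. (norm (\<psi> x + f x))\<^sup>2)" unfolding set_integrable_def
    proof (rule Bochner_Integration.integrable_bound)
      show "integrable lebesgue (\<lambda>x. 2 * (indicator \<Omega> x *\<^sub>R (norm (\<psi> x))\<^sup>2) + indicat_real \<Omega> x * (2 * F\<^sup>2))"
        using \<psi>(1) fin \<Omega>l by (intro Bochner_Integration.integrable_add integrable_mult_right integrable_mult_left)
          (auto simp: L2_on_def set_integrable_def)
      have "(\<lambda>x. (norm (indicator \<Omega> x *\<^sub>R (\<psi> x + f x)))\<^sup>2) \<in> borel_measurable lebesgue" using mf by measurable
      moreover have "(norm (indicator \<Omega> x *\<^sub>R (\<psi> x + f x)))\<^sup>2 = indicat_real \<Omega> x *\<^sub>R (norm (\<psi> x + f x))\<^sup>2" for x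
        by (simp add: indicator_def)
      ultimately show "(\<lambda>x. indicat_real \<Omega> x *\<^sub>R (norm (\<psi> x + f x))\<^sup>2) \<in> borel_measurable lebesgue" by simp
      have "(norm (\<psi> x + f x))\<^sup>2 \<le> 2 * (norm (\<psi> x))\<^sup>2 + 2 * F\<^sup>2" if "x \<in> \<Omega>" for x
      proof -
        have "norm (f x) \<le> F" using F M that by blast
        hence "(norm (f x))\<^sup>2 \<le> F\<^sup>2" by (intro power_mono) auto
        moreover have "(norm (\<psi> x + f x))\<^sup>2 \<le> (norm (\<psi> x) + norm (f x))\<^sup>2"
          by (intro power_mono norm_triangle_ineq) simp
        moreover have "2 * norm (\<psi> x) * norm (f x) \<le> (norm (\<psi> x))\<^sup>2 + (norm (f x))\<^sup>2" by (rule sum_squares_bound)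
        ultimately show ?thesis by (simp add: power2_sum)
      qed
      thus "AE x in lebesgue. norm (indicat_real \<Omega> x *\<^sub>R (norm (\<psi> x + f x))\<^sup>2)
        \<le> norm (2 * (indicator \<Omega> x *\<^sub>R (norm (\<psi> x))\<^sup>2) + indicat_real \<Omega> x * (2 * F\<^sup>2))"
        by (intro AE_I2) (auto simp: indicator_def)
    qed
  qed
  obtain p where p: "p \<in> borel_measurable borel" and p\<psi>: "AE z in lborel. z \<in> \<Omega> \<longrightarrow> p z = \<psi> z"
    and p2: "integrable lborel (\<lambda>z. (norm (p z))\<^sup>2)"
    and int: "\<And>\<kappa> x. (LINT z:\<Omega>|lebesgue. G_plus \<kappa> (x - z) * v z * \<psi> z) = (LINT z|lborel. G_plus \<kappa> (x - z) * (v' z * p z))"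
    using L2_version[OF \<psi>(1)] by blast
  obtain q where q: "q \<in> borel_measurable borel" and q\<psi>: "AE z in lborel. z \<in> \<Omega> \<longrightarrow> q z = \<psi> z + f z"
    and q2: "integrable lborel (\<lambda>z. (norm (q z))\<^sup>2)"
    and intq: "\<And>\<kappa> x. (LINT z:\<Omega>|lebesgue. G_plus \<kappa> (x - z) * v z * (\<psi> z + f z)) = (LINT z|lborel. G_plus \<kappa> (x - z) * (v' z * q z))"
    using L2_version[OF L2] by blast
  note p [measurable] and q [measurable]
  obtain B where B: "B > 0" "\<And>z. norm (v' z) \<le> B" using bdd_density_bound[OF density] by blast
  have KM: "K \<subseteq> cball 0 M" using K_subset M by blast
  have fd: "bdd_density K (\<lambda>z. v' z * f z)" by (rule bdd_density_mult_cont[OF density bounded_K f])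
  have sum: "(LINT z:\<Omega>|lebesgue. G_plus \<kappa> (x - z) * v z * (\<psi> z + f z))
    = (LINT z:\<Omega>|lebesgue. G_plus \<kappa> (x - z) * v z * \<psi> z) + f x" if x: "x \<in> \<Omega>" for x
  proof -
    have xM: "norm x \<le> M" using x M by auto
    have "(LINT z|lborel. G_plus \<kappa> (x - z) * (v' z * q z)) = (LINT z|lborel. G_plus \<kappa> (x - z) * (v' z * p z) + G_plus \<kappa> (x - z) * (v' z * f z))"
    proof (rule integral_cong_AE)
      show "AE z in lborel. G_plus \<kappa> (x - z) * (v' z * q z) = G_plus \<kappa> (x - z) * (v' z * p z) + G_plus \<kappa> (x - z) * (v' z * f z)"
        using p\<psi> q\<psi>
      proof eventually_elim
        case (elim z)
        show ?case
        proof (cases "z \<in> \<Omega>")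
          case False
          hence "v' z = 0" using bdd_density_zero[OF density] K_subset by blast
          thus ?thesis by simp
        qed (use elim in \<open>simp add: algebra_simps\<close>)
      qed
    qed measurable
    also have "\<dots> = (LINT z|lborel. G_plus \<kappa> (x - z) * (v' z * p z)) + potential \<kappa> (\<lambda>z. v' z * f z) x"
      unfolding potential_def
      by (intro Bochner_Integration.integral_add square_integrable_potential(1)[OF density KM B(2) xM p p2] integrable_potential[OF fd bounded_K])
    finally show ?thesis unfolding intq int using eq[OF xM] by simp
  qed
  have "AE x in lebesgue. x \<in> \<Omega> \<longrightarrow> integral_equation_at v \<Omega> \<kappa> 0 (\<lambda>z. \<psi> z + f z) x"
    using \<psi>(2) by eventually_elim (simp add: integral_equation_at_def sum)
  with US \<psi> L2 have "AE x in lebesgue. x \<in> \<Omega> \<longrightarrow> \<psi> x = \<psi> x + f x" unfolding US_def by blast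
  hence "AE x in lborel. x \<in> \<Omega> \<longrightarrow> \<psi> x = \<psi> x + f x" by (simp only: AE_completion_iff)
  thus ?thesis
  proof eventually_elim
    case (elim z)
    show ?case using elim bdd_density_zero[OF density, of z] K_subset by (cases "z \<in> \<Omega>") auto
  qed
qed

end

section \<open>The product of two solutions\<close>

text \<open>Complex geometrical optics solutions for \<open>v\<close> enter the argument only through this duality, which
  no longer mentions the frame, the frequency \<open>\<tau>\<close> or the Faddeev kernel.\<close>

definition cgo_pairing :: "real \<Rightarrow> (real^3) set \<Rightarrow> (real^3 \<Rightarrow> complex) \<Rightarrow> (real^3 \<Rightarrow> complex) \<Rightarrow> bool" where
  "cgo_pairing \<kappa> K v u \<longleftrightarrow> (\<forall>\<sigma>. bdd_density K \<sigma> \<longrightarrow> annihilates \<kappa> \<sigma> \<longrightarrow>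
     (LINT z|lborel. \<sigma> z * u z) = (LINT z|lborel. v z * u z * potential \<kappa> \<sigma> z))"

text \<open>Integrate the equation for u against \<sigma>: the incident exponential drops out since
  \<sigma> annihilates it, the potential moves over to \<sigma> by symmetry, and the
  \<open>hom\<close> term, transposed by Fubini, is again an integral of \<sigma> against such
  exponentials.\<close>

lemma (in frame) cgo_pairingI:
  assumes v: "bdd_density K v" and K: "bounded K" and \<kappa>: "\<kappa> \<ge> 0" and \<tau>: "\<tau> \<ge> 0" and u: "continuous_on UNIV u"
    and AB: "A \<bullet> B = 0" "A \<bullet> A - B \<bullet> B = \<kappa>\<^sup>2"
    and eq: "\<And>z. z \<in> K \<Longrightarrow> u z = pw A B z + potential \<kappa> (\<lambda>s. v s * u s) z + (LINT s|lborel. hom \<kappa> \<tau> (z - s) * (v s * u s))"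
  shows "cgo_pairing \<kappa> K v u"
  unfolding cgo_pairing_def
proof (intro allI impI)
  fix \<sigma> assume \<sigma>: "bdd_density K \<sigma>" and ann: "annihilates \<kappa> \<sigma>"
  obtain M where M: "K \<subseteq> cball 0 M" using bounded_subset_cball0[OF K] by blast
  define h where "h s = v s * u s" for s
  have h: "bdd_density K h" unfolding h_def[abs_def] by (rule bdd_density_mult_cont[OF v K u])
  define H where "H z = (LINT s|lborel. hom \<kappa> \<tau> (z - s) * h s)" for z
  have hc: "continuous_on UNIV (hom \<kappa> \<tau>)" by (rule continuous_on_hom)
  have Hc: "continuous_on UNIV H" unfolding H_def
    by (rule continuous_density_integral[OF h K]) (unfold case_prod_beta, intro continuous_on_compose2[OF hc] continuous_intros, auto)
  have int: "integrable lborel (\<lambda>z. \<sigma> z * g z)" if "continuous_on UNIV g" for g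
    by (rule integrable_bdd_density[OF bdd_density_mult_cont[OF \<sigma> K that] K])
  have Tc: "continuous_on UNIV (potential \<kappa> h)" by (rule continuous_potential[OF h K \<kappa>])
  have pc: "continuous_on UNIV (pw A B)" by (intro continuous_intros)
  have "\<sigma> z * u z = \<sigma> z * pw A B z + \<sigma> z * potential \<kappa> h z + \<sigma> z * H z" for z
    using eq[of z] bdd_density_zero[OF \<sigma>, of z] by (cases "z \<in> K") (simp_all add: h_def[abs_def] H_def algebra_simps)
  hence "(LINT z|lborel. \<sigma> z * u z) = (LINT z|lborel. \<sigma> z * pw A B z) + (LINT z|lborel. \<sigma> z * potential \<kappa> h z) + (LINT z|lborel. \<sigma> z * H z)"
    using int[OF pc] int[OF Tc] int[OF Hc] by simp
  moreover have "(LINT z|lborel. \<sigma> z * pw A B z) = 0"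
    using ann AB by (simp add: annihilates_def mult.commute)
  moreover have "(LINT z|lborel. \<sigma> z * potential \<kappa> h z) = (LINT z|lborel. h z * potential \<kappa> \<sigma> z)"
    by (rule potential_symmetric[OF h \<sigma> K])
  moreover have "(LINT z|lborel. \<sigma> z * H z) = 0"
  proof -
    have "compact (hom \<kappa> \<tau> ` cball 0 (2 * M))"
      by (intro compact_continuous_image continuous_on_subset[OF hc]) auto
    then obtain C where C: "C > 0" "\<And>y. y \<in> cball 0 (2 * M) \<Longrightarrow> norm (hom \<kappa> \<tau> y) \<le> C"
      using compact_imp_bounded bounded_pos by (metis imageI)
    have "norm (hom \<kappa> \<tau> y) \<le> C * (1 + 1 / (norm y)\<^sup>2)" if "norm y \<le> 2 * M" for y
    proof -
      have "norm (hom \<kappa> \<tau> y) \<le> C * 1" using C(2)[of y] that by simp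
      also have "\<dots> \<le> C * (1 + 1 / (norm y)\<^sup>2)" using C(1) by (intro mult_left_mono) auto
      finally show ?thesis .
    qed
    from conv_symmetric[OF h \<sigma> M borel_measurable_continuous_onI[OF hc] this]
    have "(LINT z|lborel. \<sigma> z * H z) = (LINT s|lborel. h s * (LINT z|lborel. hom \<kappa> \<tau> (z - s) * \<sigma> z))"
      by (simp add: H_def)
    moreover have "(LINT z|lborel. hom \<kappa> \<tau> (z - s) * \<sigma> z) = 0" for s
      using hom_annihilates[OF \<sigma> K ann, of 1 \<tau> "-s"] \<kappa> \<tau> by simp
    ultimately show ?thesis by simp
  qed
  ultimately show "(LINT z|lborel. \<sigma> z * u z) = (LINT z|lborel. v z * u z * potential \<kappa> \<sigma> z)"
    by (simp add: h_def)
qed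

text \<open>\<open>w1 z x\<close> and \<open>w2 z x\<close> stand for the Green functions with
  source x on the plane. Each of the two pairings is applied to a density whose potential is
  explicit on \<open>K\<close>: the difference of the Green functions for the first, and - \<phi>
  with \<phi> the solution of the Lippmann-Schwinger equation for the second.\<close>

theorem cgo_product_integral_zero:
  assumes K: "K \<subseteq> cball 0 M" "M \<ge> 0" and \<kappa>: "\<kappa> \<ge> 0" and v: "bdd_density K v1" "bdd_density K v2"
    and ann: "\<And>f. bdd_density K f \<Longrightarrow> (\<And>x. x \<in> X \<Longrightarrow> potential \<kappa> f x = 0) \<Longrightarrow> annihilates \<kappa> f"
    and d1: "\<And>x. x \<in> X \<Longrightarrow> bdd_density K (\<lambda>z. v1 z * w1 z x)"
    and d2: "\<And>x. x \<in> X \<Longrightarrow> bdd_density K (\<lambda>z. v2 z * w2 z x)"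
    and w1: "\<And>x z. x \<in> X \<Longrightarrow> z \<in> K \<Longrightarrow> w1 z x = - G_plus \<kappa> (z - x) + potential \<kappa> (\<lambda>z. v1 z * w1 z x) z"
    and w2: "\<And>x z. x \<in> X \<Longrightarrow> z \<in> K \<Longrightarrow> w2 z x = - G_plus \<kappa> (z - x) + potential \<kappa> (\<lambda>z. v2 z * w2 z x) z"
    and zero: "\<And>x y. x \<in> X \<Longrightarrow> y \<in> X \<Longrightarrow> potential \<kappa> (\<lambda>z. v1 z * w1 z x - v2 z * w2 z x) y = 0"
    and inj: "\<And>f. continuous_on UNIV f \<Longrightarrow>
      (\<And>x. norm x \<le> M \<Longrightarrow> f x = potential \<kappa> (\<lambda>z. v1 z * f z) x) \<Longrightarrow> AE z in lborel. v1 z * f z = 0"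
    and u: "continuous_on UNIV u1" "continuous_on UNIV u2"
    and c: "cgo_pairing \<kappa> K v1 u1" "cgo_pairing \<kappa> K v2 u2"
  shows "(LINT z|lborel. (v1 z - v2 z) * u2 z * u1 z) = 0"
proof -
  have bK: "bounded K" using K(1) bounded_subset bounded_cball by blast
  note mc = bdd_density_mult_cont[OF _ bK] and pot = continuous_potential[OF _ bK \<kappa>] and int = integrable_bdd_density[OF _ bK]
  define \<rho> where "\<rho> z = (v1 z - v2 z) * u2 z" for z
  have \<rho>: "bdd_density K \<rho>" unfolding \<rho>_def[abs_def] by (intro mc bdd_density_diff v u)
  have \<rho>w: "integrable lborel (\<lambda>z. \<rho> z * w1 z x)" "(LINT z|lborel. \<rho> z * w1 z x) = 0" if x: "x \<in> X" for x
  proof -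
    define \<sigma> where "\<sigma> z = v1 z * w1 z x - v2 z * w2 z x" for z
    have \<sigma>: "bdd_density K \<sigma>" unfolding \<sigma>_def[abs_def] by (intro bdd_density_diff d1 d2 x)
    have a: "annihilates \<kappa> \<sigma>" by (rule ann[OF \<sigma>]) (simp add: \<sigma>_def[abs_def] zero[OF x])
    \<comment> \<open>The free terms \<open>- G_plus \<kappa> (z - x)\<close> cancel in the
      difference of the two equations.\<close>
    have T: "potential \<kappa> \<sigma> z = w1 z x - w2 z x" if "z \<in> K" for z
      using w1[OF x that] w2[OF x that] potential_diff[OF d1[OF x] d2[OF x] bK, of \<kappa> z] by (simp add: \<sigma>_def[abs_def])
    have eq: "(\<lambda>z. \<rho> z * w1 z x) = (\<lambda>z. \<sigma> z * u2 z - v2 z * u2 z * potential \<kappa> \<sigma> z)"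
    proof
      fix z show "\<rho> z * w1 z x = \<sigma> z * u2 z - v2 z * u2 z * potential \<kappa> \<sigma> z"
      proof (cases "z \<in> K")
        case True
        show ?thesis unfolding T[OF True] by (simp add: \<rho>_def \<sigma>_def algebra_simps)
      next
        case False
        thus ?thesis using bdd_density_zero[OF v(1) False] bdd_density_zero[OF v(2) False] bdd_density_zero[OF \<sigma> False]
          by (simp add: \<rho>_def)
      qed
    qed
    have i: "integrable lborel (\<lambda>z. \<sigma> z * u2 z)" "integrable lborel (\<lambda>z. v2 z * u2 z * potential \<kappa> \<sigma> z)"
      by (intro int mc \<sigma> u v pot)+
    show "integrable lborel (\<lambda>z. \<rho> z * w1 z x)" unfolding eq by (intro Bochner_Integration.integrable_diff i)
    show "(LINT z|lborel. \<rho> z * w1 z x) = 0"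
      unfolding eq Bochner_Integration.integral_diff[OF i] using c(2) \<sigma> a by (simp add: cgo_pairing_def)
  qed
  have gc: "continuous_on UNIV (\<lambda>x. - potential \<kappa> \<rho> x)" by (intro continuous_intros pot \<rho>)
  obtain \<phi> where \<phi>: "continuous_on UNIV \<phi>"
    "\<And>x. norm x \<le> M \<Longrightarrow> \<phi> x = - potential \<kappa> \<rho> x + potential \<kappa> (\<lambda>z. v1 z * \<phi> z) x"
    using lippmann_schwinger_solvable[OF v(1) K \<kappa> inj gc] by blast
  \<comment> \<open>By the equation for \<phi> the potential of this density is - \<phi> on
    \<open>K\<close>.\<close>
  define \<sigma> where "\<sigma> z = \<rho> z - v1 z * \<phi> z" for z
  have v\<phi>: "bdd_density K (\<lambda>z. v1 z * \<phi> z)" by (rule mc[OF v(1) \<phi>(1)])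
  have \<sigma>: "bdd_density K \<sigma>" unfolding \<sigma>_def[abs_def] by (intro bdd_density_diff \<rho> v\<phi>)
  have T: "potential \<kappa> \<sigma> z = - \<phi> z" if "z \<in> K" for z
    using \<phi>(2)[of z] K(1) that potential_diff[OF \<rho> v\<phi> bK, of \<kappa> z] by (auto simp: \<sigma>_def[abs_def])
  have "annihilates \<kappa> \<sigma>"
  proof (rule ann[OF \<sigma>])
    fix x assume x: "x \<in> X"
    let ?h = "\<lambda>z. v1 z * w1 z x"
    \<comment> \<open>\<open>G_plus \<kappa> (x - z)\<close> is eliminated by the equation for
      \<open>w1\<close>. This brings in the integral of \<open>\<rho> z * w1 z x\<close>, already
      known to vanish, and a term in which the potential can be moved back to \<sigma>.\<close>
    have "potential \<kappa> \<sigma> x = (LINT z|lborel. \<sigma> z * potential \<kappa> ?h z - (\<rho> z * w1 z x - ?h z * \<phi> z))"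
      unfolding potential_def[of _ \<sigma>]
    proof (rule Bochner_Integration.integral_cong[OF refl])
      fix z show "G_plus \<kappa> (x - z) * \<sigma> z = \<sigma> z * potential \<kappa> ?h z - (\<rho> z * w1 z x - ?h z * \<phi> z)"
      proof (cases "z \<in> K")
        case True
        have G: "G_plus \<kappa> (x - z) = potential \<kappa> ?h z - w1 z x" using w1[OF x True] by (simp add: G_plus_even)
        show ?thesis unfolding G by (simp add: \<sigma>_def algebra_simps)
      next
        case False
        thus ?thesis using bdd_density_zero[OF v(1) False] bdd_density_zero[OF \<rho> False] bdd_density_zero[OF \<sigma> False] by simp
      qed
    qed
    also have "\<dots> = (LINT z|lborel. \<sigma> z * potential \<kappa> ?h z) - ((LINT z|lborel. \<rho> z * w1 z x) - (LINT z|lborel. ?h z * \<phi> z))"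
      using int[OF mc[OF \<sigma> pot[OF d1[OF x]]]] \<rho>w(1)[OF x] int[OF mc[OF d1[OF x] \<phi>(1)]] by simp
    also have "\<dots> = (LINT z|lborel. ?h z * potential \<kappa> \<sigma> z) + (LINT z|lborel. ?h z * \<phi> z)"
      using \<rho>w(2)[OF x] potential_symmetric[OF d1[OF x] \<sigma> bK, of \<kappa>] by simp
    also have "(LINT z|lborel. ?h z * potential \<kappa> \<sigma> z) = (LINT z|lborel. - (?h z * \<phi> z))"
    proof (rule Bochner_Integration.integral_cong[OF refl])
      fix z show "?h z * potential \<kappa> \<sigma> z = - (?h z * \<phi> z)"
        using T[of z] bdd_density_zero[OF v(1), of z] by (cases "z \<in> K") simp_all
    qed
    finally show "potential \<kappa> \<sigma> x = 0" by simp
  qed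
  with c(1) \<sigma> have "(LINT z|lborel. \<sigma> z * u1 z) = (LINT z|lborel. v1 z * u1 z * potential \<kappa> \<sigma> z)"
    by (simp add: cgo_pairing_def)
  also have "\<dots> = (LINT z|lborel. - (v1 z * \<phi> z * u1 z))"
  proof (rule Bochner_Integration.integral_cong[OF refl])
    fix z show "v1 z * u1 z * potential \<kappa> \<sigma> z = - (v1 z * \<phi> z * u1 z)"
      using T[of z] bdd_density_zero[OF v(1), of z] by (cases "z \<in> K") simp_all
  qed
  finally have "(LINT z|lborel. \<sigma> z * u1 z) + (LINT z|lborel. v1 z * \<phi> z * u1 z) = 0" by simp
  moreover have "(LINT z|lborel. \<rho> z * u1 z) = (LINT z|lborel. \<sigma> z * u1 z + v1 z * \<phi> z * u1 z)"
    by (simp add: \<sigma>_def algebra_simps)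
  moreover have "\<dots> = (LINT z|lborel. \<sigma> z * u1 z) + (LINT z|lborel. v1 z * \<phi> z * u1 z)"
    by (intro Bochner_Integration.integral_add int mc \<sigma> v\<phi> u)
  ultimately show ?thesis by (simp add: \<rho>_def)
qed

section \<open>Reciprocity of the Green function\<close>

context scatterer
begin

lemma outgoing_green_density:
  assumes R: "outgoing_green v \<Omega> \<kappa> R" and y: "y \<notin> \<Omega>"
  shows "bdd_density K (\<lambda>z. v' z * R z y)"
    and "\<And>x. x \<noteq> y \<Longrightarrow> R x y = - G_plus \<kappa> (x - y) + potential \<kappa> (\<lambda>z. v' z * R z y) x"
  using green_density[of "\<lambda>x. R x y", OF _ y] R unfolding outgoing_green_def by blast+

text \<open>Expressing \<open>G_plus\<close> by the equation for the other source turns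
  \<open>potential \<kappa> (h y) x\<close> into a bilinear integral, symmetric by
  \<open>potential_symmetric\<close>, minus the integral of v' R(z, x) R(z, y), which is symmetric
  in x and y.\<close>

lemma reciprocity:
  assumes R: "outgoing_green v \<Omega> \<kappa> R" and xy: "x \<notin> \<Omega>" "y \<notin> \<Omega>" "x \<noteq> y" and \<kappa>: "\<kappa> \<ge> 0"
  shows "R x y = R y x"
proof -
  define h where "h y z = v' z * R z y" for y z
  have h: "bdd_density K (h x)" "bdd_density K (h y)"
    unfolding h_def[abs_def] using outgoing_green_density(1)[OF R] xy by auto
  have Rx: "R z x = - G_plus \<kappa> (z - x) + potential \<kappa> (h x) z" if "z \<noteq> x" for z
    unfolding h_def[abs_def] by (rule outgoing_green_density(2)[OF R xy(1) that])
  have Ry: "R z y = - G_plus \<kappa> (z - y) + potential \<kappa> (h y) z" if "z \<noteq> y" for z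
    unfolding h_def[abs_def] by (rule outgoing_green_density(2)[OF R xy(2) that])
  have pot: "integrable lborel (\<lambda>z. h s z * potential \<kappa> (h t) z)" if "s \<in> {x, y}" "t \<in> {x, y}" for s t
    using that h by (intro integrable_bdd_density[OF _ bounded_K] bdd_density_mult_cont[OF _ bounded_K] continuous_potential[OF _ bounded_K \<kappa>]) auto
  have K0: "z \<noteq> x" "z \<noteq> y" if "z \<in> K" for z using that xy K_subset by auto
  have "potential \<kappa> (h y) x - (LINT z|lborel. h y z * potential \<kappa> (h x) z)
      = (LINT z|lborel. G_plus \<kappa> (x - z) * h y z - h y z * potential \<kappa> (h x) z)"
    unfolding potential_def[of _ "h y" x] using pot[of y x]
    by (intro Bochner_Integration.integral_diff[symmetric] integrable_potential[OF h(2) bounded_K]) simp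
  also have "\<dots> = (LINT z|lborel. G_plus \<kappa> (y - z) * h x z - h x z * potential \<kappa> (h y) z)"
  proof (rule Bochner_Integration.integral_cong[OF refl])
    fix z show "G_plus \<kappa> (x - z) * h y z - h y z * potential \<kappa> (h x) z = G_plus \<kappa> (y - z) * h x z - h x z * potential \<kappa> (h y) z"
    proof (cases "z \<in> K")
      case True
      have G: "G_plus \<kappa> (x - z) = potential \<kappa> (h x) z - R z x" "G_plus \<kappa> (y - z) = potential \<kappa> (h y) z - R z y"
        using Rx[OF K0(1)[OF True]] Ry[OF K0(2)[OF True]] by (simp_all add: G_plus_even)
      show ?thesis unfolding G by (simp add: h_def algebra_simps)
    next
      case False
      thus ?thesis using bdd_density_zero[OF density False] by (simp add: h_def)
    qed
  qed
  also have "\<dots> = potential \<kappa> (h x) y - (LINT z|lborel. h x z * potential \<kappa> (h y) z)"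
    unfolding potential_def[of _ "h x" y] using pot[of x y]
    by (intro Bochner_Integration.integral_diff integrable_potential[OF h(1) bounded_K]) simp
  finally have "potential \<kappa> (h y) x = potential \<kappa> (h x) y"
    using potential_symmetric[OF h bounded_K, of \<kappa>] by simp
  thus ?thesis using Rx[of y] Ry[of x] xy by (simp add: G_plus_even[of \<kappa> x y])
qed

end

section \<open>Determination of the potential\<close>

text \<open>Multiplying the equation for f by the exponential undoes the conjugation in
  \<open>faddeev\<close>; the conditions on \<open>A\<close> put A - i \<tau> e on the quadric
  \<zeta> . \<zeta> = \<kappa>^2.\<close>

lemma (in frame) ex_cgo_pairing:
  assumes v: "bdd_density K v" and K: "K \<subseteq> cball 0 M" and M: "M \<ge> 0" and \<kappa>: "\<kappa> > 0" and \<eta>: "\<eta> > 0"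
  shows "\<exists>\<tau>0>0. \<forall>\<tau>\<ge>\<tau>0. \<forall>A. A \<bullet> e = 0 \<longrightarrow> A \<bullet> A = \<kappa>\<^sup>2 + \<tau>\<^sup>2 \<longrightarrow>
    (\<exists>f. continuous_on UNIV f \<and> (\<forall>x. norm (f x - 1) \<le> \<eta>) \<and> cgo_pairing \<kappa> K v (\<lambda>z. pw A (-(\<tau> *\<^sub>R e)) z * f z))"
proof -
  have bK: "bounded K" using K bounded_subset bounded_cball by blast
  obtain \<tau>0 where \<tau>0: "\<tau>0 > 0" and ex: "\<And>\<tau> A. \<tau> \<ge> \<tau>0 \<Longrightarrow> \<exists>f. continuous_on UNIV f \<and> (\<forall>x. norm (f x - 1) \<le> \<eta>) \<and>
    (\<forall>x. norm x \<le> M \<longrightarrow> f x = 1 + faddeev \<kappa> \<tau> A (\<lambda>z. v z * f z) x)"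
    using complex_geometrical_optics[OF v K M \<kappa> \<eta>] by blast
  show ?thesis
  proof (intro exI[of _ \<tau>0] conjI allI impI \<tau>0)
    fix \<tau> A assume \<tau>: "\<tau>0 \<le> \<tau>" and A: "A \<bullet> e = 0" "A \<bullet> A = \<kappa>\<^sup>2 + \<tau>\<^sup>2"
    obtain f where f: "continuous_on UNIV f" "\<forall>x. norm (f x - 1) \<le> \<eta>"
      "\<And>x. norm x \<le> M \<Longrightarrow> f x = 1 + faddeev \<kappa> \<tau> A (\<lambda>z. v z * f z) x"
      using ex[OF \<tau>] by blast
    let ?E = "pw A (-(\<tau> *\<^sub>R e))"
    have "cgo_pairing \<kappa> K v (\<lambda>z. ?E z * f z)"
    proof (rule cgo_pairingI[OF v bK])
      show "continuous_on UNIV (\<lambda>z. ?E z * f z)" by (intro continuous_intros f(1))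
      show "A \<bullet> -(\<tau> *\<^sub>R e) = 0" using A by simp
      show "A \<bullet> A - -(\<tau> *\<^sub>R e) \<bullet> -(\<tau> *\<^sub>R e) = \<kappa>\<^sup>2" using A by (simp add: power2_eq_square)
      fix z assume "z \<in> K"
      hence z: "norm z \<le> M" using K by auto
      have E: "?E z * pw (-A) (\<tau> *\<^sub>R e) z = 1" by (simp add: pw_def exp_add[symmetric])
      have "?E z * f z = ?E z + (?E z * pw (-A) (\<tau> *\<^sub>R e) z) * (potential \<kappa> (\<lambda>s. ?E s * (v s * f s)) z
          + (LINT s|lborel. hom \<kappa> \<tau> (z - s) * (?E s * (v s * f s))))"
        by (subst f(3)[OF z]) (simp add: faddeev_def distrib_left mult.assoc)
      thus "?E z * f z = ?E z + potential \<kappa> (\<lambda>s. v s * (?E s * f s)) z + (LINT s|lborel. hom \<kappa> \<tau> (z - s) * (v s * (?E s * f s)))"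
        unfolding E by (simp add: mult.left_commute)
    qed (use \<kappa> \<tau> \<tau>0 in auto)
    with f show "\<exists>f. continuous_on UNIV f \<and> (\<forall>x. norm (f x - 1) \<le> \<eta>) \<and> cgo_pairing \<kappa> K v (\<lambda>z. ?E z * f z)" by blast
  qed
qed

lemma ex_frame:
  assumes "e \<bullet> e = 1"
  obtains a b where "frame a b e"
proof -
  interpret F: frame "axis 1 1" "axis 2 1" "axis 3 (1::real)" by (rule frame_axes)
  obtain a where a: "e \<bullet> a = 0" "a \<bullet> a = 1\<^sup>2" by (rule F.ex_orthogonal_vector[of 1 e]) auto
  have "(norm (cross3 e a))\<^sup>2 = 1" using norm_cross_dot[of e a] a assms by (simp add: norm_eq_sqrt_inner)
  hence "frame a (cross3 e a) e"
    using a assms by unfold_locales (simp_all add: dot_cross_self power2_norm_eq_inner inner_commute[of a e])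
  thus thesis by (rule that)
qed

text \<open>Take \<zeta>_1 = p / 2 + \<omega> b - i \<tau> a and \<zeta>_2 = p / 2 - \<omega> b + i
  \<tau> a with a and b orthonormal and orthogonal to p. They add up to p, so the growth of one
  exponential is undone by the other, and the third dimension leaves room for \<omega>, which
  adjusts both squares to \<kappa>^2. The remaining factors are uniformly close to 1 for large
  \<tau>.\<close>

lemma fourier_null_of_cgo:
  assumes v: "bdd_density K v1" "bdd_density K v2" and K: "K \<subseteq> cball 0 M" and M: "M \<ge> 0" and \<kappa>: "\<kappa> > 0"
    and orth: "\<And>u1 u2. continuous_on UNIV u1 \<Longrightarrow> continuous_on UNIV u2 \<Longrightarrow> cgo_pairing \<kappa> K v1 u1 \<Longrightarrow>
      cgo_pairing \<kappa> K v2 u2 \<Longrightarrow> (LINT z|lborel. (v1 z - v2 z) * u2 z * u1 z) = 0"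
  shows "fourier_null K (\<lambda>z. v1 z - v2 z)"
  unfolding fourier_null_def
proof (intro conjI allI)
  have bK: "bounded K" using K bounded_subset bounded_cball by blast
  define q where "q z = v1 z - v2 z" for z
  have q: "bdd_density K q" unfolding q_def[abs_def] by (rule bdd_density_diff[OF v])
  thus "bdd_density K (\<lambda>z. v1 z - v2 z)" by (simp add: q_def[abs_def])
  fix p :: "real^3"
  let ?F = "\<lambda>z. exp (\<i> * of_real (p \<bullet> z))"
  define I where "I = (LINT z|lborel. norm (q z))"
  have I: "I \<ge> 0" unfolding I_def by (intro Bochner_Integration.integral_nonneg) simp
  obtain d :: "real^3" where d: "d \<bullet> d = 1" and pd: "p = norm p *\<^sub>R d"
  proof (cases "p = 0")
    case True
    thus thesis using that[of "axis 1 1"] by (simp add: inner_axis_axis)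
  next
    case False
    thus thesis using that[of "p /\<^sub>R norm p"] by (simp add: power2_norm_eq_inner[symmetric] power2_eq_square)
  qed
  obtain a b where F: "frame a b d" using ex_frame[OF d] .
  interpret F: frame a b d by (rule F)
  \<comment> \<open>Opposite growth directions a and - a for the two potentials, both orthogonal to
    p.\<close>
  interpret F1: frame d b a by unfold_locales simp_all
  interpret F2: frame d b "-a" by unfold_locales simp_all
  have pab: "p \<bullet> a = 0" "p \<bullet> b = 0" by (subst pd, simp)+
  have bound: "norm (LINT z|lborel. ?F z * q z) \<le> \<eta> * (3 * I)" if \<eta>: "0 < \<eta>" "\<eta> \<le> 1" for \<eta>
  proof -
    obtain \<tau>1 where \<tau>1: "\<And>\<tau> A. \<tau> \<ge> \<tau>1 \<Longrightarrow> A \<bullet> a = 0 \<Longrightarrow> A \<bullet> A = \<kappa>\<^sup>2 + \<tau>\<^sup>2 \<Longrightarrow>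
      \<exists>f. continuous_on UNIV f \<and> (\<forall>x. norm (f x - 1) \<le> \<eta>) \<and> cgo_pairing \<kappa> K v1 (\<lambda>z. pw A (-(\<tau> *\<^sub>R a)) z * f z)"
      using F1.ex_cgo_pairing[OF v(1) K M \<kappa> \<eta>(1)] by blast
    obtain \<tau>2 where \<tau>2: "\<And>\<tau> A. \<tau> \<ge> \<tau>2 \<Longrightarrow> A \<bullet> (-a) = 0 \<Longrightarrow> A \<bullet> A = \<kappa>\<^sup>2 + \<tau>\<^sup>2 \<Longrightarrow>
      \<exists>f. continuous_on UNIV f \<and> (\<forall>x. norm (f x - 1) \<le> \<eta>) \<and> cgo_pairing \<kappa> K v2 (\<lambda>z. pw A (-(\<tau> *\<^sub>R (-a))) z * f z)"
      using F2.ex_cgo_pairing[OF v(2) K M \<kappa> \<eta>(1)] by blast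
    \<comment> \<open>At least norm p, which keeps the radicand of \<omega> nonnegative.\<close>
    define \<tau> where "\<tau> = max (max \<tau>1 \<tau>2) (norm p)"
    have \<tau>: "\<tau> \<ge> \<tau>1" "\<tau> \<ge> \<tau>2" by (simp_all add: \<tau>_def)
    define \<omega> where "\<omega> = sqrt (\<kappa>\<^sup>2 + \<tau>\<^sup>2 - (norm p)\<^sup>2 / 4)"
    have "(norm p)\<^sup>2 \<le> \<tau>\<^sup>2" by (intro power_mono) (simp_all add: \<tau>_def)
    hence "\<kappa>\<^sup>2 + \<tau>\<^sup>2 - (norm p)\<^sup>2 / 4 \<ge> 0" using zero_le_power2[of \<kappa>] zero_le_power2[of "norm p"] by linarith
    hence \<omega>: "\<omega>\<^sup>2 = \<kappa>\<^sup>2 + \<tau>\<^sup>2 - (norm p)\<^sup>2 / 4" by (simp add: \<omega>_def)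
    define A1 A2 where "A1 = (1/2) *\<^sub>R p + \<omega> *\<^sub>R b" and "A2 = (1/2) *\<^sub>R p - \<omega> *\<^sub>R b"
    have pp: "p \<bullet> p = norm p * norm p" by (simp add: power2_norm_eq_inner[symmetric] power2_eq_square)
    have A: "A1 \<bullet> a = 0" "A2 \<bullet> (-a) = 0" "A1 \<bullet> A1 = \<kappa>\<^sup>2 + \<tau>\<^sup>2" "A2 \<bullet> A2 = \<kappa>\<^sup>2 + \<tau>\<^sup>2"
      using \<omega> pab by (simp_all add: A1_def A2_def inner_add_left inner_add_right inner_diff_left inner_diff_right
          inner_commute[of b p] pp power2_eq_square algebra_simps)
    obtain f1 where f1: "continuous_on UNIV f1" "\<And>x. norm (f1 x - 1) \<le> \<eta>" "cgo_pairing \<kappa> K v1 (\<lambda>z. pw A1 (-(\<tau> *\<^sub>R a)) z * f1 z)"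
      using \<tau>1[OF \<tau>(1) A(1,3)] by blast
    obtain f2 where f2: "continuous_on UNIV f2" "\<And>x. norm (f2 x - 1) \<le> \<eta>" "cgo_pairing \<kappa> K v2 (\<lambda>z. pw A2 (-(\<tau> *\<^sub>R (-a))) z * f2 z)"
      using \<tau>2[OF \<tau>(2) A(2,4)] by blast
    have prod: "pw A2 (-(\<tau> *\<^sub>R (-a))) z * pw A1 (-(\<tau> *\<^sub>R a)) z = ?F z" for z
    proof -
      have "A1 \<bullet> z + A2 \<bullet> z = p \<bullet> z" by (simp add: A1_def A2_def inner_add_left inner_diff_left)
      hence "\<i> * of_real (p \<bullet> z) = \<i> * of_real (A1 \<bullet> z) + \<i> * of_real (A2 \<bullet> z)"
        by (simp add: of_real_add[symmetric] distrib_left[symmetric] del: of_real_add)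
      thus ?thesis by (simp add: pw_def exp_add[symmetric] add.commute)
    qed
    have "(LINT z|lborel. q z * (pw A2 (-(\<tau> *\<^sub>R (-a))) z * f2 z) * (pw A1 (-(\<tau> *\<^sub>R a)) z * f1 z)) = 0"
      unfolding q_def by (intro orth f1(3) f2(3) continuous_intros f1(1) f2(1))
    moreover have "q z * (pw A2 (-(\<tau> *\<^sub>R (-a))) z * f2 z) * (pw A1 (-(\<tau> *\<^sub>R a)) z * f1 z) = q z * (?F z * (f1 z * f2 z))" for z
      unfolding prod[symmetric] by (simp only: mult_ac)
    ultimately have z0: "(LINT z|lborel. q z * (?F z * (f1 z * f2 z))) = 0" by (simp only:)
    have Fc: "continuous_on UNIV ?F" by (intro continuous_intros)
    have i: "integrable lborel (\<lambda>z. q z * ?F z)" "integrable lborel (\<lambda>z. q z * (?F z * (f1 z * f2 z)))"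
      by (intro integrable_bdd_density[OF bdd_density_mult_cont[OF q bK] bK] continuous_intros f1(1) f2(1))+
    have "(LINT z|lborel. ?F z * q z) = (LINT z|lborel. q z * ?F z - q z * (?F z * (f1 z * f2 z)))"
      using Bochner_Integration.integral_diff[OF i] z0 by (simp add: mult.commute)
    also have "norm \<dots> \<le> (LINT z|lborel. norm (q z) * (3 * \<eta>))"
    proof (rule Bochner_Integration.integral_norm_bound_integral)
      show "integrable lborel (\<lambda>z. q z * ?F z - q z * (?F z * (f1 z * f2 z)))"
        by (intro Bochner_Integration.integrable_diff i)
      show "integrable lborel (\<lambda>z. norm (q z) * (3 * \<eta>))"
        by (intro integrable_mult_left integrable_norm integrable_bdd_density[OF q bK])
      fix z
      \<comment> \<open>\<eta>^2 + 2 \<eta> \<le> 3 \<eta> because \<eta> \<le> 1.\<close>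
      have n: "norm (1 - f1 z * f2 z) \<le> 3 * \<eta>"
      proof -
        define P Q where "P = f1 z - 1" and "Q = f2 z - 1"
        have "1 - f1 z * f2 z = - (P * Q) - P - Q" by (simp add: P_def Q_def algebra_simps)
        hence "norm (1 - f1 z * f2 z) \<le> norm P * norm Q + norm P + norm Q"
          using norm_triangle_ineq4[of "- (P * Q) - P" Q] norm_triangle_ineq4[of "- (P * Q)" P] by (simp add: norm_mult)
        also have "\<dots> \<le> \<eta> * 1 + \<eta> + \<eta>"
          using f1(2)[of z] f2(2)[of z] \<eta> unfolding P_def[symmetric] Q_def[symmetric] by (intro add_mono mult_mono) auto
        finally show ?thesis by simp
      qed
      have "q z * ?F z - q z * (?F z * (f1 z * f2 z)) = q z * ?F z * (1 - f1 z * f2 z)" by (simp add: algebra_simps)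
      hence "norm (q z * ?F z - q z * (?F z * (f1 z * f2 z))) = norm (q z) * norm (1 - f1 z * f2 z)" by (simp add: norm_mult)
      also have "\<dots> \<le> norm (q z) * (3 * \<eta>)" using n by (intro mult_left_mono) auto
      finally show "norm (q z * ?F z - q z * (?F z * (f1 z * f2 z))) \<le> norm (q z) * (3 * \<eta>)" .
    qed
    also have "\<dots> = \<eta> * (3 * I)" by (simp add: I_def)
    finally show ?thesis .
  qed
  have "norm (LINT z|lborel. ?F z * q z) \<le> \<epsilon>" if "\<epsilon> > 0" for \<epsilon>
  proof -
    define \<eta> where "\<eta> = min 1 (\<epsilon> / (3 * I + 1))"
    have \<eta>: "0 < \<eta>" "\<eta> \<le> 1" "\<eta> \<le> \<epsilon> / (3 * I + 1)" using that I by (auto simp: \<eta>_def)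
    have "norm (LINT z|lborel. ?F z * q z) \<le> \<eta> * (3 * I)" by (rule bound[OF \<eta>(1,2)])
    also have "\<dots> \<le> \<eta> * (3 * I + 1)" using \<eta> by (intro mult_left_mono) auto
    also have "\<dots> \<le> \<epsilon>" using \<eta>(3) I by (simp add: field_simps)
    finally show ?thesis .
  qed
  from field_le_epsilon[of _ 0, simplified, OF this] show "(LINT z|lborel. ?F z * (v1 z - v2 z)) = 0" by (simp add: q_def)
qed

text \<open>Every point of the plane lies on a line through the centre of a disc where the imaginary
  part vanishes, and such a line misses \<open>K\<close> because the plane does. The exceptional
  point \<open>y\<close>, the source of the Green functions, is avoided by moving the centre away
  from it.\<close>

lemma (in frame) potential_zero_on_plane:
  assumes f: "bdd_density K f" and K: "compact K" and \<kappa>: "\<kappa> > 0" and off: "\<And>z. z \<in> K \<Longrightarrow> z \<bullet> e > s0"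
    and x0: "x0 \<bullet> e = s0" and \<epsilon>: "\<epsilon> > 0"
    and Im0: "\<And>x. x \<bullet> e = s0 \<Longrightarrow> dist x x0 < \<epsilon> \<Longrightarrow> x \<noteq> y \<Longrightarrow> Im (potential \<kappa> f x) = 0"
    and x: "x \<bullet> e = s0"
  shows "potential \<kappa> f x = 0"
proof -
  have na: "norm a = 1" by (simp add: norm_eq_sqrt_inner)
  obtain x1 \<delta> where x1: "x1 \<bullet> e = s0" "\<delta> > 0"
    and Im1: "\<And>x. x \<bullet> e = s0 \<Longrightarrow> dist x x1 < \<delta> \<Longrightarrow> Im (potential \<kappa> f x) = 0"
  proof (cases "x0 = y")
    case True
    define x1 where "x1 = x0 + (\<epsilon> / 2) *\<^sub>R a"
    have d: "dist x1 x0 = \<epsilon> / 2" using \<epsilon> na by (simp add: x1_def dist_norm)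
    have "Im (potential \<kappa> f x) = 0" if "x \<bullet> e = s0" "dist x x1 < \<epsilon> / 2" for x
      using dist_triangle[of x x0 x1] that d True by (intro Im0) (auto simp: dist_commute)
    thus thesis using that[of x1 "\<epsilon> / 2"] x0 \<epsilon> by (simp add: x1_def inner_add_left)
  next
    case False
    have "Im (potential \<kappa> f x) = 0" if "x \<bullet> e = s0" "dist x x0 < min \<epsilon> (dist x0 y)" for x
      using that by (intro Im0) (auto simp: dist_commute)
    thus thesis using that[of x0 "min \<epsilon> (dist x0 y)"] x0 \<epsilon> False by simp
  qed
  have line: "potential \<kappa> f (x1 + t *\<^sub>R d) = 0" if d: "norm d = 1" "d \<bullet> e = 0" for d t
  proof (rule potential_line_zero[OF f K \<kappa> d(1) _ x1(2)])
    show "x1 + t *\<^sub>R d \<notin> K" for t using off[of "x1 + t *\<^sub>R d"] x1 d by (auto simp: inner_add_left)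
    show "Im (potential \<kappa> f (x1 + t *\<^sub>R d)) = 0" if "\<bar>t\<bar> < \<delta>" for t
      using that x1 d by (intro Im1) (auto simp: inner_add_left dist_norm)
  qed
  show ?thesis
  proof (cases "x = x1")
    case True
    thus ?thesis using line[OF na, of 0] by simp
  next
    case False
    have "(x - x1) \<bullet> e = 0" using x x1 by (simp add: inner_diff_left)
    thus ?thesis using line[of "(x - x1) /\<^sub>R norm (x - x1)" "norm (x - x1)"] False by simp
  qed
qed

text \<open>The heights of a connected set form an interval that misses s0; the sign of the unit
  normal is then chosen so that the set lies above the plane.\<close>

lemma plane_beside_connected:
  fixes \<Omega> X :: "(real^3) set"
  assumes "connected \<Omega>" "affine X" "aff_dim X = 2" "X \<inter> \<Omega> = {}"
  obtains e s0 where "e \<bullet> e = 1" "X = {x. x \<bullet> e = s0}" "\<And>z. z \<in> \<Omega> \<Longrightarrow> z \<bullet> e > s0"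
proof -
  have "\<exists>a b. a \<noteq> 0 \<and> affine hull X = {x. a \<bullet> x = b}"
    using assms(3) by (subst aff_dim_eq_hyperplane[symmetric]) simp
  then obtain n r where n: "n \<noteq> 0" and X: "X = {x. n \<bullet> x = r}" using affine_hull_eq[THEN iffD2, OF assms(2)] by auto
  define e s0 where "e = n /\<^sub>R norm n" and "s0 = r / norm n"
  have e: "e \<bullet> e = 1" using n by (simp add: e_def power2_norm_eq_inner[symmetric] power2_eq_square)
  have Xe: "X = {x. x \<bullet> e = s0}" unfolding X e_def s0_def using n by (auto simp: inner_commute field_simps)
  have "connected ((\<lambda>z. z \<bullet> e) ` \<Omega>)"
    by (intro connected_continuous_image assms(1) continuous_intros)
  moreover have s0: "s0 \<notin> (\<lambda>z. z \<bullet> e) ` \<Omega>" using assms(4) Xe by auto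
  ultimately have sep: "\<not> (x \<bullet> e \<le> s0 \<and> s0 \<le> y \<bullet> e)" if "x \<in> \<Omega>" "y \<in> \<Omega>" for x y
    using connectedD_interval[of "(\<lambda>z. z \<bullet> e) ` \<Omega>" "x \<bullet> e" "y \<bullet> e" s0] that by blast
  have "(\<forall>z\<in>\<Omega>. z \<bullet> e > s0) \<or> (\<forall>z\<in>\<Omega>. z \<bullet> e < s0)"
    using sep by (meson linorder_not_le order_less_imp_le)
  thus thesis
  proof
    assume "\<forall>z\<in>\<Omega>. z \<bullet> e > s0"
    thus thesis using that[OF e Xe] by blast
  next
    assume "\<forall>z\<in>\<Omega>. z \<bullet> e < s0"
    thus thesis using that[of "-e" "-s0"] e Xe by auto
  qed
qed

theorem theorem3:
  fixes \<Omega> X \<D> :: "(real ^ 3) set"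
    and v\<^sub>1 v\<^sub>2 :: "real ^ 3 \<Rightarrow> complex"
    and R\<^sub>1 R\<^sub>2 :: "real ^ 3 \<Rightarrow> real ^ 3 \<Rightarrow> complex"
    and \<kappa> :: real
  assumes "open \<Omega>" and "bounded \<Omega>" and "connected \<Omega>"
    and "affine X" and "aff_dim X = 2" and "X \<subseteq> - closure \<Omega>"
    and "\<kappa> > 0"
    and "L_infty v\<^sub>1" and "ess_support v\<^sub>1 \<subseteq> \<Omega>" and "US v\<^sub>1 \<Omega> \<kappa>"
    and "L_infty v\<^sub>2" and "ess_support v\<^sub>2 \<subseteq> \<Omega>" and "US v\<^sub>2 \<Omega> \<kappa>"
    and "outgoing_green v\<^sub>1 \<Omega> \<kappa> R\<^sub>1" and "outgoing_green v\<^sub>2 \<Omega> \<kappa> R\<^sub>2"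
    and "openin (top_of_set X) \<D>" and "\<D> \<noteq> {}"
    and "\<And>x y. x \<in> \<D> \<Longrightarrow> y \<in> \<D> \<Longrightarrow> Im_green R\<^sub>1 x y = Im_green R\<^sub>2 x y"
  shows "AE x in lebesgue. v\<^sub>1 x = v\<^sub>2 x"
proof -
  \<comment> \<open>One compact set for both supports keeps sums and differences of the two
    densities in the same class.\<close>
  define K where "K = ess_support v\<^sub>1 \<union> ess_support v\<^sub>2"
  have K\<Omega>: "K \<subseteq> \<Omega>" and cl: "closed K"
    using assms(9,12) closed_ess_support by (auto simp: K_def)
  have cK: "compact K" using cl K\<Omega> assms(2) bounded_subset compact_eq_bounded_closed by blast
  obtain w1 where w1: "bdd_density K w1" "AE x in lborel. v\<^sub>1 x = w1 x"
    by (rule L_infty_density[OF assms(8) cl]) (auto simp: K_def)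
  obtain w2 where w2: "bdd_density K w2" "AE x in lborel. v\<^sub>2 x = w2 x"
    by (rule L_infty_density[OF assms(11) cl]) (auto simp: K_def)
  interpret S1: scatterer \<Omega> K v\<^sub>1 w1 by unfold_locales (use assms w1 cK K\<Omega> in auto)
  interpret S2: scatterer \<Omega> K v\<^sub>2 w2 by unfold_locales (use assms w2 cK K\<Omega> in auto)
  note bK = S1.bounded_K
  obtain M0 where M0: "\<Omega> \<subseteq> cball 0 M0" using bounded_subset_cball0[OF assms(2)] by blast
  define M where "M = max M0 0"
  have M: "\<Omega> \<subseteq> cball 0 M" "M \<ge> 0" using M0 by (auto simp: M_def)
  have KM: "K \<subseteq> cball 0 M" using K\<Omega> M by blast
  have X\<Omega>: "X \<inter> \<Omega> = {}" using assms(6) closure_subset by blast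
  obtain e s0 where e: "e \<bullet> e = 1" and X: "X = {x. x \<bullet> e = s0}" and side: "\<And>z. z \<in> \<Omega> \<Longrightarrow> z \<bullet> e > s0"
    by (rule plane_beside_connected[OF assms(3-5) X\<Omega>]) blast
  obtain a b where F: "frame a b e" using ex_frame[OF e] .
  interpret frame a b e by (rule F)
  have K_side: "z \<bullet> e > s0" if "z \<in> K" for z using side that K\<Omega> by blast
  have X_off: "x \<notin> \<Omega>" if "x \<in> X" for x using that X\<Omega> by blast
  obtain x0 \<epsilon> where x0: "x0 \<in> X" "\<epsilon> > 0" and D: "\<And>x. x \<in> X \<Longrightarrow> dist x x0 < \<epsilon> \<Longrightarrow> x \<in> \<D>" and DX: "\<D> \<subseteq> X"
    using assms(16,17) unfolding openin_euclidean_subtopology_iff by blast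
  define \<rho> where "\<rho> y z = w1 z * R\<^sub>1 z y - w2 z * R\<^sub>2 z y" for y z
  have d1: "bdd_density K (\<lambda>z. w1 z * R\<^sub>1 z y)" and d2: "bdd_density K (\<lambda>z. w2 z * R\<^sub>2 z y)" if "y \<in> X" for y
    using S1.outgoing_green_density(1)[OF assms(14) X_off[OF that]] S2.outgoing_green_density(1)[OF assms(15) X_off[OF that]] by auto
  have e1: "R\<^sub>1 x y = - G_plus \<kappa> (x - y) + potential \<kappa> (\<lambda>z. w1 z * R\<^sub>1 z y) x"
    and e2: "R\<^sub>2 x y = - G_plus \<kappa> (x - y) + potential \<kappa> (\<lambda>z. w2 z * R\<^sub>2 z y) x" if "y \<in> X" "x \<noteq> y" for x y
    using S1.outgoing_green_density(2)[OF assms(14) X_off[OF that(1)] that(2)]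
      S2.outgoing_green_density(2)[OF assms(15) X_off[OF that(1)] that(2)] by auto
  have \<rho>: "bdd_density K (\<rho> y)" if "y \<in> X" for y
    unfolding \<rho>_def[abs_def] by (intro bdd_density_diff d1 d2 that)
  have T\<rho>: "potential \<kappa> (\<rho> y) x = R\<^sub>1 x y - R\<^sub>2 x y" if "y \<in> X" "x \<noteq> y" for x y
    using e1[OF that] e2[OF that] potential_diff[OF d1[OF that(1)] d2[OF that(1)] bK, of \<kappa> x] by (simp add: \<rho>_def[abs_def])
  \<comment> \<open>Used twice: with y in \<D>, where the data give the imaginary part near x0, and
    with y anywhere in X, where reciprocity and the first use give the values near x0.\<close>
  have plane: "potential \<kappa> (\<rho> y) x = 0"
    if y: "y \<in> X" and x: "x \<in> X" and Im0: "\<And>x. x \<in> X \<Longrightarrow> dist x x0 < \<epsilon> \<Longrightarrow> x \<noteq> y \<Longrightarrow> Im (potential \<kappa> (\<rho> y) x) = 0" for x y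
  proof (rule potential_zero_on_plane[OF \<rho>[OF y] cK assms(7) K_side])
    show "x0 \<bullet> e = s0" "x \<bullet> e = s0" using x x0 X by auto
    show "Im (potential \<kappa> (\<rho> y) x) = 0" if "x \<bullet> e = s0" "dist x x0 < \<epsilon>" "x \<noteq> y" for x
      using that X by (intro Im0) auto
  qed (simp_all add: x0(2))
  have D_zero: "potential \<kappa> (\<rho> y) x = 0" if y: "y \<in> \<D>" and x: "x \<in> X" for x y
  proof (rule plane[OF _ x])
    show yX: "y \<in> X" using y DX by blast
    fix x assume x: "x \<in> X" "dist x x0 < \<epsilon>" "x \<noteq> y"
    \<comment> \<open>Off the diagonal \<open>Im_green\<close> is the imaginary part of R, and the
      difference of the two Green functions is the potential of \<open>\<rho> y\<close>.\<close>
    have "Im_green R\<^sub>1 x y = Im_green R\<^sub>2 x y" by (rule assms(18)[OF D[OF x(1,2)] y])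
    thus "Im (potential \<kappa> (\<rho> y) x) = 0" using x(3) T\<rho>[OF yX x(3)] by (simp add: Im_green_def)
  qed
  have zero: "potential \<kappa> (\<rho> y) x = 0" if y: "y \<in> X" and x: "x \<in> X" for x y
  proof (rule plane[OF y x])
    fix x assume x: "x \<in> X" "dist x x0 < \<epsilon>" "x \<noteq> y"
    have "potential \<kappa> (\<rho> y) x = R\<^sub>1 x y - R\<^sub>2 x y" by (rule T\<rho>[OF y x(3)])
    also have "\<dots> = R\<^sub>1 y x - R\<^sub>2 y x"
      using S1.reciprocity[OF assms(14) X_off[OF x(1)] X_off[OF y] x(3)] S2.reciprocity[OF assms(15) X_off[OF x(1)] X_off[OF y] x(3)]
        assms(7) by simp
    also have "\<dots> = potential \<kappa> (\<rho> x) y" using T\<rho>[OF x(1), of y] x(3) by simp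
    also have "\<dots> = 0" by (rule D_zero[OF D[OF x(1,2)] y])
    finally show "Im (potential \<kappa> (\<rho> y) x) = 0" by simp
  qed
  have "fourier_null K (\<lambda>z. w1 z - w2 z)"
  proof (rule fourier_null_of_cgo[OF w1(1) w2(1) KM M(2) assms(7)])
    fix u1 u2 assume u: "continuous_on UNIV u1" "continuous_on UNIV u2" "cgo_pairing \<kappa> K w1 u1" "cgo_pairing \<kappa> K w2 u2"
    show "(LINT z|lborel. (w1 z - w2 z) * u2 z * u1 z) = 0"
    proof (rule cgo_product_integral_zero[OF KM M(2) _ w1(1) w2(1), of \<kappa> X R\<^sub>1 R\<^sub>2])
      show "annihilates \<kappa> f" if "bdd_density K f" "\<And>x. x \<in> X \<Longrightarrow> potential \<kappa> f x = 0" for f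
        by (rule half_space_annihilates[OF that(1) cK assms(7) K_side]) (use that(2) X in auto)
      show "R\<^sub>1 z x = - G_plus \<kappa> (z - x) + potential \<kappa> (\<lambda>z. w1 z * R\<^sub>1 z x) z" if "x \<in> X" "z \<in> K" for x z
        using that X_off K\<Omega> by (intro e1) auto
      show "R\<^sub>2 z x = - G_plus \<kappa> (z - x) + potential \<kappa> (\<lambda>z. w2 z * R\<^sub>2 z x) z" if "x \<in> X" "z \<in> K" for x z
        using that X_off K\<Omega> by (intro e2) auto
      show "potential \<kappa> (\<lambda>z. w1 z * R\<^sub>1 z x - w2 z * R\<^sub>2 z x) y = 0" if "x \<in> X" "y \<in> X" for x y
        using zero[OF that] by (simp add: \<rho>_def[abs_def])
      show "AE z in lborel. w1 z * f z = 0"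
        if "continuous_on UNIV f" "\<And>x. norm x \<le> M \<Longrightarrow> f x = potential \<kappa> (\<lambda>z. w1 z * f z) x" for f
        by (rule S1.US_injective[OF assms(10) that(1) M(1) that(2)])
    qed (use u d1 d2 assms(7) in auto)
  qed
  from fourier_null_imp_AE_zero[OF this bK] have "AE z in lborel. w1 z - w2 z = 0" .
  hence "AE z in lborel. v\<^sub>1 z = v\<^sub>2 z" using w1(2) w2(2) by eventually_elim simp
  thus ?thesis by (simp only: AE_completion_iff)
qed

end
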